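(* Let $G=\mathrm{GL}_n$, $1\le r\le n-1$, and let $D$ be an effective divisor with $d_x\ge1$, with a ramification datum $\mathcal H=\{H^y\}_{y\in\operatorname{supp}D}$. Let $P\subset\mathrm{GL}_n$ be the standard (upper) parabolic of block type $(r,n-r)$ with unipotent radical $U$, and let $P^-,U^-$ be their transposes. Consider the Hecke correspondence at $x$ for the $r$-th fundamental coweight $\omega_r$, and let $(\mathcal E,\phi)$ be a rank $n$ vector bundle on $X$ with $\mathcal H$-level structure over $D$. (i) If $U\subset H^x\subset P$, then exactly $q^{r(n-r)\deg(x)}$ distinct subbundles $\mathcal E'\subset\mathcal E$ (with $\mathcal E/\mathcal E'\cong k_x^{\oplus r}$) occur as targets of edges from $(\mathcal E,\phi)$, and each of them has a unique compatible $H^x$-level structure. (ii) If $U^-\subset H^x\subset P^-$, or if $H^x$ is contained in the Levi subgroup of $P$, then a unique subbundle $\mathcal E'\subset\mathcal E$ occurs as the underlying bundle of a target of an edge from $(\mathcal E,\phi)$, but the edges are parametrized by the affine space $M_{r\times(n-r)}(k_x)$, of cardinality $q^{r(n-r)\deg(x)}$: the map $C\mapsto\begin{pmatrix}1&\pi_x^{d_x}C\\0&1\end{pmatrix}\Delta_xK_x$ is a bijection from $M_{r\times(n-r)}(k_x)$ onto $K_x\Delta_xK_x/K_x$.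
   Context: $X$ is a smooth projective geometrically connected curve over $k=\mathbb F_q$, $x$ a closed point. For a closed point $y$, $\mathcal O_y$ is the completed local ring, $\pi_y$ a uniformizer, $k_y$ the residue field; elements $C$ of $M_{r\times(n-r)}(k_x)$ are regarded as matrices over $\mathcal O_x$ via lifts. $D=\sum_yd_y[y]$ is an effective divisor. A ramification datum is a choice of an algebraic subgroup $H^y\subset\mathrm{GL}_n$ for each $y\in\operatorname{supp}D$. $K_x\subset\mathrm{GL}_n(\mathcal O_x)$ is the preimage of $H^x(\mathcal O_x/\pi_x^{d_x})$ under reduction, and $\Delta_x=\operatorname{diag}(\pi_xI_r,I_{n-r})$. The Levi subgroup of $P$ is the block diagonal subgroup $\mathrm{GL}_r\times\mathrm{GL}_{n-r}$. An $\mathcal H$-level structure over $D$ on a rank $n$ bundle $\mathcal E$ is, for each $y\in\operatorname{supp}D$, a class in $H^y(\mathcal O_y/\pi_y^{d_y})\backslash\operatorname{Iso}(\mathcal E|_{d_y[y]},(\mathcal O_y/\pi_y^{d_y})^n)$ (i.e. a reduction to $H^y$). A trivialization of $\mathcal E$ over $\mathcal O_x$ is compatible with the level structure if its reduction mod $\pi_x^{d_x}$ lies in the given class. Edges of the Hecke correspondence $\Phi_x^{\omega_r}$ out of $(\mathcal E,\phi)$: fix a trivialization $\tilde a:\mathcal E|_{\mathcal O_x}\simeq\mathcal O_x^n$ compatible with $\phi_x$. Edges are indexed by cosets $gK_x\in K_x\Delta_xK_x/K_x$. The edge $gK_x$ goes to $(\mathcal E',\phi')$, where $\mathcal E'\subset\mathcal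 E$ is the subsheaf ("subbundle") equal to $\mathcal E$ away from $x$ with $\mathcal E'|_{\mathcal O_x}=\tilde a^{-1}(g\mathcal O_x^n)$ (so $\mathcal E/\mathcal E'\cong k_x^{\oplus r}$), the level structure at $x$ is the class of $g^{-1}\tilde a:\mathcal E'|_{\mathcal O_x}\simeq\mathcal O_x^n$, and the level structures at points $y\neq x$ are those of $\mathcal E$. A level structure at $x$ on $\mathcal E'$ is compatible if it arises from such an edge. *)

theory Defs
  imports "HOL-Algebra.Algebra" "HOL-Algebra.Indexed_Polynomials"
begin

section \<open>Modules over a ring\<close>

definition free_module :: "nat \<Rightarrow> ('a, 'm) ring_scheme \<Rightarrow> ('a, nat \<Rightarrow> 'a) module" where
  "free_module n R =
    \<lparr>carrier = {..<n} \<rightarrow>\<^sub>E carrier R, monoid.mult = undefined, one = undefined,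
     ring.zero = (\<lambda>i\<in>{..<n}. \<zero>\<^bsub>R\<^esub>),
     add = (\<lambda>v w. \<lambda>i\<in>{..<n}. v i \<oplus>\<^bsub>R\<^esub> w i),
     smult = (\<lambda>c v. \<lambda>i\<in>{..<n}. c \<otimes>\<^bsub>R\<^esub> v i)\<rparr>"

definition module_isos ::
    "('a, 'm) ring_scheme \<Rightarrow> ('a, 'b) module \<Rightarrow> ('a, 'c) module \<Rightarrow> ('b \<Rightarrow> 'c) set" where
  "module_isos R M N =
    {f \<in> extensional (carrier M).
       bij_betw f (carrier M) (carrier N) \<and>
       (\<forall>s\<in>carrier M. \<forall>t\<in>carrier M. f (s \<oplus>\<^bsub>M\<^esub> t) = f s \<oplus>\<^bsub>N\<^esub> f t) \<and>
       (\<forall>c\<in>carrier R. \<forall>s\<in>carrier M. f (c \<odot>\<^bsub>M\<^esub> s) = c \<odot>\<^bsub>N\<^esub> f s)}"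

definition ideal_smult :: "('a, 'm) ring_scheme \<Rightarrow> 'a set \<Rightarrow> ('a, 'b) module \<Rightarrow> 'b set" where
  "ideal_smult R I M =
    \<Inter>{N. submodule N R M \<and> (\<forall>c\<in>I. \<forall>s\<in>carrier M. c \<odot>\<^bsub>M\<^esub> s \<in> N)}"

text \<open>The quotient \<open>M / N\<close> as a module over \<open>R / I\<close>; it is only meaningful if \<open>I\<close> kills
  \<open>M / N\<close>. As in \<^const>\<open>FactRing\<close>, the scalars and the elements are cosets and the
  operations are those on representatives; the ideal \<open>I\<close> is implicit in the scalars.\<close>

definition quot_module :: "('a, 'b) module \<Rightarrow> 'b set \<Rightarrow> ('a set, 'b set) module" where
  "quot_module M N =
    \<lparr>carrier = a_rcosets\<^bsub>M\<^esub> N, monoid.mult = undefined, one = undefined,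
     ring.zero = N, add = set_add M,
     smult = (\<lambda>A S. \<Union>c\<in>A. \<Union>s\<in>S. N +>\<^bsub>M\<^esub> (c \<odot>\<^bsub>M\<^esub> s))\<rparr>"

section \<open>Local rings and their completions\<close>

definition max_ideal :: "('a, 'm) ring_scheme \<Rightarrow> 'a set" where
  "max_ideal R = (THE I. maximalideal I R)"

definition residue_field :: "('a, 'm) ring_scheme \<Rightarrow> 'a set ring" where
  "residue_field R = R Quot max_ideal R"

definition max_ideal_pow :: "('a, 'm) ring_scheme \<Rightarrow> nat \<Rightarrow> 'a set" where
  "max_ideal_pow R d = max_ideal R [^]\<^bsub>ideals_set R\<^esub> d"

definition trunc_ring :: "('a, 'm) ring_scheme \<Rightarrow> nat \<Rightarrow> 'a set ring" where
  "trunc_ring R d = R Quot max_ideal_pow R d"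

definition trunc_module :: "('a, 'm) ring_scheme \<Rightarrow> ('a, 'b) module \<Rightarrow> nat \<Rightarrow> ('a set, 'b set) module" where
  "trunc_module R M d = quot_module M (ideal_smult R (max_ideal_pow R d) M)"

text \<open>The completions are the inverse limits of the truncations. An element is a sequence of
  cosets; it is compatible iff the sequence is decreasing. Reduction modulo the \<open>d\<close>-th power of
  the maximal ideal is evaluation at \<open>d\<close>, i.e. the quotient of the completed ring (module) by
  that power is identified with \<^const>\<open>trunc_ring\<close> (\<^const>\<open>trunc_module\<close>).\<close>

definition completion :: "('a, 'm) ring_scheme \<Rightarrow> (nat \<Rightarrow> 'a set) ring" where
  "completion R =
    \<lparr>carrier = {f. \<forall>d. f d \<in> carrier (trunc_ring R d) \<and> f (Suc d) \<subseteq> f d},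
     monoid.mult = (\<lambda>f g d. f d \<otimes>\<^bsub>trunc_ring R d\<^esub> g d),
     one = (\<lambda>d. \<one>\<^bsub>trunc_ring R d\<^esub>),
     ring.zero = (\<lambda>d. \<zero>\<^bsub>trunc_ring R d\<^esub>),
     add = (\<lambda>f g d. f d \<oplus>\<^bsub>trunc_ring R d\<^esub> g d)\<rparr>"

definition module_completion ::
    "('a, 'm) ring_scheme \<Rightarrow> ('a, 'b) module \<Rightarrow> (nat \<Rightarrow> 'a set, nat \<Rightarrow> 'b set) module" where
  "module_completion R M =
    \<lparr>carrier = {s. \<forall>d. s d \<in> carrier (trunc_module R M d) \<and> s (Suc d) \<subseteq> s d},
     monoid.mult = undefined, one = undefined,
     ring.zero = (\<lambda>d. \<zero>\<^bsub>trunc_module R M d\<^esub>),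
     add = (\<lambda>s t d. s d \<oplus>\<^bsub>trunc_module R M d\<^esub> t d),
     smult = (\<lambda>c s d. c d \<odot>\<^bsub>trunc_module R M d\<^esub> s d)\<rparr>"

text \<open>The map of completions induced by the inclusion of a submodule into \<open>M\<close>.\<close>

definition completion_incl ::
    "('a, 'm) ring_scheme \<Rightarrow> ('a, 'b) module \<Rightarrow> (nat \<Rightarrow> 'b set) \<Rightarrow> nat \<Rightarrow> 'b set" where
  "completion_incl R M s = (\<lambda>d. ideal_smult R (max_ideal_pow R d) M <+>\<^bsub>M\<^esub> s d)"

section \<open>Matrices and subgroups of the general linear group\<close>

definition mat_monoid :: "nat \<Rightarrow> ('a, 'm) ring_scheme \<Rightarrow> (nat \<times> nat \<Rightarrow> 'a) monoid" where
  "mat_monoid n R =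
    \<lparr>carrier = {..<n} \<times> {..<n} \<rightarrow>\<^sub>E carrier R,
     monoid.mult = (\<lambda>A B. \<lambda>(i, j)\<in>{..<n} \<times> {..<n}. \<Oplus>\<^bsub>R\<^esub>l\<in>{..<n}. A (i, l) \<otimes>\<^bsub>R\<^esub> B (l, j)),
     one = (\<lambda>(i, j)\<in>{..<n} \<times> {..<n}. if i = j then \<one>\<^bsub>R\<^esub> else \<zero>\<^bsub>R\<^esub>)\<rparr>"

definition GL :: "nat \<Rightarrow> ('a, 'm) ring_scheme \<Rightarrow> (nat \<times> nat \<Rightarrow> 'a) monoid" where
  "GL n R = units_of (mat_monoid n R)"

definition mat_vec ::
    "nat \<Rightarrow> ('a, 'm) ring_scheme \<Rightarrow> (nat \<times> nat \<Rightarrow> 'a) \<Rightarrow> (nat \<Rightarrow> 'a) \<Rightarrow> nat \<Rightarrow> 'a" where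
  "mat_vec n R A v = (\<lambda>i\<in>{..<n}. \<Oplus>\<^bsub>R\<^esub>j\<in>{..<n}. A (i, j) \<otimes>\<^bsub>R\<^esub> v j)"

definition mat_transpose :: "nat \<Rightarrow> (nat \<times> nat \<Rightarrow> 'a) \<Rightarrow> nat \<times> nat \<Rightarrow> 'a" where
  "mat_transpose n A = (\<lambda>(i, j)\<in>{..<n} \<times> {..<n}. A (j, i))"

definition parabolic :: "nat \<Rightarrow> nat \<Rightarrow> ('a, 'm) ring_scheme \<Rightarrow> (nat \<times> nat \<Rightarrow> 'a) set" where
  "parabolic n r R =
    {g \<in> carrier (GL n R). \<forall>i j. r \<le> i \<and> i < n \<and> j < r \<longrightarrow> g (i, j) = \<zero>\<^bsub>R\<^esub>}"

definition unip_radical :: "nat \<Rightarrow> nat \<Rightarrow> ('a, 'm) ring_scheme \<Rightarrow> (nat \<times> nat \<Rightarrow> 'a) set" where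
  "unip_radical n r R =
    {g \<in> parabolic n r R. \<forall>i<n. \<forall>j<n. (i < r \<longleftrightarrow> j < r) \<longrightarrow>
       g (i, j) = (if i = j then \<one>\<^bsub>R\<^esub> else \<zero>\<^bsub>R\<^esub>)}"

definition opp_parabolic :: "nat \<Rightarrow> nat \<Rightarrow> ('a, 'm) ring_scheme \<Rightarrow> (nat \<times> nat \<Rightarrow> 'a) set" where
  "opp_parabolic n r R = mat_transpose n ` parabolic n r R"

definition opp_unip_radical :: "nat \<Rightarrow> nat \<Rightarrow> ('a, 'm) ring_scheme \<Rightarrow> (nat \<times> nat \<Rightarrow> 'a) set" where
  "opp_unip_radical n r R = mat_transpose n ` unip_radical n r R"

definition levi :: "nat \<Rightarrow> nat \<Rightarrow> ('a, 'm) ring_scheme \<Rightarrow> (nat \<times> nat \<Rightarrow> 'a) set" where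
  "levi n r R =
    {g \<in> carrier (GL n R). \<forall>i<n. \<forall>j<n. (i < r) \<noteq> (j < r) \<longrightarrow> g (i, j) = \<zero>\<^bsub>R\<^esub>}"

text \<open>Here \<open>k\<close> is a subfield of \<open>F\<close>. Below, \<open>F\<close> is a function field, so its type is infinite and
  every \<open>k\<close>-algebra of finite type (\<open>k\<close> finite) has an isomorphic copy whose elements have type
  \<^typ>\<open>'a set\<close>. By the Yoneda lemma, testing closed subschemes of the general linear group over
  \<open>k\<close> on the algebras of this type therefore loses nothing.\<close>

definition k_algebra :: "'a set \<Rightarrow> 'a ring \<Rightarrow> 'a set ring \<Rightarrow> ('a \<Rightarrow> 'a set) \<Rightarrow> bool" where
  "k_algebra k F R \<iota> \<longleftrightarrow> cring R \<and> \<iota> \<in> ring_hom (F\<lparr>carrier := k\<rparr>) R"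

definition poly_eval ::
    "'a ring \<Rightarrow> 'b ring \<Rightarrow> ('a \<Rightarrow> 'b) \<Rightarrow> ('c multiset \<Rightarrow> 'a) \<Rightarrow> ('c \<Rightarrow> 'b) \<Rightarrow> 'b" where
  "poly_eval F R \<iota> p g =
    (\<Oplus>\<^bsub>R\<^esub>m\<in>{m. p m \<noteq> \<zero>\<^bsub>F\<^esub>}.
       \<iota> (p m) \<otimes>\<^bsub>R\<^esub> (\<Otimes>\<^bsub>R\<^esub>v\<in>set_mset m. g v [^]\<^bsub>R\<^esub> count m v))"

text \<open>A closed subscheme of the general linear group is given by a set \<open>S\<close> of polynomials in the
  matrix entries; powers of the inverse determinant can be cleared, the determinant being a unit.\<close>

definition GL_points ::
    "nat \<Rightarrow> 'a ring \<Rightarrow> ((nat \<times> nat) multiset \<Rightarrow> 'a) set \<Rightarrow> 'b ring \<Rightarrow> ('a \<Rightarrow> 'b) \<Rightarrow>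
     (nat \<times> nat \<Rightarrow> 'b) set" where
  "GL_points n F S R \<iota> = {g \<in> carrier (GL n R). \<forall>p\<in>S. poly_eval F R \<iota> p g = \<zero>\<^bsub>R\<^esub>}"

definition algebraic_subgroup ::
    "nat \<Rightarrow> 'a set \<Rightarrow> 'a ring \<Rightarrow> ((nat \<times> nat) multiset \<Rightarrow> 'a) set \<Rightarrow> bool" where
  "algebraic_subgroup n k F S \<longleftrightarrow>
    S \<subseteq> ring.indexed_pset F ({..<n} \<times> {..<n}) k \<and>
    (\<forall>R \<iota>. k_algebra k F R \<iota> \<longrightarrow> subgroup (GL_points n F S R \<iota>) (GL n R))"

definition subfunctor ::
    "'a set \<Rightarrow> 'a ring \<Rightarrow> ('a set ring \<Rightarrow> ('a \<Rightarrow> 'a set) \<Rightarrow> 'c set) \<Rightarrow>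
     ('a set ring \<Rightarrow> ('a \<Rightarrow> 'a set) \<Rightarrow> 'c set) \<Rightarrow> bool" where
  "subfunctor k F A B \<longleftrightarrow> (\<forall>R \<iota>. k_algebra k F R \<iota> \<longrightarrow> A R \<iota> \<subseteq> B R \<iota>)"

section \<open>Curves\<close>

text \<open>A smooth projective geometrically connected curve over the finite field \<open>k\<close> is
  represented by its function field \<open>F\<close>, as an abstract nonsingular curve in the sense of
  Hartshorne I.6: the closed points are the discrete valuation rings of \<open>F / k\<close> (the local rings
  at these points), the topology is the cofinite one, and the regular functions on a nonempty open
  set are the elements of the intersection of the local rings. As \<open>k\<close> is perfect, regular means
  smooth, and the curve is geometrically connected iff \<open>k\<close> is algebraically closed in \<open>F\<close>.\<close>

definition curve_over_finite_field :: "'a set \<Rightarrow> 'a ring \<Rightarrow> bool" where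
  "curve_over_finite_field k F \<longleftrightarrow>
    field F \<and> subfield k F \<and> finite k \<and>
    (\<exists>t\<in>carrier F. ring.transcendental F k t \<and>
       ring.finite_dimension F (generate_field F (insert t k)) (carrier F)) \<and>
    (\<forall>t\<in>carrier F. ring.algebraic F k t \<longrightarrow> t \<in> k)"

definition dvr :: "('a, 'm) ring_scheme \<Rightarrow> bool" where
  "dvr R \<longleftrightarrow> principal_domain R \<and> \<not> field R \<and> (\<exists>!I. maximalideal I R)"

definition closed_points :: "'a set \<Rightarrow> 'a ring \<Rightarrow> 'a set set" where
  "closed_points k F =
    {y. subring y F \<and> k \<subseteq> y \<and> dvr (F\<lparr>carrier := y\<rparr>) \<and>
        (\<forall>a\<in>carrier F. \<exists>b\<in>y. \<exists>c\<in>y - {\<zero>\<^bsub>F\<^esub>}. a \<otimes>\<^bsub>F\<^esub> c = b)}"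

definition local_ring :: "'a ring \<Rightarrow> 'a set \<Rightarrow> 'a ring" where
  "local_ring F y = F\<lparr>carrier := y\<rparr>"

definition degree_at :: "'a set \<Rightarrow> 'a ring \<Rightarrow> 'a set \<Rightarrow> nat" where
  "degree_at k F y =
    (let \<kappa> = residue_field (local_ring F y)
     in ring.dim \<kappa> ((\<lambda>a. max_ideal (local_ring F y) +>\<^bsub>local_ring F y\<^esub> a) ` k) (carrier \<kappa>))"

definition nonempty_opens :: "'a set \<Rightarrow> 'a ring \<Rightarrow> 'a set set set" where
  "nonempty_opens k F =
    {U. U \<subseteq> closed_points k F \<and> U \<noteq> {} \<and> finite (closed_points k F - U)}"

definition regular_functions :: "'a ring \<Rightarrow> 'a set set \<Rightarrow> 'a ring" where
  "regular_functions F U = F\<lparr>carrier := \<Inter>U\<rparr>"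

section \<open>Vector bundles and level structures\<close>

text \<open>A vector bundle is a locally free sheaf. The curve is integral, so such a sheaf is a
  subsheaf of the constant sheaf given by its generic stalk \<open>V\<close>, a vector space over \<open>F\<close>, and
  restriction maps are inclusions. Only nonempty open sets carry information, and any two of them
  meet, so a compatible family of sections is one element of \<open>V\<close>. Extensionality makes equality of
  bundles in \<open>V\<close> mean equality of subsheaves.\<close>

definition lin_comb :: "nat \<Rightarrow> ('a, 'v) module \<Rightarrow> (nat \<Rightarrow> 'v) \<Rightarrow> (nat \<Rightarrow> 'a) \<Rightarrow> 'v" where
  "lin_comb n V e c = (\<Oplus>\<^bsub>V\<^esub>i\<in>{..<n}. c i \<odot>\<^bsub>V\<^esub> e i)"

definition vector_bundle ::
    "'a set \<Rightarrow> 'a ring \<Rightarrow> ('a, 'v) module \<Rightarrow> nat \<Rightarrow> ('a set set \<Rightarrow> 'v set) \<Rightarrow> bool" where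
  "vector_bundle k F V n E \<longleftrightarrow>
    module F V \<and> E \<in> extensional (nonempty_opens k F) \<and>
    (\<forall>U\<in>nonempty_opens k F. submodule (E U) (regular_functions F U) V) \<and>
    (\<forall>U\<in>nonempty_opens k F. \<forall>W\<in>nonempty_opens k F. W \<subseteq> U \<longrightarrow> E U \<subseteq> E W) \<and>
    (\<forall>\<U>\<subseteq>nonempty_opens k F. \<U> \<noteq> {} \<longrightarrow> (\<Inter>W\<in>\<U>. E W) \<subseteq> E (\<Union>\<U>)) \<and>
    (\<forall>y\<in>closed_points k F. \<exists>U\<in>nonempty_opens k F. y \<in> U \<and>
       (\<exists>e\<in>{..<n} \<rightarrow> carrier V.
          bij_betw (lin_comb n V e) ({..<n} \<rightarrow>\<^sub>E carrier F) (carrier V) \<and>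
          (\<forall>W\<in>nonempty_opens k F. W \<subseteq> U \<longrightarrow>
             E W = lin_comb n V e ` ({..<n} \<rightarrow>\<^sub>E carrier (regular_functions F W)))))"

definition stalk ::
    "'a set \<Rightarrow> 'a ring \<Rightarrow> ('a, 'v) module \<Rightarrow> ('a set set \<Rightarrow> 'v set) \<Rightarrow> 'a set \<Rightarrow> ('a, 'v) module" where
  "stalk k F V E y = V\<lparr>carrier := \<Union>{E U |U. U \<in> nonempty_opens k F \<and> y \<in> U}\<rparr>"

definition trivializations ::
    "'a set \<Rightarrow> 'a ring \<Rightarrow> ('a, 'v) module \<Rightarrow> nat \<Rightarrow> ('a set set \<Rightarrow> 'v set) \<Rightarrow> 'a set \<Rightarrow>
     ((nat \<Rightarrow> 'v set) \<Rightarrow> nat \<Rightarrow> nat \<Rightarrow> 'a set) set" where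
  "trivializations k F V n E y =
    (let R = local_ring F y
     in module_isos (completion R) (module_completion R (stalk k F V E y))
          (free_module n (completion R)))"

definition reduce_trivialization ::
    "'a set \<Rightarrow> 'a ring \<Rightarrow> ('a, 'v) module \<Rightarrow> nat \<Rightarrow> ('a set set \<Rightarrow> 'v set) \<Rightarrow> 'a set \<Rightarrow> nat \<Rightarrow>
     ((nat \<Rightarrow> 'v set) \<Rightarrow> nat \<Rightarrow> nat \<Rightarrow> 'a set) \<Rightarrow> 'v set \<Rightarrow> nat \<Rightarrow> 'a set" where
  "reduce_trivialization k F V n E y d a =
    (let R = local_ring F y; M = stalk k F V E y
     in (\<lambda>t\<in>carrier (trunc_module R M d).
          THE v. \<exists>s\<in>carrier (module_completion R M). s d = t \<and> v = (\<lambda>i\<in>{..<n}. a s i d)))"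

definition supp :: "'a set \<Rightarrow> 'a ring \<Rightarrow> ('a set \<Rightarrow> nat) \<Rightarrow> 'a set set" where
  "supp k F D = {y \<in> closed_points k F. D y > 0}"

definition effective_divisor :: "'a set \<Rightarrow> 'a ring \<Rightarrow> ('a set \<Rightarrow> nat) \<Rightarrow> bool" where
  "effective_divisor k F D \<longleftrightarrow> finite (supp k F D)"

text \<open>The points of \<open>S\<close> over the truncated local ring at \<open>y\<close>, a \<open>k\<close>-algebra via \<open>k \<subseteq> y\<close>.\<close>

definition local_points ::
    "nat \<Rightarrow> 'a ring \<Rightarrow> ((nat \<times> nat) multiset \<Rightarrow> 'a) set \<Rightarrow> 'a set \<Rightarrow> nat \<Rightarrow>
     (nat \<times> nat \<Rightarrow> 'a set) set" where
  "local_points n F S y d =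
    (let R = local_ring F y
     in GL_points n F S (trunc_ring R d) (\<lambda>a. max_ideal_pow R d +>\<^bsub>R\<^esub> a))"

definition level_class ::
    "'a set \<Rightarrow> 'a ring \<Rightarrow> ('a, 'v) module \<Rightarrow> nat \<Rightarrow> ((nat \<times> nat) multiset \<Rightarrow> 'a) set \<Rightarrow> nat \<Rightarrow>
     ('a set set \<Rightarrow> 'v set) \<Rightarrow> 'a set \<Rightarrow> ('v set \<Rightarrow> nat \<Rightarrow> 'a set) \<Rightarrow> ('v set \<Rightarrow> nat \<Rightarrow> 'a set) set" where
  "level_class k F V n S d E y f =
    (let R = local_ring F y; M = trunc_module R (stalk k F V E y) d
     in (\<lambda>h. \<lambda>s\<in>carrier M. mat_vec n (trunc_ring R d) h (f s)) ` local_points n F S y d)"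

definition local_level_structures ::
    "'a set \<Rightarrow> 'a ring \<Rightarrow> ('a, 'v) module \<Rightarrow> nat \<Rightarrow> ((nat \<times> nat) multiset \<Rightarrow> 'a) set \<Rightarrow> nat \<Rightarrow>
     ('a set set \<Rightarrow> 'v set) \<Rightarrow> 'a set \<Rightarrow> ('v set \<Rightarrow> nat \<Rightarrow> 'a set) set set" where
  "local_level_structures k F V n S d E y =
    (let R = local_ring F y
     in level_class k F V n S d E y `
          module_isos (trunc_ring R d) (trunc_module R (stalk k F V E y) d)
            (free_module n (trunc_ring R d)))"

definition level_structures ::
    "'a set \<Rightarrow> 'a ring \<Rightarrow> ('a, 'v) module \<Rightarrow> nat \<Rightarrow> ('a set \<Rightarrow> nat) \<Rightarrow>
     ('a set \<Rightarrow> ((nat \<times> nat) multiset \<Rightarrow> 'a) set) \<Rightarrow> ('a set set \<Rightarrow> 'v set) \<Rightarrow>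
     ('a set \<Rightarrow> ('v set \<Rightarrow> nat \<Rightarrow> 'a set) set) set" where
  "level_structures k F V n D H E =
    (\<Pi>\<^sub>E y\<in>supp k F D. local_level_structures k F V n (H y) (D y) E y)"

definition compatible_trivialization ::
    "'a set \<Rightarrow> 'a ring \<Rightarrow> ('a, 'v) module \<Rightarrow> nat \<Rightarrow> ('a set \<Rightarrow> nat) \<Rightarrow> 'a set \<Rightarrow>
     ('a set set \<Rightarrow> 'v set) \<Rightarrow> ('a set \<Rightarrow> ('v set \<Rightarrow> nat \<Rightarrow> 'a set) set) \<Rightarrow>
     ((nat \<Rightarrow> 'v set) \<Rightarrow> nat \<Rightarrow> nat \<Rightarrow> 'a set) \<Rightarrow> bool" where
  "compatible_trivialization k F V n D x E \<phi> a \<longleftrightarrow>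
    a \<in> trivializations k F V n E x \<and> reduce_trivialization k F V n E x (D x) a \<in> \<phi> x"

section \<open>The Hecke correspondence\<close>

definition compl_ring :: "'a ring \<Rightarrow> 'a set \<Rightarrow> (nat \<Rightarrow> 'a set) ring" where
  "compl_ring F x = completion (local_ring F x)"

definition uniformizer :: "'a ring \<Rightarrow> 'a set \<Rightarrow> (nat \<Rightarrow> 'a set) \<Rightarrow> bool" where
  "uniformizer F x \<pi> \<longleftrightarrow>
    \<pi> \<in> carrier (compl_ring F x) \<and> maximalideal (PIdl\<^bsub>compl_ring F x\<^esub> \<pi>) (compl_ring F x)"

definition level_subgroup ::
    "nat \<Rightarrow> 'a ring \<Rightarrow> ((nat \<times> nat) multiset \<Rightarrow> 'a) set \<Rightarrow> nat \<Rightarrow> 'a set \<Rightarrow>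
     (nat \<times> nat \<Rightarrow> nat \<Rightarrow> 'a set) set" where
  "level_subgroup n F S d x =
    {g \<in> carrier (GL n (compl_ring F x)).
       (\<lambda>ij\<in>{..<n} \<times> {..<n}. g ij d) \<in> local_points n F S x d}"

definition Delta :: "nat \<Rightarrow> nat \<Rightarrow> ('a, 'm) ring_scheme \<Rightarrow> 'a \<Rightarrow> nat \<times> nat \<Rightarrow> 'a" where
  "Delta n r R \<pi> =
    (\<lambda>(i, j)\<in>{..<n} \<times> {..<n}.
       if i \<noteq> j then \<zero>\<^bsub>R\<^esub> else if i < r then \<pi> else \<one>\<^bsub>R\<^esub>)"

text \<open>All cosets \<open>g K\<close> with \<open>g\<close> in the double coset \<open>K \<Delta> K\<close> consist of matrices with entries in the
  completed local ring, so no passage to its fraction field is needed.\<close>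

definition edge_cosets ::
    "nat \<Rightarrow> nat \<Rightarrow> 'a ring \<Rightarrow> ((nat \<times> nat) multiset \<Rightarrow> 'a) set \<Rightarrow> nat \<Rightarrow> 'a set \<Rightarrow>
     (nat \<Rightarrow> 'a set) \<Rightarrow> (nat \<times> nat \<Rightarrow> nat \<Rightarrow> 'a set) set set" where
  "edge_cosets n r F S d x \<pi> =
    (let R = compl_ring F x; M = mat_monoid n R; K = level_subgroup n F S d x
     in (\<lambda>g. g <#\<^bsub>M\<^esub> K) ` (K <#>\<^bsub>M\<^esub> {Delta n r R \<pi>} <#>\<^bsub>M\<^esub> K))"

text \<open>The edge given by a coset \<open>c = g K\<close> leads from \<open>(E, \<phi>)\<close> to \<open>(E', \<phi>')\<close>. Here \<open>a\<close> is the fixed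
  trivialization of \<open>E\<close> at \<open>x\<close>, and \<open>a'\<close> is \<open>g\<^sup>-\<^sup>1 a\<close>, characterized by \<open>g a' = a\<close> on the completed
  stalk of \<open>E'\<close>. For \<open>y \<noteq> x\<close> the stalks of \<open>E\<close> and \<open>E'\<close> coincide as subsets of \<open>V\<close>, so that the
  equation between \<open>\<phi>' y\<close> and \<open>\<phi> y\<close> makes sense.\<close>

definition hecke_edge ::
    "'a set \<Rightarrow> 'a ring \<Rightarrow> ('a, 'v) module \<Rightarrow> nat \<Rightarrow> ('a set \<Rightarrow> nat) \<Rightarrow>
     ('a set \<Rightarrow> ((nat \<times> nat) multiset \<Rightarrow> 'a) set) \<Rightarrow> 'a set \<Rightarrow>
     ('a set set \<Rightarrow> 'v set) \<Rightarrow> ('a set \<Rightarrow> ('v set \<Rightarrow> nat \<Rightarrow> 'a set) set) \<Rightarrow>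
     ((nat \<Rightarrow> 'v set) \<Rightarrow> nat \<Rightarrow> nat \<Rightarrow> 'a set) \<Rightarrow> (nat \<times> nat \<Rightarrow> nat \<Rightarrow> 'a set) set \<Rightarrow>
     ('a set set \<Rightarrow> 'v set) \<Rightarrow> ('a set \<Rightarrow> ('v set \<Rightarrow> nat \<Rightarrow> 'a set) set) \<Rightarrow> bool" where
  "hecke_edge k F V n D H x E \<phi> a c E' \<phi>' \<longleftrightarrow>
    vector_bundle k F V n E' \<and> \<phi>' \<in> level_structures k F V n D H E' \<and>
    (\<forall>U\<in>nonempty_opens k F. E' U \<subseteq> E U) \<and>
    (\<forall>U\<in>nonempty_opens k F. x \<notin> U \<longrightarrow> E' U = E U) \<and>
    (\<forall>y\<in>supp k F D - {x}. \<phi>' y = \<phi> y) \<and>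
    (let R = local_ring F x; C = completion R;
         M = stalk k F V E x; M' = stalk k F V E' x
     in \<exists>g\<in>c.
          completion_incl R M ` carrier (module_completion R M') =
            {s \<in> carrier (module_completion R M).
               a s \<in> mat_vec n C g ` carrier (free_module n C)} \<and>
          (\<exists>a'\<in>trivializations k F V n E' x.
             (\<forall>s\<in>carrier (module_completion R M').
                mat_vec n C g (a' s) = a (completion_incl R M s)) \<and>
             \<phi>' x = level_class k F V n (H x) (D x) E' x
                      (reduce_trivialization k F V n E' x (D x) a')))"

definition hecke_targets ::
    "'a set \<Rightarrow> 'a ring \<Rightarrow> ('a, 'v) module \<Rightarrow> nat \<Rightarrow> nat \<Rightarrow> ('a set \<Rightarrow> nat) \<Rightarrow>
     ('a set \<Rightarrow> ((nat \<times> nat) multiset \<Rightarrow> 'a) set) \<Rightarrow> 'a set \<Rightarrow> (nat \<Rightarrow> 'a set) \<Rightarrow>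
     ('a set set \<Rightarrow> 'v set) \<Rightarrow> ('a set \<Rightarrow> ('v set \<Rightarrow> nat \<Rightarrow> 'a set) set) \<Rightarrow>
     ((nat \<Rightarrow> 'v set) \<Rightarrow> nat \<Rightarrow> nat \<Rightarrow> 'a set) \<Rightarrow>
     (('a set set \<Rightarrow> 'v set) \<times> ('a set \<Rightarrow> ('v set \<Rightarrow> nat \<Rightarrow> 'a set) set)) set" where
  "hecke_targets k F V n r D H x \<pi> E \<phi> a =
    {(E', \<phi>'). \<exists>c\<in>edge_cosets n r F (H x) (D x) x \<pi>. hecke_edge k F V n D H x E \<phi> a c E' \<phi>'}"

text \<open>The quotient sheaf \<open>E / E'\<close> is isomorphic to the skyscraper sheaf at \<open>x\<close> given by the
  \<open>r\<close>-th power of the residue field.\<close>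

definition quotient_iso_residue_power ::
    "'a set \<Rightarrow> 'a ring \<Rightarrow> ('a, 'v) module \<Rightarrow> nat \<Rightarrow> 'a set \<Rightarrow>
     ('a set set \<Rightarrow> 'v set) \<Rightarrow> ('a set set \<Rightarrow> 'v set) \<Rightarrow> bool" where
  "quotient_iso_residue_power k F V r x E E' \<longleftrightarrow>
    (\<forall>y\<in>closed_points k F - {x}. stalk k F V E' y = stalk k F V E y) \<and>
    (let R = local_ring F x; M = stalk k F V E x; N = carrier (stalk k F V E' x)
     in (\<forall>c\<in>max_ideal R. \<forall>s\<in>carrier M. c \<odot>\<^bsub>V\<^esub> s \<in> N) \<and>
        module_isos (residue_field R) (quot_module M N) (free_module r (residue_field R)) \<noteq> {})"

definition residue_matrices :: "'a ring \<Rightarrow> 'a set \<Rightarrow> nat \<Rightarrow> nat \<Rightarrow> (nat \<times> nat \<Rightarrow> 'a set) set" where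
  "residue_matrices F x r s = {..<r} \<times> {..<s} \<rightarrow>\<^sub>E carrier (residue_field (local_ring F x))"

definition residue_lift :: "'a ring \<Rightarrow> 'a set \<Rightarrow> ('a set \<Rightarrow> nat \<Rightarrow> 'a set) \<Rightarrow> bool" where
  "residue_lift F x l \<longleftrightarrow>
    (\<forall>c\<in>carrier (residue_field (local_ring F x)). l c \<in> carrier (compl_ring F x) \<and> l c 1 = c)"

definition upper_block ::
    "nat \<Rightarrow> nat \<Rightarrow> ('a, 'm) ring_scheme \<Rightarrow> (nat \<times> nat \<Rightarrow> 'a) \<Rightarrow> nat \<times> nat \<Rightarrow> 'a" where
  "upper_block n r R B =
    (\<lambda>(i, j)\<in>{..<n} \<times> {..<n}.
       if i = j then \<one>\<^bsub>R\<^esub> else if i < r \<and> r \<le> j then B (i, j - r) else \<zero>\<^bsub>R\<^esub>)"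

end

theory Submission
  imports Defs
begin

text \<open>Multiplying by elements of \<open>K\<close>, the cosets in \<open>K \<Delta> K / K\<close> get the normal forms
  \<open>u(\<pi>\<^sup>s C) \<Delta> K\<close>, with \<open>u(B)\<close> the upper unipotent matrix with block \<open>B\<close>, \<open>s = 0\<close> in case (i)
  and \<open>s = d\<^sub>x\<close> in case (ii): the rest of \<open>K\<close> is moved across \<open>\<Delta>\<close>. For this one needs that the
  conjugate of an element of \<open>K\<close> by \<open>\<Delta>\<close>, if its upper right block is still divisible by \<open>\<pi>\<^sup>s\<close>, is again in
  \<open>K\<close>: its reduction has the same diagonal blocks, so modulo \<open>\<pi>\<^sup>d\<close> it differs only by an element of
  \<open>U\<close>, of \<open>U\<^sup>-\<close>, or not at all. If \<open>s = 0\<close>, then \<open>C\<close> can be recovered from the lattice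
  \<open>u(C) \<Delta> \<O>\<^sup>n\<close>; if \<open>s \<ge> 1\<close>, then \<open>u(\<pi>\<^sup>s C)\<close> preserves \<open>\<Delta> \<O>\<^sup>n\<close>.

  A lattice \<open>g \<O>\<^sup>n\<close> with \<open>g \<in> K \<Delta> K\<close> is cut out of \<open>\<O>\<^sup>n\<close> by the vanishing of \<open>r\<close> independent linear
  functionals to the residue field. Imposing them one at a time, each step changes a local basis
  near \<open>x\<close> in an elementary way, so that the resulting subsheaf is again locally free. That this
  basis works on an open neighbourhood uses that a rational function has only finitely many poles;
  this is proved without valuations of extensions: an element \<open>g\<close> with too many zeros would
  contradict a \<open>k[g]\<close>-linear relation between elements that separate these zeros.\<close>

section \<open>Matrices and double cosets\<close>

text \<open>All hypotheses on the level group enter through one parameter \<open>s\<close>, the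
  power of \<open>\<pi>\<close> known to divide the upper right blocks of \<open>K\<close>. For
  \<open>s = 0\<close> this says nothing, and vanishing of the lower left blocks modulo
  \<open>\<pi>\<close> takes its place. Either way the reductions modulo \<open>\<pi>\<close> are
  block triangular, so that lower right blocks multiply; this makes the block \<open>C\<close> of a
  normal form computable. Each lattice that occurs contains \<open>\<pi>\<close> times the full one.
  So membership is visible modulo \<open>\<pi>\<close>, and the lattice comes from a submodule of
  the stalk itself. The harder half of the edge relation is the converse: it prescribes only the
  completed stalk of an otherwise unknown bundle \<open>E'\<close>. To recover the stalk, some power
  of a uniformizer has to carry the stalk of \<open>E\<close> into it, which follows by expressing a
  local basis of one bundle in a local basis of the other over \<open>F\<close>. Since
  \<open>k\<close> is finite, dimension counts are replaced by counting elements: functions with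
  bounded denominators form finite sets, and pigeonhole gives linear relations. The relation used
  for zeros also shows that residue fields are finite, which gives \<open>degree_at\<close> its
  meaning.\<close>

lemma (in abelian_monoid) finsum_swap:
  assumes "finite A" "finite B" "\<And>i j. i \<in> A \<Longrightarrow> j \<in> B \<Longrightarrow> f i j \<in> carrier G"
  shows "(\<Oplus>i\<in>A. \<Oplus>j\<in>B. f i j) = (\<Oplus>j\<in>B. \<Oplus>i\<in>A. f i j)"
  using assms(1,3)
proof (induction A rule: finite_induct)
  case empty then show ?case by simp
next
  case (insert a A)
  have "(\<Oplus>i\<in>insert a A. \<Oplus>j\<in>B. f i j) = (\<Oplus>j\<in>B. f a j) \<oplus> (\<Oplus>j\<in>B. \<Oplus>i\<in>A. f i j)"
    using insert by (simp add: finsum_insert Pi_def)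
  also have "\<dots> = (\<Oplus>j\<in>B. f a j \<oplus> (\<Oplus>i\<in>A. f i j))"
    using insert assms(2) by (subst finsum_addf) (auto simp: Pi_def)
  also have "\<dots> = (\<Oplus>j\<in>B. \<Oplus>i\<in>insert a A. f i j)"
    using insert by (intro finsum_cong') (auto simp: Pi_def finsum_insert)
  finally show ?case .
qed

lemma (in abelian_monoid) finsum_single:
  assumes "finite A" "i \<in> A" "\<And>j. j \<in> A \<Longrightarrow> j \<noteq> i \<Longrightarrow> f j = \<zero>" "f i \<in> carrier G"
  shows "(\<Oplus>j\<in>A. f j) = f i"
proof -
  have "(\<Oplus>j\<in>A. f j) = (\<Oplus>j\<in>A. if i = j then f j else \<zero>)"
    using assms(2-4) by (intro finsum_cong') fastforce+
  also have "\<dots> = f i"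
    using assms by (subst finsum_singleton) fastforce+
  finally show ?thesis .
qed

lemma (in ring_hom_ring) hom_finsum':
  assumes "finite A" "f \<in> A \<rightarrow> carrier R"
  shows "h (\<Oplus>i\<in>A. f i) = (\<Oplus>\<^bsub>S\<^esub>i\<in>A. h (f i))"
  using assms by (induction A rule: finite_induct) (auto simp: Pi_def)

section \<open>Matrix monoids and their action on vectors\<close>

lemma mat_mult_eq: "i < n \<Longrightarrow> j < n \<Longrightarrow>
   (A \<otimes>\<^bsub>mat_monoid n R\<^esub> B) (i, j) = (\<Oplus>\<^bsub>R\<^esub>l\<in>{..<n}. A (i, l) \<otimes>\<^bsub>R\<^esub> B (l, j))"
  by (simp add: mat_monoid_def)

lemma mat_one_eq: "i < n \<Longrightarrow> j < n \<Longrightarrow>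
   \<one>\<^bsub>mat_monoid n R\<^esub> (i, j) = (if i = j then \<one>\<^bsub>R\<^esub> else \<zero>\<^bsub>R\<^esub>)"
  by (simp add: mat_monoid_def)

lemma mat_entry: "A \<in> carrier (mat_monoid n R) \<Longrightarrow> i < n \<Longrightarrow> j < n \<Longrightarrow> A (i, j) \<in> carrier R"
  by (auto simp: mat_monoid_def)

lemma mat_eqI:
  assumes "A \<in> carrier (mat_monoid n R)" "B \<in> carrier (mat_monoid n R)"
    and "\<And>i j. i < n \<Longrightarrow> j < n \<Longrightarrow> A (i, j) = B (i, j)"
  shows "A = B"
proof (rule PiE_ext)
  show "A \<in> {..<n} \<times> {..<n} \<rightarrow>\<^sub>E carrier R" "B \<in> {..<n} \<times> {..<n} \<rightarrow>\<^sub>E carrier R"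
    using assms by (simp_all add: mat_monoid_def)
qed (use assms(3) in auto)

lemma mat_carrierI:
  assumes "\<And>i j. i < n \<Longrightarrow> j < n \<Longrightarrow> f i j \<in> carrier R"
  shows "(\<lambda>(i, j)\<in>{..<n} \<times> {..<n}. f i j) \<in> carrier (mat_monoid n R)"
  using assms by (auto simp: mat_monoid_def)

lemma vec_eqI:
  assumes "v \<in> {..<n} \<rightarrow>\<^sub>E A" "w \<in> {..<n} \<rightarrow>\<^sub>E A" "\<And>i. i < n \<Longrightarrow> v i = w i"
  shows "v = w"
  using assms by (intro PiE_ext[OF assms(1,2)]) auto

lemma GL_mult [simp]: "A \<otimes>\<^bsub>GL n R\<^esub> B = A \<otimes>\<^bsub>mat_monoid n R\<^esub> B"
  by (simp add: GL_def units_of_def)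

lemma GL_one [simp]: "\<one>\<^bsub>GL n R\<^esub> = \<one>\<^bsub>mat_monoid n R\<^esub>"
  by (simp add: GL_def units_of_def)

lemma GL_carrier: "carrier (GL n R) = Units (mat_monoid n R)"
  by (simp add: GL_def units_of_def)

definition mat_unit_vec :: "nat \<Rightarrow> ('a, 'm) ring_scheme \<Rightarrow> nat \<Rightarrow> nat \<Rightarrow> 'a" where
  "mat_unit_vec n R j = (\<lambda>i\<in>{..<n}. if i = j then \<one>\<^bsub>R\<^esub> else \<zero>\<^bsub>R\<^esub>)"

context cring
begin

lemma mat_mult_closed:
  assumes "A \<in> carrier (mat_monoid n R)" "B \<in> carrier (mat_monoid n R)"
  shows "A \<otimes>\<^bsub>mat_monoid n R\<^esub> B \<in> carrier (mat_monoid n R)"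
  using mat_entry[OF assms(1)] mat_entry[OF assms(2)]
  by (auto simp: mat_monoid_def intro!: finsum_closed)

lemma mat_monoid_monoid: "monoid (mat_monoid n R)"
proof (rule monoidI)
  fix A B assume A: "A \<in> carrier (mat_monoid n R)" and B: "B \<in> carrier (mat_monoid n R)"
  show "A \<otimes>\<^bsub>mat_monoid n R\<^esub> B \<in> carrier (mat_monoid n R)"
    by (rule mat_mult_closed[OF A B])
next
  show "\<one>\<^bsub>mat_monoid n R\<^esub> \<in> carrier (mat_monoid n R)"
    by (auto simp: mat_monoid_def)
next
  fix A B C assume A: "A \<in> carrier (mat_monoid n R)" and B: "B \<in> carrier (mat_monoid n R)"
    and C: "C \<in> carrier (mat_monoid n R)"
  note e = mat_entry[OF A] mat_entry[OF B] mat_entry[OF C]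
  have eq: "(\<Oplus>l\<in>{..<n}. (\<Oplus>m\<in>{..<n}. A (i, m) \<otimes> B (m, l)) \<otimes> C (l, j))
      = (\<Oplus>m\<in>{..<n}. A (i, m) \<otimes> (\<Oplus>l\<in>{..<n}. B (m, l) \<otimes> C (l, j)))" if "i < n" "j < n" for i j
  proof -
    have "(\<Oplus>l\<in>{..<n}. (\<Oplus>m\<in>{..<n}. A (i, m) \<otimes> B (m, l)) \<otimes> C (l, j))
       = (\<Oplus>l\<in>{..<n}. \<Oplus>m\<in>{..<n}. A (i, m) \<otimes> B (m, l) \<otimes> C (l, j))"
      using that e by (intro finsum_cong') (auto simp: Pi_def finsum_ldistr)
    also have "\<dots> = (\<Oplus>m\<in>{..<n}. \<Oplus>l\<in>{..<n}. A (i, m) \<otimes> B (m, l) \<otimes> C (l, j))"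
      using that e by (intro finsum_swap) auto
    also have "\<dots> = (\<Oplus>m\<in>{..<n}. A (i, m) \<otimes> (\<Oplus>l\<in>{..<n}. B (m, l) \<otimes> C (l, j)))"
      using that e by (intro finsum_cong') (auto simp: Pi_def finsum_rdistr m_assoc intro!: finsum_cong')
    finally show ?thesis .
  qed
  show "A \<otimes>\<^bsub>mat_monoid n R\<^esub> B \<otimes>\<^bsub>mat_monoid n R\<^esub> C = A \<otimes>\<^bsub>mat_monoid n R\<^esub> (B \<otimes>\<^bsub>mat_monoid n R\<^esub> C)"
  proof (rule mat_eqI)
    fix i j assume ij: "i < n" "j < n"
    have "(A \<otimes>\<^bsub>mat_monoid n R\<^esub> B \<otimes>\<^bsub>mat_monoid n R\<^esub> C) (i, j) =
       (\<Oplus>l\<in>{..<n}. (\<Oplus>m\<in>{..<n}. A (i, m) \<otimes> B (m, l)) \<otimes> C (l, j))"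
      using ij e by (subst mat_mult_eq) (auto simp: mat_mult_eq intro!: finsum_cong')
    also have "\<dots> = (A \<otimes>\<^bsub>mat_monoid n R\<^esub> (B \<otimes>\<^bsub>mat_monoid n R\<^esub> C)) (i, j)"
      unfolding eq[OF ij] using ij e
      by (subst mat_mult_eq) (auto simp: mat_mult_eq intro!: finsum_cong')
    finally show "(A \<otimes>\<^bsub>mat_monoid n R\<^esub> B \<otimes>\<^bsub>mat_monoid n R\<^esub> C) (i, j) =
      (A \<otimes>\<^bsub>mat_monoid n R\<^esub> (B \<otimes>\<^bsub>mat_monoid n R\<^esub> C)) (i, j)" .
  qed (use A B C mat_mult_closed in blast)+
next
  fix A assume A: "A \<in> carrier (mat_monoid n R)"
  note e = mat_entry[OF A]
  have one: "\<one>\<^bsub>mat_monoid n R\<^esub> \<in> carrier (mat_monoid n R)"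
    by (auto simp: mat_monoid_def)
  have "(\<Oplus>l\<in>{..<n}. \<one>\<^bsub>mat_monoid n R\<^esub> (i, l) \<otimes> A (l, j)) = A (i, j)" if "i < n" "j < n" for i j
    using that e by (subst finsum_single[where i = i]) (auto simp: mat_one_eq)
  then show "\<one>\<^bsub>mat_monoid n R\<^esub> \<otimes>\<^bsub>mat_monoid n R\<^esub> A = A"
    using A one mat_mult_closed by (intro mat_eqI[of _ n R]) (auto simp: mat_mult_eq)
  have "(\<Oplus>l\<in>{..<n}. A (i, l) \<otimes> \<one>\<^bsub>mat_monoid n R\<^esub> (l, j)) = A (i, j)" if "i < n" "j < n" for i j
    using that e by (subst finsum_single[where i = j]) (auto simp: mat_one_eq)
  then show "A \<otimes>\<^bsub>mat_monoid n R\<^esub> \<one>\<^bsub>mat_monoid n R\<^esub> = A"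
    using A one mat_mult_closed by (intro mat_eqI[of _ n R]) (auto simp: mat_mult_eq)
qed

lemma GL_group: "group (GL n R)"
  unfolding GL_def by (rule monoid.units_group[OF mat_monoid_monoid])

lemma GL_in_mat: "A \<in> carrier (GL n R) \<Longrightarrow> A \<in> carrier (mat_monoid n R)"
  unfolding GL_carrier by (rule monoid.Units_closed[OF mat_monoid_monoid])

lemma GL_I:
  assumes "A \<in> carrier (mat_monoid n R)" "B \<in> carrier (mat_monoid n R)"
    "A \<otimes>\<^bsub>mat_monoid n R\<^esub> B = \<one>\<^bsub>mat_monoid n R\<^esub>" "B \<otimes>\<^bsub>mat_monoid n R\<^esub> A = \<one>\<^bsub>mat_monoid n R\<^esub>"
  shows "A \<in> carrier (GL n R)"
  using assms unfolding GL_carrier Units_def by auto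

lemma mat_vec_closed:
  assumes "A \<in> carrier (mat_monoid n R)" "v \<in> {..<n} \<rightarrow>\<^sub>E carrier R"
  shows "mat_vec n R A v \<in> {..<n} \<rightarrow>\<^sub>E carrier R"
  using mat_entry[OF assms(1)] assms(2) by (auto simp: mat_vec_def intro!: finsum_closed)

lemma mat_vec_mult:
  assumes "A \<in> carrier (mat_monoid n R)" "B \<in> carrier (mat_monoid n R)" "v \<in> {..<n} \<rightarrow>\<^sub>E carrier R"
  shows "mat_vec n R (A \<otimes>\<^bsub>mat_monoid n R\<^esub> B) v = mat_vec n R A (mat_vec n R B v)"
proof -
  note e = mat_entry[OF assms(1)] mat_entry[OF assms(2)]
  have v: "v i \<in> carrier R" if "i < n" for i using assms(3) that by auto
  have "(\<Oplus>l\<in>{..<n}. (\<Oplus>m\<in>{..<n}. A (i, m) \<otimes> B (m, l)) \<otimes> v l)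
      = (\<Oplus>m\<in>{..<n}. A (i, m) \<otimes> (\<Oplus>l\<in>{..<n}. B (m, l) \<otimes> v l))" if "i < n" for i
  proof -
    have "(\<Oplus>l\<in>{..<n}. (\<Oplus>m\<in>{..<n}. A (i, m) \<otimes> B (m, l)) \<otimes> v l)
       = (\<Oplus>l\<in>{..<n}. \<Oplus>m\<in>{..<n}. A (i, m) \<otimes> B (m, l) \<otimes> v l)"
      using that e v by (intro finsum_cong') (auto simp: Pi_def finsum_ldistr)
    also have "\<dots> = (\<Oplus>m\<in>{..<n}. \<Oplus>l\<in>{..<n}. A (i, m) \<otimes> B (m, l) \<otimes> v l)"
      using that e v by (intro finsum_swap) auto
    also have "\<dots> = (\<Oplus>m\<in>{..<n}. A (i, m) \<otimes> (\<Oplus>l\<in>{..<n}. B (m, l) \<otimes> v l))"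
      using that e v by (intro finsum_cong') (auto simp: Pi_def finsum_rdistr m_assoc intro!: finsum_cong')
    finally show ?thesis .
  qed
  moreover have "(\<Oplus>l\<in>{..<n}. (A \<otimes>\<^bsub>mat_monoid n R\<^esub> B) (i, l) \<otimes> v l) =
     (\<Oplus>l\<in>{..<n}. (\<Oplus>m\<in>{..<n}. A (i, m) \<otimes> B (m, l)) \<otimes> v l)" if "i < n" for i
    using that e v by (intro finsum_cong') (auto simp: mat_mult_eq)
  moreover have "(\<Oplus>m\<in>{..<n}. A (i, m) \<otimes> mat_vec n R B v m) =
     (\<Oplus>m\<in>{..<n}. A (i, m) \<otimes> (\<Oplus>l\<in>{..<n}. B (m, l) \<otimes> v l))" if "i < n" for i
    using that e v by (intro finsum_cong') (auto simp: mat_vec_def)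
  ultimately show ?thesis
    unfolding mat_vec_def[of n R "A \<otimes>\<^bsub>mat_monoid n R\<^esub> B"] mat_vec_def[of n R A]
    by (intro restrict_ext) auto
qed

lemma mat_vec_one:
  assumes "v \<in> {..<n} \<rightarrow>\<^sub>E carrier R"
  shows "mat_vec n R \<one>\<^bsub>mat_monoid n R\<^esub> v = v"
proof (rule vec_eqI[OF _ assms])
  show "mat_vec n R \<one>\<^bsub>mat_monoid n R\<^esub> v \<in> {..<n} \<rightarrow>\<^sub>E carrier R"
    using assms by (intro mat_vec_closed monoid.one_closed[OF mat_monoid_monoid])
  fix i assume i: "i < n"
  have "v j \<in> carrier R" if "j < n" for j using assms that by auto
  then show "mat_vec n R \<one>\<^bsub>mat_monoid n R\<^esub> v i = v i"
    using i by (simp add: mat_vec_def mat_one_eq) (subst finsum_single[where i = i], auto simp: mat_one_eq)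
qed

lemma mat_vec_add:
  assumes "A \<in> carrier (mat_monoid n R)" "v \<in> {..<n} \<rightarrow>\<^sub>E carrier R" "w \<in> {..<n} \<rightarrow>\<^sub>E carrier R"
  shows "mat_vec n R A (\<lambda>i\<in>{..<n}. v i \<oplus> w i) = (\<lambda>i\<in>{..<n}. mat_vec n R A v i \<oplus> mat_vec n R A w i)"
proof -
  have "v i \<in> carrier R" "w i \<in> carrier R" if "i < n" for i using assms that by auto
  moreover note mat_entry[OF assms(1)]
  ultimately have "(\<Oplus>j\<in>{..<n}. A (i, j) \<otimes> (\<lambda>i\<in>{..<n}. v i \<oplus> w i) j) =
      (\<Oplus>j\<in>{..<n}. A (i, j) \<otimes> v j) \<oplus> (\<Oplus>j\<in>{..<n}. A (i, j) \<otimes> w j)" if "i < n" for i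
    using that by (subst finsum_addf[symmetric]) (auto intro!: finsum_cong' simp: r_distr simp del: finsum_addf)
  then show ?thesis unfolding mat_vec_def by (intro restrict_ext) auto
qed

lemma mat_vec_smult:
  assumes "A \<in> carrier (mat_monoid n R)" "v \<in> {..<n} \<rightarrow>\<^sub>E carrier R" "c \<in> carrier R"
  shows "mat_vec n R A (\<lambda>i\<in>{..<n}. c \<otimes> v i) = (\<lambda>i\<in>{..<n}. c \<otimes> mat_vec n R A v i)"
proof -
  have "v i \<in> carrier R" if "i < n" for i using assms that by auto
  moreover note mat_entry[OF assms(1)]
  ultimately have "(\<Oplus>j\<in>{..<n}. A (i, j) \<otimes> (\<lambda>i\<in>{..<n}. c \<otimes> v i) j) =
      c \<otimes> (\<Oplus>j\<in>{..<n}. A (i, j) \<otimes> v j)" if "i < n" for i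
    using that assms(3) by (subst finsum_rdistr) (auto intro!: finsum_cong' simp: m_lcomm)
  then show ?thesis unfolding mat_vec_def by (intro restrict_ext) auto
qed

lemma mat_unit_vec_closed: "mat_unit_vec n R j \<in> {..<n} \<rightarrow>\<^sub>E carrier R"
  by (auto simp: mat_unit_vec_def)

lemma mat_vec_unit:
  assumes "A \<in> carrier (mat_monoid n R)" "i < n" "j < n"
  shows "mat_vec n R A (mat_unit_vec n R j) i = A (i, j)"
  using mat_entry[OF assms(1)] assms(2,3)
  by (simp add: mat_vec_def) (subst finsum_single[where i = j], auto simp: mat_unit_vec_def)

lemma GL_mat_vec_inv:
  assumes "A \<in> carrier (GL n R)" "v \<in> {..<n} \<rightarrow>\<^sub>E carrier R"
  shows "mat_vec n R (inv\<^bsub>GL n R\<^esub> A) (mat_vec n R A v) = v"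
    and "mat_vec n R A (mat_vec n R (inv\<^bsub>GL n R\<^esub> A) v) = v"
proof -
  interpret G: group "GL n R" by (rule GL_group)
  show "mat_vec n R (inv\<^bsub>GL n R\<^esub> A) (mat_vec n R A v) = v"
    "mat_vec n R A (mat_vec n R (inv\<^bsub>GL n R\<^esub> A) v) = v"
    using assms G.l_inv[OF assms(1)] G.r_inv[OF assms(1)] G.inv_closed[OF assms(1)]
    by (simp_all add: mat_vec_mult[symmetric] GL_in_mat mat_vec_one)
qed

lemma mat_vec_GL_bij:
  assumes "A \<in> carrier (GL n R)"
  shows "bij_betw (mat_vec n R A) ({..<n} \<rightarrow>\<^sub>E carrier R) ({..<n} \<rightarrow>\<^sub>E carrier R)"
  using assms GL_mat_vec_inv[OF assms] group.inv_closed[OF GL_group assms]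
  by (intro bij_betwI[where g = "mat_vec n R (inv\<^bsub>GL n R\<^esub> A)"])
    (blast intro!: mat_vec_closed GL_in_mat)+

end

section \<open>Entrywise application of ring homomorphisms\<close>

definition mat_map :: "nat \<Rightarrow> ('a \<Rightarrow> 'b) \<Rightarrow> (nat \<times> nat \<Rightarrow> 'a) \<Rightarrow> nat \<times> nat \<Rightarrow> 'b" where
  "mat_map n h A = (\<lambda>ij\<in>{..<n} \<times> {..<n}. h (A ij))"

context ring_hom_cring
begin

lemma ring_hom_ring': "ring_hom_ring R S h"
  by (rule ring_hom_ringI2[OF R.ring_axioms S.ring_axioms homh])

lemma mat_map_closed:
  "A \<in> carrier (mat_monoid n R) \<Longrightarrow> mat_map n h A \<in> carrier (mat_monoid n S)"
  using mat_entry[of A n R] by (auto simp: mat_map_def mat_monoid_def)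

lemma mat_map_one: "mat_map n h \<one>\<^bsub>mat_monoid n R\<^esub> = \<one>\<^bsub>mat_monoid n S\<^esub>"
  by (auto simp: mat_map_def mat_monoid_def intro!: restrict_ext)

lemma mat_map_mult:
  assumes "A \<in> carrier (mat_monoid n R)" "B \<in> carrier (mat_monoid n R)"
  shows "mat_map n h (A \<otimes>\<^bsub>mat_monoid n R\<^esub> B) = mat_map n h A \<otimes>\<^bsub>mat_monoid n S\<^esub> mat_map n h B"
proof (rule mat_eqI[of _ n S])
  show "mat_map n h (A \<otimes>\<^bsub>mat_monoid n R\<^esub> B) \<in> carrier (mat_monoid n S)"
    "mat_map n h A \<otimes>\<^bsub>mat_monoid n S\<^esub> mat_map n h B \<in> carrier (mat_monoid n S)"
    using assms monoid.m_closed[OF R.mat_monoid_monoid] monoid.m_closed[OF S.mat_monoid_monoid]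
      mat_map_closed by blast+
  fix i j assume ij: "i < n" "j < n"
  note e = mat_entry[OF assms(1)] mat_entry[OF assms(2)]
  have "h (\<Oplus>l\<in>{..<n}. A (i, l) \<otimes> B (l, j)) = (\<Oplus>\<^bsub>S\<^esub>l\<in>{..<n}. h (A (i, l) \<otimes> B (l, j)))"
    using ij e by (subst ring_hom_ring.hom_finsum'[OF ring_hom_ring']) auto
  also have "\<dots> = (\<Oplus>\<^bsub>S\<^esub>l\<in>{..<n}. mat_map n h A (i, l) \<otimes>\<^bsub>S\<^esub> mat_map n h B (l, j))"
    using ij e by (intro S.finsum_cong') (auto simp: mat_map_def)
  finally show "mat_map n h (A \<otimes>\<^bsub>mat_monoid n R\<^esub> B) (i, j) =
      (mat_map n h A \<otimes>\<^bsub>mat_monoid n S\<^esub> mat_map n h B) (i, j)"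
    using ij by (simp add: mat_mult_eq mat_map_def)
qed

lemma mat_map_GL: "A \<in> carrier (GL n R) \<Longrightarrow> mat_map n h A \<in> carrier (GL n S)"
  unfolding GL_carrier Units_def
  using mat_map_closed mat_map_mult mat_map_one
  by (smt (verit, ccfv_threshold) mem_Collect_eq)

lemma mat_map_inv:
  assumes "A \<in> carrier (GL n R)"
  shows "mat_map n h (inv\<^bsub>GL n R\<^esub> A) = inv\<^bsub>GL n S\<^esub> mat_map n h A"
proof -
  interpret G: group "GL n R" by (rule R.GL_group)
  interpret G': group "GL n S" by (rule S.GL_group)
  have "mat_map n h (inv\<^bsub>GL n R\<^esub> A) \<otimes>\<^bsub>GL n S\<^esub> mat_map n h A = \<one>\<^bsub>GL n S\<^esub>"
    using G.l_inv[OF assms] G.inv_closed[OF assms] assms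
    by (simp add: mat_map_mult[symmetric] R.GL_in_mat mat_map_one)
  then show ?thesis
    using mat_map_GL assms G.inv_closed[OF assms] G'.inv_equality by metis
qed

lemma mat_map_mat_vec:
  assumes "A \<in> carrier (mat_monoid n R)" "v \<in> {..<n} \<rightarrow>\<^sub>E carrier R"
  shows "(\<lambda>i\<in>{..<n}. h (mat_vec n R A v i)) = mat_vec n S (mat_map n h A) (\<lambda>i\<in>{..<n}. h (v i))"
proof -
  note e = mat_entry[OF assms(1)]
  have v: "v i \<in> carrier R" if "i < n" for i using assms that by auto
  have "h (\<Oplus>j\<in>{..<n}. A (i, j) \<otimes> v j) = (\<Oplus>\<^bsub>S\<^esub>j\<in>{..<n}. mat_map n h A (i, j) \<otimes>\<^bsub>S\<^esub> (\<lambda>i\<in>{..<n}. h (v i)) j)"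
    if "i < n" for i
    using e v that by (subst ring_hom_ring.hom_finsum'[OF ring_hom_ring'])
      (auto simp: mat_map_def intro!: S.finsum_cong')
  then show ?thesis unfolding mat_vec_def by (intro restrict_ext) auto
qed

end

section \<open>The diagonal matrix \<open>Delta\<close> and its lattices\<close>

text \<open>The positions whose entries get divided by \<open>\<pi>\<close> when a matrix is moved
  across \<open>\<Delta>\<close> from left to right. The lower left entries get multiplied by
  \<open>\<pi>\<close>, and all others stay.\<close>

definition upper_right :: "nat \<Rightarrow> nat \<Rightarrow> nat \<Rightarrow> nat \<Rightarrow> bool" where
  "upper_right n r i j \<longleftrightarrow> i < r \<and> r \<le> j \<and> j < n"

definition lattice :: "nat \<Rightarrow> ('a, 'm) ring_scheme \<Rightarrow> (nat \<times> nat \<Rightarrow> 'a) \<Rightarrow> (nat \<Rightarrow> 'a) set" where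
  "lattice n R g = mat_vec n R g ` ({..<n} \<rightarrow>\<^sub>E carrier R)"

text \<open>Cancellation of \<open>\<pi>\<close> stands in for integrality, since it is the property
  established for the completed ring. As there is no fraction field, the conjugate of
  \<open>A\<close> by \<open>\<Delta>\<close> is always expressed by an equation
  \<open>A \<Delta> = \<Delta> Z\<close>.\<close>

locale scaling = cring R for R (structure) +
  fixes n r :: nat and \<pi> :: 'a
  assumes r_le: "r \<le> n"
    and pi_closed [simp, intro]: "\<pi> \<in> carrier R"
    and pi_cancel: "\<lbrakk>a \<in> carrier R; b \<in> carrier R; \<pi> \<otimes> a = \<pi> \<otimes> b\<rbrakk> \<Longrightarrow> a = b"
begin

abbreviation "M \<equiv> mat_monoid n R"
abbreviation "G \<equiv> GL n R"
abbreviation "\<Delta> \<equiv> Delta n r R \<pi>"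
abbreviation "u \<equiv> upper_block n r R"

sublocale M: monoid M by (rule mat_monoid_monoid)
sublocale G: group G by (rule GL_group)

lemmas G_M = GL_in_mat

definition q :: "nat \<Rightarrow> 'a" where "q i = (if i < r then \<pi> else \<one>)"

lemma q_closed [simp]: "q i \<in> carrier R" by (simp add: q_def)

lemma q_cancel: "\<lbrakk>a \<in> carrier R; b \<in> carrier R; q i \<otimes> a = q i \<otimes> b\<rbrakk> \<Longrightarrow> a = b"
  using pi_cancel[of a b] by (cases "i < r") (simp_all add: q_def)

lemma Delta_closed [simp]: "\<Delta> \<in> carrier M"
  unfolding Delta_def by (rule mat_carrierI) auto

lemma Delta_entry: "i < n \<Longrightarrow> j < n \<Longrightarrow> \<Delta> (i, j) = (if i = j then q i else \<zero>)"
  by (auto simp: Delta_def q_def)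

lemma Delta_mult:
  assumes "A \<in> carrier M" "i < n" "j < n"
  shows "(\<Delta> \<otimes>\<^bsub>M\<^esub> A) (i, j) = q i \<otimes> A (i, j)"
proof -
  have "(\<Oplus>l\<in>{..<n}. \<Delta> (i, l) \<otimes> A (l, j)) = \<Delta> (i, i) \<otimes> A (i, j)"
    using assms mat_entry[OF assms(1)] by (intro finsum_single) (auto simp: Delta_entry)
  then show ?thesis using assms by (simp add: mat_mult_eq Delta_entry)
qed

lemma mult_Delta:
  assumes "A \<in> carrier M" "i < n" "j < n"
  shows "(A \<otimes>\<^bsub>M\<^esub> \<Delta>) (i, j) = A (i, j) \<otimes> q j"
proof -
  have "(\<Oplus>l\<in>{..<n}. A (i, l) \<otimes> \<Delta> (l, j)) = A (i, j) \<otimes> \<Delta> (j, j)"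
    using assms mat_entry[OF assms(1)] by (intro finsum_single) (auto simp: Delta_entry)
  then show ?thesis using assms by (simp add: mat_mult_eq Delta_entry)
qed

lemma Delta_cancel:
  assumes "A \<in> carrier M" "B \<in> carrier M" "\<Delta> \<otimes>\<^bsub>M\<^esub> A = \<Delta> \<otimes>\<^bsub>M\<^esub> B"
  shows "A = B"
proof (rule mat_eqI[OF assms(1,2)])
  fix i j assume ij: "i < n" "j < n"
  then have "q i \<otimes> A (i, j) = q i \<otimes> B (i, j)"
    using assms Delta_mult by metis
  then show "A (i, j) = B (i, j)"
    using q_cancel mat_entry[OF assms(1) ij] mat_entry[OF assms(2) ij] by blast
qed

lemma Delta_vec:
  assumes "v \<in> {..<n} \<rightarrow>\<^sub>E carrier R" "i < n"
  shows "mat_vec n R \<Delta> v i = q i \<otimes> v i"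
proof -
  have "(\<Oplus>l\<in>{..<n}. \<Delta> (i, l) \<otimes> v l) = \<Delta> (i, i) \<otimes> v i"
  proof (rule finsum_single)
    show "\<Delta> (i, j) \<otimes> v j = \<zero>" if "j \<in> {..<n}" "j \<noteq> i" for j
    proof -
      have "v j \<in> carrier R" using that assms by auto
      then show ?thesis using that assms by (simp add: Delta_entry)
    qed
    have "v i \<in> carrier R" using assms by auto
    then show "\<Delta> (i, i) \<otimes> v i \<in> carrier R" using assms by (simp add: Delta_entry)
  qed (use assms in auto)
  then show ?thesis using assms by (simp add: mat_vec_def Delta_entry)
qed

definition dvd_ur :: "nat \<Rightarrow> (nat \<times> nat \<Rightarrow> 'a) \<Rightarrow> bool" where
  "dvd_ur s A \<longleftrightarrow> (\<forall>i j. upper_right n r i j \<longrightarrow> (\<exists>c\<in>carrier R. A (i, j) = \<pi> [^] s \<otimes> c))"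

lemma dvd_urD:
  assumes "dvd_ur s A" "upper_right n r i j"
  obtains c where "c \<in> carrier R" "A (i, j) = \<pi> [^] s \<otimes> c"
  using assms unfolding dvd_ur_def by blast

lemma dvd_ur_mono:
  assumes "dvd_ur (s + t) A"
  shows "dvd_ur s A"
  unfolding dvd_ur_def
proof (intro allI impI)
  fix i j assume "upper_right n r i j"
  then obtain c where "c \<in> carrier R" "A (i, j) = \<pi> [^] (s + t) \<otimes> c"
    using assms dvd_urD by blast
  then show "\<exists>c\<in>carrier R. A (i, j) = \<pi> [^] s \<otimes> c"
    by (intro bexI[where x = "\<pi> [^] t \<otimes> c"]) (auto simp: nat_pow_mult[symmetric] m_assoc)
qed

text \<open>The equation is solved entry by entry: \<open>A (i, j) \<otimes> q j\<close> has to be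
  divisible by \<open>q i\<close>. This is automatic if \<open>q i\<close> is \<open>\<one>\<close>
  or equals \<open>q j\<close>, and the remaining case is the upper right block.\<close>

lemma conj_ex:
  assumes A: "A \<in> carrier M" and d: "dvd_ur 1 A"
  shows "\<exists>Z\<in>carrier M. A \<otimes>\<^bsub>M\<^esub> \<Delta> = \<Delta> \<otimes>\<^bsub>M\<^esub> Z"
proof -
  have "\<exists>c\<in>carrier R. A (i, j) \<otimes> q j = q i \<otimes> c" if "i < n" "j < n" for i j
  proof (cases "upper_right n r i j")
    case True
    then obtain c where "c \<in> carrier R" "A (i, j) = \<pi> [^] (1::nat) \<otimes> c" using dvd_urD[OF d] by blast
    then show ?thesis using True by (intro bexI[where x = c]) (auto simp: q_def upper_right_def)
  next
    case False
    have "A (i, j) \<in> carrier R" using mat_entry[OF A] that by auto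
    moreover have "q i = \<one> \<or> q i = q j" using False that by (auto simp: q_def upper_right_def)
    ultimately show ?thesis by (metis l_one m_closed m_comm q_closed)
  qed
  then obtain f where f: "\<And>i j. i < n \<Longrightarrow> j < n \<Longrightarrow> f i j \<in> carrier R \<and> A (i, j) \<otimes> q j = q i \<otimes> f i j"
    by metis
  let ?Z = "\<lambda>(i, j)\<in>{..<n} \<times> {..<n}. f i j"
  have Z: "?Z \<in> carrier M" using f by (intro mat_carrierI) auto
  moreover have "A \<otimes>\<^bsub>M\<^esub> \<Delta> = \<Delta> \<otimes>\<^bsub>M\<^esub> ?Z"
  proof (rule mat_eqI[of _ n R])
    fix i j assume ij: "i < n" "j < n"
    then show "(A \<otimes>\<^bsub>M\<^esub> \<Delta>) (i, j) = (\<Delta> \<otimes>\<^bsub>M\<^esub> ?Z) (i, j)"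
      using f by (simp add: mult_Delta[OF A] Delta_mult[OF Z])
  qed (use A Z in auto)
  ultimately show ?thesis by blast
qed

text \<open>The conjugate of the inverse is the inverse of the conjugate, which is why divisibility
  is asked of both matrices.\<close>

lemma conj_GL:
  assumes A: "A \<in> carrier G" and d: "dvd_ur 1 A" "dvd_ur 1 (inv\<^bsub>G\<^esub> A)"
  shows "\<exists>Z\<in>carrier G. A \<otimes>\<^bsub>M\<^esub> \<Delta> = \<Delta> \<otimes>\<^bsub>M\<^esub> Z"
proof -
  have Ai: "inv\<^bsub>G\<^esub> A \<in> carrier M" "A \<in> carrier M" using A G_M by auto
  obtain Z where Z: "Z \<in> carrier M" "A \<otimes>\<^bsub>M\<^esub> \<Delta> = \<Delta> \<otimes>\<^bsub>M\<^esub> Z" using conj_ex Ai d by blast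
  obtain Y where Y: "Y \<in> carrier M" "inv\<^bsub>G\<^esub> A \<otimes>\<^bsub>M\<^esub> \<Delta> = \<Delta> \<otimes>\<^bsub>M\<^esub> Y" using conj_ex Ai d by blast
  have i: "A \<otimes>\<^bsub>M\<^esub> inv\<^bsub>G\<^esub> A = \<one>\<^bsub>M\<^esub>" "inv\<^bsub>G\<^esub> A \<otimes>\<^bsub>M\<^esub> A = \<one>\<^bsub>M\<^esub>"
    using G.r_inv[OF A] G.l_inv[OF A] by simp_all
  have "\<Delta> \<otimes>\<^bsub>M\<^esub> (Z \<otimes>\<^bsub>M\<^esub> Y) = A \<otimes>\<^bsub>M\<^esub> \<Delta> \<otimes>\<^bsub>M\<^esub> Y"
    unfolding Z(2) using Z(1) Y(1) by (simp add: M.m_assoc)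
  also have "\<dots> = A \<otimes>\<^bsub>M\<^esub> inv\<^bsub>G\<^esub> A \<otimes>\<^bsub>M\<^esub> \<Delta>"
    using Z(1) Y(1) Ai Y(2)[symmetric] by (simp add: M.m_assoc)
  also have "\<dots> = \<Delta> \<otimes>\<^bsub>M\<^esub> \<one>\<^bsub>M\<^esub>" using i by simp
  finally have XY: "Z \<otimes>\<^bsub>M\<^esub> Y = \<one>\<^bsub>M\<^esub>" by (rule Delta_cancel[rotated 2]) (simp_all add: Z(1) Y(1))
  have "\<Delta> \<otimes>\<^bsub>M\<^esub> (Y \<otimes>\<^bsub>M\<^esub> Z) = inv\<^bsub>G\<^esub> A \<otimes>\<^bsub>M\<^esub> \<Delta> \<otimes>\<^bsub>M\<^esub> Z"
    unfolding Y(2) using Z(1) Y(1) by (simp add: M.m_assoc)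
  also have "\<dots> = inv\<^bsub>G\<^esub> A \<otimes>\<^bsub>M\<^esub> A \<otimes>\<^bsub>M\<^esub> \<Delta>"
    using Z(1) Y(1) Ai Z(2)[symmetric] by (simp add: M.m_assoc)
  also have "\<dots> = \<Delta> \<otimes>\<^bsub>M\<^esub> \<one>\<^bsub>M\<^esub>" using i by simp
  finally have YX: "Y \<otimes>\<^bsub>M\<^esub> Z = \<one>\<^bsub>M\<^esub>" by (rule Delta_cancel[rotated 2]) (simp_all add: Z(1) Y(1))
  show ?thesis using Z GL_I[OF Z(1) Y(1) XY YX] by blast
qed

lemma upper_block_closed:
  assumes "B \<in> {..<r} \<times> {..<n - r} \<rightarrow> carrier R"
  shows "u B \<in> carrier M"
  unfolding upper_block_def
proof (rule mat_carrierI)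
  fix i j assume "i < n" "j < n"
  then show "(if i = j then \<one> else if i < r \<and> r \<le> j then B (i, j - r) else \<zero>) \<in> carrier R"
    using assms r_le by (auto simp: Pi_def)
qed

text \<open>Read as a row operation: row \<open>i < r\<close> receives multiples of the rows below.
  The sum runs over all of \<open>{..<n}\<close> with zero coefficients outside the block, which
  avoids shifted index ranges.\<close>

lemma upper_block_mult:
  assumes B: "B \<in> {..<r} \<times> {..<n - r} \<rightarrow> carrier R" and A: "A \<in> carrier M" and ij: "i < n" "j < n"
  shows "(u B \<otimes>\<^bsub>M\<^esub> A) (i, j) =
     A (i, j) \<oplus> (\<Oplus>l\<in>{..<n}. (if upper_right n r i l then B (i, l - r) else \<zero>) \<otimes> A (l, j))"
proof -
  note e = mat_entry[OF A]
  have b: "B (i, l - r) \<in> carrier R" if "upper_right n r i l" for l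
    using that B by (auto simp: upper_right_def)
  have "(\<Oplus>l\<in>{..<n}. u B (i, l) \<otimes> A (l, j)) =
     (\<Oplus>l\<in>{..<n}. (if i = l then A (l, j) else \<zero>) \<oplus> (if upper_right n r i l then B (i, l - r) else \<zero>) \<otimes> A (l, j))"
    using ij e b by (intro finsum_cong') (auto simp: upper_block_def upper_right_def)
  also have "\<dots> = (\<Oplus>l\<in>{..<n}. if i = l then A (l, j) else \<zero>) \<oplus>
     (\<Oplus>l\<in>{..<n}. (if upper_right n r i l then B (i, l - r) else \<zero>) \<otimes> A (l, j))"
    using ij e b by (intro finsum_addf) auto
  also have "(\<Oplus>l\<in>{..<n}. if i = l then A (l, j) else \<zero>) = A (i, j)"
    using ij e by (subst finsum_single[where i = i]) auto
  finally show ?thesis using ij by (simp add: mat_mult_eq)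
qed

lemma upper_block_mult_upper_block:
  assumes B: "B \<in> {..<r} \<times> {..<n - r} \<rightarrow> carrier R" "B' \<in> {..<r} \<times> {..<n - r} \<rightarrow> carrier R"
  shows "u B \<otimes>\<^bsub>M\<^esub> u B' = u (\<lambda>ij. B ij \<oplus> B' ij)"
proof (rule mat_eqI[of _ n R])
  show "u B \<otimes>\<^bsub>M\<^esub> u B' \<in> carrier M" using assms by (intro M.m_closed upper_block_closed)
  show "u (\<lambda>ij. B ij \<oplus> B' ij) \<in> carrier M" using assms by (intro upper_block_closed) (auto simp: Pi_def)
  fix i j assume ij: "i < n" "j < n"
  have b: "B (i, l - r) \<in> carrier R" "B' (i, l - r) \<in> carrier R" if "upper_right n r i l" for l
    using that B by (auto simp: upper_right_def)
  have "(if upper_right n r i l then B (i, l - r) else \<zero>) \<otimes> u B' (l, j) =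
      (if l = j then (if upper_right n r i j then B (i, j - r) else \<zero>) else \<zero>)" if "l < n" for l
    using ij b that upper_block_closed[OF B(2)] mat_entry[of "u B'" n R l j] r_le
    by (cases "upper_right n r i l") (auto simp: upper_block_def upper_right_def)
  then have "(\<Oplus>l\<in>{..<n}. (if upper_right n r i l then B (i, l - r) else \<zero>) \<otimes> u B' (l, j)) =
     (if upper_right n r i j then B (i, j - r) else \<zero>)"
    using b ij by (subst finsum_single[where i = j]) auto
  then show "(u B \<otimes>\<^bsub>M\<^esub> u B') (i, j) = u (\<lambda>ij. B ij \<oplus> B' ij) (i, j)"
    using ij b by (subst upper_block_mult[OF B(1) upper_block_closed[OF B(2)] ij])
      (auto simp: upper_block_def upper_right_def a_comm)
qed

lemma upper_block_zero:
  assumes "\<And>ij. ij \<in> {..<r} \<times> {..<n - r} \<Longrightarrow> B ij = \<zero>"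
  shows "u B = \<one>\<^bsub>M\<^esub>"
  using assms by (auto simp: upper_block_def mat_monoid_def intro!: restrict_ext)

lemma upper_block_inv:
  assumes B: "B \<in> {..<r} \<times> {..<n - r} \<rightarrow> carrier R"
  shows "u B \<in> carrier G" "inv\<^bsub>G\<^esub> (u B) = u (\<lambda>ij. \<ominus> B ij)"
proof -
  have B': "(\<lambda>ij. \<ominus> B ij) \<in> {..<r} \<times> {..<n - r} \<rightarrow> carrier R" using B by auto
  have 1: "u B \<otimes>\<^bsub>M\<^esub> u (\<lambda>ij. \<ominus> B ij) = \<one>\<^bsub>M\<^esub>" "u (\<lambda>ij. \<ominus> B ij) \<otimes>\<^bsub>M\<^esub> u B = \<one>\<^bsub>M\<^esub>"
    unfolding upper_block_mult_upper_block[OF B B'] upper_block_mult_upper_block[OF B' B]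
    using B by (auto intro!: upper_block_zero simp: Pi_def r_neg l_neg)
  then show G: "u B \<in> carrier G" using upper_block_closed B B' by (intro GL_I[of _ n "u (\<lambda>ij. \<ominus> B ij)"]) auto
  have "u (\<lambda>ij. \<ominus> B ij) \<in> carrier G" using 1 upper_block_closed B B' by (intro GL_I[of _ n "u B"]) auto
  then show "inv\<^bsub>G\<^esub> (u B) = u (\<lambda>ij. \<ominus> B ij)" using 1 G by (intro G.inv_equality) auto
qed

lemma lattice_mult_GL:
  assumes "g \<in> carrier M" "A \<in> carrier G"
  shows "lattice n R (g \<otimes>\<^bsub>M\<^esub> A) = lattice n R g"
proof -
  have "lattice n R (g \<otimes>\<^bsub>M\<^esub> A) = mat_vec n R g ` (mat_vec n R A ` ({..<n} \<rightarrow>\<^sub>E carrier R))"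
    unfolding lattice_def image_image using assms G_M by (intro image_cong) (auto simp: mat_vec_mult)
  then show ?thesis unfolding lattice_def
    using mat_vec_GL_bij[OF assms(2)] by (simp add: bij_betw_def)
qed

text \<open>The columns of \<open>g'\<close> are the images of the unit vectors and lie in the
  lattice of \<open>g\<close>; their coordinates there form the columns of \<open>Z\<close>.\<close>

lemma lattice_le_imp:
  assumes "g \<in> carrier M" "g' \<in> carrier M" "lattice n R g' \<subseteq> lattice n R g"
  shows "\<exists>Z\<in>carrier M. g' = g \<otimes>\<^bsub>M\<^esub> Z"
proof -
  have "\<exists>w\<in>{..<n} \<rightarrow>\<^sub>E carrier R. mat_vec n R g' (mat_unit_vec n R j) = mat_vec n R g w" for j
    using assms(3) mat_unit_vec_closed[of n j] unfolding lattice_def by blast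
  then obtain w where w: "\<And>j. w j \<in> {..<n} \<rightarrow>\<^sub>E carrier R"
     "\<And>j. mat_vec n R g' (mat_unit_vec n R j) = mat_vec n R g (w j)" by metis
  let ?Z = "\<lambda>(i, j)\<in>{..<n} \<times> {..<n}. w j i"
  have Z: "?Z \<in> carrier M" using w(1) by (intro mat_carrierI) auto
  have "g' = g \<otimes>\<^bsub>M\<^esub> ?Z"
  proof (rule mat_eqI[OF assms(2)])
    show "g \<otimes>\<^bsub>M\<^esub> ?Z \<in> carrier M" using assms Z by blast
    fix i j assume ij: "i < n" "j < n"
    have "g' (i, j) = mat_vec n R g (w j) i" using w(2) mat_vec_unit[OF assms(2) ij] by metis
    also have "\<dots> = (g \<otimes>\<^bsub>M\<^esub> ?Z) (i, j)" 
      using ij mat_entry[OF assms(1)] w(1)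
      by (auto simp: mat_mult_eq mat_vec_def Pi_def PiE_def intro!: finsum_cong')
    finally show "g' (i, j) = (g \<otimes>\<^bsub>M\<^esub> ?Z) (i, j)" .
  qed
  then show ?thesis using Z by blast
qed

text \<open>The double coset of \<open>\<Delta>\<close> for the full group \<open>GL\<close>. Facts
  about lattices alone are proved for its elements, independently of any level group.\<close>

definition scaled :: "(nat \<times> nat \<Rightarrow> 'a) set" where
  "scaled = {A \<otimes>\<^bsub>M\<^esub> \<Delta> \<otimes>\<^bsub>M\<^esub> B |A B. A \<in> carrier G \<and> B \<in> carrier G}"

lemma scaledE:
  assumes "g \<in> scaled"
  obtains A B where "A \<in> carrier G" "B \<in> carrier G" "g = A \<otimes>\<^bsub>M\<^esub> \<Delta> \<otimes>\<^bsub>M\<^esub> B"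
  using assms unfolding scaled_def by blast

lemma scaled_in_M: "g \<in> scaled \<Longrightarrow> g \<in> carrier M"
  by (elim scaledE) (simp add: G_M)

text \<open>\<open>g\<close> has no inverse over the ring; it can be cancelled because each of its
  three factors can.\<close>

lemma scaled_cancel:
  assumes g: "g \<in> scaled" and XY: "Z \<in> carrier M" "Y \<in> carrier M" "g \<otimes>\<^bsub>M\<^esub> Z = g \<otimes>\<^bsub>M\<^esub> Y"
  shows "Z = Y"
proof -
  obtain A B where AB: "A \<in> carrier G" "B \<in> carrier G" "g = A \<otimes>\<^bsub>M\<^esub> \<Delta> \<otimes>\<^bsub>M\<^esub> B"
    using g by (rule scaledE)
  have u: "A \<in> Units M" "B \<in> Units M" using AB by (auto simp: GL_carrier)
  note c = G_M[OF AB(1)] G_M[OF AB(2)]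
  have "A \<otimes>\<^bsub>M\<^esub> (\<Delta> \<otimes>\<^bsub>M\<^esub> (B \<otimes>\<^bsub>M\<^esub> Z)) = A \<otimes>\<^bsub>M\<^esub> (\<Delta> \<otimes>\<^bsub>M\<^esub> (B \<otimes>\<^bsub>M\<^esub> Y))"
    using XY AB(3) c by (simp add: M.m_assoc)
  then have "\<Delta> \<otimes>\<^bsub>M\<^esub> (B \<otimes>\<^bsub>M\<^esub> Z) = \<Delta> \<otimes>\<^bsub>M\<^esub> (B \<otimes>\<^bsub>M\<^esub> Y)"
    using u c XY(1,2) by (subst (asm) M.Units_l_cancel) simp_all
  then have "B \<otimes>\<^bsub>M\<^esub> Z = B \<otimes>\<^bsub>M\<^esub> Y" by (rule Delta_cancel[rotated 2]) (simp_all add: c XY(1,2))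
  then show ?thesis using u XY(1,2) by (simp add: M.Units_l_cancel)
qed

lemma scaled_vec_inj:
  assumes g: "g \<in> scaled"
  shows "inj_on (mat_vec n R g) ({..<n} \<rightarrow>\<^sub>E carrier R)"
proof (rule inj_onI)
  fix v w assume vw: "v \<in> {..<n} \<rightarrow>\<^sub>E carrier R" "w \<in> {..<n} \<rightarrow>\<^sub>E carrier R" "mat_vec n R g v = mat_vec n R g w"
  obtain A B where AB: "A \<in> carrier G" "B \<in> carrier G" "g = A \<otimes>\<^bsub>M\<^esub> \<Delta> \<otimes>\<^bsub>M\<^esub> B"
    using g by (rule scaledE)
  note c = G_M[OF AB(1)] G_M[OF AB(2)]
  have "mat_vec n R A (mat_vec n R \<Delta> (mat_vec n R B v)) = mat_vec n R A (mat_vec n R \<Delta> (mat_vec n R B w))"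
    using vw AB(3) c by (simp add: mat_vec_mult mat_vec_closed)
  then have eq: "mat_vec n R \<Delta> (mat_vec n R B v) = mat_vec n R \<Delta> (mat_vec n R B w)"
    by (rule inj_onD[OF bij_betw_imp_inj_on[OF mat_vec_GL_bij[OF AB(1)]]])
      (intro mat_vec_closed Delta_closed c vw)+
  have cl: "mat_vec n R B v \<in> {..<n} \<rightarrow>\<^sub>E carrier R" "mat_vec n R B w \<in> {..<n} \<rightarrow>\<^sub>E carrier R"
    using c vw by (auto intro!: mat_vec_closed simp del: PiE_iff)
  have "mat_vec n R B v = mat_vec n R B w"
  proof (rule vec_eqI[OF cl])
    fix i assume i: "i < n"
    have "mat_vec n R B v i \<in> carrier R" "mat_vec n R B w i \<in> carrier R"
      using PiE_mem[OF cl(1), of i] PiE_mem[OF cl(2), of i] i by simp_all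
    moreover have "q i \<otimes> mat_vec n R B v i = q i \<otimes> mat_vec n R B w i"
      using fun_cong[OF eq, of i] by (simp only: Delta_vec[OF cl(1) i] Delta_vec[OF cl(2) i])
    ultimately show "mat_vec n R B v i = mat_vec n R B w i" by (rule q_cancel)
  qed
  then show "v = w" using mat_vec_GL_bij[OF AB(2)] vw by (meson bij_betw_imp_inj_on inj_on_eq_iff)
qed

text \<open>Equal lattices give divisibility in both directions, and cancelling \<open>g\<close> and
  \<open>g'\<close> shows that the two quotients are inverse to each other.\<close>

lemma scaled_lattice_eq:
  assumes g: "g \<in> scaled" "g' \<in> scaled" and eq: "lattice n R g = lattice n R g'"
  shows "\<exists>A\<in>carrier G. g' = g \<otimes>\<^bsub>M\<^esub> A"
proof -
  note c = scaled_in_M[OF g(1)] scaled_in_M[OF g(2)]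
  obtain Z where Z: "Z \<in> carrier M" "g' = g \<otimes>\<^bsub>M\<^esub> Z" using lattice_le_imp[OF c] eq by auto
  obtain Y where Y: "Y \<in> carrier M" "g = g' \<otimes>\<^bsub>M\<^esub> Y" using lattice_le_imp[OF c(2,1)] eq by auto
  have "g \<otimes>\<^bsub>M\<^esub> (Z \<otimes>\<^bsub>M\<^esub> Y) = g \<otimes>\<^bsub>M\<^esub> \<one>\<^bsub>M\<^esub>" "g' \<otimes>\<^bsub>M\<^esub> (Y \<otimes>\<^bsub>M\<^esub> Z) = g' \<otimes>\<^bsub>M\<^esub> \<one>\<^bsub>M\<^esub>"
    using Z Y c M.m_assoc M.r_one by metis+
  then have "Z \<otimes>\<^bsub>M\<^esub> Y = \<one>\<^bsub>M\<^esub>" "Y \<otimes>\<^bsub>M\<^esub> Z = \<one>\<^bsub>M\<^esub>"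
    using scaled_cancel[OF g(1) M.m_closed[OF Z(1) Y(1)]] scaled_cancel[OF g(2) M.m_closed[OF Y(1) Z(1)]] by simp_all
  then show ?thesis using Z Y GL_I by blast
qed

text \<open>\<open>\<pi>\<close> times the inverse of \<open>\<Delta>\<close> is integral: it is the
  diagonal matrix with \<open>\<one>\<close> in the first \<open>r\<close> places and
  \<open>\<pi>\<close> in the others. It appears below as the vector \<open>w'\<close>.\<close>

lemma lattice_scaled_pi:
  assumes g: "g \<in> scaled" and v: "v \<in> {..<n} \<rightarrow>\<^sub>E carrier R"
  shows "(\<lambda>i\<in>{..<n}. \<pi> \<otimes> v i) \<in> lattice n R g"
proof -
  obtain A B where AB: "A \<in> carrier G" "B \<in> carrier G" "g = A \<otimes>\<^bsub>M\<^esub> \<Delta> \<otimes>\<^bsub>M\<^esub> B"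
    using g by (rule scaledE)
  note c = G_M[OF AB(1)] G_M[OF AB(2)]
  have L: "lattice n R g = lattice n R (A \<otimes>\<^bsub>M\<^esub> \<Delta>)" using AB c by (simp add: lattice_mult_GL)
  define w where "w = mat_vec n R (inv\<^bsub>G\<^esub> A) v"
  have w: "w \<in> {..<n} \<rightarrow>\<^sub>E carrier R" unfolding w_def using AB v G_M by (intro mat_vec_closed) auto
  have v_eq: "v = mat_vec n R A w" unfolding w_def using GL_mat_vec_inv(2)[OF AB(1) v] by simp
  define w' where "w' = (\<lambda>i\<in>{..<n}. (if i < r then \<one> else \<pi>) \<otimes> w i)"
  have w': "w' \<in> {..<n} \<rightarrow>\<^sub>E carrier R" unfolding w'_def using PiE_mem[OF w] by simp
  have "mat_vec n R \<Delta> w' = (\<lambda>i\<in>{..<n}. \<pi> \<otimes> w i)"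
  proof (rule vec_eqI[of _ n "carrier R"])
    show "mat_vec n R \<Delta> w' \<in> {..<n} \<rightarrow>\<^sub>E carrier R" using w' by (intro mat_vec_closed) auto
    show "(\<lambda>i\<in>{..<n}. \<pi> \<otimes> w i) \<in> {..<n} \<rightarrow>\<^sub>E carrier R" using w by auto
    fix i assume i: "i < n"
    then have "w i \<in> carrier R" using w by auto
    then show "mat_vec n R \<Delta> w' i = (\<lambda>i\<in>{..<n}. \<pi> \<otimes> w i) i"
      using i unfolding Delta_vec[OF w' i] by (simp add: w'_def q_def)
  qed
  then have "mat_vec n R (A \<otimes>\<^bsub>M\<^esub> \<Delta>) w' = (\<lambda>i\<in>{..<n}. \<pi> \<otimes> v i)"
    using c w w' by (simp add: mat_vec_mult mat_vec_smult v_eq)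
  then show ?thesis unfolding L unfolding lattice_def using w' by (intro image_eqI[of _ _ w']) simp_all
qed

end

context cring
begin

lemma diag_closed:
  "c \<in> carrier R \<Longrightarrow> Delta n r R c \<in> carrier (mat_monoid n R)"
  unfolding Delta_def by (rule mat_carrierI) auto

lemma diag_mult:
  assumes "c \<in> carrier R" "A \<in> carrier (mat_monoid n R)" "i < n" "j < n"
  shows "(Delta n r R c \<otimes>\<^bsub>mat_monoid n R\<^esub> A) (i, j) = (if i < r then c else \<one>) \<otimes> A (i, j)"
proof -
  have "(\<Oplus>l\<in>{..<n}. Delta n r R c (i, l) \<otimes> A (l, j)) = Delta n r R c (i, i) \<otimes> A (i, j)"
    using assms mat_entry[OF assms(2)] by (intro finsum_single) (auto simp: Delta_def)
  then show ?thesis using assms by (simp add: mat_mult_eq Delta_def)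
qed

lemma mult_diag:
  assumes "c \<in> carrier R" "A \<in> carrier (mat_monoid n R)" "i < n" "j < n"
  shows "(A \<otimes>\<^bsub>mat_monoid n R\<^esub> Delta n r R c) (i, j) = A (i, j) \<otimes> (if j < r then c else \<one>)"
proof -
  have "(\<Oplus>l\<in>{..<n}. A (i, l) \<otimes> Delta n r R c (l, j)) = A (i, j) \<otimes> Delta n r R c (j, j)"
    using assms mat_entry[OF assms(2)] by (intro finsum_single) (auto simp: Delta_def)
  then show ?thesis using assms by (simp add: mat_mult_eq Delta_def)
qed

text \<open>A matrix is block diagonal iff it commutes with the projection onto the last coordinates.\<close>

lemma inv_block_diagonal:
  assumes A: "A \<in> carrier (GL n R)"
    and z: "\<And>i j. i < n \<Longrightarrow> j < n \<Longrightarrow> (i < r) \<noteq> (j < r) \<Longrightarrow> A (i, j) = \<zero>"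
    and ij: "i < n" "j < n" "(i < r) \<noteq> (j < r)"
  shows "(inv\<^bsub>GL n R\<^esub> A) (i, j) = \<zero>"
proof -
  interpret M: monoid "mat_monoid n R" by (rule mat_monoid_monoid)
  interpret G: group "GL n R" by (rule GL_group)
  let ?E = "Delta n r R \<zero>" and ?I = "inv\<^bsub>GL n R\<^esub> A"
  note E = diag_closed[OF zero_closed, of n r]
  have c: "A \<in> carrier (mat_monoid n R)" "?I \<in> carrier (mat_monoid n R)" using A GL_in_mat by auto
  have "A \<otimes>\<^bsub>mat_monoid n R\<^esub> ?E = ?E \<otimes>\<^bsub>mat_monoid n R\<^esub> A"
  proof (rule mat_eqI[of _ n R])
    fix i j assume ij: "i < n" "j < n"
    have "A (i, j) \<in> carrier R" using mat_entry[OF c(1) ij] .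
    then show "(A \<otimes>\<^bsub>mat_monoid n R\<^esub> ?E) (i, j) = (?E \<otimes>\<^bsub>mat_monoid n R\<^esub> A) (i, j)"
      using z[OF ij] by (auto simp: diag_mult[OF _ c(1) ij] mult_diag[OF _ c(1) ij])
  qed (use c E in auto)
  note comm = this
  have I: "?I \<otimes>\<^bsub>mat_monoid n R\<^esub> A = \<one>\<^bsub>mat_monoid n R\<^esub>" "A \<otimes>\<^bsub>mat_monoid n R\<^esub> ?I = \<one>\<^bsub>mat_monoid n R\<^esub>"
    using G.l_inv[OF A] G.r_inv[OF A] by simp_all
  have "?E \<otimes>\<^bsub>mat_monoid n R\<^esub> ?I = (?I \<otimes>\<^bsub>mat_monoid n R\<^esub> A) \<otimes>\<^bsub>mat_monoid n R\<^esub> (?E \<otimes>\<^bsub>mat_monoid n R\<^esub> ?I)"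
    unfolding I using c E by simp
  also have "\<dots> = ?I \<otimes>\<^bsub>mat_monoid n R\<^esub> (A \<otimes>\<^bsub>mat_monoid n R\<^esub> ?E) \<otimes>\<^bsub>mat_monoid n R\<^esub> ?I"
    using c E by (simp add: M.m_assoc)
  also have "\<dots> = ?I \<otimes>\<^bsub>mat_monoid n R\<^esub> (?E \<otimes>\<^bsub>mat_monoid n R\<^esub> (A \<otimes>\<^bsub>mat_monoid n R\<^esub> ?I))"
    unfolding comm using c E by (simp add: M.m_assoc)
  also have "\<dots> = ?I \<otimes>\<^bsub>mat_monoid n R\<^esub> ?E"
    unfolding I using c E by simp
  finally have "?E \<otimes>\<^bsub>mat_monoid n R\<^esub> ?I = ?I \<otimes>\<^bsub>mat_monoid n R\<^esub> ?E" .
  then have "(?E \<otimes>\<^bsub>mat_monoid n R\<^esub> ?I) (i, j) = (?I \<otimes>\<^bsub>mat_monoid n R\<^esub> ?E) (i, j)" by simp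
  moreover have "?I (i, j) \<in> carrier R" using mat_entry[OF c(2)] ij by auto
  ultimately show ?thesis
    using ij by (cases "i < r") (simp_all add: diag_mult[OF _ c(2)] mult_diag[OF _ c(2)])
qed

end

context scaling
begin

lemma pow_pi_cancel:
  "\<lbrakk>a \<in> carrier R; b \<in> carrier R; \<pi> [^] (s::nat) \<otimes> a = \<pi> [^] s \<otimes> b\<rbrakk> \<Longrightarrow> a = b"
proof (induction s)
  case (Suc s)
  have "\<pi> \<otimes> (\<pi> [^] s \<otimes> a) = \<pi> \<otimes> (\<pi> [^] s \<otimes> b)"
    using Suc by (simp add: m_assoc[symmetric] m_comm)
  then have "\<pi> [^] s \<otimes> a = \<pi> [^] s \<otimes> b" by (rule pi_cancel[rotated 2]) (use Suc in simp_all)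
  then show ?case using Suc by blast
qed simp

end

section \<open>Normal forms in the double coset of a level group\<close>

text \<open>\<open>h\<close> is reduction modulo \<open>\<pi>\<close>. The level group is known only
  through closure properties that its different shapes share. \<open>K_ll\<close> makes the
  reductions block triangular: upper triangular by the second alternative, lower triangular by
  \<open>K_ur\<close> if \<open>s \<ge> 1\<close>.\<close>

locale hecke_matrices = scaling R n r \<pi> + h: ring_hom_cring R S h
  for R (structure) and n r \<pi> and S (structure) and h +
  fixes s :: nat and K
  assumes h_ker: "a \<in> carrier R \<Longrightarrow> h a = \<zero>\<^bsub>S\<^esub> \<longleftrightarrow> (\<exists>c\<in>carrier R. a = \<pi> \<otimes> c)"
    and h_surj: "h ` carrier R = carrier S"
    and K_subgroup: "subgroup K (GL n R)"
    and K_ur: "k \<in> K \<Longrightarrow> dvd_ur s k"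
    and K_u: "B \<in> {..<r} \<times> {..<n - r} \<rightarrow> carrier R \<Longrightarrow> u (\<lambda>ij. \<pi> [^] s \<otimes> B ij) \<in> K"
    and K_conj: "\<lbrakk>k \<in> K; Z \<in> carrier G; k \<otimes>\<^bsub>M\<^esub> \<Delta> = \<Delta> \<otimes>\<^bsub>M\<^esub> Z; dvd_ur s Z\<rbrakk> \<Longrightarrow> Z \<in> K"
    and K_ll: "s \<ge> 1 \<or> (\<forall>k\<in>K. \<forall>i j. r \<le> i \<and> i < n \<and> j < r \<longrightarrow> h (k (i, j)) = \<zero>\<^bsub>S\<^esub>)"
begin

lemma K_G: "k \<in> K \<Longrightarrow> k \<in> carrier G"
  using subgroup.subset[OF K_subgroup] by blast

lemma K_M: "k \<in> K \<Longrightarrow> k \<in> carrier M"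
  using K_G G_M by blast

lemma K_mult: "k \<in> K \<Longrightarrow> k' \<in> K \<Longrightarrow> k \<otimes>\<^bsub>M\<^esub> k' \<in> K"
  using subgroup.m_closed[OF K_subgroup] by simp

lemma K_inv: "k \<in> K \<Longrightarrow> inv\<^bsub>G\<^esub> k \<in> K"
  using subgroup.m_inv_closed[OF K_subgroup] by simp

lemma K_one: "\<one>\<^bsub>M\<^esub> \<in> K"
  using subgroup.one_closed[OF K_subgroup] by simp

lemma dvd_ur_1_iff: "A \<in> carrier M \<Longrightarrow> dvd_ur 1 A \<longleftrightarrow> (\<forall>i j. upper_right n r i j \<longrightarrow> h (A (i, j)) = \<zero>\<^bsub>S\<^esub>)"
  unfolding dvd_ur_def using h_ker mat_entry[of A n R] r_le by (auto simp: upper_right_def)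

text \<open>For \<open>s \<ge> 1\<close> divisibility holds for every element of \<open>K\<close>,
  in particular for the inverse. For \<open>s = 0\<close> the hypothesis and \<open>K_ll\<close>
  make the reduction block diagonal, and so is the inverse of a block diagonal matrix.\<close>

lemma K_inv_dvd:
  assumes k: "k \<in> K" and d: "dvd_ur 1 k"
  shows "dvd_ur 1 (inv\<^bsub>G\<^esub> k)"
proof (cases "s \<ge> 1")
  case True
  then obtain t where "s = 1 + t" using le_Suc_ex by blast
  then show ?thesis using K_ur[OF K_inv[OF k]] dvd_ur_mono by metis
next
  case False
  let ?A = "mat_map n h k"
  have A: "?A \<in> carrier (GL n S)" using h.mat_map_GL[OF K_G[OF k]] .
  have z: "?A (i, j) = \<zero>\<^bsub>S\<^esub>" if "i < n" "j < n" "(i < r) \<noteq> (j < r)" for i j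
    using that False K_ll k d dvd_ur_1_iff[OF K_M[OF k]]
    by (cases "i < r") (auto simp: mat_map_def upper_right_def)
  have "h ((inv\<^bsub>G\<^esub> k) (i, j)) = \<zero>\<^bsub>S\<^esub>" if "upper_right n r i j" for i j
    using h.S.inv_block_diagonal[where i = i and j = j and r = r, OF A z] that r_le
    unfolding h.mat_map_inv[OF K_G[OF k], symmetric] by (auto simp: mat_map_def upper_right_def)
  then show ?thesis using dvd_ur_1_iff K_M[OF K_inv[OF k]] by blast
qed

lemma K_conj_ex:
  assumes k: "k \<in> K" and d: "dvd_ur 1 k"
  shows "\<exists>Z\<in>carrier G. k \<otimes>\<^bsub>M\<^esub> \<Delta> = \<Delta> \<otimes>\<^bsub>M\<^esub> Z"
  using conj_GL[OF K_G[OF k] d K_inv_dvd[OF k d]] .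

text \<open>Moving \<open>k\<close> across \<open>\<Delta>\<close> uses up one factor
  \<open>\<pi>\<close> of its upper right block. The other \<open>s\<close> factors survive in
  \<open>Z\<close>, as \<open>K_conj\<close> demands.\<close>

lemma K_conj_ex':
  assumes k: "k \<in> K" and d: "dvd_ur (Suc s) k"
  shows "\<exists>Z\<in>K. k \<otimes>\<^bsub>M\<^esub> \<Delta> = \<Delta> \<otimes>\<^bsub>M\<^esub> Z"
proof -
  have "dvd_ur 1 k" using dvd_ur_mono[of 1 s k] d by simp
  then obtain Z where Z: "Z \<in> carrier G" "k \<otimes>\<^bsub>M\<^esub> \<Delta> = \<Delta> \<otimes>\<^bsub>M\<^esub> Z" using K_conj_ex k by blast
  have "dvd_ur s Z"
    unfolding dvd_ur_def
  proof (intro allI impI)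
    fix i j assume ur: "upper_right n r i j"
    then obtain c where c: "c \<in> carrier R" "k (i, j) = \<pi> [^] Suc s \<otimes> c" using dvd_urD[OF d] by blast
    have ij: "i < n" "j < n" "i < r" "\<not> j < r" using ur r_le by (auto simp: upper_right_def)
    have kij: "k (i, j) \<in> carrier R" and zij: "Z (i, j) \<in> carrier R"
      using mat_entry[OF K_M[OF k]] mat_entry[OF G_M[OF Z(1)]] ij by auto
    have "\<pi> \<otimes> Z (i, j) = k (i, j)"
      using arg_cong[OF Z(2), of "\<lambda>A. A (i, j)"] ij kij
      by (simp add: Delta_mult[OF G_M[OF Z(1)]] mult_Delta[OF K_M[OF k]] q_def)
    then have "\<pi> \<otimes> Z (i, j) = \<pi> \<otimes> (\<pi> [^] s \<otimes> c)"
      using c by (simp add: m_assoc[symmetric] m_comm)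
    then have "Z (i, j) = \<pi> [^] s \<otimes> c" by (rule pi_cancel[rotated 2]) (use c zij in simp_all)
    then show "\<exists>c\<in>carrier R. Z (i, j) = \<pi> [^] s \<otimes> c" using c by blast
  qed
  then show ?thesis using Z K_conj[OF k] by blast
qed

definition is_lift :: "(nat \<times> nat \<Rightarrow> 'c) \<Rightarrow> (nat \<times> nat \<Rightarrow> 'a) \<Rightarrow> bool" where
  "is_lift C L \<longleftrightarrow> (\<forall>ij\<in>{..<r} \<times> {..<n - r}. L ij \<in> carrier R \<and> h (L ij) = C ij)"

abbreviation "U L \<equiv> u (\<lambda>ij. \<pi> [^] s \<otimes> L ij)"

lemma U_in_K: "is_lift C L \<Longrightarrow> U L \<in> K"
  by (rule K_u) (auto simp: is_lift_def)

text \<open>Let \<open>\<pi> [^] s \<otimes> f\<close> be the upper right block of \<open>k\<close>,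
  and \<open>d\<close> its lower right block. Then the upper right block of
  \<open>inverse (U L) * k\<close> is \<open>\<pi> [^] s\<close> times \<open>f - L d\<close>, so
  \<open>L\<close> must solve \<open>L d = f\<close> modulo \<open>\<pi>\<close>. By triangularity
  the lower right block of the inverse of \<open>k\<close> inverts \<open>d\<close> modulo
  \<open>\<pi>\<close>. The solution \<open>C\<close> depends on reductions only, whence every lift
  \<open>L\<close> of it will do.\<close>

lemma K_decomp:
  assumes k: "k \<in> K"
  shows "\<exists>C\<in>{..<r} \<times> {..<n - r} \<rightarrow>\<^sub>E carrier S. \<forall>L. is_lift C L \<longrightarrow>
     (\<exists>k2\<in>K. dvd_ur (Suc s) k2 \<and> k = U L \<otimes>\<^bsub>M\<^esub> k2)"
proof -
  have "\<exists>c. upper_right n r i j \<longrightarrow> c \<in> carrier R \<and> k (i, j) = \<pi> [^] s \<otimes> c" for i j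
    using dvd_urD[OF K_ur[OF k]] by metis
  then obtain f where f: "\<And>i j. upper_right n r i j \<Longrightarrow> f i j \<in> carrier R \<and> k (i, j) = \<pi> [^] s \<otimes> f i j"
    by metis
  define ki where "ki = inv\<^bsub>G\<^esub> k"
  have kiK: "ki \<in> K" unfolding ki_def using k by (rule K_inv)
  note ek = mat_entry[OF K_M[OF k]] and eki = mat_entry[OF K_M[OF kiK]]
  define b where "b i m = (if upper_right n r i m then h (f i m) else \<zero>\<^bsub>S\<^esub>)" for i m
  have b: "b i m \<in> carrier S" for i m using f by (auto simp: b_def)
  \<comment> \<open>The product of the reduced block \<open>f\<close> with the inverse matrix.
    Because \<open>b\<close> vanishes for \<open>m < r\<close>, only rows \<open>m \<ge> r\<close>
    of the inverse contribute.\<close>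
  define g where "g i l = (\<Oplus>\<^bsub>S\<^esub>m\<in>{..<n}. b i m \<otimes>\<^bsub>S\<^esub> h (ki (m, l)))" for i l
  have g: "g i l \<in> carrier S" if "l < n" for i l
    unfolding g_def using b eki that by (intro h.S.finsum_closed) auto
  define C where "C = (\<lambda>(i, j)\<in>{..<r} \<times> {..<n - r}. g i (r + j))"
  \<comment> \<open>The equation \<open>C d = f\<close> modulo \<open>\<pi>\<close>, with the blocks
    extended by zero.\<close>
  have key: "(\<Oplus>\<^bsub>S\<^esub>l\<in>{..<n}. (if upper_right n r i l then g i l else \<zero>\<^bsub>S\<^esub>) \<otimes>\<^bsub>S\<^esub> h (k (l, j))) = b i j"
    if ur: "upper_right n r i j" for i j
  proof -
    have ij: "i < r" "r \<le> j" "j < n" using ur by (auto simp: upper_right_def)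
    let ?t = "\<lambda>m l. h (ki (m, l)) \<otimes>\<^bsub>S\<^esub> h (k (l, j))"
    have inner: "(\<Oplus>\<^bsub>S\<^esub>l\<in>{..<n}. if r \<le> l then ?t m l else \<zero>\<^bsub>S\<^esub>) = (if m = j then \<one>\<^bsub>S\<^esub> else \<zero>\<^bsub>S\<^esub>)"
      if m: "r \<le> m" "m < n" for m
    proof -
      \<comment> \<open>Here triangularity enters: for \<open>l < r\<close> the factor from
        \<open>k\<close> lies in the upper right block and the factor from its inverse in the lower
        left block. One of the two reduces to zero, so restricting the product of the inverse and
        \<open>k\<close> to lower right blocks loses nothing.\<close>
      have zero: "?t m l = \<zero>\<^bsub>S\<^esub>" if "l < n" "\<not> r \<le> l" for l
      proof (cases "s \<ge> 1")
        case True
        then have "s = 1 + (s - 1)" by simp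
        then have "dvd_ur 1 k" using K_ur[OF k] dvd_ur_mono by metis
        then have "h (k (l, j)) = \<zero>\<^bsub>S\<^esub>"
          using dvd_ur_1_iff[OF K_M[OF k]] that ij by (auto simp: upper_right_def)
        then show ?thesis using eki m that by simp
      next
        case False
        then have "h (ki (m, l)) = \<zero>\<^bsub>S\<^esub>" using K_ll kiK m that by auto
        then show ?thesis using ek ij that by simp
      qed
      have "(\<Oplus>\<^bsub>S\<^esub>l\<in>{..<n}. if r \<le> l then ?t m l else \<zero>\<^bsub>S\<^esub>) = (\<Oplus>\<^bsub>S\<^esub>l\<in>{..<n}. h (ki (m, l) \<otimes> k (l, j)))"
        using eki ek m ij zero by (intro h.S.finsum_cong') auto
      also have "\<dots> = h (\<Oplus>l\<in>{..<n}. ki (m, l) \<otimes> k (l, j))"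
        using eki ek m ij by (subst ring_hom_ring.hom_finsum'[OF h.ring_hom_ring']) auto
      also have "(\<Oplus>l\<in>{..<n}. ki (m, l) \<otimes> k (l, j)) = (ki \<otimes>\<^bsub>M\<^esub> k) (m, j)"
        using m ij by (simp add: mat_mult_eq)
      also have "ki \<otimes>\<^bsub>M\<^esub> k = \<one>\<^bsub>M\<^esub>"
        using G.l_inv[OF K_G[OF k]] by (simp add: ki_def)
      finally show ?thesis using m ij by (simp add: mat_one_eq)
    qed
    have "(\<Oplus>\<^bsub>S\<^esub>l\<in>{..<n}. (if upper_right n r i l then g i l else \<zero>\<^bsub>S\<^esub>) \<otimes>\<^bsub>S\<^esub> h (k (l, j)))
       = (\<Oplus>\<^bsub>S\<^esub>l\<in>{..<n}. \<Oplus>\<^bsub>S\<^esub>m\<in>{..<n}. b i m \<otimes>\<^bsub>S\<^esub> (if r \<le> l then ?t m l else \<zero>\<^bsub>S\<^esub>))"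
    proof (intro h.S.finsum_cong')
      fix l assume l: "l \<in> {..<n}"
      show "(if upper_right n r i l then g i l else \<zero>\<^bsub>S\<^esub>) \<otimes>\<^bsub>S\<^esub> h (k (l, j)) =
         (\<Oplus>\<^bsub>S\<^esub>m\<in>{..<n}. b i m \<otimes>\<^bsub>S\<^esub> (if r \<le> l then ?t m l else \<zero>\<^bsub>S\<^esub>))"
      proof (cases "r \<le> l")
        case True
        have "g i l \<otimes>\<^bsub>S\<^esub> h (k (l, j)) = (\<Oplus>\<^bsub>S\<^esub>m\<in>{..<n}. b i m \<otimes>\<^bsub>S\<^esub> h (ki (m, l)) \<otimes>\<^bsub>S\<^esub> h (k (l, j)))"
          unfolding g_def using b eki ek l ij by (intro h.S.finsum_ldistr) auto
        also have "\<dots> = (\<Oplus>\<^bsub>S\<^esub>m\<in>{..<n}. b i m \<otimes>\<^bsub>S\<^esub> ?t m l)"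
          using b eki ek l ij by (intro h.S.finsum_cong') (auto simp: h.S.m_assoc)
        finally show ?thesis using True l ij by (simp add: upper_right_def)
      next
        case False
        then show ?thesis using b ek l ij by (simp add: upper_right_def)
      qed
    qed (use b eki ek ij in \<open>auto intro!: h.S.finsum_closed\<close>)
    also have "\<dots> = (\<Oplus>\<^bsub>S\<^esub>m\<in>{..<n}. \<Oplus>\<^bsub>S\<^esub>l\<in>{..<n}. b i m \<otimes>\<^bsub>S\<^esub> (if r \<le> l then ?t m l else \<zero>\<^bsub>S\<^esub>))"
      using b eki ek ij by (intro h.S.finsum_swap) auto
    also have "\<dots> = (\<Oplus>\<^bsub>S\<^esub>m\<in>{..<n}. if m = j then b i j else \<zero>\<^bsub>S\<^esub>)"
    proof (intro h.S.finsum_cong')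
      fix m assume m: "m \<in> {..<n}"
      have "(\<Oplus>\<^bsub>S\<^esub>l\<in>{..<n}. b i m \<otimes>\<^bsub>S\<^esub> (if r \<le> l then ?t m l else \<zero>\<^bsub>S\<^esub>))
         = b i m \<otimes>\<^bsub>S\<^esub> (\<Oplus>\<^bsub>S\<^esub>l\<in>{..<n}. (if r \<le> l then ?t m l else \<zero>\<^bsub>S\<^esub>))"
        using b eki ek ij m by (intro h.S.finsum_rdistr[symmetric]) auto
      also have "\<dots> = (if m = j then b i j else \<zero>\<^bsub>S\<^esub>)"
      proof (cases "r \<le> m")
        case True then show ?thesis using inner[of m] m b by simp
      next
        case False
        then have "b i m = \<zero>\<^bsub>S\<^esub>" "m \<noteq> j" using ij by (auto simp: b_def upper_right_def)
        moreover have "(\<Oplus>\<^bsub>S\<^esub>l\<in>{..<n}. (if r \<le> l then ?t m l else \<zero>\<^bsub>S\<^esub>)) \<in> carrier S"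
          using eki ek ij m by (intro h.S.finsum_closed) auto
        ultimately show ?thesis by simp
      qed
      finally show "(\<Oplus>\<^bsub>S\<^esub>l\<in>{..<n}. b i m \<otimes>\<^bsub>S\<^esub> (if r \<le> l then ?t m l else \<zero>\<^bsub>S\<^esub>))
         = (if m = j then b i j else \<zero>\<^bsub>S\<^esub>)" .
    qed (use b in auto)
    also have "\<dots> = b i j" using ij b by (subst h.S.finsum_single[where i = j]) auto
    finally show ?thesis .
  qed
  have Cc: "C \<in> {..<r} \<times> {..<n - r} \<rightarrow>\<^sub>E carrier S" unfolding C_def using g by auto
  have "\<exists>k2\<in>K. dvd_ur (Suc s) k2 \<and> k = U L \<otimes>\<^bsub>M\<^esub> k2" if L: "is_lift C L" for L
  proof -
    have UK: "U L \<in> K" using U_in_K[OF L] .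
    define k2 where "k2 = inv\<^bsub>G\<^esub> (U L) \<otimes>\<^bsub>M\<^esub> k"
    have k2: "k2 \<in> K" unfolding k2_def using UK k by (intro K_mult K_inv)
    have keq: "k = U L \<otimes>\<^bsub>M\<^esub> k2"
      unfolding k2_def using G.r_inv[OF K_G[OF UK]] K_M[OF UK] K_M[OF K_inv[OF UK]] K_M[OF k]
      by (simp add: M.m_assoc[symmetric])
    have Lc: "L (i, l - r) \<in> carrier R" "h (L (i, l - r)) = g i l" if "upper_right n r i l" for i l
      using L that by (auto simp: is_lift_def upper_right_def C_def)
    have Bc: "(\<lambda>ij. \<pi> [^] s \<otimes> L ij) \<in> {..<r} \<times> {..<n - r} \<rightarrow> carrier R" using L by (auto simp: is_lift_def)
    note ek2 = mat_entry[OF K_M[OF k2]]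
    have ent: "k (i, j) = k2 (i, j) \<oplus>
        (\<Oplus>l\<in>{..<n}. (if upper_right n r i l then \<pi> [^] s \<otimes> L (i, l - r) else \<zero>) \<otimes> k2 (l, j))"
      if "i < n" "j < n" for i j
      using upper_block_mult[OF Bc K_M[OF k2] that] keq by simp
    \<comment> \<open>\<open>U L\<close> alters only the first \<open>r\<close> rows, so the rows of
      \<open>k2\<close> that enter the block computation are those of \<open>k\<close>.\<close>
    have low: "k2 (i, j) = k (i, j)" if "r \<le> i" "i < n" "j < n" for i j
    proof -
      have "(\<Oplus>l\<in>{..<n}. (if upper_right n r i l then \<pi> [^] s \<otimes> L (i, l - r) else \<zero>) \<otimes> k2 (l, j))
         = (\<Oplus>l\<in>{..<n}. \<zero>)"
        using that ek2 by (intro finsum_cong') (auto simp: upper_right_def)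
      then show ?thesis using ent[of i j] that ek2 by simp
    qed
    have "dvd_ur (Suc s) k2"
      unfolding dvd_ur_def
    proof (intro allI impI)
      fix i j assume ur: "upper_right n r i j"
      have ij: "i < r" "i < n" "j < n" "r \<le> j" using ur r_le by (auto simp: upper_right_def)
      let ?s = "\<Oplus>l\<in>{..<n}. (if upper_right n r i l then L (i, l - r) else \<zero>) \<otimes> k (l, j)"
      have sc: "?s \<in> carrier R" using Lc ek ij by (intro finsum_closed) auto
      have "(\<Oplus>l\<in>{..<n}. (if upper_right n r i l then \<pi> [^] s \<otimes> L (i, l - r) else \<zero>) \<otimes> k2 (l, j))
         = (\<Oplus>l\<in>{..<n}. \<pi> [^] s \<otimes> ((if upper_right n r i l then L (i, l - r) else \<zero>) \<otimes> k (l, j)))"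
        using Lc ek ek2 ij low by (intro finsum_cong') (auto simp: upper_right_def m_assoc)
      also have "\<dots> = \<pi> [^] s \<otimes> ?s"
        using Lc ek ij by (intro finsum_rdistr[symmetric]) auto
      finally have "\<pi> [^] s \<otimes> f i j = k2 (i, j) \<oplus> \<pi> [^] s \<otimes> ?s" using ent ij f[OF ur] by simp
      then have 1: "k2 (i, j) = \<pi> [^] s \<otimes> (f i j \<ominus> ?s)"
        using sc f[OF ur] ek2[of i j] ij
        by (simp add: r_distr minus_eq r_minus a_assoc r_neg)
      have "h ?s = (\<Oplus>\<^bsub>S\<^esub>l\<in>{..<n}. (if upper_right n r i l then g i l else \<zero>\<^bsub>S\<^esub>) \<otimes>\<^bsub>S\<^esub> h (k (l, j)))"
        using Lc ek ij g by (subst ring_hom_ring.hom_finsum'[OF h.ring_hom_ring']) (auto intro!: h.S.finsum_cong')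
      also have "\<dots> = h (f i j)" using key[OF ur] ur by (simp add: b_def)
      finally have hz: "h (f i j \<ominus> ?s) = \<zero>\<^bsub>S\<^esub>" using sc f[OF ur] by (simp add: minus_eq h.S.r_neg)
      have "f i j \<ominus> ?s \<in> carrier R" using sc f[OF ur] by simp
      then obtain c where "c \<in> carrier R" "f i j \<ominus> ?s = \<pi> \<otimes> c" using h_ker hz by blast
      then show "\<exists>c\<in>carrier R. k2 (i, j) = \<pi> [^] Suc s \<otimes> c"
        using 1 by (intro bexI[of _ c]) (simp_all add: m_assoc)
    qed
    then show ?thesis using k2 keq by blast
  qed
  then show ?thesis using Cc by blast
qed

definition edge_mat :: "(nat \<times> nat \<Rightarrow> 'a) \<Rightarrow> nat \<times> nat \<Rightarrow> 'a" where
  "edge_mat L = U L \<otimes>\<^bsub>M\<^esub> \<Delta>"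

definition double_coset :: "(nat \<times> nat \<Rightarrow> 'a) set" where
  "double_coset = K <#>\<^bsub>M\<^esub> {\<Delta>} <#>\<^bsub>M\<^esub> K"

lemma double_cosetE:
  assumes "g \<in> double_coset"
  obtains k1 k2 where "k1 \<in> K" "k2 \<in> K" "g = k1 \<otimes>\<^bsub>M\<^esub> \<Delta> \<otimes>\<^bsub>M\<^esub> k2"
  using assms unfolding double_coset_def set_mult_def by blast

lemma double_cosetI: "k1 \<in> K \<Longrightarrow> k2 \<in> K \<Longrightarrow> k1 \<otimes>\<^bsub>M\<^esub> \<Delta> \<otimes>\<^bsub>M\<^esub> k2 \<in> double_coset"
  unfolding double_coset_def set_mult_def by blast

lemma double_coset_scaled: "g \<in> double_coset \<Longrightarrow> g \<in> scaled"
  by (elim double_cosetE) (auto simp: scaled_def dest: K_G)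

lemma double_coset_mult: "g \<in> double_coset \<Longrightarrow> k \<in> K \<Longrightarrow> g \<otimes>\<^bsub>M\<^esub> k \<in> double_coset"
proof (elim double_cosetE)
  fix k1 k2 assume *: "k \<in> K" "k1 \<in> K" "k2 \<in> K" "g = k1 \<otimes>\<^bsub>M\<^esub> \<Delta> \<otimes>\<^bsub>M\<^esub> k2"
  then have "g \<otimes>\<^bsub>M\<^esub> k = k1 \<otimes>\<^bsub>M\<^esub> \<Delta> \<otimes>\<^bsub>M\<^esub> (k2 \<otimes>\<^bsub>M\<^esub> k)" by (simp add: M.m_assoc K_M)
  then show ?thesis using * by (simp add: double_cosetI K_mult)
qed

lemma edge_mat_double_coset:
  assumes "is_lift C L" shows "edge_mat L \<in> double_coset"
  using double_cosetI[OF U_in_K[OF assms] K_one] K_M[OF U_in_K[OF assms]] by (simp add: edge_mat_def)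

lemma coset_mem: "g \<in> carrier M \<Longrightarrow> g \<in> g <#\<^bsub>M\<^esub> K"
  unfolding l_coset_def using K_one by force

lemma coset_absorb:
  assumes g: "g \<in> carrier M" and k: "k \<in> K"
  shows "(g \<otimes>\<^bsub>M\<^esub> k) <#\<^bsub>M\<^esub> K = g <#\<^bsub>M\<^esub> K"
proof
  show "(g \<otimes>\<^bsub>M\<^esub> k) <#\<^bsub>M\<^esub> K \<subseteq> g <#\<^bsub>M\<^esub> K"
    using g k K_mult by (auto simp: l_coset_def M.m_assoc K_M)
  show "g <#\<^bsub>M\<^esub> K \<subseteq> (g \<otimes>\<^bsub>M\<^esub> k) <#\<^bsub>M\<^esub> K"
  proof
    fix y assume "y \<in> g <#\<^bsub>M\<^esub> K"
    then obtain k' where k': "k' \<in> K" "y = g \<otimes>\<^bsub>M\<^esub> k'" by (auto simp: l_coset_def)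
    have inv: "k \<otimes>\<^bsub>M\<^esub> inv\<^bsub>G\<^esub> k = \<one>\<^bsub>M\<^esub>" using G.r_inv[OF K_G[OF k]] by simp
    have "g \<otimes>\<^bsub>M\<^esub> k \<otimes>\<^bsub>M\<^esub> (inv\<^bsub>G\<^esub> k \<otimes>\<^bsub>M\<^esub> k') = g \<otimes>\<^bsub>M\<^esub> (k \<otimes>\<^bsub>M\<^esub> inv\<^bsub>G\<^esub> k) \<otimes>\<^bsub>M\<^esub> k'"
      using g k k' K_inv[OF k] by (simp add: M.m_assoc K_M)
    then have "y = g \<otimes>\<^bsub>M\<^esub> k \<otimes>\<^bsub>M\<^esub> (inv\<^bsub>G\<^esub> k \<otimes>\<^bsub>M\<^esub> k')" using g k' inv by simp
    then show "y \<in> (g \<otimes>\<^bsub>M\<^esub> k) <#\<^bsub>M\<^esub> K"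
      using K_mult[OF K_inv[OF k] k'(1)] by (auto simp: l_coset_def)
  qed
qed

text \<open>\<open>C\<close> is found before the lift is chosen; hence the representatives can be
  formed with any given choice of lifts. The left factor of \<open>g\<close> is decomposed by
  \<open>K_decomp\<close>, and what remains crosses \<open>\<Delta>\<close> by
  \<open>K_conj_ex'\<close>.\<close>

lemma double_coset_normal_form:
  assumes g: "g \<in> double_coset"
  shows "\<exists>C\<in>{..<r} \<times> {..<n - r} \<rightarrow>\<^sub>E carrier S. \<forall>L. is_lift C L \<longrightarrow> (\<exists>k\<in>K. g = edge_mat L \<otimes>\<^bsub>M\<^esub> k)"
proof -
  obtain k1 k2 where k: "k1 \<in> K" "k2 \<in> K" "g = k1 \<otimes>\<^bsub>M\<^esub> \<Delta> \<otimes>\<^bsub>M\<^esub> k2" using g by (rule double_cosetE)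
  obtain C where C: "C \<in> {..<r} \<times> {..<n - r} \<rightarrow>\<^sub>E carrier S"
    "\<And>L. is_lift C L \<Longrightarrow> \<exists>k3\<in>K. dvd_ur (Suc s) k3 \<and> k1 = U L \<otimes>\<^bsub>M\<^esub> k3" using K_decomp[OF k(1)] by blast
  have "\<exists>k\<in>K. g = edge_mat L \<otimes>\<^bsub>M\<^esub> k" if L: "is_lift C L" for L
  proof -
    obtain k3 where k3: "k3 \<in> K" "dvd_ur (Suc s) k3" "k1 = U L \<otimes>\<^bsub>M\<^esub> k3" using C(2)[OF L] by blast
    obtain Z where Z: "Z \<in> K" "k3 \<otimes>\<^bsub>M\<^esub> \<Delta> = \<Delta> \<otimes>\<^bsub>M\<^esub> Z" using K_conj_ex'[OF k3(1,2)] by blast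
    have UM: "U L \<in> carrier M" using K_M[OF U_in_K[OF L]] .
    have "g = U L \<otimes>\<^bsub>M\<^esub> (k3 \<otimes>\<^bsub>M\<^esub> \<Delta>) \<otimes>\<^bsub>M\<^esub> k2" 
      unfolding k(3) k3(3) using UM k k3 by (simp add: M.m_assoc K_M)
    also have "\<dots> = edge_mat L \<otimes>\<^bsub>M\<^esub> (Z \<otimes>\<^bsub>M\<^esub> k2)"
      unfolding Z(2) edge_mat_def using UM k Z(1) by (simp add: M.m_assoc K_M)
    finally show ?thesis using K_mult[OF Z(1) k(2)] by blast
  qed
  then show ?thesis using C(1) by blast
qed

lemma edge_mat_inj:
  assumes L: "is_lift C L" "is_lift C' L'" and Z: "Z \<in> carrier G" "dvd_ur s Z"
    and eq: "edge_mat L \<otimes>\<^bsub>M\<^esub> Z = edge_mat L'" and ij: "i < r" "j < n - r"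
  shows "C (i, j) = C' (i, j)"
proof -
  have Bc: "(\<lambda>ij. \<pi> [^] s \<otimes> L ij) \<in> {..<r} \<times> {..<n - r} \<rightarrow> carrier R" using L by (auto simp: is_lift_def)
  have Lc: "L (i, l - r) \<in> carrier R" if "upper_right n r i l" for i l
    using L that by (auto simp: is_lift_def upper_right_def)
  have UM: "U L \<in> carrier M" "U L' \<in> carrier M" using K_M U_in_K L by blast+
  have ZM: "Z \<in> carrier M" "\<Delta> \<otimes>\<^bsub>M\<^esub> Z \<in> carrier M" using G_M[OF Z(1)] by auto
  note eZ = mat_entry[OF ZM(1)]
  have eq': "U L \<otimes>\<^bsub>M\<^esub> (\<Delta> \<otimes>\<^bsub>M\<^esub> Z) = U L' \<otimes>\<^bsub>M\<^esub> \<Delta>"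
    using eq UM ZM by (simp add: edge_mat_def M.m_assoc)
  have ent: "q i \<otimes> Z (i, j) \<oplus> (\<Oplus>l\<in>{..<n}. (if upper_right n r i l then \<pi> [^] s \<otimes> L (i, l - r) else \<zero>) \<otimes> (q l \<otimes> Z (l, j)))
      = U L' (i, j) \<otimes> q j" if ij: "i < n" "j < n" for i j
  proof -
    have "(\<Oplus>l\<in>{..<n}. (if upper_right n r i l then \<pi> [^] s \<otimes> L (i, l - r) else \<zero>) \<otimes> (\<Delta> \<otimes>\<^bsub>M\<^esub> Z) (l, j))
       = (\<Oplus>l\<in>{..<n}. (if upper_right n r i l then \<pi> [^] s \<otimes> L (i, l - r) else \<zero>) \<otimes> (q l \<otimes> Z (l, j)))"
      using ij eZ Lc by (intro finsum_cong') (auto simp: Delta_mult[OF ZM(1)])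
    then show ?thesis
      using arg_cong[OF eq', of "\<lambda>A. A (i, j)"] ij
      unfolding upper_block_mult[OF Bc ZM(2) ij] mult_Delta[OF UM(2) ij] Delta_mult[OF ZM(1) ij] by simp
  qed
  \<comment> \<open>In the rows from \<open>r\<close> on both sides of the equation carry no trace
    of \<open>L\<close> and \<open>L'\<close>, and \<open>\<Delta>\<close> has the entry
    \<open>\<one>\<close>.\<close>
  have low: "Z (i, j) = (if i = j then \<one> else \<zero>)" if ij: "r \<le> i" "i < n" "r \<le> j" "j < n" for i j
  proof -
    have "(\<Oplus>l\<in>{..<n}. (if upper_right n r i l then \<pi> [^] s \<otimes> L (i, l - r) else \<zero>) \<otimes> (q l \<otimes> Z (l, j)))
       = (\<Oplus>l\<in>{..<n}. \<zero>)"
      using ij eZ by (intro finsum_cong') (auto simp: upper_right_def)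
    then show ?thesis using ent[of i j] ij eZ[of i j] by (auto simp: q_def upper_block_def)
  qed
  define j' where "j' = r + j"
  have ij': "i < n" "j' < n" "r \<le> j'" "i < r" "upper_right n r i j'" "i \<noteq> j'" "j' - r = j"
    using ij r_le by (auto simp: j'_def upper_right_def)
  have "(\<Oplus>l\<in>{..<n}. (if upper_right n r i l then \<pi> [^] s \<otimes> L (i, l - r) else \<zero>) \<otimes> (q l \<otimes> Z (l, j')))
     = \<pi> [^] s \<otimes> L (i, j)"
    using ij' low Lc eZ by (subst finsum_single[where i = j']) (auto simp: q_def upper_right_def)
  then have 1: "\<pi> \<otimes> Z (i, j') \<oplus> \<pi> [^] s \<otimes> L (i, j) = \<pi> [^] s \<otimes> L' (i, j)"
    using ent[of i j'] ij' L(2) ij by (simp add: q_def upper_block_def is_lift_def)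
  obtain c where c: "c \<in> carrier R" "Z (i, j') = \<pi> [^] s \<otimes> c" using dvd_urD[OF Z(2) ij'(5)] by blast
  have Lij: "L (i, j) \<in> carrier R" "h (L (i, j)) = C (i, j)" "L' (i, j) \<in> carrier R" "h (L' (i, j)) = C' (i, j)"
    using L ij by (auto simp: is_lift_def)
  have "\<pi> [^] s \<otimes> (\<pi> \<otimes> c \<oplus> L (i, j)) = \<pi> [^] s \<otimes> L' (i, j)"
    using 1 c Lij by (simp add: r_distr m_lcomm)
  then have "\<pi> \<otimes> c \<oplus> L (i, j) = L' (i, j)" by (rule pow_pi_cancel[rotated 2]) (use c Lij in simp_all)
  then have "h (\<pi> \<otimes> c) \<oplus>\<^bsub>S\<^esub> h (L (i, j)) = h (L' (i, j))" using c Lij by (metis h.hom_add m_closed pi_closed)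
  moreover have "h (\<pi> \<otimes> c) = \<zero>\<^bsub>S\<^esub>" using h_ker[of "\<pi> \<otimes> c"] c by blast
  ultimately show ?thesis using Lij h.hom_closed[OF Lij(1)] by (simp add: h.S.l_zero)
qed

lemma lift_ex:
  assumes "C \<in> {..<r} \<times> {..<n - r} \<rightarrow>\<^sub>E carrier S"
  shows "\<exists>L. is_lift C L"
proof -
  have "\<exists>a\<in>carrier R. h a = C ij" if "ij \<in> {..<r} \<times> {..<n - r}" for ij
    using h_surj PiE_mem[OF assms that] by (metis imageE)
  then have "\<forall>ij. \<exists>a. ij \<in> {..<r} \<times> {..<n - r} \<longrightarrow> a \<in> carrier R \<and> h a = C ij" by blast
  then show ?thesis unfolding is_lift_def by metis
qed

theorem edge_cosets_bij:
  assumes lift: "\<And>C. C \<in> {..<r} \<times> {..<n - r} \<rightarrow>\<^sub>E carrier S \<Longrightarrow> is_lift C (L C)"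
  shows "bij_betw (\<lambda>C. edge_mat (L C) <#\<^bsub>M\<^esub> K) ({..<r} \<times> {..<n - r} \<rightarrow>\<^sub>E carrier S)
    ((\<lambda>g. g <#\<^bsub>M\<^esub> K) ` double_coset)"
proof (rule bij_betw_imageI)
  have EM: "edge_mat (L C) \<in> carrier M" if "C \<in> {..<r} \<times> {..<n - r} \<rightarrow>\<^sub>E carrier S" for C
    using scaled_in_M double_coset_scaled edge_mat_double_coset lift that by blast
  show "inj_on (\<lambda>C. edge_mat (L C) <#\<^bsub>M\<^esub> K) ({..<r} \<times> {..<n - r} \<rightarrow>\<^sub>E carrier S)"
  proof (rule inj_onI)
    fix C C' assume C: "C \<in> {..<r} \<times> {..<n - r} \<rightarrow>\<^sub>E carrier S" "C' \<in> {..<r} \<times> {..<n - r} \<rightarrow>\<^sub>E carrier S"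
      and eq: "edge_mat (L C) <#\<^bsub>M\<^esub> K = edge_mat (L C') <#\<^bsub>M\<^esub> K"
    obtain Z where Z: "Z \<in> K" "edge_mat (L C') = edge_mat (L C) \<otimes>\<^bsub>M\<^esub> Z"
      using coset_mem[OF EM[OF C(2)]] unfolding eq[symmetric] by (auto simp: l_coset_def)
    show "C = C'"
    proof (rule PiE_ext[OF C])
      fix ij assume "ij \<in> {..<r} \<times> {..<n - r}"
      then show "C ij = C' ij"
        using edge_mat_inj[OF lift[OF C(1)] lift[OF C(2)] K_G[OF Z(1)] K_ur[OF Z(1)] Z(2)[symmetric]]
        by (cases ij) auto
    qed
  qed
  show "(\<lambda>C. edge_mat (L C) <#\<^bsub>M\<^esub> K) ` ({..<r} \<times> {..<n - r} \<rightarrow>\<^sub>E carrier S) = (\<lambda>g. g <#\<^bsub>M\<^esub> K) ` double_coset"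
  proof
    show "(\<lambda>C. edge_mat (L C) <#\<^bsub>M\<^esub> K) ` ({..<r} \<times> {..<n - r} \<rightarrow>\<^sub>E carrier S) \<subseteq> (\<lambda>g. g <#\<^bsub>M\<^esub> K) ` double_coset"
      using edge_mat_double_coset lift by blast
    show "(\<lambda>g. g <#\<^bsub>M\<^esub> K) ` double_coset \<subseteq> (\<lambda>C. edge_mat (L C) <#\<^bsub>M\<^esub> K) ` ({..<r} \<times> {..<n - r} \<rightarrow>\<^sub>E carrier S)"
    proof
      fix c assume "c \<in> (\<lambda>g. g <#\<^bsub>M\<^esub> K) ` double_coset"
      then obtain g where g: "g \<in> double_coset" "c = g <#\<^bsub>M\<^esub> K" by blast
      obtain C where C: "C \<in> {..<r} \<times> {..<n - r} \<rightarrow>\<^sub>E carrier S"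
        "\<And>L. is_lift C L \<Longrightarrow> \<exists>k\<in>K. g = edge_mat L \<otimes>\<^bsub>M\<^esub> k" using double_coset_normal_form[OF g(1)] by blast
      then obtain k where k: "k \<in> K" "g = edge_mat (L C) \<otimes>\<^bsub>M\<^esub> k" using lift by blast
      then have "c = edge_mat (L C) <#\<^bsub>M\<^esub> K" using g(2) coset_absorb EM[OF C(1)] by simp
      then show "c \<in> (\<lambda>C. edge_mat (L C) <#\<^bsub>M\<^esub> K) ` ({..<r} \<times> {..<n - r} \<rightarrow>\<^sub>E carrier S)" using C(1) by blast
    qed
  qed
qed

text \<open>Equal lattices only provide some \<open>Z\<close> in \<open>GL\<close>, but for
  \<open>s = 0\<close> the divisibility condition of \<open>edge_mat_inj\<close> is empty.\<close>

lemma edge_mat_lattice_inj: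
  assumes "s = 0" and L: "is_lift C L" "is_lift C' L'"
    and eq: "lattice n R (edge_mat L) = lattice n R (edge_mat L')" and ij: "i < r" "j < n - r"
  shows "C (i, j) = C' (i, j)"
proof -
  obtain Z where Z: "Z \<in> carrier G" "edge_mat L' = edge_mat L \<otimes>\<^bsub>M\<^esub> Z"
    using scaled_lattice_eq[OF double_coset_scaled[OF edge_mat_double_coset[OF L(1)]]
        double_coset_scaled[OF edge_mat_double_coset[OF L(2)]] eq] by blast
  have "dvd_ur s Z"
    unfolding dvd_ur_def
  proof (intro allI impI)
    fix i j assume "upper_right n r i j"
    then have "Z (i, j) \<in> carrier R" using mat_entry[OF G_M[OF Z(1)]] r_le by (auto simp: upper_right_def)
    then show "\<exists>c\<in>carrier R. Z (i, j) = \<pi> [^] s \<otimes> c" using \<open>s = 0\<close> by auto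
  qed
  then show ?thesis using edge_mat_inj[OF L Z(1) _ Z(2)[symmetric] ij] by blast
qed

text \<open>A coset can be read off from its lattice when \<open>s = 0\<close>: both matrices have
  normal forms, the blocks agree by \<open>edge_mat_lattice_inj\<close>, and then one lift serves
  for both. This is the source of the uniqueness of level structures.\<close>

lemma double_coset_lattice_eq:
  assumes "s = 0" and g: "g \<in> double_coset" "g' \<in> double_coset" and eq: "lattice n R g = lattice n R g'"
  shows "\<exists>k\<in>K. g' = g \<otimes>\<^bsub>M\<^esub> k"
proof -
  obtain C where C: "C \<in> {..<r} \<times> {..<n - r} \<rightarrow>\<^sub>E carrier S"
    "\<And>L. is_lift C L \<Longrightarrow> \<exists>k\<in>K. g = edge_mat L \<otimes>\<^bsub>M\<^esub> k" using double_coset_normal_form[OF g(1)] by blast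
  obtain C' where C': "C' \<in> {..<r} \<times> {..<n - r} \<rightarrow>\<^sub>E carrier S"
    "\<And>L. is_lift C' L \<Longrightarrow> \<exists>k\<in>K. g' = edge_mat L \<otimes>\<^bsub>M\<^esub> k" using double_coset_normal_form[OF g(2)] by blast
  obtain L L' where L: "is_lift C L" "is_lift C' L'" using lift_ex[OF C(1)] lift_ex[OF C'(1)] by blast
  obtain k k' where k: "k \<in> K" "g = edge_mat L \<otimes>\<^bsub>M\<^esub> k" "k' \<in> K" "g' = edge_mat L' \<otimes>\<^bsub>M\<^esub> k'"
    using C(2)[OF L(1)] C'(2)[OF L(2)] by blast
  have EM: "edge_mat L \<in> carrier M" "edge_mat L' \<in> carrier M"
    using scaled_in_M double_coset_scaled edge_mat_double_coset L by blast+
  have "lattice n R (edge_mat L) = lattice n R (edge_mat L')"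
    using eq k EM by (simp add: lattice_mult_GL K_G)
  then have CC: "C ij = C' ij" if "ij \<in> {..<r} \<times> {..<n - r}" for ij
    using edge_mat_lattice_inj[OF \<open>s = 0\<close> L] that by (cases ij) auto
  have "C = C'" by (rule PiE_ext[OF C(1) C'(1) CC])
  then have "is_lift C' L" using L(1) by simp
  then obtain k'' where k'': "k'' \<in> K" "g' = edge_mat L \<otimes>\<^bsub>M\<^esub> k''" using C'(2) by blast
  have inv: "k \<otimes>\<^bsub>M\<^esub> inv\<^bsub>G\<^esub> k = \<one>\<^bsub>M\<^esub>" using G.r_inv[OF K_G[OF k(1)]] by simp
  have "g \<otimes>\<^bsub>M\<^esub> (inv\<^bsub>G\<^esub> k \<otimes>\<^bsub>M\<^esub> k'') = edge_mat L \<otimes>\<^bsub>M\<^esub> (k \<otimes>\<^bsub>M\<^esub> inv\<^bsub>G\<^esub> k) \<otimes>\<^bsub>M\<^esub> k''"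
    unfolding k(2) using EM k(1) k'' K_inv[OF k(1)] by (simp add: M.m_assoc K_M)
  then have "g' = g \<otimes>\<^bsub>M\<^esub> (inv\<^bsub>G\<^esub> k \<otimes>\<^bsub>M\<^esub> k'')" using inv k'' EM by simp
  then show ?thesis using K_mult[OF K_inv[OF k(1)] k''(1)] by blast
qed

text \<open>The whole left factor \<open>k1\<close> crosses \<open>\<Delta>\<close>. The result lies
  in \<open>GL\<close>, though not necessarily in \<open>K\<close>, and this suffices for the
  lattice.\<close>

lemma double_coset_lattice_const:
  assumes "s \<ge> 1" and g: "g \<in> double_coset"
  shows "lattice n R g = lattice n R \<Delta>"
proof -
  obtain k1 k2 where k: "k1 \<in> K" "k2 \<in> K" "g = k1 \<otimes>\<^bsub>M\<^esub> \<Delta> \<otimes>\<^bsub>M\<^esub> k2" using g by (rule double_cosetE)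
  have "s = 1 + (s - 1)" using \<open>s \<ge> 1\<close> by simp
  then have "dvd_ur 1 k1" using K_ur[OF k(1)] dvd_ur_mono by metis
  then obtain Z where Z: "Z \<in> carrier G" "k1 \<otimes>\<^bsub>M\<^esub> \<Delta> = \<Delta> \<otimes>\<^bsub>M\<^esub> Z" using K_conj_ex[OF k(1)] by blast
  show ?thesis unfolding k(3) Z(2) using Z(1) k(2) by (simp add: lattice_mult_GL K_G G_M)
qed

end

section \<open>Completions\<close>

text \<open>Covers the ring with the powers of its maximal ideal and a module with its multiples by
  these powers, so that both completions share one theory of limits.\<close>

locale filtered_group = abelian_group G for G (structure) +
  fixes N :: "nat \<Rightarrow> 'a set"
  assumes N_sub: "additive_subgroup (N d) G"
    and N_Suc: "N (Suc d) \<subseteq> N d"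
begin

lemma N_abelian_subgroup: "abelian_subgroup (N d) G"
  by (rule abelian_subgroupI3[OF N_sub abelian_group_axioms])

lemma N_closed: "a \<in> N d \<Longrightarrow> a \<in> carrier G"
  using additive_subgroup.a_Hcarr[OF N_sub] .

lemma N_add: "a \<in> N d \<Longrightarrow> b \<in> N d \<Longrightarrow> a \<oplus> b \<in> N d"
  using additive_subgroup.a_closed[OF N_sub] .

lemma N_neg: "a \<in> N d \<Longrightarrow> \<ominus> a \<in> N d"
  using abelian_subgroup.a_rcos_const[OF N_abelian_subgroup]
  by (metis N_sub abelian_group_axioms additive_subgroup.a_inv_closed)

lemma N_zero: "\<zero> \<in> N d"
  using additive_subgroup.zero_closed[OF N_sub] .

lemma N_antimono: "d \<le> e \<Longrightarrow> N e \<subseteq> N d"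
  by (rule lift_Suc_antimono_le) (rule N_Suc)

lemma mem_coset_iff: "a \<in> carrier G \<Longrightarrow> b \<in> carrier G \<Longrightarrow> b \<in> N d +> a \<longleftrightarrow> b \<oplus> \<ominus> a \<in> N d"
  using abelian_subgroup.a_rcos_module[OF N_abelian_subgroup] .

lemma coset_eq_iff:
  assumes "a \<in> carrier G" "b \<in> carrier G"
  shows "N d +> a = N d +> b \<longleftrightarrow> a \<oplus> \<ominus> b \<in> N d"
  using assms mem_coset_iff[of b a d] abelian_subgroup.a_repr_independence'[OF N_abelian_subgroup]
    abelian_subgroup.a_rcos_self[OF N_abelian_subgroup] by (metis)

lemma coset_self: "a \<in> carrier G \<Longrightarrow> a \<in> N d +> a"
  using abelian_subgroup.a_rcos_self[OF N_abelian_subgroup] .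

lemma cosetE:
  assumes "A \<in> a_rcosets (N d)" obtains a where "a \<in> carrier G" "A = N d +> a"
  using assms unfolding A_RCOSETS_def' a_r_coset_def' by blast

lemma coset_in: "a \<in> carrier G \<Longrightarrow> N d +> a \<in> a_rcosets (N d)"
  using a_rcosetsI[OF additive_subgroup.a_subset[OF N_sub]] .

lemma coset_add:
  "a \<in> carrier G \<Longrightarrow> b \<in> carrier G \<Longrightarrow> (N d +> a) <+> (N d +> b) = N d +> (a \<oplus> b)"
  using abelian_subgroup.a_rcos_sum[OF N_abelian_subgroup] .

lemma coset_zero_iff: "a \<in> carrier G \<Longrightarrow> N d +> a = N d \<longleftrightarrow> a \<in> N d"
proof -
  assume "a \<in> carrier G"
  moreover have "\<ominus> \<zero> = \<zero>" by (metis a_inv_closed l_zero r_neg zero_closed)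
  ultimately show ?thesis
    using coset_eq_iff[of a \<zero> d] abelian_subgroup.a_rcos_const[OF N_abelian_subgroup N_zero[of d]]
    by (metis r_zero zero_closed)
qed

lemma coset_carrier: "a \<in> carrier G \<Longrightarrow> b \<in> N d +> a \<Longrightarrow> b \<in> carrier G"
  using abelian_subgroup.a_elemrcos_carrier[OF N_abelian_subgroup] .

lemma coset_mono: "d \<le> e \<Longrightarrow> N e +> a \<subseteq> N d +> a"
  using N_antimono[of d e] by (auto simp: a_r_coset_def')

lemma coset_subset_iff:
  assumes "a \<in> carrier G" "b \<in> carrier G" "d \<le> e"
  shows "N e +> b \<subseteq> N d +> a \<longleftrightarrow> N d +> b = N d +> a"
proof
  assume "N e +> b \<subseteq> N d +> a"
  then have "b \<in> N d +> a" using coset_self[OF assms(2)] by blast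
  then show "N d +> b = N d +> a"
    using abelian_subgroup.a_repr_independence'[OF N_abelian_subgroup] assms(1) by metis
next
  assume "N d +> b = N d +> a" then show "N e +> b \<subseteq> N d +> a" using coset_mono[OF assms(3), of b] by simp
qed

definition limit :: "(nat \<Rightarrow> 'a set) set" where
  "limit = {s. \<forall>d. s d \<in> a_rcosets (N d) \<and> s (Suc d) \<subseteq> s d}"

text \<open>Elements of the limit are handled through sequences of representatives, on which
  operations are computed directly. The representative \<open>a d\<close> matters only modulo
  \<open>N d\<close>.\<close>

definition coherent :: "(nat \<Rightarrow> 'a) \<Rightarrow> bool" where
  "coherent a \<longleftrightarrow> (\<forall>d. a d \<in> carrier G \<and> N d +> a (Suc d) = N d +> a d)"

definition fseq :: "(nat \<Rightarrow> 'a) \<Rightarrow> nat \<Rightarrow> 'a set" where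
  "fseq a = (\<lambda>d. N d +> a d)"

lemma fseq_in: "coherent a \<Longrightarrow> fseq a \<in> limit"
  unfolding limit_def coherent_def fseq_def using coset_in coset_subset_iff by auto

lemma limitE:
  assumes "s \<in> limit"
  obtains a where "coherent a" "s = fseq a"
proof -
  have "\<exists>a. a \<in> carrier G \<and> s d = N d +> a" for d
  proof -
    have "s d \<in> a_rcosets (N d)" using assms unfolding limit_def by blast
    then show ?thesis using cosetE by metis
  qed
  then obtain a where a: "\<And>d. a d \<in> carrier G" "\<And>d. s d = N d +> a d" by metis
  have "N d +> a (Suc d) = N d +> a d" for d
    using assms a coset_subset_iff[OF a(1)[of d] a(1)[of "Suc d"], of d "Suc d"] unfolding limit_def by auto
  then show ?thesis using a by (intro that[of a]) (auto simp: coherent_def fseq_def)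
qed

lemma coherent_closed: "coherent a \<Longrightarrow> a d \<in> carrier G"
  by (simp add: coherent_def)

lemma coherent_le:
  assumes "coherent a" "d \<le> e"
  shows "N d +> a e = N d +> a d"
  using assms(2)
proof (induction e rule: dec_induct)
  case (step e)
  have "N e +> a (Suc e) = N e +> a e" using assms(1) by (simp add: coherent_def)
  then have "a (Suc e) \<oplus> \<ominus> a e \<in> N e" using coset_eq_iff coherent_closed[OF assms(1)] by blast
  then have "a (Suc e) \<oplus> \<ominus> a e \<in> N d" using N_antimono step(1) by blast
  then show ?case using step coset_eq_iff coherent_closed[OF assms(1)] by blast
qed simp

lemma coherent_const: "a \<in> carrier G \<Longrightarrow> coherent (\<lambda>_. a)"
  by (simp add: coherent_def)

lemma fseq_eq_iff:
  "coherent a \<Longrightarrow> coherent b \<Longrightarrow> fseq a = fseq b \<longleftrightarrow> (\<forall>d. a d \<oplus> \<ominus> b d \<in> N d)"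
  unfolding fseq_def by (simp add: fun_eq_iff coset_eq_iff coherent_closed)

lemma coherent_add:
  assumes "coherent a" "coherent b" shows "coherent (\<lambda>d. a d \<oplus> b d)"
  using assms unfolding coherent_def by (metis a_closed coset_add)

lemma coherent_neg:
  assumes "coherent a" shows "coherent (\<lambda>d. \<ominus> a d)"
  unfolding coherent_def
proof (intro allI conjI)
  fix d
  note c = coherent_closed[OF assms]
  show "\<ominus> a d \<in> carrier G" using c by simp
  have "a (Suc d) \<oplus> \<ominus> a d \<in> N d" using assms coset_eq_iff c unfolding coherent_def by blast
  then have "\<ominus> (a (Suc d) \<oplus> \<ominus> a d) \<in> N d" by (rule N_neg)
  then have "\<ominus> a (Suc d) \<oplus> \<ominus> (\<ominus> a d) \<in> N d" using c by (simp add: minus_add)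
  then show "N d +> \<ominus> a (Suc d) = N d +> \<ominus> a d" using coset_eq_iff c by blast
qed

end

section \<open>Completion of a discrete valuation ring\<close>

lemma (in ring) ideal_unit_imp_carrier:
  assumes "ideal J R" "a \<in> J" "a \<in> Units R"
  shows "J = carrier R"
proof -
  obtain b where "b \<in> carrier R" "b \<otimes> a = \<one>" using Units_l_inv_ex[OF assms(3)] by blast
  then have "\<one> \<in> J" using ideal.I_l_closed[OF assms(1,2)] by metis
  then show ?thesis by (rule ideal.one_imp_carrier[OF assms(1)])
qed

text \<open>The nonunits are the multiples of \<open>p\<close>, that is, the ring is local with
  maximal ideal generated by \<open>p\<close>. The factorisation of nonzero elements into a unit and
  a power of \<open>p\<close> is carried separately, by \<open>pts_unif\<close>.\<close>

locale unif_ring = domain R for R (structure) +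
  fixes p :: 'a
  assumes p_closed [simp, intro]: "p \<in> carrier R"
    and p_nonzero: "p \<noteq> \<zero>"
    and p_nonunit: "p \<notin> Units R"
    and p_gen: "\<lbrakk>a \<in> carrier R; a \<notin> Units R\<rbrakk> \<Longrightarrow> \<exists>b\<in>carrier R. a = b \<otimes> p"
begin

definition I :: "nat \<Rightarrow> 'a set" where "I d = PIdl (p [^] d)"

lemma mem_I: "a \<in> I d \<longleftrightarrow> (\<exists>b\<in>carrier R. a = b \<otimes> p [^] d)"
  unfolding I_def cgenideal_def by blast

lemma I_ideal: "ideal (I d) R"
  unfolding I_def by (rule cgenideal_ideal) simp

lemma pow_nonzero: "p [^] (d::nat) \<noteq> \<zero>"
  by (induction d) (auto simp: p_nonzero integral_iff)

lemma pow_cancel: "\<lbrakk>a \<in> carrier R; b \<in> carrier R; a \<otimes> p [^] (d::nat) = b \<otimes> p [^] d\<rbrakk> \<Longrightarrow> a = b"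
  using m_rcancel[OF pow_nonzero[of d]] by simp

sublocale F: filtered_group R I
proof (intro filtered_group.intro filtered_group_axioms.intro abelian_group_axioms)
  show "additive_subgroup (I d) R" for d using I_ideal ideal_def by blast
  show "I (Suc d) \<subseteq> I d" for d
  proof
    fix a assume "a \<in> I (Suc d)"
    then obtain b where b: "b \<in> carrier R" "a = b \<otimes> p [^] Suc d" unfolding mem_I by blast
    then have "a = (b \<otimes> p) \<otimes> p [^] d" by (simp add: m_assoc m_comm[of p])
    then show "a \<in> I d" using b(1) unfolding mem_I by blast
  qed
qed

lemma I_0: "I 0 = carrier R"
  by (auto simp: mem_I)

lemma mem_I_1: "a \<in> carrier R \<Longrightarrow> a \<in> I 1 \<longleftrightarrow> a \<notin> Units R"
proof
  assume a: "a \<in> carrier R" "a \<in> I 1"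
  then obtain b where b: "b \<in> carrier R" "a = b \<otimes> p" by (auto simp: mem_I)
  show "a \<notin> Units R"
  proof
    assume "a \<in> Units R"
    then have "p \<in> Units R" using b prod_unit_r[of b p] unit_factor[of p b] m_comm by simp
    then show False using p_nonunit by blast
  qed
qed (use p_gen in \<open>auto simp: mem_I\<close>)

lemma I_proper: "carrier R \<noteq> I 1"
  using mem_I_1[of \<one>] by auto

lemma I_1_maximal: "maximalideal (I 1) R"
proof (rule maximalidealI[OF I_ideal])
  show "carrier R \<noteq> I 1" by (rule I_proper)
  fix J assume J: "ideal J R" "I 1 \<subseteq> J" "J \<subseteq> carrier R"
  show "J = I 1 \<or> J = carrier R"
  proof (rule disjCI)
    assume "J \<noteq> carrier R"
    then have "a \<notin> Units R" if "a \<in> J" for a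
      using that ideal_unit_imp_carrier[OF J(1)] by blast
    then have "J \<subseteq> I 1" using J mem_I_1 by blast
    then show "J = I 1" using J by blast
  qed
qed

lemma max_ideal_eq: "max_ideal R = I 1"
  unfolding max_ideal_def
proof (rule the_equality)
  show "maximalideal (I 1) R" by (rule I_1_maximal)
  fix J assume "maximalideal J R"
  then interpret J: maximalideal J R .
  have "a \<notin> Units R" if "a \<in> J" for a
    using that ideal_unit_imp_carrier[OF J.is_ideal] J.I_notcarr by blast
  then have "J \<subseteq> I 1" using J.Icarr mem_I_1 by blast
  then show "J = I 1" using J.I_maximal[OF I_ideal, of 1] ideal.Icarr[OF I_ideal, of _ 1]
      maximalideal.I_notcarr[OF I_1_maximal] by blast
qed

text \<open>Products of principal ideals are principal, and the ideal product is the ideal generated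
  by the elementwise product.\<close>

lemma max_ideal_pow_eq: "max_ideal_pow R d = I d"
proof (induction d)
  case 0
  then show ?case by (simp add: max_ideal_pow_def nat_pow_def ideals_set_def I_0)
next
  case (Suc d)
  have "max_ideal_pow R (Suc d) = max_ideal_pow R d \<cdot> max_ideal R"
    by (simp add: max_ideal_pow_def nat_pow_def ideals_set_def)
  also have "\<dots> = I d \<cdot> I 1" using Suc max_ideal_eq by simp
  also have "\<dots> = I (Suc d)"
  proof
    have "I d <#> I 1 = I (Suc d)"
      unfolding I_def using cgenideal_prod[of "p [^] d" "p [^] (1::nat)"] by simp
    moreover have "I (Suc d) \<subseteq> carrier R" using ideal.Icarr[OF I_ideal] by blast
    ultimately show "I d \<cdot> I 1 \<subseteq> I (Suc d)" "I (Suc d) \<subseteq> I d \<cdot> I 1"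
      using ideal_prod_eq_genideal[OF I_ideal[of d] I_ideal[of 1]] genideal_minimal[OF I_ideal[of "Suc d"]]
        genideal_self[of "I (Suc d)"] by auto
  qed
  finally show ?case .
qed

lemma trunc_ring_eq: "trunc_ring R d = R Quot I d"
  by (simp add: trunc_ring_def max_ideal_pow_eq)

lemma residue_field_eq: "residue_field R = trunc_ring R 1"
  by (simp add: residue_field_def trunc_ring_eq max_ideal_eq)

abbreviation "T d \<equiv> trunc_ring R d"
abbreviation "\<O> \<equiv> completion R"

lemma T_cring: "cring (T d)"
  unfolding trunc_ring_eq by (rule ideal.quotient_is_cring[OF I_ideal cring_axioms])

lemma T_carrier: "carrier (T d) = a_rcosets (I d)"
  by (simp add: trunc_ring_eq FactRing_def)

lemma T_hom: "ring_hom_cring R (T d) (\<lambda>a. I d +> a)"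
  unfolding trunc_ring_eq by (rule ideal.rcos_ring_hom_cring[OF I_ideal cring_axioms])

lemma T_ops:
  "a \<in> carrier R \<Longrightarrow> b \<in> carrier R \<Longrightarrow> (I d +> a) \<otimes>\<^bsub>T d\<^esub> (I d +> b) = I d +> (a \<otimes> b)"
  "a \<in> carrier R \<Longrightarrow> b \<in> carrier R \<Longrightarrow> (I d +> a) \<oplus>\<^bsub>T d\<^esub> (I d +> b) = I d +> (a \<oplus> b)"
  "\<one>\<^bsub>T d\<^esub> = I d +> \<one>" "\<zero>\<^bsub>T d\<^esub> = I d"
  unfolding trunc_ring_eq
  by (simp_all add: FactRing_def ideal.rcoset_mult_add[OF I_ideal] F.coset_add)

lemma I_coset_zero: "I d +> \<zero> = I d"
  using F.coset_zero_iff[of \<zero> d] F.N_zero by simp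

lemma O_carrier: "carrier \<O> = F.limit"
  by (simp add: completion_def F.limit_def T_carrier)

lemma O_ops:
  "(f \<otimes>\<^bsub>\<O>\<^esub> g) d = f d \<otimes>\<^bsub>T d\<^esub> g d" "(f \<oplus>\<^bsub>\<O>\<^esub> g) d = f d \<oplus>\<^bsub>T d\<^esub> g d"
  "\<one>\<^bsub>\<O>\<^esub> d = \<one>\<^bsub>T d\<^esub>" "\<zero>\<^bsub>\<O>\<^esub> d = \<zero>\<^bsub>T d\<^esub>"
  by (simp_all add: completion_def)

lemma O_eval: "f \<in> carrier \<O> \<Longrightarrow> f d \<in> carrier (T d)"
  by (simp add: completion_def)

abbreviation "seq \<equiv> F.fseq"
abbreviation "coh \<equiv> F.coherent"

lemma O_E:
  assumes "f \<in> carrier \<O>" obtains a where "coh a" "f = seq a"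
  using assms F.limitE unfolding O_carrier by blast

lemma seq_in: "coh a \<Longrightarrow> seq a \<in> carrier \<O>"
  unfolding O_carrier by (rule F.fseq_in)

lemma coh_mult:
  assumes "coh a" "coh b" shows "coh (\<lambda>d. a d \<otimes> b d)"
  using assms unfolding F.coherent_def by (metis m_closed T_ops(1))

lemma seq_mult: "coh a \<Longrightarrow> coh b \<Longrightarrow> seq a \<otimes>\<^bsub>\<O>\<^esub> seq b = seq (\<lambda>d. a d \<otimes> b d)"
  by (simp add: fun_eq_iff O_ops F.fseq_def T_ops F.coherent_closed)

lemma seq_add: "coh a \<Longrightarrow> coh b \<Longrightarrow> seq a \<oplus>\<^bsub>\<O>\<^esub> seq b = seq (\<lambda>d. a d \<oplus> b d)"
  by (simp add: fun_eq_iff O_ops F.fseq_def T_ops F.coherent_closed)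

definition emb :: "'a \<Rightarrow> nat \<Rightarrow> 'a set" where "emb a = seq (\<lambda>_. a)"

lemma emb_eval: "emb a d = I d +> a"
  by (simp add: emb_def F.fseq_def)

lemma emb_closed: "a \<in> carrier R \<Longrightarrow> emb a \<in> carrier \<O>"
  unfolding emb_def by (rule seq_in[OF F.coherent_const])

lemma O_one: "\<one>\<^bsub>\<O>\<^esub> = emb \<one>"
  by (simp add: fun_eq_iff O_ops emb_eval T_ops)

lemma O_zero: "\<zero>\<^bsub>\<O>\<^esub> = emb \<zero>"
  by (simp add: fun_eq_iff O_ops emb_eval T_ops I_coset_zero)

text \<open>The axioms hold in each truncation; only closure and negatives call for
  representatives.\<close>

lemma O_cring: "cring \<O>"
proof -
  have closed: "f \<oplus>\<^bsub>\<O>\<^esub> g \<in> carrier \<O>" "f \<otimes>\<^bsub>\<O>\<^esub> g \<in> carrier \<O>" if fg: "f \<in> carrier \<O>" "g \<in> carrier \<O>" for f g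
  proof -
    obtain a where a: "coh a" "f = seq a" using fg O_E by blast
    obtain b where b: "coh b" "g = seq b" using fg O_E by blast
    show "f \<oplus>\<^bsub>\<O>\<^esub> g \<in> carrier \<O>" "f \<otimes>\<^bsub>\<O>\<^esub> g \<in> carrier \<O>"
      using a b by (simp_all add: seq_add seq_mult seq_in F.coherent_add coh_mult)
  qed
  note [simp] = O_eval
  have one_zero: "\<one>\<^bsub>\<O>\<^esub> \<in> carrier \<O>" "\<zero>\<^bsub>\<O>\<^esub> \<in> carrier \<O>" by (simp_all add: O_one O_zero emb_closed)
  show ?thesis
  proof (intro cringI abelian_groupI comm_monoidI)
    fix f assume f: "f \<in> carrier \<O>"
    obtain a where a: "coh a" "f = seq a" using f O_E by blast
    show "\<exists>g\<in>carrier \<O>. g \<oplus>\<^bsub>\<O>\<^esub> f = \<zero>\<^bsub>\<O>\<^esub>"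
      using a F.coherent_neg[OF a(1)] F.coherent_closed[OF a(1)]
      by (intro bexI[of _ "seq (\<lambda>d. \<ominus> a d)"]) (simp_all add: seq_add seq_in O_zero emb_def l_neg)
  qed (auto simp: fun_eq_iff O_ops one_zero cring.cring_simprules[OF T_cring] monoid.r_one[OF ring.is_monoid[OF cring.axioms(1)[OF T_cring]]]
      simp del: Union_iff intro: closed)
qed

sublocale O: cring \<O> by (rule O_cring)

lemma ev_hom: "ring_hom_cring \<O> (T d) (\<lambda>f. f d)"
  by (intro ring_hom_cringI ring_hom_ringI2 O.cring_axioms T_cring ring_hom_memI O.ring_axioms cring.axioms(1)[OF T_cring]) (auto simp: O_ops O_eval)

lemma ev_surj: "(\<lambda>f. f d) ` carrier \<O> = carrier (T d)"
proof
  show "carrier (T d) \<subseteq> (\<lambda>f. f d) ` carrier \<O>"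
  proof
    fix A assume "A \<in> carrier (T d)"
    then obtain a where "a \<in> carrier R" "A = I d +> a" unfolding T_carrier by (rule F.cosetE)
    then show "A \<in> (\<lambda>f. f d) ` carrier \<O>" using emb_closed emb_eval by (metis image_eqI)
  qed
qed (auto simp: O_eval)

lemma emb_hom: "ring_hom_cring R \<O> emb"
  by (intro ring_hom_cringI ring_hom_ringI2 cring_axioms O.cring_axioms ring_hom_memI ring_axioms O.ring_axioms)
    (auto simp: emb_closed fun_eq_iff O_ops emb_eval T_ops)

lemma emb_pow: "a \<in> carrier R \<Longrightarrow> emb a [^]\<^bsub>\<O>\<^esub> (d::nat) = emb (a [^] d)"
  by (induction d) (simp_all add: O_one ring_hom_mult[OF ring_hom_cring.homh[OF emb_hom]])

text \<open>Division by \<open>p [^] d\<close> costs \<open>d\<close> steps of precision, so the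
  quotient takes at level \<open>e\<close> the representative of \<open>f\<close> at level
  \<open>e + d\<close>. Cancelling \<open>p [^] d\<close> shows that these quotients are coherent
  again.\<close>

lemma emb_p_dvd:
  assumes f: "f \<in> carrier \<O>" and z: "f d = \<zero>\<^bsub>T d\<^esub>"
  shows "\<exists>c\<in>carrier \<O>. f = emb (p [^] d) \<otimes>\<^bsub>\<O>\<^esub> c"
proof -
  obtain a where a: "coh a" "f = seq a" using f O_E by blast
  note ac = F.coherent_closed[OF a(1)]
  have "a d \<in> I d" using z a(2) F.coset_zero_iff[OF ac] by (simp add: F.fseq_def T_ops)
  then have "a e \<in> I d" if "d \<le> e" for e
    using F.coherent_le[OF a(1) that] F.coset_zero_iff ac by metis
  then have "\<exists>b. b \<in> carrier R \<and> a (e + d) = b \<otimes> p [^] d" for e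
    unfolding mem_I by (metis le_add2)
  then obtain b where b: "\<And>e. b e \<in> carrier R" "\<And>e. a (e + d) = b e \<otimes> p [^] d" by metis
  have cb: "coh b"
    unfolding F.coherent_def
  proof (intro allI conjI b(1))
    fix e
    have "a (Suc (e + d)) \<oplus> \<ominus> a (e + d) \<in> I (e + d)"
      using a(1) F.coset_eq_iff ac unfolding F.coherent_def by blast
    then obtain x where x: "x \<in> carrier R" "a (Suc (e + d)) \<oplus> \<ominus> a (e + d) = x \<otimes> p [^] (e + d)"
      unfolding mem_I by blast
    have "(b (Suc e) \<oplus> \<ominus> b e) \<otimes> p [^] d = (x \<otimes> p [^] e) \<otimes> p [^] d"
      using x b(1) b(2)[of "Suc e"] b(2)[of e] by (simp add: l_distr l_minus m_assoc nat_pow_mult)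
    then have "b (Suc e) \<oplus> \<ominus> b e = x \<otimes> p [^] e" by (rule pow_cancel[rotated 2]) (use b x in simp_all)
    then have "b (Suc e) \<oplus> \<ominus> b e \<in> I e" using x mem_I by blast
    then show "I e +> b (Suc e) = I e +> b e" using F.coset_eq_iff b(1) by blast
  qed
  have "f = emb (p [^] d) \<otimes>\<^bsub>\<O>\<^esub> seq b"
  proof
    fix e
    have "(emb (p [^] d) \<otimes>\<^bsub>\<O>\<^esub> seq b) e = I e +> (p [^] d \<otimes> b e)"
      using b(1) by (simp add: O_ops emb_eval F.fseq_def T_ops)
    also have "\<dots> = I e +> a (e + d)" using b by (simp add: m_comm)
    also have "\<dots> = I e +> a e" using F.coherent_le[OF a(1), of e "e + d"] by simp
    finally show "f e = (emb (p [^] d) \<otimes>\<^bsub>\<O>\<^esub> seq b) e" using a(2) by (simp add: F.fseq_def)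
  qed
  then show ?thesis using seq_in[OF cb] by blast
qed

lemma emb_p_eval:
  "c \<in> carrier \<O> \<Longrightarrow> (emb (p [^] d) \<otimes>\<^bsub>\<O>\<^esub> c) d = \<zero>\<^bsub>T d\<^esub>"
proof -
  assume c: "c \<in> carrier \<O>"
  have "p [^] d \<in> I d" unfolding mem_I by (intro bexI[of _ \<one>]) simp_all
  then have "emb (p [^] d) d = \<zero>\<^bsub>T d\<^esub>" using F.coset_zero_iff[of "p [^] d" d] by (simp add: emb_eval T_ops)
  then show ?thesis using O_eval[OF c] by (simp add: O_ops cring.cring_simprules[OF T_cring])
qed

text \<open>Again one step of precision is lost: the equation at level \<open>Suc d\<close>
  determines \<open>f\<close> at level \<open>d\<close>.\<close>

lemma emb_p_cancel:
  assumes f: "f \<in> carrier \<O>" and z: "emb p \<otimes>\<^bsub>\<O>\<^esub> f = \<zero>\<^bsub>\<O>\<^esub>"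
  shows "f = \<zero>\<^bsub>\<O>\<^esub>"
proof
  fix d
  obtain a where a: "coh a" "f = seq a" using f O_E by blast
  note ac = F.coherent_closed[OF a(1)]
  have "I (Suc d) +> (p \<otimes> a (Suc d)) = I (Suc d)"
    using fun_cong[OF z, of "Suc d"] ac by (simp add: a(2) O_ops emb_eval F.fseq_def T_ops)
  then have "p \<otimes> a (Suc d) \<in> I (Suc d)" using F.coset_zero_iff ac by simp
  then obtain x where x: "x \<in> carrier R" "p \<otimes> a (Suc d) = x \<otimes> p [^] Suc d" unfolding mem_I by blast
  then have "a (Suc d) \<otimes> p [^] (1::nat) = (x \<otimes> p [^] d) \<otimes> p [^] (1::nat)"
    using ac m_comm[of p "a (Suc d)"] by (simp add: m_assoc)
  then have "a (Suc d) = x \<otimes> p [^] d" by (rule pow_cancel[rotated 2]) (use x ac in simp_all)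
  then have "a (Suc d) \<in> I d" using x mem_I by blast
  then have "a d \<in> I d" using F.coherent_le[OF a(1), of d "Suc d"] F.coset_zero_iff ac by (metis le_SucI order_refl)
  then show "f d = \<zero>\<^bsub>\<O>\<^esub> d" using F.coset_zero_iff ac by (simp add: a(2) F.fseq_def O_ops T_ops)
qed

text \<open>Representatives that are nonzero in the residue field are units of the ring itself.
  Their inverses are coherent because inverses in a truncation are unique.\<close>

lemma O_unitI:
  assumes f: "f \<in> carrier \<O>" and nz: "f 1 \<noteq> \<zero>\<^bsub>T 1\<^esub>"
  shows "f \<in> Units \<O>"
proof -
  obtain a where a: "coh a" "f = seq a" using f O_E by blast
  note ac = F.coherent_closed[OF a(1)]
  have "a 1 \<notin> I 1" using nz F.coset_zero_iff[OF ac] by (simp add: a(2) F.fseq_def T_ops)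
  then have "a (Suc d) \<notin> I 1" for d
    using F.coherent_le[OF a(1), of 1 "Suc d"] F.coset_zero_iff ac by (metis One_nat_def Suc_le_mono zero_le)
  then have u: "a (Suc d) \<in> Units R" for d using mem_I_1 ac by blast
  \<comment> \<open>The shift is essential: \<open>I 0\<close> is the whole ring, so
    \<open>a 0\<close> is arbitrary and may fail to be a unit.\<close>
  define b where "b d = inv (a (Suc d))" for d
  have bc: "b d \<in> carrier R" for d using u by (simp add: b_def)
  have 1: "(I d +> b d) \<otimes>\<^bsub>T d\<^esub> (I d +> a e) = \<one>\<^bsub>T d\<^esub>" if "d \<le> e" for d e
  proof -
    have "I d +> a e = I d +> a (Suc d)"
      using F.coherent_le[OF a(1), of d] that by (metis le_SucI order_refl)
    then have "(I d +> b d) \<otimes>\<^bsub>T d\<^esub> (I d +> a e) = I d +> (b d \<otimes> a (Suc d))" using bc ac by (simp add: T_ops)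
    then show ?thesis using u by (simp add: b_def T_ops)
  qed
  have cb: "coh b"
    unfolding F.coherent_def
  proof (intro allI conjI bc)
    fix d
    interpret Td: cring "T d" by (rule T_cring)
    have c: "I d +> b (Suc d) \<in> carrier (T d)" "I d +> b d \<in> carrier (T d)" "I d +> a (Suc (Suc d)) \<in> carrier (T d)"
      unfolding T_carrier using F.coset_in bc ac by blast+
    have "(I d +> b (Suc d)) \<otimes>\<^bsub>T d\<^esub> (I d +> a (Suc (Suc d))) = \<one>\<^bsub>T d\<^esub>"
      using u ac bc by (simp add: T_ops b_def)
    moreover have "(I d +> b d) \<otimes>\<^bsub>T d\<^esub> (I d +> a (Suc (Suc d))) = \<one>\<^bsub>T d\<^esub>" using 1 by simp
    ultimately show "I d +> b (Suc d) = I d +> b d" using c Td.inv_unique Td.m_comm by metis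
  qed
  have "seq b \<otimes>\<^bsub>\<O>\<^esub> f = \<one>\<^bsub>\<O>\<^esub>"
    unfolding a(2) by (rule ext) (use 1 in \<open>simp add: O_ops F.fseq_def\<close>)
  moreover have "f \<otimes>\<^bsub>\<O>\<^esub> seq b = \<one>\<^bsub>\<O>\<^esub>" using calculation f seq_in[OF cb] O.m_comm by metis
  ultimately show ?thesis using f seq_in[OF cb] unfolding Units_def by blast
qed

lemma O_unit_iff: "f \<in> carrier \<O> \<Longrightarrow> f \<in> Units \<O> \<longleftrightarrow> f 1 \<noteq> \<zero>\<^bsub>T 1\<^esub>"
proof
  assume f: "f \<in> Units \<O>"
  interpret ring_hom_cring \<O> "T 1" "\<lambda>f. f 1" by (rule ev_hom)
  have "f 1 \<otimes>\<^bsub>T 1\<^esub> (inv\<^bsub>\<O>\<^esub> f) 1 = \<one>\<^bsub>T 1\<^esub>"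
    using f by (metis O.Units_closed O.Units_inv_closed O.Units_r_inv hom_mult hom_one)
  moreover have "\<one>\<^bsub>T 1\<^esub> \<noteq> \<zero>\<^bsub>T 1\<^esub>"
    using F.coset_zero_iff[of \<one> 1] mem_I_1[of \<one>] by (simp add: T_ops)
  ultimately show "f 1 \<noteq> \<zero>\<^bsub>T 1\<^esub>" using f O.Units_inv_closed O_eval S.l_null by metis
qed (rule O_unitI)

definition is_uniformizer :: "(nat \<Rightarrow> 'a set) \<Rightarrow> bool" where
  "is_uniformizer \<pi> \<longleftrightarrow> \<pi> \<in> carrier \<O> \<and> maximalideal (PIdl\<^bsub>\<O>\<^esub> \<pi>) \<O>"

lemma ev_1_kernel_ideal: "ideal {f \<in> carrier \<O>. f 1 = \<zero>\<^bsub>T 1\<^esub>} \<O>"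
  using ring_hom_ring.kernel_is_ideal[OF ring_hom_cring.ring_hom_ring'[OF ev_hom[of 1]]]
  by (simp add: a_kernel_def')

text \<open>An element of a proper ideal is no unit and hence vanishes in the residue field. So the
  given maximal ideal is contained in the kernel of evaluation at \<open>1\<close>, which is a
  proper ideal.\<close>

lemma uniformizer_ideal:
  assumes "is_uniformizer \<pi>"
  shows "PIdl\<^bsub>\<O>\<^esub> \<pi> = {f \<in> carrier \<O>. f 1 = \<zero>\<^bsub>T 1\<^esub>}"
proof -
  have pc: "\<pi> \<in> carrier \<O>" and max: "maximalideal (PIdl\<^bsub>\<O>\<^esub> \<pi>) \<O>" using assms by (auto simp: is_uniformizer_def)
  interpret J: maximalideal "PIdl\<^bsub>\<O>\<^esub> \<pi>" \<O> by (rule max)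
  have "f \<notin> Units \<O>" if "f \<in> PIdl\<^bsub>\<O>\<^esub> \<pi>" for f
    using that O.ideal_unit_imp_carrier[OF J.is_ideal] J.I_notcarr by blast
  then have sub: "PIdl\<^bsub>\<O>\<^esub> \<pi> \<subseteq> {f \<in> carrier \<O>. f 1 = \<zero>\<^bsub>T 1\<^esub>}"
    using J.Icarr O_unitI by blast
  have "\<one>\<^bsub>\<O>\<^esub> \<notin> {f \<in> carrier \<O>. f 1 = \<zero>\<^bsub>T 1\<^esub>}" using O_unit_iff[of "\<one>\<^bsub>\<O>\<^esub>"] O.Units_one_closed by blast
  then show ?thesis using J.I_maximal[OF ev_1_kernel_ideal sub] by blast
qed

context
  fixes \<pi> assumes unif: "is_uniformizer \<pi>"
begin

lemma unif_closed [simp]: "\<pi> \<in> carrier \<O>"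
  using unif by (simp add: is_uniformizer_def)

text \<open>\<open>\<pi>\<close> and the image of \<open>p\<close> generate the same ideal.
  Divisibility and cancellation for an arbitrary uniformizer of the completion are thereby reduced
  to \<open>p\<close>.\<close>

lemma unif_associated:
  obtains w w' where "w \<in> carrier \<O>" "w' \<in> carrier \<O>" "\<pi> = emb p \<otimes>\<^bsub>\<O>\<^esub> w" "emb p = \<pi> \<otimes>\<^bsub>\<O>\<^esub> w'"
proof -
  have "\<pi> \<in> PIdl\<^bsub>\<O>\<^esub> \<pi>" by (rule O.cgenideal_self) simp
  then have "\<pi> 1 = \<zero>\<^bsub>T 1\<^esub>" unfolding uniformizer_ideal[OF unif] by blast
  then obtain w where w: "w \<in> carrier \<O>" "\<pi> = emb p \<otimes>\<^bsub>\<O>\<^esub> w" using emb_p_dvd[of \<pi> 1] by auto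
  have "emb p 1 = \<zero>\<^bsub>T 1\<^esub>" using emb_p_eval[of "\<one>\<^bsub>\<O>\<^esub>" 1] emb_closed[of p] by simp
  then have "emb p \<in> PIdl\<^bsub>\<O>\<^esub> \<pi>" unfolding uniformizer_ideal[OF unif] using emb_closed by blast
  then obtain w' where "w' \<in> carrier \<O>" "emb p = w' \<otimes>\<^bsub>\<O>\<^esub> \<pi>" unfolding cgenideal_def by blast
  then show ?thesis using w that O.m_comm unif_closed by metis
qed

text \<open>The kernel of reduction at level \<open>d\<close> is generated by
  \<open>\<pi> [^] d\<close>. Powers of the cofactors \<open>w\<close> and \<open>w'\<close> convert
  between \<open>\<pi> [^] d\<close> and \<open>p [^] d\<close>.\<close>

lemma unif_dvd_iff:
  assumes f: "f \<in> carrier \<O>"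
  shows "f d = \<zero>\<^bsub>T d\<^esub> \<longleftrightarrow> (\<exists>c\<in>carrier \<O>. f = \<pi> [^]\<^bsub>\<O>\<^esub> d \<otimes>\<^bsub>\<O>\<^esub> c)"
proof -
  obtain w w' where w: "w \<in> carrier \<O>" "w' \<in> carrier \<O>" "\<pi> = emb p \<otimes>\<^bsub>\<O>\<^esub> w" "emb p = \<pi> \<otimes>\<^bsub>\<O>\<^esub> w'"
    by (rule unif_associated)
  have pw: "\<pi> [^]\<^bsub>\<O>\<^esub> d = emb (p [^] d) \<otimes>\<^bsub>\<O>\<^esub> w [^]\<^bsub>\<O>\<^esub> d"
    using w by (metis O.pow_mult_distrib O.m_comm emb_closed emb_pow p_closed)
  have pw': "emb (p [^] d) = \<pi> [^]\<^bsub>\<O>\<^esub> d \<otimes>\<^bsub>\<O>\<^esub> w' [^]\<^bsub>\<O>\<^esub> d"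
    using w by (metis O.pow_mult_distrib O.m_comm unif_closed emb_pow p_closed)
  show ?thesis
  proof
    assume "f d = \<zero>\<^bsub>T d\<^esub>"
    then obtain c where c: "c \<in> carrier \<O>" "f = emb (p [^] d) \<otimes>\<^bsub>\<O>\<^esub> c" using emb_p_dvd[OF f] by blast
    then show "\<exists>c\<in>carrier \<O>. f = \<pi> [^]\<^bsub>\<O>\<^esub> d \<otimes>\<^bsub>\<O>\<^esub> c"
      using w(2) unfolding pw' by (intro bexI[of _ "w' [^]\<^bsub>\<O>\<^esub> d \<otimes>\<^bsub>\<O>\<^esub> c"]) (simp_all add: O.m_assoc)
  next
    assume "\<exists>c\<in>carrier \<O>. f = \<pi> [^]\<^bsub>\<O>\<^esub> d \<otimes>\<^bsub>\<O>\<^esub> c"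
    then obtain c where c: "c \<in> carrier \<O>" "f = \<pi> [^]\<^bsub>\<O>\<^esub> d \<otimes>\<^bsub>\<O>\<^esub> c" by blast
    then have "f = emb (p [^] d) \<otimes>\<^bsub>\<O>\<^esub> (w [^]\<^bsub>\<O>\<^esub> d \<otimes>\<^bsub>\<O>\<^esub> c)"
      using w(1) emb_closed[of "p [^] d"] unfolding pw by (simp add: O.m_assoc)
    then show "f d = \<zero>\<^bsub>T d\<^esub>" using emb_p_eval[of "w [^]\<^bsub>\<O>\<^esub> d \<otimes>\<^bsub>\<O>\<^esub> c" d] w(1) c(1) by simp
  qed
qed

lemma unif_cancel:
  assumes "f \<in> carrier \<O>" "g \<in> carrier \<O>" "\<pi> \<otimes>\<^bsub>\<O>\<^esub> f = \<pi> \<otimes>\<^bsub>\<O>\<^esub> g"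
  shows "f = g"
proof -
  obtain w w' where w: "w \<in> carrier \<O>" "w' \<in> carrier \<O>" "\<pi> = emb p \<otimes>\<^bsub>\<O>\<^esub> w" "emb p = \<pi> \<otimes>\<^bsub>\<O>\<^esub> w'"
    by (rule unif_associated)
  have "emb p \<otimes>\<^bsub>\<O>\<^esub> (f \<ominus>\<^bsub>\<O>\<^esub> g) = w' \<otimes>\<^bsub>\<O>\<^esub> (\<pi> \<otimes>\<^bsub>\<O>\<^esub> f \<ominus>\<^bsub>\<O>\<^esub> \<pi> \<otimes>\<^bsub>\<O>\<^esub> g)"
    unfolding w(4) using w(2) assms(1,2) unif_closed by algebra
  also have "\<dots> = \<zero>\<^bsub>\<O>\<^esub>" unfolding assms(3) using assms(2) w(2) by (simp add: O.r_neg O.minus_eq)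
  finally have "f \<ominus>\<^bsub>\<O>\<^esub> g = \<zero>\<^bsub>\<O>\<^esub>" by (rule emb_p_cancel[rotated]) (use assms(1,2) in simp_all)
  then show ?thesis using assms(1,2) by simp
qed

end

end

section \<open>Completion of a torsion-free module\<close>

locale torsion_free_module = unif_ring R p + W: module R W
  for R :: "('a, 'm) ring_scheme" (structure) and p and W :: "('a, 'v) module" +
  assumes torsion_free: "\<lbrakk>v \<in> carrier W; p \<odot>\<^bsub>W\<^esub> v = \<zero>\<^bsub>W\<^esub>\<rbrakk> \<Longrightarrow> v = \<zero>\<^bsub>W\<^esub>"
begin

definition J :: "nat \<Rightarrow> 'v set" where "J d = (\<lambda>v. p [^] d \<odot>\<^bsub>W\<^esub> v) ` carrier W"

lemma mem_J: "x \<in> J d \<longleftrightarrow> (\<exists>v\<in>carrier W. x = p [^] d \<odot>\<^bsub>W\<^esub> v)"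
  by (auto simp: J_def)

lemma J_submodule: "submodule (J d) R W"
proof (rule W.submoduleI)
  show "\<zero>\<^bsub>W\<^esub> \<in> J d" unfolding mem_J by (intro bexI[of _ "\<zero>\<^bsub>W\<^esub>"]) simp_all
  show "\<ominus>\<^bsub>W\<^esub> a \<in> J d" if a: "a \<in> J d" for a
  proof -
    obtain v where v: "v \<in> carrier W" "a = p [^] d \<odot>\<^bsub>W\<^esub> v" using a unfolding mem_J by blast
    have "\<ominus>\<^bsub>W\<^esub> a = p [^] d \<odot>\<^bsub>W\<^esub> (\<ominus>\<^bsub>W\<^esub> v)"
      unfolding v(2) by (rule W.smult_r_minus[symmetric]) (use v in simp_all)
    then show ?thesis using v(1) unfolding mem_J by blast
  qed
  show "a \<oplus>\<^bsub>W\<^esub> b \<in> J d" if a: "a \<in> J d" and b: "b \<in> J d" for a b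
  proof -
    obtain v where v: "v \<in> carrier W" "a = p [^] d \<odot>\<^bsub>W\<^esub> v" using a unfolding mem_J by blast
    obtain w where w: "w \<in> carrier W" "b = p [^] d \<odot>\<^bsub>W\<^esub> w" using b unfolding mem_J by blast
    have "a \<oplus>\<^bsub>W\<^esub> b = p [^] d \<odot>\<^bsub>W\<^esub> (v \<oplus>\<^bsub>W\<^esub> w)" using v w by (simp add: W.smult_r_distr)
    then show ?thesis using v(1) w(1) unfolding mem_J by blast
  qed
  show "a \<odot>\<^bsub>W\<^esub> x \<in> J d" if a: "a \<in> carrier R" and x: "x \<in> J d" for a x
  proof -
    obtain v where v: "v \<in> carrier W" "x = p [^] d \<odot>\<^bsub>W\<^esub> v" using x unfolding mem_J by blast
    then have "a \<odot>\<^bsub>W\<^esub> x = p [^] d \<odot>\<^bsub>W\<^esub> (a \<odot>\<^bsub>W\<^esub> v)"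
      using a by (simp add: W.smult_assoc1[symmetric] m_comm)
    then show ?thesis using a v unfolding mem_J by blast
  qed
qed (auto simp: J_def)

sublocale FW: filtered_group W J
proof (intro filtered_group.intro filtered_group_axioms.intro W.M.abelian_group_axioms)
  show "additive_subgroup (J d) W" for d
    using J_submodule submodule.axioms(1) additive_subgroup.intro by blast
  show "J (Suc d) \<subseteq> J d" for d
  proof
    fix x assume "x \<in> J (Suc d)"
    then obtain v where v: "v \<in> carrier W" "x = p [^] Suc d \<odot>\<^bsub>W\<^esub> v" unfolding mem_J by blast
    then have "x = p [^] d \<odot>\<^bsub>W\<^esub> (p \<odot>\<^bsub>W\<^esub> v)" by (simp add: W.smult_assoc1)
    then show "x \<in> J d" using v(1) unfolding mem_J by blast
  qed
qed

text \<open>Because the ideal is principal, the multiples of its generator already form a submodule,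
  and this is the smallest one in the intersection.\<close>

lemma ideal_smult_eq: "ideal_smult R (max_ideal_pow R d) W = J d"
  unfolding ideal_smult_def max_ideal_pow_eq
proof
  have "c \<odot>\<^bsub>W\<^esub> s \<in> J d" if c: "c \<in> I d" and s: "s \<in> carrier W" for c s
  proof -
    obtain b where b: "b \<in> carrier R" "c = b \<otimes> p [^] d" using c mem_I by blast
    then have "c \<odot>\<^bsub>W\<^esub> s = p [^] d \<odot>\<^bsub>W\<^esub> (b \<odot>\<^bsub>W\<^esub> s)" using s by (simp add: W.smult_assoc1[symmetric] m_comm)
    then show ?thesis using b s mem_J by blast
  qed
  then show "\<Inter>{N. submodule N R W \<and> (\<forall>c\<in>I d. \<forall>s\<in>carrier W. c \<odot>\<^bsub>W\<^esub> s \<in> N)} \<subseteq> J d"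
    using J_submodule by blast
  have "p [^] d \<in> I d" unfolding mem_I by (intro bexI[of _ \<one>]) simp_all
  then show "J d \<subseteq> \<Inter>{N. submodule N R W \<and> (\<forall>c\<in>I d. \<forall>s\<in>carrier W. c \<odot>\<^bsub>W\<^esub> s \<in> N)}"
    unfolding J_def by blast
qed

lemma pow_torsion_free:
  "\<lbrakk>v \<in> carrier W; w \<in> carrier W; p [^] (d::nat) \<odot>\<^bsub>W\<^esub> v = p [^] d \<odot>\<^bsub>W\<^esub> w\<rbrakk> \<Longrightarrow> v = w"
proof (induction d)
  case 0 then show ?case by simp
next
  case (Suc d)
  have "p \<odot>\<^bsub>W\<^esub> (p [^] d \<odot>\<^bsub>W\<^esub> v \<oplus>\<^bsub>W\<^esub> \<ominus>\<^bsub>W\<^esub> (p [^] d \<odot>\<^bsub>W\<^esub> w)) =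
      p [^] Suc d \<odot>\<^bsub>W\<^esub> v \<oplus>\<^bsub>W\<^esub> \<ominus>\<^bsub>W\<^esub> (p [^] Suc d \<odot>\<^bsub>W\<^esub> w)"
    using Suc(2,3) by (simp add: W.smult_r_distr W.smult_r_minus W.smult_assoc1[symmetric] m_comm)
  also have "\<dots> = \<zero>\<^bsub>W\<^esub>" using Suc(2-4) by (simp add: W.M.r_neg)
  finally have "p [^] d \<odot>\<^bsub>W\<^esub> v \<oplus>\<^bsub>W\<^esub> \<ominus>\<^bsub>W\<^esub> (p [^] d \<odot>\<^bsub>W\<^esub> w) = \<zero>\<^bsub>W\<^esub>"
    by (rule torsion_free[rotated]) (use Suc in simp)
  then have "p [^] d \<odot>\<^bsub>W\<^esub> v = p [^] d \<odot>\<^bsub>W\<^esub> w" using Suc(2,3)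
    by (metis W.M.minus_equality W.M.minus_minus W.M.a_inv_closed W.smult_closed nat_pow_closed p_closed)
  then show ?case using Suc by blast
qed

abbreviation "TW d \<equiv> trunc_module R W d"
abbreviation "\<W> \<equiv> module_completion R W"

lemma TW_eq: "TW d = quot_module W (J d)"
  by (simp add: trunc_module_def ideal_smult_eq)

lemma TW_carrier: "carrier (TW d) = a_rcosets\<^bsub>W\<^esub> (J d)"
  by (simp add: TW_eq quot_module_def)

lemma TW_ops:
  "v \<in> carrier W \<Longrightarrow> w \<in> carrier W \<Longrightarrow> (J d +>\<^bsub>W\<^esub> v) \<oplus>\<^bsub>TW d\<^esub> (J d +>\<^bsub>W\<^esub> w) = J d +>\<^bsub>W\<^esub> (v \<oplus>\<^bsub>W\<^esub> w)"
  "\<zero>\<^bsub>TW d\<^esub> = J d"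
  by (simp_all add: TW_eq quot_module_def FW.coset_add)

text \<open>The scalar multiplication of \<open>quot_module\<close> is a union over all
  representatives; the content is that they all produce the same coset.\<close>

lemma TW_smult:
  assumes c: "c \<in> carrier R" and v: "v \<in> carrier W"
  shows "(I d +> c) \<odot>\<^bsub>TW d\<^esub> (J d +>\<^bsub>W\<^esub> v) = J d +>\<^bsub>W\<^esub> (c \<odot>\<^bsub>W\<^esub> v)"
proof -
  have eq: "J d +>\<^bsub>W\<^esub> (c' \<odot>\<^bsub>W\<^esub> v') = J d +>\<^bsub>W\<^esub> (c \<odot>\<^bsub>W\<^esub> v)" if c': "c' \<in> I d +> c" and v': "v' \<in> J d +>\<^bsub>W\<^esub> v" for c' v'
  proof -
    have cl: "c' \<in> carrier R" "v' \<in> carrier W" using F.coset_carrier[OF c c'] FW.coset_carrier[OF v v'] .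
    have "c' \<oplus> \<ominus> c \<in> I d" using F.mem_coset_iff[OF c cl(1)] c' by simp
    then obtain b where b: "b \<in> carrier R" "c' \<oplus> \<ominus> c = b \<otimes> p [^] d" unfolding mem_I by blast
    have "v' \<oplus>\<^bsub>W\<^esub> \<ominus>\<^bsub>W\<^esub> v \<in> J d" using FW.mem_coset_iff[OF v cl(2)] v' by simp
    then obtain w where w: "w \<in> carrier W" "v' \<oplus>\<^bsub>W\<^esub> \<ominus>\<^bsub>W\<^esub> v = p [^] d \<odot>\<^bsub>W\<^esub> w" unfolding mem_J by blast
    \<comment> \<open>The usual splitting \<open>c' v' - c v = (c' - c) v' + c (v' - v)\<close>,
      where both differences contribute a factor \<open>p [^] d\<close>.\<close>
    have "c' \<odot>\<^bsub>W\<^esub> v' \<oplus>\<^bsub>W\<^esub> \<ominus>\<^bsub>W\<^esub> (c \<odot>\<^bsub>W\<^esub> v) =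
       (c' \<oplus> \<ominus> c) \<odot>\<^bsub>W\<^esub> v' \<oplus>\<^bsub>W\<^esub> c \<odot>\<^bsub>W\<^esub> (v' \<oplus>\<^bsub>W\<^esub> \<ominus>\<^bsub>W\<^esub> v)"
      using c v cl by (simp add: W.smult_l_distr W.smult_r_distr W.smult_l_minus W.smult_r_minus W.M.a_assoc[symmetric])
        (simp add: W.M.a_assoc W.M.l_neg)
    also have "\<dots> = p [^] d \<odot>\<^bsub>W\<^esub> (b \<odot>\<^bsub>W\<^esub> v' \<oplus>\<^bsub>W\<^esub> c \<odot>\<^bsub>W\<^esub> w)"
      unfolding b(2) w(2) using b(1) w(1) c v cl
      by (simp add: W.smult_r_distr W.smult_assoc1[symmetric] m_comm)
    finally have "c' \<odot>\<^bsub>W\<^esub> v' \<oplus>\<^bsub>W\<^esub> \<ominus>\<^bsub>W\<^esub> (c \<odot>\<^bsub>W\<^esub> v) \<in> J d" unfolding mem_J using b(1) w(1) c cl by blast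
    then show ?thesis using FW.coset_eq_iff c v cl by simp
  qed
  have "(I d +> c) \<odot>\<^bsub>TW d\<^esub> (J d +>\<^bsub>W\<^esub> v) = (\<Union>c'\<in>I d +> c. \<Union>v'\<in>J d +>\<^bsub>W\<^esub> v. J d +>\<^bsub>W\<^esub> (c' \<odot>\<^bsub>W\<^esub> v'))"
    by (simp add: TW_eq quot_module_def)
  also have "\<dots> = (\<Union>c'\<in>I d +> c. \<Union>v'\<in>J d +>\<^bsub>W\<^esub> v. J d +>\<^bsub>W\<^esub> (c \<odot>\<^bsub>W\<^esub> v))" using eq by simp
  also have "\<dots> = J d +>\<^bsub>W\<^esub> (c \<odot>\<^bsub>W\<^esub> v)" using F.coset_self[OF c] FW.coset_self[OF v] by blast
  finally show ?thesis .
qed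

lemma MC_carrier: "carrier \<W> = FW.limit"
  by (simp add: module_completion_def FW.limit_def TW_carrier)

lemma MC_ops:
  "(s \<oplus>\<^bsub>\<W>\<^esub> t) d = s d \<oplus>\<^bsub>TW d\<^esub> t d" "\<zero>\<^bsub>\<W>\<^esub> d = \<zero>\<^bsub>TW d\<^esub>" "(c \<odot>\<^bsub>\<W>\<^esub> s) d = c d \<odot>\<^bsub>TW d\<^esub> s d"
  by (simp_all add: module_completion_def)

lemma MC_eval: "s \<in> carrier \<W> \<Longrightarrow> s d \<in> carrier (TW d)"
  by (simp add: module_completion_def)

abbreviation "mseq \<equiv> FW.fseq"
abbreviation "mcoh \<equiv> FW.coherent"

lemma MC_E:
  assumes "s \<in> carrier \<W>" obtains v where "mcoh v" "s = mseq v"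
  using assms FW.limitE unfolding MC_carrier by blast

lemma mseq_in: "mcoh v \<Longrightarrow> mseq v \<in> carrier \<W>"
  unfolding MC_carrier by (rule FW.fseq_in)

lemma mseq_add: "mcoh v \<Longrightarrow> mcoh w \<Longrightarrow> mseq v \<oplus>\<^bsub>\<W>\<^esub> mseq w = mseq (\<lambda>d. v d \<oplus>\<^bsub>W\<^esub> w d)"
  by (simp add: fun_eq_iff MC_ops FW.fseq_def TW_ops FW.coherent_closed)

lemma mseq_smult: "coh c \<Longrightarrow> mcoh v \<Longrightarrow> seq c \<odot>\<^bsub>\<W>\<^esub> mseq v = mseq (\<lambda>d. c d \<odot>\<^bsub>W\<^esub> v d)"
  by (simp add: fun_eq_iff MC_ops F.fseq_def FW.fseq_def TW_smult FW.coherent_closed F.coherent_closed)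

lemma mcoh_smult:
  assumes "coh c" "mcoh v" shows "mcoh (\<lambda>d. c d \<odot>\<^bsub>W\<^esub> v d)"
  using assms unfolding F.coherent_def FW.coherent_def by (metis W.smult_closed TW_smult)

definition hat :: "'v \<Rightarrow> nat \<Rightarrow> 'v set" where "hat v = mseq (\<lambda>_. v)"

lemma hat_eval: "hat v d = J d +>\<^bsub>W\<^esub> v"
  by (simp add: hat_def FW.fseq_def)

lemma hat_closed: "v \<in> carrier W \<Longrightarrow> hat v \<in> carrier \<W>"
  unfolding hat_def by (rule mseq_in[OF FW.coherent_const])

lemma hat_add: "v \<in> carrier W \<Longrightarrow> w \<in> carrier W \<Longrightarrow> hat (v \<oplus>\<^bsub>W\<^esub> w) = hat v \<oplus>\<^bsub>\<W>\<^esub> hat w"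
  by (simp add: hat_def mseq_add FW.coherent_const)

lemma hat_smult: "c \<in> carrier R \<Longrightarrow> v \<in> carrier W \<Longrightarrow> hat (c \<odot>\<^bsub>W\<^esub> v) = emb c \<odot>\<^bsub>\<W>\<^esub> hat v"
  by (simp add: hat_def emb_def mseq_smult FW.coherent_const F.coherent_const)

lemma MC_zero: "\<zero>\<^bsub>\<W>\<^esub> = hat \<zero>\<^bsub>W\<^esub>"
  using FW.coset_zero_iff[OF W.M.zero_closed] FW.N_zero by (simp add: fun_eq_iff MC_ops TW_ops hat_eval)

lemma MC_module: "module \<O> \<W>"
proof -
  note [simp] = mseq_add mseq_smult seq_add seq_mult FW.coherent_add mcoh_smult F.coherent_add coh_mult
    FW.coherent_closed F.coherent_closed mseq_in
  have closed: "s \<oplus>\<^bsub>\<W>\<^esub> t \<in> carrier \<W>" if st: "s \<in> carrier \<W>" "t \<in> carrier \<W>" for s t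
  proof -
    obtain v where "mcoh v" "s = mseq v" using st MC_E by blast
    moreover obtain w where "mcoh w" "t = mseq w" using st MC_E by blast
    ultimately show ?thesis by simp
  qed
  show ?thesis
  proof (intro moduleI O_cring abelian_groupI)
    fix s assume "s \<in> carrier \<W>"
    then obtain v where v: "mcoh v" "s = mseq v" using MC_E by blast
    show "\<zero>\<^bsub>\<W>\<^esub> \<oplus>\<^bsub>\<W>\<^esub> s = s" using v by (simp add: MC_zero hat_def FW.coherent_const)
    show "\<exists>t\<in>carrier \<W>. t \<oplus>\<^bsub>\<W>\<^esub> s = \<zero>\<^bsub>\<W>\<^esub>"
      using v FW.coherent_neg[OF v(1)]
      by (intro bexI[of _ "mseq (\<lambda>d. \<ominus>\<^bsub>W\<^esub> v d)"]) (simp_all add: MC_zero hat_def W.M.l_neg)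
    show "\<one>\<^bsub>\<O>\<^esub> \<odot>\<^bsub>\<W>\<^esub> s = s" using v by (simp add: O_one emb_def F.coherent_const)
    fix t assume "t \<in> carrier \<W>"
    then obtain w where w: "mcoh w" "t = mseq w" using MC_E by blast
    show "s \<oplus>\<^bsub>\<W>\<^esub> t = t \<oplus>\<^bsub>\<W>\<^esub> s" using v w by (simp add: W.M.a_comm)
    show "s \<oplus>\<^bsub>\<W>\<^esub> t \<in> carrier \<W>" using v w by simp
    fix t' assume "t' \<in> carrier \<W>"
    then obtain w' where w': "mcoh w'" "t' = mseq w'" using MC_E by blast
    show "s \<oplus>\<^bsub>\<W>\<^esub> t \<oplus>\<^bsub>\<W>\<^esub> t' = s \<oplus>\<^bsub>\<W>\<^esub> (t \<oplus>\<^bsub>\<W>\<^esub> t')" using v w w' by (simp add: W.M.a_assoc)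
  next
    fix f s assume f: "f \<in> carrier \<O>" and s: "s \<in> carrier \<W>"
    obtain v where v: "mcoh v" "s = mseq v" using s MC_E by blast
    obtain c where c: "coh c" "f = seq c" using f O_E by blast
    show "f \<odot>\<^bsub>\<W>\<^esub> s \<in> carrier \<W>" using c v by simp
  next
    fix f g s assume f: "f \<in> carrier \<O>" "g \<in> carrier \<O>" and s: "s \<in> carrier \<W>"
    obtain v where v: "mcoh v" "s = mseq v" using s MC_E by blast
    obtain c where c: "coh c" "f = seq c" using f O_E by blast
    obtain c' where c': "coh c'" "g = seq c'" using f O_E by blast
    show "(f \<oplus>\<^bsub>\<O>\<^esub> g) \<odot>\<^bsub>\<W>\<^esub> s = f \<odot>\<^bsub>\<W>\<^esub> s \<oplus>\<^bsub>\<W>\<^esub> g \<odot>\<^bsub>\<W>\<^esub> s"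
      "f \<otimes>\<^bsub>\<O>\<^esub> g \<odot>\<^bsub>\<W>\<^esub> s = f \<odot>\<^bsub>\<W>\<^esub> (g \<odot>\<^bsub>\<W>\<^esub> s)"
      using c c' v by (simp_all add: W.smult_l_distr W.smult_assoc1)
  next
    fix f s t assume f: "f \<in> carrier \<O>" and s: "s \<in> carrier \<W>" "t \<in> carrier \<W>"
    obtain v where v: "mcoh v" "s = mseq v" using s MC_E by blast
    obtain w where w: "mcoh w" "t = mseq w" using s MC_E by blast
    obtain c where c: "coh c" "f = seq c" using f O_E by blast
    show "f \<odot>\<^bsub>\<W>\<^esub> (s \<oplus>\<^bsub>\<W>\<^esub> t) = f \<odot>\<^bsub>\<W>\<^esub> s \<oplus>\<^bsub>\<W>\<^esub> f \<odot>\<^bsub>\<W>\<^esub> t"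
      using c v w by (simp add: W.smult_r_distr)
  qed (auto simp: MC_zero hat_closed)
qed

sublocale MC: module \<O> \<W> by (rule MC_module)

lemma TW_surj:
  assumes "t \<in> carrier (TW d)" shows "\<exists>v\<in>carrier W. t = hat v d"
proof -
  obtain v where "v \<in> carrier W" "t = J d +>\<^bsub>W\<^esub> v"
    by (rule FW.cosetE[of t d]) (use assms TW_carrier in auto)
  then show ?thesis unfolding hat_eval by blast
qed

text \<open>The argument of \<open>emb_p_dvd\<close>, with torsion-freeness in place of cancellation
  in the ring.\<close>

lemma MC_dvd:
  assumes s: "s \<in> carrier \<W>" and z: "s d = J d"
  shows "\<exists>t\<in>carrier \<W>. s = emb (p [^] d) \<odot>\<^bsub>\<W>\<^esub> t"
proof -
  obtain a where a: "mcoh a" "s = mseq a" using s MC_E by blast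
  note ac = FW.coherent_closed[OF a(1)]
  have "a d \<in> J d" using z a(2) FW.coset_zero_iff[OF ac] by (simp add: FW.fseq_def)
  then have "a e \<in> J d" if "d \<le> e" for e
    using FW.coherent_le[OF a(1) that] FW.coset_zero_iff ac by metis
  then have "\<exists>b. b \<in> carrier W \<and> a (e + d) = p [^] d \<odot>\<^bsub>W\<^esub> b" for e
    unfolding mem_J by (metis le_add2)
  then obtain b where b: "\<And>e. b e \<in> carrier W" "\<And>e. a (e + d) = p [^] d \<odot>\<^bsub>W\<^esub> b e" by metis
  have cb: "mcoh b"
    unfolding FW.coherent_def
  proof (intro allI conjI b(1))
    fix e
    have "a (Suc (e + d)) \<oplus>\<^bsub>W\<^esub> \<ominus>\<^bsub>W\<^esub> a (e + d) \<in> J (e + d)"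
      using a(1) FW.coset_eq_iff ac unfolding FW.coherent_def by blast
    then obtain x where x: "x \<in> carrier W" "a (Suc (e + d)) \<oplus>\<^bsub>W\<^esub> \<ominus>\<^bsub>W\<^esub> a (e + d) = p [^] (e + d) \<odot>\<^bsub>W\<^esub> x"
      unfolding mem_J by blast
    have "p [^] d \<odot>\<^bsub>W\<^esub> (b (Suc e) \<oplus>\<^bsub>W\<^esub> \<ominus>\<^bsub>W\<^esub> b e) = p [^] d \<odot>\<^bsub>W\<^esub> (p [^] e \<odot>\<^bsub>W\<^esub> x)"
      using x b(1) b(2)[of "Suc e"] b(2)[of e]
      by (simp add: W.smult_r_distr W.smult_r_minus W.smult_assoc1[symmetric] nat_pow_mult add.commute)
    then have "b (Suc e) \<oplus>\<^bsub>W\<^esub> \<ominus>\<^bsub>W\<^esub> b e = p [^] e \<odot>\<^bsub>W\<^esub> x"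
      by (rule pow_torsion_free[rotated 2]) (use b x in simp_all)
    then have "b (Suc e) \<oplus>\<^bsub>W\<^esub> \<ominus>\<^bsub>W\<^esub> b e \<in> J e" using x mem_J by blast
    then show "J e +>\<^bsub>W\<^esub> b (Suc e) = J e +>\<^bsub>W\<^esub> b e" using FW.coset_eq_iff b(1) by blast
  qed
  have "s = emb (p [^] d) \<odot>\<^bsub>\<W>\<^esub> mseq b"
  proof
    fix e
    have "(emb (p [^] d) \<odot>\<^bsub>\<W>\<^esub> mseq b) e = J e +>\<^bsub>W\<^esub> (p [^] d \<odot>\<^bsub>W\<^esub> b e)"
      using b(1) by (simp add: MC_ops emb_eval FW.fseq_def TW_smult)
    also have "\<dots> = J e +>\<^bsub>W\<^esub> a (e + d)" using b by simp
    also have "\<dots> = J e +>\<^bsub>W\<^esub> a e" using FW.coherent_le[OF a(1), of e "e + d"] by simp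
    finally show "s e = (emb (p [^] d) \<odot>\<^bsub>\<W>\<^esub> mseq b) e" using a(2) by (simp add: FW.fseq_def)
  qed
  then show ?thesis using mseq_in[OF cb] by blast
qed

lemma TW_smult_zero:
  assumes c: "c \<in> carrier \<O>" "c d = \<zero>\<^bsub>T d\<^esub>" and s: "s \<in> carrier \<W>"
  shows "(c \<odot>\<^bsub>\<W>\<^esub> s) d = J d"
proof -
  obtain v where v: "v \<in> carrier W" "s d = J d +>\<^bsub>W\<^esub> v" using TW_surj[OF MC_eval[OF s]] hat_eval by metis
  have "(c \<odot>\<^bsub>\<W>\<^esub> s) d = (I d +> \<zero>) \<odot>\<^bsub>TW d\<^esub> (J d +>\<^bsub>W\<^esub> v)"
    using c v by (simp add: MC_ops T_ops I_coset_zero)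
  also have "\<dots> = J d +>\<^bsub>W\<^esub> \<zero>\<^bsub>W\<^esub>" using v by (simp add: TW_smult)
  also have "\<dots> = J d" using FW.coset_zero_iff FW.N_zero by simp
  finally show ?thesis .
qed

text \<open>Turns equality in a truncation into a linear equation in the completion, to which linear
  maps can be applied.\<close>

lemma MC_eval_eq:
  assumes s: "s \<in> carrier \<W>" "t \<in> carrier \<W>" and eq: "s d = t d"
  shows "\<exists>w\<in>carrier \<W>. s = t \<oplus>\<^bsub>\<W>\<^esub> emb (p [^] d) \<odot>\<^bsub>\<W>\<^esub> w"
proof -
  obtain a where a: "mcoh a" "s = mseq a" using s MC_E by blast
  obtain b where b: "mcoh b" "t = mseq b" using s MC_E by blast
  let ?u = "mseq (\<lambda>d. a d \<oplus>\<^bsub>W\<^esub> \<ominus>\<^bsub>W\<^esub> b d)"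
  note cl = FW.coherent_closed[OF a(1)] FW.coherent_closed[OF b(1)]
  have cu: "mcoh (\<lambda>d. a d \<oplus>\<^bsub>W\<^esub> \<ominus>\<^bsub>W\<^esub> b d)" using a b FW.coherent_add FW.coherent_neg by blast
  have "a d \<oplus>\<^bsub>W\<^esub> \<ominus>\<^bsub>W\<^esub> b d \<in> J d" using eq a b FW.coset_eq_iff cl by (simp add: FW.fseq_def)
  then have "?u d = J d" using FW.coset_zero_iff cl by (simp add: FW.fseq_def)
  then obtain w where w: "w \<in> carrier \<W>" "?u = emb (p [^] d) \<odot>\<^bsub>\<W>\<^esub> w" using MC_dvd[OF mseq_in[OF cu]] by blast
  have "s = t \<oplus>\<^bsub>\<W>\<^esub> ?u"
    unfolding a(2) b(2) mseq_add[OF b(1) cu]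
    by (rule arg_cong[of _ _ mseq], rule ext)
      (use cl in \<open>simp add: W.M.a_lcomm W.M.r_neg\<close>)
  then show ?thesis using w by auto
qed

end

lemma module_isosD:
  assumes "f \<in> module_isos R M N"
  shows "bij_betw f (carrier M) (carrier N)"
    "\<And>s t. s \<in> carrier M \<Longrightarrow> t \<in> carrier M \<Longrightarrow> f (s \<oplus>\<^bsub>M\<^esub> t) = f s \<oplus>\<^bsub>N\<^esub> f t"
    "\<And>c s. c \<in> carrier R \<Longrightarrow> s \<in> carrier M \<Longrightarrow> f (c \<odot>\<^bsub>M\<^esub> s) = c \<odot>\<^bsub>N\<^esub> f s"
    "f \<in> extensional (carrier M)"
    "\<And>s. s \<in> carrier M \<Longrightarrow> f s \<in> carrier N"
  using assms unfolding module_isos_def by (auto simp: bij_betw_def)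

lemma module_isosI:
  assumes "bij_betw f (carrier M) (carrier N)" "f \<in> extensional (carrier M)"
    "\<And>s t. s \<in> carrier M \<Longrightarrow> t \<in> carrier M \<Longrightarrow> f (s \<oplus>\<^bsub>M\<^esub> t) = f s \<oplus>\<^bsub>N\<^esub> f t"
    "\<And>c s. c \<in> carrier R \<Longrightarrow> s \<in> carrier M \<Longrightarrow> f (c \<odot>\<^bsub>M\<^esub> s) = c \<odot>\<^bsub>N\<^esub> f s"
  shows "f \<in> module_isos R M N"
  using assms unfolding module_isos_def by auto

lemma free_module_simps:
  "carrier (free_module n R) = {..<n} \<rightarrow>\<^sub>E carrier R"
  "v \<oplus>\<^bsub>free_module n R\<^esub> w = (\<lambda>i\<in>{..<n}. v i \<oplus>\<^bsub>R\<^esub> w i)"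
  "c \<odot>\<^bsub>free_module n R\<^esub> v = (\<lambda>i\<in>{..<n}. c \<otimes>\<^bsub>R\<^esub> v i)"
  by (simp_all add: free_module_def)

section \<open>Trivializations and their reductions\<close>

context torsion_free_module
begin

lemma eval_surj: "t \<in> carrier (TW d) \<Longrightarrow> \<exists>s\<in>carrier \<W>. t = s d"
  using TW_surj[of t d] hat_closed by blast

abbreviation "triv n \<equiv> module_isos \<O> \<W> (free_module n \<O>)"

context
  fixes n a assumes a: "a \<in> triv n"
begin

lemma triv_closed: "s \<in> carrier \<W> \<Longrightarrow> a s \<in> {..<n} \<rightarrow>\<^sub>E carrier \<O>"
  using module_isosD(5)[OF a] by (simp add: free_module_simps)

lemma triv_coord: "s \<in> carrier \<W> \<Longrightarrow> i < n \<Longrightarrow> a s i \<in> carrier \<O>"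
  using triv_closed[of s] by auto

lemma triv_add: "s \<in> carrier \<W> \<Longrightarrow> t \<in> carrier \<W> \<Longrightarrow> a (s \<oplus>\<^bsub>\<W>\<^esub> t) = (\<lambda>i\<in>{..<n}. a s i \<oplus>\<^bsub>\<O>\<^esub> a t i)"
  using module_isosD(2)[OF a] by (simp add: free_module_simps)

lemma triv_smult: "s \<in> carrier \<W> \<Longrightarrow> c \<in> carrier \<O> \<Longrightarrow> a (c \<odot>\<^bsub>\<W>\<^esub> s) = (\<lambda>i\<in>{..<n}. c \<otimes>\<^bsub>\<O>\<^esub> a s i)"
  using module_isosD(3)[OF a] by (simp add: free_module_simps)

lemma triv_inj: "s \<in> carrier \<W> \<Longrightarrow> t \<in> carrier \<W> \<Longrightarrow> a s = a t \<Longrightarrow> s = t"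
  using module_isosD(1)[OF a] by (meson bij_betw_imp_inj_on inj_on_eq_iff)

lemma triv_surj: "v \<in> {..<n} \<rightarrow>\<^sub>E carrier \<O> \<Longrightarrow> \<exists>s\<in>carrier \<W>. a s = v"
  using bij_betw_imp_surj_on[OF module_isosD(1)[OF a]] unfolding free_module_simps
  by (simp add: set_eq_iff image_iff) metis

text \<open>By linearity a trivialization maps multiples of \<open>p [^] d\<close> to multiples of
  \<open>p [^] d\<close>, so it descends to the truncations.\<close>

lemma triv_eval:
  assumes s: "s \<in> carrier \<W>" "t \<in> carrier \<W>" and eq: "s d = t d" and i: "i < n"
  shows "a s i d = a t i d"
proof -
  obtain w where w: "w \<in> carrier \<W>" "s = t \<oplus>\<^bsub>\<W>\<^esub> emb (p [^] d) \<odot>\<^bsub>\<W>\<^esub> w" using MC_eval_eq[OF s eq] by blast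
  have e: "emb (p [^] d) \<in> carrier \<O>" by (rule emb_closed) simp
  have "a s i = a t i \<oplus>\<^bsub>\<O>\<^esub> (emb (p [^] d) \<otimes>\<^bsub>\<O>\<^esub> a w i)"
    unfolding w(2) using i w(1) s e by (simp add: triv_add triv_smult)
  then have "a s i d = a t i d \<oplus>\<^bsub>T d\<^esub> (emb (p [^] d) \<otimes>\<^bsub>\<O>\<^esub> a w i) d" by (simp add: O_ops)
  then show ?thesis
    using emb_p_eval[OF triv_coord[OF w(1) i]] O_eval[OF triv_coord[OF s(2) i]]
    by (simp add: cring.cring_simprules[OF T_cring])
qed

text \<open>The coordinates differ by multiples of \<open>p [^] d\<close>. Surjectivity of
  \<open>a\<close> gathers the cofactors in one element \<open>w\<close> of the completed module,
  and then injectivity identifies the difference of \<open>s\<close> and \<open>t\<close> as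
  \<open>p [^] d\<close> times \<open>w\<close>.\<close>

lemma triv_eval_conv:
  assumes s: "s \<in> carrier \<W>" "t \<in> carrier \<W>" and eq: "\<And>i. i < n \<Longrightarrow> a s i d = a t i d"
  shows "s d = t d"
proof -
  have e: "emb (p [^] d) \<in> carrier \<O>" by (rule emb_closed) simp
  have "\<exists>c\<in>carrier \<O>. a s i = a t i \<oplus>\<^bsub>\<O>\<^esub> emb (p [^] d) \<otimes>\<^bsub>\<O>\<^esub> c" if i: "i < n" for i
  proof -
    note cl = triv_coord[OF s(1) i] triv_coord[OF s(2) i]
    interpret h: ring_hom_cring \<O> "T d" "\<lambda>f. f d" by (rule ev_hom)
    have "(a s i \<ominus>\<^bsub>\<O>\<^esub> a t i) d = \<zero>\<^bsub>T d\<^esub>"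
      using cl eq[OF i] h.hom_add[of "a s i" "\<ominus>\<^bsub>\<O>\<^esub> a t i"] h.hom_a_inv[of "a t i"] h.hom_closed[of "a t i"]
      by (simp add: a_minus_def h.S.r_neg)
    then obtain c where c: "c \<in> carrier \<O>" "a s i \<ominus>\<^bsub>\<O>\<^esub> a t i = emb (p [^] d) \<otimes>\<^bsub>\<O>\<^esub> c"
      using emb_p_dvd[of "a s i \<ominus>\<^bsub>\<O>\<^esub> a t i" d] cl by auto
    have "a s i = a t i \<oplus>\<^bsub>\<O>\<^esub> (a s i \<ominus>\<^bsub>\<O>\<^esub> a t i)" using cl by algebra
    then show ?thesis using c by auto
  qed
  then obtain c where c: "\<And>i. i < n \<Longrightarrow> c i \<in> carrier \<O> \<and> a s i = a t i \<oplus>\<^bsub>\<O>\<^esub> emb (p [^] d) \<otimes>\<^bsub>\<O>\<^esub> c i" by metis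
  obtain w where w: "w \<in> carrier \<W>" "a w = (\<lambda>i\<in>{..<n}. c i)" using triv_surj[of "\<lambda>i\<in>{..<n}. c i"] c by auto
  let ?u = "emb (p [^] d) \<odot>\<^bsub>\<W>\<^esub> w"
  have u: "?u \<in> carrier \<W>" using e w by simp
  have "a s = a (t \<oplus>\<^bsub>\<W>\<^esub> ?u)"
    using triv_closed[OF s(1)] c w(1) u s e triv_coord[OF s(2)]
    by (intro vec_eqI[of _ n "carrier \<O>"]) (auto simp: triv_add triv_smult w(2))
  then have "s = t \<oplus>\<^bsub>\<W>\<^esub> ?u" by (rule triv_inj[rotated 2]) (use s u in simp_all)
  then have "s d = t d \<oplus>\<^bsub>TW d\<^esub> ?u d" by (metis MC_ops(1))
  moreover have "?u d = J d"
    using TW_smult_zero[OF e _ w(1)] emb_p_eval[of "\<one>\<^bsub>\<O>\<^esub>" d] e by simp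
  moreover obtain v where v: "v \<in> carrier W" "t d = hat v d" using TW_surj[OF MC_eval[OF s(2)]] by blast
  moreover have "J d = J d +>\<^bsub>W\<^esub> \<zero>\<^bsub>W\<^esub>" using FW.coset_zero_iff[OF W.M.zero_closed] FW.N_zero by simp
  ultimately show ?thesis using TW_ops(1)[of v "\<zero>\<^bsub>W\<^esub>" d] by (simp add: hat_eval)
qed

text \<open>The value of \<open>reduce_trivialization\<close> in this setting. The description is
  proper by \<open>triv_eval\<close>: the vector does not depend on the lift \<open>s\<close> of the
  coset \<open>t\<close>.\<close>

definition red :: "nat \<Rightarrow> 'v set \<Rightarrow> nat \<Rightarrow> 'a set" where
  "red d = (\<lambda>t\<in>carrier (TW d). THE v. \<exists>s\<in>carrier \<W>. s d = t \<and> v = (\<lambda>i\<in>{..<n}. a s i d))"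

lemma red_eq:
  assumes s: "s \<in> carrier \<W>"
  shows "red d (s d) = (\<lambda>i\<in>{..<n}. a s i d)"
proof -
  have "(THE v. \<exists>s'\<in>carrier \<W>. s' d = s d \<and> v = (\<lambda>i\<in>{..<n}. a s' i d)) = (\<lambda>i\<in>{..<n}. a s i d)"
  proof (rule the_equality)
    fix v assume "\<exists>s'\<in>carrier \<W>. s' d = s d \<and> v = (\<lambda>i\<in>{..<n}. a s' i d)"
    then obtain s' where "s' \<in> carrier \<W>" "s' d = s d" "v = (\<lambda>i\<in>{..<n}. a s' i d)" by blast
    then show "v = (\<lambda>i\<in>{..<n}. a s i d)"
      using triv_eval[of s' s d] s by (simp add: restrict_def fun_eq_iff)
  qed (use s in blast)
  then show ?thesis using MC_eval[OF s] by (simp add: red_def)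
qed

lemma red_closed: "t \<in> carrier (TW d) \<Longrightarrow> red d t \<in> {..<n} \<rightarrow>\<^sub>E carrier (T d)"
proof -
  assume "t \<in> carrier (TW d)"
  then obtain s where s: "s \<in> carrier \<W>" "t = s d" using eval_surj by blast
  show ?thesis unfolding s(2) red_eq[OF s(1)] using O_eval triv_coord[OF s(1)] by auto
qed

lemma red_iso: "red d \<in> module_isos (T d) (TW d) (free_module n (T d))"
proof (rule module_isosI)
  show "red d \<in> extensional (carrier (TW d))" by (simp add: red_def)
  show "red d (s \<oplus>\<^bsub>TW d\<^esub> t) = red d s \<oplus>\<^bsub>free_module n (T d)\<^esub> red d t"
    if st: "s \<in> carrier (TW d)" "t \<in> carrier (TW d)" for s t
  proof -
    obtain s' where s': "s' \<in> carrier \<W>" "s = s' d" using eval_surj st by blast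
    obtain t' where t': "t' \<in> carrier \<W>" "t = t' d" using eval_surj st by blast
    have "s \<oplus>\<^bsub>TW d\<^esub> t = (s' \<oplus>\<^bsub>\<W>\<^esub> t') d" using s' t' by (simp add: MC_ops)
    then have "red d (s \<oplus>\<^bsub>TW d\<^esub> t) = (\<lambda>i\<in>{..<n}. a (s' \<oplus>\<^bsub>\<W>\<^esub> t') i d)"
      using red_eq[of "s' \<oplus>\<^bsub>\<W>\<^esub> t'" d] s' t' by simp
    then show ?thesis
      using s' t' by (auto simp: free_module_simps red_eq triv_add O_ops intro!: restrict_ext)
  qed
  show "red d (c \<odot>\<^bsub>TW d\<^esub> s) = c \<odot>\<^bsub>free_module n (T d)\<^esub> red d s"
    if c: "c \<in> carrier (T d)" and s: "s \<in> carrier (TW d)" for c s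
  proof -
    obtain s' where s': "s' \<in> carrier \<W>" "s = s' d" using eval_surj s by blast
    obtain c' where c': "c' \<in> carrier \<O>" "c = c' d" using ev_surj c by blast
    have "c \<odot>\<^bsub>TW d\<^esub> s = (c' \<odot>\<^bsub>\<W>\<^esub> s') d" using s' c' by (simp add: MC_ops)
    then have "red d (c \<odot>\<^bsub>TW d\<^esub> s) = (\<lambda>i\<in>{..<n}. a (c' \<odot>\<^bsub>\<W>\<^esub> s') i d)"
      using red_eq[of "c' \<odot>\<^bsub>\<W>\<^esub> s'" d] s' c' by simp
    then show ?thesis
      using s' c' by (auto simp: free_module_simps red_eq triv_smult O_ops intro!: restrict_ext)
  qed
  show "bij_betw (red d) (carrier (TW d)) (carrier (free_module n (T d)))"
  proof (rule bij_betw_imageI)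
    show "inj_on (red d) (carrier (TW d))"
    proof (rule inj_onI)
      fix s t assume st: "s \<in> carrier (TW d)" "t \<in> carrier (TW d)" "red d s = red d t"
      obtain s' where s': "s' \<in> carrier \<W>" "s = s' d" using eval_surj st by blast
      obtain t' where t': "t' \<in> carrier \<W>" "t = t' d" using eval_surj st by blast
      have "a s' i d = a t' i d" if "i < n" for i
        using fun_cong[OF st(3), of i] that s' t' by (simp add: red_eq)
      then show "s = t" using triv_eval_conv s' t' by simp
    qed
    show "red d ` carrier (TW d) = carrier (free_module n (T d))"
    proof
      show "red d ` carrier (TW d) \<subseteq> carrier (free_module n (T d))"
        using red_closed by (auto simp: free_module_simps simp del: PiE_iff)
      show "carrier (free_module n (T d)) \<subseteq> red d ` carrier (TW d)"
      proof
        fix v assume "v \<in> carrier (free_module n (T d))"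
        then have v: "v \<in> {..<n} \<rightarrow>\<^sub>E carrier (T d)" by (simp add: free_module_simps)
        then have "\<forall>i. \<exists>f. i < n \<longrightarrow> f \<in> carrier \<O> \<and> f d = v i"
          using ev_surj[of d] unfolding set_eq_iff image_iff by (metis PiE_mem lessThan_iff)
        then obtain f where f: "\<And>i. i < n \<Longrightarrow> f i \<in> carrier \<O> \<and> f i d = v i" by metis
        obtain s where s: "s \<in> carrier \<W>" "a s = (\<lambda>i\<in>{..<n}. f i)" using triv_surj[of "\<lambda>i\<in>{..<n}. f i"] f by auto
        have "red d (s d) = v"
          unfolding red_eq[OF s(1)] s(2) using f v by (intro vec_eqI[OF _ v]) auto
        then show "v \<in> red d ` carrier (TW d)" using MC_eval[OF s(1)] by blast
      qed
    qed
  qed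
qed

end

text \<open>Links matrices over the completed ring to classes modulo the level: trivializations that
  differ by \<open>h\<close> have reductions that differ by the reduction of
  \<open>h\<close>.\<close>

lemma red_mat_vec:
  assumes a: "a \<in> triv n" "a' \<in> triv n" and h: "h \<in> carrier (mat_monoid n \<O>)"
    and eq: "\<And>s. s \<in> carrier \<W> \<Longrightarrow> a' s = mat_vec n \<O> h (a s)" and t: "t \<in> carrier (TW d)"
  shows "red n a' d t = mat_vec n (T d) (mat_map n (\<lambda>f. f d) h) (red n a d t)"
proof -
  obtain s where s: "s \<in> carrier \<W>" "t = s d" using eval_surj t by blast
  interpret h: ring_hom_cring \<O> "T d" "\<lambda>f. f d" by (rule ev_hom)
  show ?thesis
    unfolding s(2) red_eq[OF a(1) s(1)] red_eq[OF a(2) s(1)] eq[OF s(1)]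
    by (rule h.mat_map_mat_vec[OF h triv_closed[OF a(1) s(1)]])
qed

\<comment> \<open>Submodules and the induced map of completions\<close>
end

text \<open>\<open>N\<close> is completed with respect to its own multiples by
  \<open>p [^] d\<close>. These may be smaller than the intersection of \<open>N\<close> with
  \<open>J d\<close>, so that \<open>completion_incl\<close> has to enlarge each coset.\<close>

locale submodule_pair = torsion_free_module R p W
  for R :: "('a, 'm) ring_scheme" (structure) and p and W :: "('a, 'v) module" +
  fixes N :: "'v set"
  assumes N_submodule: "submodule N R W"
begin

abbreviation "W' \<equiv> W\<lparr>carrier := N\<rparr>"

lemma N_W: "v \<in> N \<Longrightarrow> v \<in> carrier W"
  using W.submoduleE(1)[OF N_submodule] by blast

lemma N_add: "v \<in> N \<Longrightarrow> w \<in> N \<Longrightarrow> v \<oplus>\<^bsub>W\<^esub> w \<in> N"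
  using W.submoduleE(5)[OF N_submodule] .

lemma N_smult: "c \<in> carrier R \<Longrightarrow> v \<in> N \<Longrightarrow> c \<odot>\<^bsub>W\<^esub> v \<in> N"
  using W.submoduleE(4)[OF N_submodule] .

lemma N_neg: "v \<in> N \<Longrightarrow> \<ominus>\<^bsub>W\<^esub> v \<in> N"
  using W.submoduleE(3)[OF N_submodule] .

sublocale S: torsion_free_module R p W'
proof (intro torsion_free_module.intro torsion_free_module_axioms.intro unif_ring_axioms)
  show "module R W'" by (rule submodule.submodule_is_module[OF N_submodule W.module_axioms])
qed (use torsion_free N_W in auto)

lemma neg_N: "v \<in> N \<Longrightarrow> \<ominus>\<^bsub>W'\<^esub> v = \<ominus>\<^bsub>W\<^esub> v"
  using S.W.M.minus_equality[of "\<ominus>\<^bsub>W\<^esub> v" v] N_neg by (simp add: N_W W.M.l_neg)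

lemma coset_W': "H +>\<^bsub>W'\<^esub> v = H +>\<^bsub>W\<^esub> v"
  by (simp add: a_r_coset_def')

lemma J_N: "S.J d \<subseteq> J d"
  unfolding J_def S.J_def using N_W by auto

lemma S_mcoh: "S.mcoh v \<Longrightarrow> mcoh v"
  unfolding FW.coherent_def
proof (intro allI conjI)
  fix d assume v: "S.mcoh v"
  have vN: "v d \<in> N" for d using S.FW.coherent_closed[OF v, of d] by simp
  show "v d \<in> carrier W" using vN N_W by blast
  have "v (Suc d) \<oplus>\<^bsub>W'\<^esub> \<ominus>\<^bsub>W'\<^esub> v d \<in> S.J d"
    using v S.FW.coset_eq_iff[of "v (Suc d)" "v d" d] vN unfolding S.FW.coherent_def by simp
  then have "v (Suc d) \<oplus>\<^bsub>W\<^esub> \<ominus>\<^bsub>W\<^esub> v d \<in> J d" using J_N vN by (auto simp: neg_N)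
  then show "J d +>\<^bsub>W\<^esub> v (Suc d) = J d +>\<^bsub>W\<^esub> v d" using FW.coset_eq_iff vN N_W by blast
qed

abbreviation "incl \<equiv> completion_incl R W"

lemma incl_mseq:
  assumes v: "S.mcoh v" shows "incl (S.mseq v) = mseq v"
proof
  fix d
  have vN: "v d \<in> N" using S.FW.coherent_closed[OF v, of d] by simp
  have "incl (S.mseq v) d = J d <+>\<^bsub>W\<^esub> (S.J d +>\<^bsub>W\<^esub> v d)"
    by (simp add: completion_incl_def ideal_smult_eq S.FW.fseq_def coset_W')
  also have "\<dots> = J d +>\<^bsub>W\<^esub> v d"
  proof
    show "J d <+>\<^bsub>W\<^esub> (S.J d +>\<^bsub>W\<^esub> v d) \<subseteq> J d +>\<^bsub>W\<^esub> v d"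
    proof
      fix x assume "x \<in> J d <+>\<^bsub>W\<^esub> (S.J d +>\<^bsub>W\<^esub> v d)"
      then obtain y z where y: "y \<in> J d" "z \<in> S.J d" "x = y \<oplus>\<^bsub>W\<^esub> (z \<oplus>\<^bsub>W\<^esub> v d)"
        unfolding set_add_def' a_r_coset_def' by blast
      have zJ: "z \<in> J d" using y J_N by blast
      have "x = (y \<oplus>\<^bsub>W\<^esub> z) \<oplus>\<^bsub>W\<^esub> v d"
        using y FW.N_closed[OF y(1)] FW.N_closed[OF zJ] N_W[OF vN] by (simp add: W.M.a_assoc)
      then show "x \<in> J d +>\<^bsub>W\<^esub> v d" using FW.N_add[OF y(1) zJ] unfolding a_r_coset_def' by blast
    qed
    show "J d +>\<^bsub>W\<^esub> v d \<subseteq> J d <+>\<^bsub>W\<^esub> (S.J d +>\<^bsub>W\<^esub> v d)"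
    proof
      fix x assume "x \<in> J d +>\<^bsub>W\<^esub> v d"
      then obtain h where h: "h \<in> J d" "x = h \<oplus>\<^bsub>W\<^esub> v d" unfolding a_r_coset_def' by blast
      have "v d \<in> S.J d +>\<^bsub>W\<^esub> v d" using S.FW.coset_self[of "v d" d] vN by (simp add: coset_W')
      then show "x \<in> J d <+>\<^bsub>W\<^esub> (S.J d +>\<^bsub>W\<^esub> v d)" using h unfolding set_add_def' by blast
    qed
  qed
  finally show "incl (S.mseq v) d = mseq v d" by (simp add: FW.fseq_def)
qed

lemma incl_hat: "v \<in> N \<Longrightarrow> incl (S.hat v) = hat v"
  unfolding S.hat_def hat_def by (rule incl_mseq) (simp add: S.FW.coherent_const)

lemma incl_closed: "s \<in> carrier S.\<W> \<Longrightarrow> incl s \<in> carrier \<W>"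
  by (metis S.MC_E incl_mseq S_mcoh mseq_in)

lemma incl_add:
  assumes "s \<in> carrier S.\<W>" "t \<in> carrier S.\<W>"
  shows "incl (s \<oplus>\<^bsub>S.\<W>\<^esub> t) = incl s \<oplus>\<^bsub>\<W>\<^esub> incl t"
proof -
  obtain v where v: "S.mcoh v" "s = S.mseq v" using assms S.MC_E by blast
  obtain w where w: "S.mcoh w" "t = S.mseq w" using assms S.MC_E by blast
  show ?thesis
    using incl_mseq[OF S.FW.coherent_add[OF v(1) w(1)]]
    by (simp add: v(2) w(2) S.mseq_add[OF v(1) w(1)] incl_mseq[OF v(1)] incl_mseq[OF w(1)] mseq_add[OF S_mcoh[OF v(1)] S_mcoh[OF w(1)]])
qed

lemma incl_smult:
  assumes "c \<in> carrier \<O>" "s \<in> carrier S.\<W>"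
  shows "incl (c \<odot>\<^bsub>S.\<W>\<^esub> s) = c \<odot>\<^bsub>\<W>\<^esub> incl s"
proof -
  obtain v where v: "S.mcoh v" "s = S.mseq v" using assms S.MC_E by blast
  obtain b where b: "coh b" "c = seq b" using assms O_E by blast
  show ?thesis
    using incl_mseq[OF S.mcoh_smult[OF b(1) v(1)]]
    by (simp add: v(2) b(2) S.mseq_smult[OF b(1) v(1)] incl_mseq[OF v(1)] mseq_smult[OF b(1) S_mcoh[OF v(1)]])
qed

text \<open>If \<open>J D\<close> is contained in \<open>N\<close>, the truncation at level
  \<open>D\<close> decides membership: \<open>v\<close> agrees modulo \<open>J D\<close> with the
  representative \<open>w D\<close>, which lies in \<open>N\<close>.\<close>

lemma incl_hat_conv:
  assumes D: "\<And>v. v \<in> carrier W \<Longrightarrow> p [^] (D::nat) \<odot>\<^bsub>W\<^esub> v \<in> N"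
    and v: "v \<in> carrier W" "hat v \<in> incl ` carrier S.\<W>"
  shows "v \<in> N"
proof -
  obtain s where s: "s \<in> carrier S.\<W>" "hat v = incl s" using v by blast
  obtain w where w: "S.mcoh w" "s = S.mseq w" using s S.MC_E by blast
  have wN: "w D \<in> N" using S.FW.coherent_closed[OF w(1), of D] by simp
  have "hat v D = mseq w D" using s w incl_mseq by simp
  then have "v \<oplus>\<^bsub>W\<^esub> \<ominus>\<^bsub>W\<^esub> w D \<in> J D"
    using FW.coset_eq_iff v N_W[OF wN] by (simp add: hat_eval FW.fseq_def)
  then have "v \<oplus>\<^bsub>W\<^esub> \<ominus>\<^bsub>W\<^esub> w D \<in> N" using D unfolding mem_J by auto
  then have "v \<oplus>\<^bsub>W\<^esub> \<ominus>\<^bsub>W\<^esub> w D \<oplus>\<^bsub>W\<^esub> w D \<in> N" using N_add wN by blast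
  then show ?thesis using v N_W[OF wN] by (simp add: W.M.a_assoc W.M.l_neg)
qed

context
  assumes pW: "\<And>v. v \<in> carrier W \<Longrightarrow> p \<odot>\<^bsub>W\<^esub> v \<in> N"
begin

text \<open>The filtrations interleave with a shift by one, \<open>J (Suc d)\<close> being contained
  in \<open>S.J d\<close> and the latter in \<open>J d\<close>. This accounts for every
  \<open>Suc\<close> in the next two proofs.\<close>

lemma J_Suc_N: "J (Suc d) \<subseteq> S.J d"
proof
  fix x assume "x \<in> J (Suc d)"
  then obtain v where v: "v \<in> carrier W" "x = p [^] Suc d \<odot>\<^bsub>W\<^esub> v" unfolding mem_J by blast
  then have "x = p [^] d \<odot>\<^bsub>W\<^esub> (p \<odot>\<^bsub>W\<^esub> v)" by (simp add: W.smult_assoc1)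
  then show "x \<in> S.J d" using pW[OF v(1)] unfolding S.mem_J by auto
qed

lemma incl_inj: "inj_on incl (carrier S.\<W>)"
proof (rule inj_onI)
  fix s t assume st: "s \<in> carrier S.\<W>" "t \<in> carrier S.\<W>" "incl s = incl t"
  obtain v where v: "S.mcoh v" "s = S.mseq v" using st S.MC_E by blast
  obtain w where w: "S.mcoh w" "t = S.mseq w" using st S.MC_E by blast
  have vN: "v d \<in> N" "w d \<in> N" for d
    using S.FW.coherent_closed[OF v(1), of d] S.FW.coherent_closed[OF w(1), of d] by simp_all
  have "mseq v = mseq w" using st v w incl_mseq by simp
  then have "v d \<oplus>\<^bsub>W\<^esub> \<ominus>\<^bsub>W\<^esub> w d \<in> J d" for d
    using FW.fseq_eq_iff[OF S_mcoh[OF v(1)] S_mcoh[OF w(1)]] by blast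
  then have "v (Suc d) \<oplus>\<^bsub>W'\<^esub> \<ominus>\<^bsub>W'\<^esub> w (Suc d) \<in> S.J d" for d using J_Suc_N vN by (auto simp: neg_N)
  then have "S.J d +>\<^bsub>W'\<^esub> v (Suc d) = S.J d +>\<^bsub>W'\<^esub> w (Suc d)" for d
    using S.FW.coset_eq_iff[of "v (Suc d)" "w (Suc d)" d] vN by simp
  then show "s = t" using v w unfolding S.FW.coherent_def by (simp add: S.FW.fseq_def fun_eq_iff)
qed

text \<open>Since \<open>J 1\<close> is contained in \<open>N\<close>, a sequence whose first term
  comes from \<open>N\<close> has all later representatives in \<open>N\<close>. Shifted by one,
  they are coherent for the filtration of \<open>N\<close>.\<close>

lemma incl_image: "incl ` carrier S.\<W> = {s \<in> carrier \<W>. \<exists>v\<in>N. s 1 = hat v 1}"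
proof
  show "incl ` carrier S.\<W> \<subseteq> {s \<in> carrier \<W>. \<exists>v\<in>N. s 1 = hat v 1}"
  proof
    fix t assume "t \<in> incl ` carrier S.\<W>"
    then obtain s where s: "s \<in> carrier S.\<W>" "t = incl s" by blast
    obtain w where w: "S.mcoh w" "s = S.mseq w" using s S.MC_E by blast
    have "w 1 \<in> N" using S.FW.coherent_closed[OF w(1), of 1] by simp
    moreover have "t 1 = hat (w 1) 1" using s(2) incl_mseq[OF w(1)] w(2) by (simp add: FW.fseq_def hat_eval)
    ultimately show "t \<in> {s \<in> carrier \<W>. \<exists>v\<in>N. s 1 = hat v 1}"
      using incl_closed[OF s(1)] s(2) by blast
  qed
  show "{s \<in> carrier \<W>. \<exists>v\<in>N. s 1 = hat v 1} \<subseteq> incl ` carrier S.\<W>"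
  proof
    fix s assume "s \<in> {s \<in> carrier \<W>. \<exists>v\<in>N. s 1 = hat v 1}"
    then obtain v where s: "s \<in> carrier \<W>" and v: "v \<in> N" "s 1 = hat v 1" by blast
    obtain a where a: "mcoh a" "s = mseq a" using s MC_E by blast
    note ac = FW.coherent_closed[OF a(1)]
    have JN: "J (Suc d) \<subseteq> N" for d using J_Suc_N[of d] S.FW.N_closed by auto
    have aN: "a (Suc d) \<in> N" for d
    proof -
      have "J 1 +>\<^bsub>W\<^esub> a (Suc d) = J 1 +>\<^bsub>W\<^esub> a 1" by (rule FW.coherent_le[OF a(1)]) simp
      also have "\<dots> = J 1 +>\<^bsub>W\<^esub> v" using v a(2) by (simp add: FW.fseq_def hat_eval)
      finally have "a (Suc d) \<oplus>\<^bsub>W\<^esub> \<ominus>\<^bsub>W\<^esub> v \<in> J 1" using FW.coset_eq_iff ac N_W[OF v(1)] by blast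
      then have "a (Suc d) \<oplus>\<^bsub>W\<^esub> \<ominus>\<^bsub>W\<^esub> v \<oplus>\<^bsub>W\<^esub> v \<in> N" using JN[of 0] N_add v(1) by auto
      then show ?thesis using ac N_W[OF v(1)] by (simp add: W.M.a_assoc W.M.l_neg)
    qed
    have co: "S.mcoh (\<lambda>d. a (Suc d))"
      unfolding S.FW.coherent_def
    proof (intro allI conjI)
      fix d show "a (Suc d) \<in> carrier W'" using aN by simp
      have "a (Suc (Suc d)) \<oplus>\<^bsub>W\<^esub> \<ominus>\<^bsub>W\<^esub> a (Suc d) \<in> J (Suc d)"
        using a(1) FW.coset_eq_iff ac unfolding FW.coherent_def by blast
      then have "a (Suc (Suc d)) \<oplus>\<^bsub>W'\<^esub> \<ominus>\<^bsub>W'\<^esub> a (Suc d) \<in> S.J d" using J_Suc_N aN by (auto simp: neg_N)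
      then show "S.J d +>\<^bsub>W'\<^esub> a (Suc (Suc d)) = S.J d +>\<^bsub>W'\<^esub> a (Suc d)"
        using S.FW.coset_eq_iff[of "a (Suc (Suc d))" "a (Suc d)" d] aN by simp
    qed
    have "incl (S.mseq (\<lambda>d. a (Suc d))) = s"
      unfolding incl_mseq[OF co] a(2) using a(1) by (simp add: FW.fseq_def FW.coherent_def fun_eq_iff)
    then show "s \<in> incl ` carrier S.\<W>" using S.mseq_in[OF co] by (intro image_eqI[where x = "S.mseq (\<lambda>d. a (Suc d))"]) simp_all
  qed
qed

end

end

section \<open>Cutting out a submodule by a lattice\<close>

context unif_ring
begin

lemma scaling_O: "is_uniformizer \<pi> \<Longrightarrow> r \<le> n \<Longrightarrow> scaling \<O> n r \<pi>"
  by (intro scaling.intro scaling_axioms.intro O_cring) (simp, rule unif_closed, simp, rule unif_cancel)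

end

lemma (in cring) lattice_add:
  assumes g: "g \<in> carrier (mat_monoid n R)" and "v \<in> lattice n R g" "w \<in> lattice n R g"
  shows "(\<lambda>i\<in>{..<n}. v i \<oplus> w i) \<in> lattice n R g"
proof -
  obtain x where x: "x \<in> {..<n} \<rightarrow>\<^sub>E carrier R" "v = mat_vec n R g x" using assms by (auto simp: lattice_def)
  obtain y where y: "y \<in> {..<n} \<rightarrow>\<^sub>E carrier R" "w = mat_vec n R g y" using assms by (auto simp: lattice_def)
  have "(\<lambda>i\<in>{..<n}. x i \<oplus> y i) \<in> {..<n} \<rightarrow>\<^sub>E carrier R" using PiE_mem[OF x(1)] PiE_mem[OF y(1)] by auto
  then have "mat_vec n R g (\<lambda>i\<in>{..<n}. x i \<oplus> y i) \<in> lattice n R g" unfolding lattice_def by (rule imageI)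
  then show ?thesis unfolding mat_vec_add[OF g x(1) y(1)] x(2) y(2) .
qed

lemma (in cring) lattice_smult:
  assumes g: "g \<in> carrier (mat_monoid n R)" and "v \<in> lattice n R g" "c \<in> carrier R"
  shows "(\<lambda>i\<in>{..<n}. c \<otimes> v i) \<in> lattice n R g"
proof -
  obtain x where x: "x \<in> {..<n} \<rightarrow>\<^sub>E carrier R" "v = mat_vec n R g x" using assms by (auto simp: lattice_def)
  have "(\<lambda>i\<in>{..<n}. c \<otimes> x i) \<in> {..<n} \<rightarrow>\<^sub>E carrier R" using PiE_mem[OF x(1)] assms(3) by auto
  then have "mat_vec n R g (\<lambda>i\<in>{..<n}. c \<otimes> x i) \<in> lattice n R g" unfolding lattice_def by (rule imageI)
  then show ?thesis unfolding mat_vec_smult[OF g x(1) assms(3)] x(2) .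
qed

lemma (in cring) lattice_closed:
  "g \<in> carrier (mat_monoid n R) \<Longrightarrow> v \<in> lattice n R g \<Longrightarrow> v \<in> {..<n} \<rightarrow>\<^sub>E carrier R"
  unfolding lattice_def using mat_vec_closed by blast

context torsion_free_module
begin

text \<open>Allows the left factor of a matrix in \<open>scaled\<close> to be absorbed into the
  trivialization, after which its lattice is given by coordinates.\<close>

lemma triv_comp:
  assumes a: "a \<in> triv n" and k: "k \<in> carrier (GL n \<O>)"
  shows "(\<lambda>s\<in>carrier \<W>. mat_vec n \<O> k (a s)) \<in> triv n"
proof (rule module_isosI)
  note kM = O.GL_in_mat[OF k]
  show "bij_betw (\<lambda>s\<in>carrier \<W>. mat_vec n \<O> k (a s)) (carrier \<W>) (carrier (free_module n \<O>))"
    using bij_betw_trans[OF module_isosD(1)[OF a] O.mat_vec_GL_bij[OF k, folded free_module_simps(1)]]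
    by (subst bij_betw_cong[of _ _ "mat_vec n \<O> k \<circ> a"]) auto
  show "(\<lambda>s\<in>carrier \<W>. mat_vec n \<O> k (a s)) (s \<oplus>\<^bsub>\<W>\<^esub> t) = (\<lambda>s\<in>carrier \<W>. mat_vec n \<O> k (a s)) s
      \<oplus>\<^bsub>free_module n \<O>\<^esub> (\<lambda>s\<in>carrier \<W>. mat_vec n \<O> k (a s)) t" if "s \<in> carrier \<W>" "t \<in> carrier \<W>" for s t
    using that O.mat_vec_add[OF kM triv_closed[OF a that(1)] triv_closed[OF a that(2)]]
    by (simp add: free_module_simps triv_add[OF a])
  show "(\<lambda>s\<in>carrier \<W>. mat_vec n \<O> k (a s)) (c \<odot>\<^bsub>\<W>\<^esub> s) = c \<odot>\<^bsub>free_module n \<O>\<^esub> (\<lambda>s\<in>carrier \<W>. mat_vec n \<O> k (a s)) s"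
    if "c \<in> carrier \<O>" "s \<in> carrier \<W>" for c s
    using that O.mat_vec_smult[OF kM triv_closed[OF a that(2)] that(1)]
    by (simp add: free_module_simps triv_smult[OF a])
qed simp

text \<open>The coordinates of a trivialization, restricted to the module and read in the residue
  field. These are the functionals imposed one at a time in the construction of the
  subsheaf.\<close>

definition coord :: "((nat \<Rightarrow> 'v set) \<Rightarrow> nat \<Rightarrow> nat \<Rightarrow> 'a set) \<Rightarrow> nat \<Rightarrow> 'v \<Rightarrow> 'a set" where
  "coord b i v = b (hat v) i 1"

context
  fixes n b assumes b: "b \<in> triv n"
begin

lemma coord_closed: "v \<in> carrier W \<Longrightarrow> i < n \<Longrightarrow> coord b i v \<in> carrier (T 1)"
  unfolding coord_def using O_eval triv_coord[OF b hat_closed] by blast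

lemma coord_add: "v \<in> carrier W \<Longrightarrow> w \<in> carrier W \<Longrightarrow> i < n \<Longrightarrow> coord b i (v \<oplus>\<^bsub>W\<^esub> w) = coord b i v \<oplus>\<^bsub>T 1\<^esub> coord b i w"
  by (simp add: coord_def hat_add triv_add[OF b] hat_closed O_ops)

lemma coord_smult: "c \<in> carrier R \<Longrightarrow> v \<in> carrier W \<Longrightarrow> i < n \<Longrightarrow> coord b i (c \<odot>\<^bsub>W\<^esub> v) = (I 1 +> c) \<otimes>\<^bsub>T 1\<^esub> coord b i v"
  by (simp add: coord_def hat_smult triv_smult[OF b] hat_closed emb_closed O_ops emb_eval)

text \<open>A preimage under the trivialization lies only in the completion. As the values concern
  level \<open>1\<close>, it may be replaced by an element of the module with the same first
  truncation.\<close>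

lemma coord_surj:
  assumes t: "\<And>i. i < n \<Longrightarrow> t i \<in> carrier (T 1)"
  shows "\<exists>v\<in>carrier W. \<forall>i<n. coord b i v = t i"
proof -
  have "\<exists>f. i < n \<longrightarrow> f \<in> carrier \<O> \<and> f 1 = t i" for i
    using t[of i] ev_surj[of 1] unfolding set_eq_iff image_iff by metis
  then obtain f where f: "\<And>i. i < n \<Longrightarrow> f i \<in> carrier \<O> \<and> f i 1 = t i" by metis
  obtain s where s: "s \<in> carrier \<W>" "b s = (\<lambda>i\<in>{..<n}. f i)" using triv_surj[OF b, of "\<lambda>i\<in>{..<n}. f i"] f by auto
  obtain v where v: "v \<in> carrier W" "s 1 = hat v 1" using TW_surj[OF MC_eval[OF s(1)]] by blast
  have "coord b i v = t i" if "i < n" for i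
    using triv_eval[OF b hat_closed[OF v(1)] s(1) v(2)[symmetric] that] f that by (simp add: coord_def s(2))
  then show ?thesis using v(1) by blast
qed

end

end

lemma (in unif_ring) scaled_lattice_iff:
  assumes unif: "is_uniformizer \<pi>" and r: "r \<le> n"
    and A: "A \<in> carrier (GL n \<O>)" "B \<in> carrier (GL n \<O>)" and v: "v \<in> {..<n} \<rightarrow>\<^sub>E carrier \<O>"
  shows "v \<in> lattice n \<O> (A \<otimes>\<^bsub>mat_monoid n \<O>\<^esub> Delta n r \<O> \<pi> \<otimes>\<^bsub>mat_monoid n \<O>\<^esub> B) \<longleftrightarrow>
     (\<forall>i<r. mat_vec n \<O> (inv\<^bsub>GL n \<O>\<^esub> A) v i 1 = \<zero>\<^bsub>T 1\<^esub>)"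
proof -
  interpret sc: scaling \<O> n r \<pi> by (rule scaling_O[OF unif r])
  let ?w = "mat_vec n \<O> (inv\<^bsub>GL n \<O>\<^esub> A) v"
  have w: "?w \<in> {..<n} \<rightarrow>\<^sub>E carrier \<O>" using A v sc.G_M by (intro O.mat_vec_closed) auto
  have wi: "?w i \<in> carrier \<O>" if "i < n" for i using PiE_mem[OF w] that by simp
  have vw: "v = mat_vec n \<O> A ?w" using O.GL_mat_vec_inv(2)[OF A(1) v] by simp
  have L: "lattice n \<O> (A \<otimes>\<^bsub>sc.M\<^esub> sc.\<Delta> \<otimes>\<^bsub>sc.M\<^esub> B) = lattice n \<O> (A \<otimes>\<^bsub>sc.M\<^esub> sc.\<Delta>)"
    using A sc.G_M by (intro sc.lattice_mult_GL) auto
  show ?thesis unfolding L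
  proof
    assume "v \<in> lattice n \<O> (A \<otimes>\<^bsub>sc.M\<^esub> sc.\<Delta>)"
    then obtain x where x: "x \<in> {..<n} \<rightarrow>\<^sub>E carrier \<O>" "v = mat_vec n \<O> (A \<otimes>\<^bsub>sc.M\<^esub> sc.\<Delta>) x" by (auto simp: lattice_def)
    have "v = mat_vec n \<O> A (mat_vec n \<O> sc.\<Delta> x)"
      unfolding x(2) using A x(1) sc.G_M by (intro O.mat_vec_mult) auto
    then have "?w = mat_vec n \<O> sc.\<Delta> x"
      using O.GL_mat_vec_inv(1)[OF A(1) O.mat_vec_closed[OF sc.Delta_closed x(1)]] by simp
    then have *: "?w i = sc.q i \<otimes>\<^bsub>\<O>\<^esub> x i" if "i < n" for i using sc.Delta_vec[OF x(1) that] by simp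
    show "\<forall>i<r. ?w i 1 = \<zero>\<^bsub>T 1\<^esub>"
    proof (intro allI impI)
      fix i assume i: "i < r"
      then have "x i \<in> carrier \<O>" using PiE_mem[OF x(1)] r by simp
      then show "?w i 1 = \<zero>\<^bsub>T 1\<^esub>"
        using unif_dvd_iff[OF unif wi, of i 1] i r *[of i] unif_closed[OF unif] by (auto simp: sc.q_def)
    qed
  next
    assume z: "\<forall>i<r. ?w i 1 = \<zero>\<^bsub>T 1\<^esub>"
    have "\<exists>c. i < n \<longrightarrow> c \<in> carrier \<O> \<and> ?w i = sc.q i \<otimes>\<^bsub>\<O>\<^esub> c" for i
    proof (cases "i < r")
      case True
      then show ?thesis using unif_dvd_iff[OF unif wi, of i 1] z r unif_closed[OF unif] by (auto simp: sc.q_def)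
    next
      case False then show ?thesis using wi[of i] by (auto simp: sc.q_def)
    qed
    then obtain c where c: "\<And>i. i < n \<Longrightarrow> c i \<in> carrier \<O> \<and> ?w i = sc.q i \<otimes>\<^bsub>\<O>\<^esub> c i" by metis
    let ?x = "\<lambda>i\<in>{..<n}. c i"
    have x: "?x \<in> {..<n} \<rightarrow>\<^sub>E carrier \<O>" using c by auto
    have "mat_vec n \<O> sc.\<Delta> ?x = ?w"
    proof (rule vec_eqI[OF O.mat_vec_closed[OF sc.Delta_closed x] w])
      fix i assume "i < n" then show "mat_vec n \<O> sc.\<Delta> ?x i = ?w i" using sc.Delta_vec[OF x] c by simp
    qed
    then have "mat_vec n \<O> (A \<otimes>\<^bsub>sc.M\<^esub> sc.\<Delta>) ?x = v"
      using O.mat_vec_mult[OF sc.G_M[OF A(1)] sc.Delta_closed x] vw by simp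
    then show "v \<in> lattice n \<O> (A \<otimes>\<^bsub>sc.M\<^esub> sc.\<Delta>)" using x unfolding lattice_def by blast
  qed
qed

locale modification = torsion_free_module R p W
  for R :: "('a, 'm) ring_scheme" (structure) and p and W :: "('a, 'v) module" +
  fixes n r :: nat and \<pi> a g
  assumes unif: "is_uniformizer \<pi>" and r_le_n: "r \<le> n"
    and a_triv: "a \<in> triv n" and g_scaled: "g \<in> scaling.scaled (completion R) n r \<pi>"
begin

sublocale sc: scaling \<O> n r \<pi> by (rule scaling_O[OF unif r_le_n])

lemmas g_M = sc.scaled_in_M[OF g_scaled]

text \<open>The part of the uncompleted module that the lattice selects; it becomes the stalk of the
  new bundle.\<close>

definition N :: "'v set" where "N = {v \<in> carrier W. a (hat v) \<in> lattice n \<O> g}"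

lemma pi_dvd_in_lattice:
  assumes s: "s \<in> carrier \<W>" and f: "f \<in> carrier \<O>" "f 1 = \<zero>\<^bsub>T 1\<^esub>"
  shows "a (f \<odot>\<^bsub>\<W>\<^esub> s) \<in> lattice n \<O> g"
proof -
  obtain c where c: "c \<in> carrier \<O>" "f = \<pi> [^]\<^bsub>\<O>\<^esub> (1::nat) \<otimes>\<^bsub>\<O>\<^esub> c" using unif_dvd_iff[OF unif f(1)] f(2) by blast
  then have "a (f \<odot>\<^bsub>\<W>\<^esub> s) = a (\<pi> \<odot>\<^bsub>\<W>\<^esub> (c \<odot>\<^bsub>\<W>\<^esub> s))" using s unif_closed[OF unif] by (simp add: MC.smult_assoc1)
  also have "\<dots> = (\<lambda>i\<in>{..<n}. \<pi> \<otimes>\<^bsub>\<O>\<^esub> a (c \<odot>\<^bsub>\<W>\<^esub> s) i)"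
    using c s unif_closed[OF unif] by (intro triv_smult[OF a_triv]) auto
  finally show ?thesis
    using sc.lattice_scaled_pi[OF g_scaled triv_closed[OF a_triv]] c s by simp
qed

lemma emb_p_1: "emb p 1 = \<zero>\<^bsub>T 1\<^esub>"
  using emb_p_eval[of "\<one>\<^bsub>\<O>\<^esub>" 1] emb_closed[of p] by simp

lemma pW: "v \<in> carrier W \<Longrightarrow> p \<odot>\<^bsub>W\<^esub> v \<in> N"
  using pi_dvd_in_lattice[OF hat_closed emb_closed emb_p_1] by (simp add: N_def hat_smult)

lemma N_submodule: "submodule N R W"
proof (rule W.submoduleI)
  show smult: "c \<odot>\<^bsub>W\<^esub> v \<in> N" if "c \<in> carrier R" "v \<in> N" for c v
    using that O.lattice_smult[OF g_M, of "a (hat v)" "emb c"]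
    by (simp add: N_def hat_smult triv_smult[OF a_triv] hat_closed emb_closed)
  show "\<zero>\<^bsub>W\<^esub> \<in> N" using pW[of "\<zero>\<^bsub>W\<^esub>"] by simp
  show "\<ominus>\<^bsub>W\<^esub> v \<in> N" if "v \<in> N" for v
  proof -
    have "v \<in> carrier W" using that by (simp add: N_def)
    then have "\<ominus>\<^bsub>W\<^esub> v = (\<ominus> \<one>) \<odot>\<^bsub>W\<^esub> v" by (simp add: W.smult_l_minus)
    then show ?thesis using smult[OF _ that] by simp
  qed
  show "v \<oplus>\<^bsub>W\<^esub> w \<in> N" if "v \<in> N" "w \<in> N" for v w
    using that O.lattice_add[OF g_M, of "a (hat v)" "a (hat w)"]
    by (simp add: N_def hat_add triv_add[OF a_triv] hat_closed)
qed (auto simp: N_def)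

sublocale submodule_pair R p W N
  by (intro submodule_pair.intro submodule_pair_axioms.intro N_submodule torsion_free_module_axioms)

text \<open>Both sides contain the multiples of \<open>p\<close>, so membership depends on the first
  truncation alone. Every such truncation is represented by an element of the module, where the
  condition is the definition of \<open>N\<close>.\<close>

lemma image_lattice: "incl ` carrier S.\<W> = {s \<in> carrier \<W>. a s \<in> lattice n \<O> g}"
proof -
  have *: "a s \<in> lattice n \<O> g" if s: "s \<in> carrier \<W>" "t \<in> carrier \<W>" "s 1 = t 1" "a t \<in> lattice n \<O> g" for s t
  proof -
    obtain w where w: "w \<in> carrier \<W>" "s = t \<oplus>\<^bsub>\<W>\<^esub> emb (p [^] (1::nat)) \<odot>\<^bsub>\<W>\<^esub> w" using MC_eval_eq s by blast
    then have "a s = (\<lambda>i\<in>{..<n}. a t i \<oplus>\<^bsub>\<O>\<^esub> a (emb p \<odot>\<^bsub>\<W>\<^esub> w) i)"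
      using s emb_closed[of p] by (simp add: triv_add[OF a_triv])
    then show ?thesis
      using O.lattice_add[OF g_M s(4) pi_dvd_in_lattice[OF w(1) emb_closed emb_p_1]] by simp
  qed
  have "incl ` carrier S.\<W> = {s \<in> carrier \<W>. \<exists>v\<in>N. s 1 = hat v 1}" by (rule incl_image) (rule pW)
  also have "\<dots> = {s \<in> carrier \<W>. a s \<in> lattice n \<O> g}"
  proof (intro Collect_cong conj_cong refl iffI)
    fix s assume s: "s \<in> carrier \<W>" and "\<exists>v\<in>N. s 1 = hat v 1"
    then obtain v where "v \<in> N" "s 1 = hat v 1" by blast
    then show "a s \<in> lattice n \<O> g" using *[OF s, of "hat v"] hat_closed by (auto simp: N_def)
  next
    fix s assume s: "s \<in> carrier \<W>" and L: "a s \<in> lattice n \<O> g"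
    obtain v where v: "v \<in> carrier W" "s 1 = hat v 1" using TW_surj[OF MC_eval[OF s]] by blast
    then have "a (hat v) \<in> lattice n \<O> g" using *[of "hat v" s] s L hat_closed by simp
    then show "\<exists>v\<in>N. s 1 = hat v 1" using v by (auto simp: N_def)
  qed
  finally show ?thesis .
qed

text \<open>The new trivialization is the inverse of \<open>g\<close> applied to \<open>a\<close>.
  \<open>g\<close> is only injective, so it is inverted on its image, which by
  \<open>image_lattice\<close> is where \<open>a\<close> sends the completion of \<open>N\<close>.
  Linearity follows by applying \<open>g\<close> and cancelling it.\<close>

lemma new_triv_ex: "\<exists>a'\<in>S.triv n. \<forall>s\<in>carrier S.\<W>. mat_vec n \<O> g (a' s) = a (incl s)"
proof -
  let ?X = "{..<n} \<rightarrow>\<^sub>E carrier \<O>"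
  define a' where "a' = (\<lambda>s\<in>carrier S.\<W>. inv_into ?X (mat_vec n \<O> g) (a (incl s)))"
  note inj = sc.scaled_vec_inj[OF g_scaled]
  have mem: "a (incl s) \<in> mat_vec n \<O> g ` ?X" if "s \<in> carrier S.\<W>" for s
    using image_lattice that unfolding lattice_def by blast
  have a'X: "a' s \<in> ?X" if "s \<in> carrier S.\<W>" for s
    using inv_into_into[OF mem[OF that]] that by (simp add: a'_def)
  have ga': "mat_vec n \<O> g (a' s) = a (incl s)" if "s \<in> carrier S.\<W>" for s
    using f_inv_into_f[OF mem[OF that]] that by (simp add: a'_def)
  have "a' \<in> S.triv n"
  proof (rule module_isosI)
    show "a' \<in> extensional (carrier S.\<W>)" by (simp add: a'_def)
    show "a' (s \<oplus>\<^bsub>S.\<W>\<^esub> t) = a' s \<oplus>\<^bsub>free_module n \<O>\<^esub> a' t"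
      if st: "s \<in> carrier S.\<W>" "t \<in> carrier S.\<W>" for s t
    proof (rule inj_onD[OF inj])
      have "mat_vec n \<O> g (a' (s \<oplus>\<^bsub>S.\<W>\<^esub> t)) = (\<lambda>i\<in>{..<n}. a (incl s) i \<oplus>\<^bsub>\<O>\<^esub> a (incl t) i)"
        using st by (simp add: ga' incl_add triv_add[OF a_triv] incl_closed)
      then show "mat_vec n \<O> g (a' (s \<oplus>\<^bsub>S.\<W>\<^esub> t)) = mat_vec n \<O> g (a' s \<oplus>\<^bsub>free_module n \<O>\<^esub> a' t)"
        using O.mat_vec_add[OF g_M a'X[OF st(1)] a'X[OF st(2)]] ga' st by (simp add: free_module_simps)
      show "a' (s \<oplus>\<^bsub>S.\<W>\<^esub> t) \<in> ?X" using st by (intro a'X) simp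
      show "a' s \<oplus>\<^bsub>free_module n \<O>\<^esub> a' t \<in> ?X"
        using PiE_mem[OF a'X[OF st(1)]] PiE_mem[OF a'X[OF st(2)]] by (auto simp: free_module_simps)
    qed
    show "a' (c \<odot>\<^bsub>S.\<W>\<^esub> s) = c \<odot>\<^bsub>free_module n \<O>\<^esub> a' s"
      if c: "c \<in> carrier \<O>" and s: "s \<in> carrier S.\<W>" for c s
    proof (rule inj_onD[OF inj])
      have "mat_vec n \<O> g (a' (c \<odot>\<^bsub>S.\<W>\<^esub> s)) = (\<lambda>i\<in>{..<n}. c \<otimes>\<^bsub>\<O>\<^esub> a (incl s) i)"
        using c s by (simp add: ga' incl_smult triv_smult[OF a_triv] incl_closed)
      then show "mat_vec n \<O> g (a' (c \<odot>\<^bsub>S.\<W>\<^esub> s)) = mat_vec n \<O> g (c \<odot>\<^bsub>free_module n \<O>\<^esub> a' s)"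
        using O.mat_vec_smult[OF g_M a'X[OF s] c] ga' s by (simp add: free_module_simps)
      show "a' (c \<odot>\<^bsub>S.\<W>\<^esub> s) \<in> ?X" using c s by (intro a'X) simp
      show "c \<odot>\<^bsub>free_module n \<O>\<^esub> a' s \<in> ?X"
        using PiE_mem[OF a'X[OF s]] c by (auto simp: free_module_simps)
    qed
    show "bij_betw a' (carrier S.\<W>) (carrier (free_module n \<O>))"
    proof (rule bij_betw_imageI)
      show "inj_on a' (carrier S.\<W>)"
      proof (rule inj_onI)
        fix s t assume st: "s \<in> carrier S.\<W>" "t \<in> carrier S.\<W>" "a' s = a' t"
        then have "a (incl s) = a (incl t)" using ga' by metis
        then have "incl s = incl t" using triv_inj[OF a_triv] incl_closed st by blast
        then show "s = t" using incl_inj[OF pW] st by (auto dest: inj_onD)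
      qed
      show "a' ` carrier S.\<W> = carrier (free_module n \<O>)"
      proof
        show "a' ` carrier S.\<W> \<subseteq> carrier (free_module n \<O>)" using a'X unfolding free_module_simps by blast
        show "carrier (free_module n \<O>) \<subseteq> a' ` carrier S.\<W>"
        proof
          fix v assume "v \<in> carrier (free_module n \<O>)"
          then have v: "v \<in> ?X" by (simp only: free_module_simps)
          obtain t where t: "t \<in> carrier \<W>" "a t = mat_vec n \<O> g v"
            using triv_surj[OF a_triv O.mat_vec_closed[OF g_M v]] by blast
          then have "t \<in> incl ` carrier S.\<W>" unfolding image_lattice lattice_def using v by blast
          then obtain s where s: "s \<in> carrier S.\<W>" "t = incl s" by blast
          have "a' s = v" by (rule inj_onD[OF inj]) (use ga'[OF s(1)] a'X[OF s(1)] v s t in auto)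
          then show "v \<in> a' ` carrier S.\<W>" using s by blast
        qed
      qed
    qed
  qed
  then show ?thesis using ga' by blast
qed

end

section \<open>Zeros and poles of rational functions\<close>

locale finite_constants = field R for R (structure) +
  fixes k :: "'a set"
  assumes k_subfield: "subfield k R" and k_finite: "finite k"
begin

lemmas k_ring = subringE[OF subfieldE(1)[OF k_subfield]]

lemma k_closed [simp]: "c \<in> k \<Longrightarrow> c \<in> carrier R"
  using k_ring(1) by blast

lemma k_card: "card k \<ge> 2"
proof -
  have "{\<zero>, \<one>} \<subseteq> k" using k_ring(2,3) by blast
  then have "card {\<zero>, \<one>} \<le> card k" using k_finite card_mono by blast
  then show ?thesis by simp
qed

text \<open>Values at \<open>x\<close> of polynomials over \<open>k\<close> of degree at most
  \<open>m\<close>, in Horner form. Working with values makes them finite subsets of the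
  field.\<close>

primrec B :: "'a \<Rightarrow> nat \<Rightarrow> 'a set" where
  "B x 0 = k"
| "B x (Suc m) = {c \<oplus> x \<otimes> b |c b. c \<in> k \<and> b \<in> B x m}"

text \<open>The polynomial in \<open>x\<close> with coefficients \<open>\<alpha> 0\<close>, ...,
  \<open>\<alpha> (n - 1)\<close>. Horner form isolates the constant term, which is what remains at
  a zero of \<open>x\<close>.\<close>

primrec pv :: "'a \<Rightarrow> nat \<Rightarrow> (nat \<Rightarrow> 'a) \<Rightarrow> 'a" where
  "pv x 0 \<alpha> = \<zero>"
| "pv x (Suc n) \<alpha> = \<alpha> 0 \<oplus> x \<otimes> pv x n (\<lambda>j. \<alpha> (Suc j))"

context
  fixes x assumes x [simp]: "x \<in> carrier R"
begin

lemma B_closed [simp]: "b \<in> B x m \<Longrightarrow> b \<in> carrier R"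
  by (induction m arbitrary: b) auto

lemma B_SucI: "c \<in> k \<Longrightarrow> b \<in> B x m \<Longrightarrow> c \<oplus> x \<otimes> b \<in> B x (Suc m)"
  by auto

lemma B_add: "b \<in> B x m \<Longrightarrow> b' \<in> B x m \<Longrightarrow> b \<oplus> b' \<in> B x m"
proof (induction m arbitrary: b b')
  case 0 then show ?case using k_ring(7) by simp
next
  case (Suc m)
  obtain c e where 1: "c \<in> k" "e \<in> B x m" "b = c \<oplus> x \<otimes> e" using Suc(2) by auto
  obtain c' e' where 2: "c' \<in> k" "e' \<in> B x m" "b' = c' \<oplus> x \<otimes> e'" using Suc(3) by auto
  have "b \<oplus> b' = (c \<oplus> c') \<oplus> x \<otimes> (e \<oplus> e')" unfolding 1 2 using 1 2 k_closed B_closed x by algebra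
  then show ?case using Suc(1)[OF 1(2) 2(2)] k_ring(7)[OF 1(1) 2(1)] B_SucI by metis
qed

lemma B_zero: "\<zero> \<in> B x m"
proof (induction m)
  case (Suc m)
  have "\<zero> \<oplus> x \<otimes> \<zero> \<in> B x (Suc m)" using k_ring(2) Suc by (rule B_SucI)
  then show ?case by simp
qed (simp add: k_ring)

lemma B_shift: "b \<in> B x m \<Longrightarrow> x \<otimes> b \<in> B x (Suc m)"
  using B_SucI[OF k_ring(2)] by (metis B_closed l_zero m_closed x)

lemma B_mono_Suc: "B x m \<subseteq> B x (Suc m)"
proof (induction m)
  case 0
  show ?case
  proof
    fix b assume "b \<in> B x 0"
    then have "b \<in> k" by simp
    then have "b \<oplus> x \<otimes> \<zero> \<in> B x (Suc 0)" using B_zero[of 0] by (rule B_SucI)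
    then show "b \<in> B x (Suc 0)" using \<open>b \<in> k\<close> by simp
  qed
next
  case (Suc m)
  then show ?case by (auto simp del: B.simps(2)) (auto simp: B.simps(2))
qed

lemma B_mono: "m \<le> m' \<Longrightarrow> b \<in> B x m \<Longrightarrow> b \<in> B x m'"
  using lift_Suc_mono_le[of "B x" m m', OF B_mono_Suc] by blast

lemma B_smult: "c \<in> k \<Longrightarrow> b \<in> B x m \<Longrightarrow> c \<otimes> b \<in> B x m"
proof (induction m arbitrary: b)
  case 0 then show ?case using k_ring(6) by simp
next
  case (Suc m)
  obtain c' e where 1: "c' \<in> k" "e \<in> B x m" "b = c' \<oplus> x \<otimes> e" using Suc(3) by auto
  have "c \<otimes> b = c \<otimes> c' \<oplus> x \<otimes> (c \<otimes> e)" unfolding 1 using 1 Suc(2) k_closed B_closed x by algebra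
  then show ?case using Suc(1)[OF Suc(2) 1(2)] k_ring(6)[OF Suc(2) 1(1)] B_SucI by metis
qed

lemma B_neg: "b \<in> B x m \<Longrightarrow> \<ominus> b \<in> B x m"
  using B_smult[OF k_ring(5)[OF k_ring(3)]] by (metis B_closed l_minus l_one one_closed)

lemma B_mult: "b \<in> B x l \<Longrightarrow> e \<in> B x m \<Longrightarrow> b \<otimes> e \<in> B x (l + m)"
proof (induction l arbitrary: b)
  case 0 then show ?case using B_smult by simp
next
  case (Suc l)
  obtain c b' where 1: "c \<in> k" "b' \<in> B x l" "b = c \<oplus> x \<otimes> b'" using Suc(2) by auto
  have "b \<otimes> e = c \<otimes> e \<oplus> x \<otimes> (b' \<otimes> e)" unfolding 1 using 1 Suc(3) k_closed B_closed x by algebra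
  moreover have "c \<otimes> e \<in> B x (Suc l + m)" using B_smult[OF 1(1) Suc(3)] by (rule B_mono[rotated]) simp
  moreover have "x \<otimes> (b' \<otimes> e) \<in> B x (Suc l + m)" using B_shift[OF Suc(1)[OF 1(2) Suc(3)]] by simp
  ultimately show ?case using B_add by metis
qed

text \<open>The bound by the number of coefficient tuples replaces a bound on the dimension over
  \<open>k\<close>.\<close>

lemma B_finite_card: "finite (B x m) \<and> card (B x m) \<le> card k ^ (m + 1)"
proof (induction m)
  case (Suc m)
  have eq: "B x (Suc m) = (\<lambda>(c, b). c \<oplus> x \<otimes> b) ` (k \<times> B x m)" by auto
  have "card (B x (Suc m)) \<le> card (k \<times> B x m)"
    unfolding eq using Suc k_finite by (intro card_image_le) auto
  also have "\<dots> \<le> card k * card k ^ (m + 1)" using Suc by (simp add: card_cartesian_product)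
  finally show ?case using Suc k_finite unfolding eq by simp
qed (simp add: k_finite)

lemma x_in_B: "x \<in> B x 1"
  using B_shift[of \<one> 0] k_ring(3) by simp

lemma pv_closed [simp]: "(\<And>j. \<alpha> j \<in> k) \<Longrightarrow> pv x n \<alpha> \<in> carrier R"
  by (induction n arbitrary: \<alpha>) auto

lemma pv_in_B: "(\<And>j. \<alpha> j \<in> k) \<Longrightarrow> pv x n \<alpha> \<in> B x n"
proof (induction n arbitrary: \<alpha>)
  case (Suc n)
  have "\<alpha> 0 \<oplus> x \<otimes> pv x n (\<lambda>j. \<alpha> (Suc j)) \<in> B x (Suc n)" by (rule B_SucI[OF Suc(2) Suc(1)]) (rule Suc(2))
  then show ?case by simp
qed (simp add: k_ring)

lemma pv_diff:
  "(\<And>j. \<alpha> j \<in> k) \<Longrightarrow> (\<And>j. \<beta> j \<in> k) \<Longrightarrow> pv x n (\<lambda>j. \<alpha> j \<ominus> \<beta> j) = pv x n \<alpha> \<ominus> pv x n \<beta>"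
proof (induction n arbitrary: \<alpha> \<beta>)
  case (Suc n)
  have IH: "pv x n (\<lambda>j. \<alpha> (Suc j) \<ominus> \<beta> (Suc j)) = pv x n (\<lambda>j. \<alpha> (Suc j)) \<ominus> pv x n (\<lambda>j. \<beta> (Suc j))"
    using Suc by simp
  have alg: "(a \<ominus> b) \<oplus> x \<otimes> (c \<ominus> d) = (a \<oplus> x \<otimes> c) \<ominus> (b \<oplus> x \<otimes> d)"
    if "a \<in> carrier R" "b \<in> carrier R" "c \<in> carrier R" "d \<in> carrier R" for a b c d
    using that x by algebra
  have "\<alpha> 0 \<in> carrier R" "\<beta> 0 \<in> carrier R" "pv x n (\<lambda>j. \<alpha> (Suc j)) \<in> carrier R" "pv x n (\<lambda>j. \<beta> (Suc j)) \<in> carrier R"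
    using Suc(2,3) by simp_all
  then show ?case unfolding pv.simps IH by (rule alg)
qed (simp add: minus_eq)

end

text \<open>The field of rational functions in \<open>x\<close> over \<open>k\<close>, described by
  the existence of a nonzero denominator; numerator and denominator have unspecified
  degrees.\<close>

definition fractions :: "'a \<Rightarrow> 'a set" where
  "fractions x = {f \<in> carrier R. \<exists>l m. \<exists>b\<in>B x l. b \<noteq> \<zero> \<and> b \<otimes> f \<in> B x m}"

lemma fractionsI:
  "x \<in> carrier R \<Longrightarrow> f \<in> carrier R \<Longrightarrow> b \<in> B x l \<Longrightarrow> b \<noteq> \<zero> \<Longrightarrow> b \<otimes> f \<in> B x m \<Longrightarrow> f \<in> fractions x"
  unfolding fractions_def by blast

lemma fractionsE:
  assumes "f \<in> fractions x"
  obtains b l m where "f \<in> carrier R" "b \<in> B x l" "b \<noteq> \<zero>" "b \<otimes> f \<in> B x m"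
  using assms unfolding fractions_def by blast

lemma fractions_subfield:
  assumes x [simp]: "x \<in> carrier R"
  shows "subfield (fractions x) R"
proof (rule subfieldI'[OF subringI])
  show "fractions x \<subseteq> carrier R" by (auto simp: fractions_def)
  show "\<one> \<in> fractions x" by (rule fractionsI[OF x, of _ \<one> 0 0]) (simp_all add: k_ring)
  fix f assume "f \<in> fractions x"
  then obtain b l m where f: "f \<in> carrier R" "b \<in> B x l" "b \<noteq> \<zero>" "b \<otimes> f \<in> B x m" by (rule fractionsE)
  have bc: "b \<in> carrier R" using B_closed[OF x f(2)] .
  show "\<ominus> f \<in> fractions x"
    using B_neg[OF x f(4)] f bc by (intro fractionsI[OF x _ f(2,3), of _ m]) (simp_all add: r_minus)
  fix f' assume "f' \<in> fractions x"
  then obtain b' l' m' where f': "f' \<in> carrier R" "b' \<in> B x l'" "b' \<noteq> \<zero>" "b' \<otimes> f' \<in> B x m'" by (rule fractionsE)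
  have bc': "b' \<in> carrier R" using B_closed[OF x f'(2)] .
  have bb: "b \<otimes> b' \<in> B x (l + l')" "b \<otimes> b' \<noteq> \<zero>" using B_mult[OF x f(2) f'(2)] f f' bc bc' by (auto simp: integral_iff)
  have "(b \<otimes> b') \<otimes> (f \<otimes> f') = (b \<otimes> f) \<otimes> (b' \<otimes> f')" using f(1) f'(1) bc bc' by algebra
  then show "f \<otimes> f' \<in> fractions x"
    using B_mult[OF x f(4) f'(4)] f(1) f'(1) by (intro fractionsI[OF x _ bb, of _ "m + m'"]) simp_all
  have "(b \<otimes> b') \<otimes> (f \<oplus> f') = b' \<otimes> (b \<otimes> f) \<oplus> b \<otimes> (b' \<otimes> f')" using f(1) f'(1) bc bc' by algebra
  moreover have "b' \<otimes> (b \<otimes> f) \<in> B x (l + l' + m + m')"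
    using B_mult[OF x f'(2) f(4)] by (rule B_mono[OF x, rotated]) simp
  moreover have "b \<otimes> (b' \<otimes> f') \<in> B x (l + l' + m + m')"
    using B_mult[OF x f(2) f'(4)] by (rule B_mono[OF x, rotated]) simp
  ultimately show "f \<oplus> f' \<in> fractions x"
    using B_add[OF x] f(1) f'(1) by (intro fractionsI[OF x _ bb, of _ "l + l' + m + m'"]) simp_all
next
  fix f assume "f \<in> fractions x - {\<zero>}"
  then obtain b l m where f: "f \<in> carrier R" "f \<noteq> \<zero>" "b \<in> B x l" "b \<noteq> \<zero>" "b \<otimes> f \<in> B x m"
    using fractionsE by (metis DiffE insertI1)
  have bc: "b \<in> carrier R" using B_closed[OF x f(3)] .
  have u: "f \<in> Units R" using f field_Units by auto
  note ui = Units_inv_closed[OF u]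
  have "(b \<otimes> f) \<otimes> inv f = b" using m_assoc[OF bc f(1) ui] Units_r_inv[OF u] bc by simp
  moreover have "b \<otimes> f \<noteq> \<zero>" using f bc by (simp add: integral_iff)
  ultimately show "inv f \<in> fractions x"
    using ui f(3) by (intro fractionsI[OF x _ f(5), of _ l]) simp_all
qed

lemma generate_field_fractions:
  assumes x: "x \<in> carrier R"
  shows "generate_field R (insert x k) \<subseteq> fractions x"
proof (rule generate_field_min_subfield1[OF _ fractions_subfield[OF x]])
  show "insert x k \<subseteq> carrier R" using x k_ring(1) by blast
  have "x \<in> fractions x" using x_in_B[OF x] x k_ring(3) by (intro fractionsI[OF x x, of \<one> 0 1]) simp_all
  moreover have "c \<in> fractions x" if "c \<in> k" for c
    using that x k_ring(3) by (intro fractionsI[OF x _ , of _ \<one> 0 0]) simp_all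
  ultimately show "insert x k \<subseteq> fractions x" by blast
qed

text \<open>An increasing filtration by finite sets, compatible with the degree filtration of the
  polynomials in \<open>t\<close>, which reaches every element of \<open>V\<close> after a
  denominator is cleared. It plays the role of functions with poles of order at most
  \<open>m\<close> at infinity; \<open>n\<close> is the dimension over the rational functions and
  gives the growth rate.\<close>

definition good :: "'a \<Rightarrow> (nat \<Rightarrow> 'a set) \<Rightarrow> nat \<Rightarrow> 'a set \<Rightarrow> bool" where
  "good t E n V \<longleftrightarrow> V \<subseteq> carrier R \<and>
     (\<forall>m. E m \<subseteq> carrier R \<and> \<zero> \<in> E m \<and> E m \<subseteq> E (Suc m) \<and> finite (E m) \<and> card (E m) \<le> card k ^ (n * (m + 1)) \<and>
        (\<forall>e\<in>E m. \<forall>e'\<in>E m. e \<oplus> e' \<in> E m)) \<and>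
     (\<forall>l m. \<forall>b\<in>B t l. \<forall>e\<in>E m. b \<otimes> e \<in> E (l + m)) \<and>
     (\<forall>f\<in>V. \<exists>l. \<exists>b\<in>B t l. b \<noteq> \<zero> \<and> (\<exists>m. b \<otimes> f \<in> E m))"

lemma goodD:
  assumes "good t E n V"
  shows "V \<subseteq> carrier R" "E m \<subseteq> carrier R" "\<zero> \<in> E m" "m \<le> m' \<Longrightarrow> E m \<subseteq> E m'" "finite (E m)"
    "card (E m) \<le> card k ^ (n * (m + 1))" "e \<in> E m \<Longrightarrow> e' \<in> E m \<Longrightarrow> e \<oplus> e' \<in> E m"
    "b \<in> B t l \<Longrightarrow> e \<in> E m \<Longrightarrow> b \<otimes> e \<in> E (l + m)"
    "f \<in> V \<Longrightarrow> \<exists>l. \<exists>b\<in>B t l. b \<noteq> \<zero> \<and> (\<exists>m. b \<otimes> f \<in> E m)"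
    "e \<in> E m \<Longrightarrow> e \<in> carrier R"
  using assms lift_Suc_mono_le[of E m m'] unfolding good_def by blast+

text \<open>Induction along a basis: each new vector contributes one copy of \<open>B t m\<close>.
  The second half says that multiplication by \<open>f\<close> is bounded, up to one denominator and
  one shift. The subspaces of the induction need not be stable under \<open>f\<close>; therefore the
  products are measured by an arbitrary filtration \<open>E'\<close> of the whole field.\<close>

lemma good_ex:
  assumes t: "t \<in> carrier R"
  shows "dimension n K V \<Longrightarrow> K \<subseteq> fractions t \<Longrightarrow>
    \<exists>E. good t E n V \<and> (\<forall>E' n'. good t E' n' (carrier R) \<longrightarrow> (\<forall>f\<in>carrier R. \<exists>l. \<exists>b\<in>B t l. b \<noteq> \<zero> \<and>
      (\<exists>\<delta>. \<forall>m. \<forall>e\<in>E m. b \<otimes> (f \<otimes> e) \<in> E' (m + \<delta>))))"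
proof (induction rule: dimension.induct)
  case (zero_dim K)
  have "good t (\<lambda>_. {\<zero>}) 0 {\<zero>}"
    unfolding good_def using B_closed[OF t] k_ring(3)
    by (auto intro!: exI[of _ 0] bexI[of _ \<one>])
  moreover have "\<exists>l. \<exists>b\<in>B t l. b \<noteq> \<zero> \<and> (\<exists>\<delta>. \<forall>m. \<forall>e\<in>{\<zero>}. b \<otimes> (f \<otimes> e) \<in> E' (m + \<delta>))"
    if "good t E' n' (carrier R)" "f \<in> carrier R" for E' n' f
    using that k_ring(3) goodD(3)[OF that(1)] by (intro exI[of _ 0] bexI[of _ \<one>]) auto
  ultimately show ?case by blast
next
  case (Suc_dim v V n K)
  then obtain E where E: "good t E n V" and
    E': "\<And>E' n' f. good t E' n' (carrier R) \<Longrightarrow> f \<in> carrier R \<Longrightarrow> \<exists>l. \<exists>b\<in>B t l. b \<noteq> \<zero> \<and>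
      (\<exists>\<delta>. \<forall>m. \<forall>e\<in>E m. b \<otimes> (f \<otimes> e) \<in> E' (m + \<delta>))" by blast
  note v = Suc_dim(1) and K = Suc_dim(5)
  note g = goodD[OF E] and Bt = B_closed[OF t]
  have ec: "e \<in> carrier R" if "e \<in> E m" for e m using goodD(10)[OF E that] .
  define E2 where "E2 m = (\<lambda>(b, e). b \<otimes> v \<oplus> e) ` (B t m \<times> E m)" for m
  have E2I: "b \<otimes> v \<oplus> e \<in> E2 m" if "b \<in> B t m" "e \<in> E m" for b e m
    using that unfolding E2_def by (intro image_eqI[of _ _ "(b, e)"]) simp_all
  have E2E: "\<exists>b\<in>B t m. \<exists>e\<in>E m. y = b \<otimes> v \<oplus> e" if "y \<in> E2 m" for y m
    using that unfolding E2_def by auto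
  have Kc: "\<kappa> \<in> carrier R" if "\<kappa> \<in> K" for \<kappa> using that K by (auto simp: fractions_def)
  have "good t E2 (Suc n) (line_extension K v V)"
    unfolding good_def
  proof (intro conjI allI ballI)
    show "line_extension K v V \<subseteq> carrier R"
      using g(1) Kc v by (auto simp: line_extension_mem_iff subset_iff)
    fix m
    show "E2 m \<subseteq> carrier R" using Bt ec v unfolding E2_def by auto
    show "\<zero> \<in> E2 m" using E2I[OF B_zero[OF t] g(3)[of m]] v by simp
    show "E2 m \<subseteq> E2 (Suc m)" using B_mono_Suc[OF t, of m] g(4)[of m "Suc m"] unfolding E2_def by auto
    show "finite (E2 m)" using B_finite_card[OF t] g(5) unfolding E2_def by blast
    have "card (E2 m) \<le> card (B t m \<times> E m)" unfolding E2_def using B_finite_card[OF t] g(5) by (intro card_image_le) blast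
    also have "\<dots> \<le> card k ^ (m + 1) * card k ^ (n * (m + 1))"
      unfolding card_cartesian_product using B_finite_card[OF t] g(6) by (intro mult_mono) auto
    finally show "card (E2 m) \<le> card k ^ (Suc n * (m + 1))" by (simp add: power_add mult.assoc mult.left_commute)
  next
    fix m y y' assume "y \<in> E2 m" "y' \<in> E2 m"
    then obtain b e b' e' where 1: "b \<in> B t m" "e \<in> E m" "y = b \<otimes> v \<oplus> e" "b' \<in> B t m" "e' \<in> E m" "y' = b' \<otimes> v \<oplus> e'"
      using E2E by metis
    have "y \<oplus> y' = (b \<oplus> b') \<otimes> v \<oplus> (e \<oplus> e')" unfolding 1 using Bt[OF 1(1)] Bt[OF 1(4)] ec[OF 1(2)] ec[OF 1(5)] v by algebra
    then show "y \<oplus> y' \<in> E2 m" using E2I[OF B_add[OF t 1(1,4)] g(7)[OF 1(2,5)]] by simp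
  next
    fix l m b y assume b: "b \<in> B t l" and "y \<in> E2 m"
    then obtain b' e where 1: "b' \<in> B t m" "e \<in> E m" "y = b' \<otimes> v \<oplus> e" using E2E by metis
    have "b \<otimes> y = (b \<otimes> b') \<otimes> v \<oplus> b \<otimes> e" unfolding 1 using Bt[OF 1(1)] Bt[OF b] ec[OF 1(2)] v by algebra
    then show "b \<otimes> y \<in> E2 (l + m)" using E2I[OF B_mult[OF t b 1(1)] g(8)[OF b 1(2)]] by simp
  next
    fix f assume "f \<in> line_extension K v V"
    then obtain \<kappa> w where f: "\<kappa> \<in> K" "w \<in> V" "f = \<kappa> \<otimes> v \<oplus> w" unfolding line_extension_mem_iff by blast
    obtain b1 l1 m1 where b1: "\<kappa> \<in> carrier R" "b1 \<in> B t l1" "b1 \<noteq> \<zero>" "b1 \<otimes> \<kappa> \<in> B t m1"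
      using f(1) K fractionsE by (metis subsetD)
    obtain b2 l2 m2 where b2: "b2 \<in> B t l2" "b2 \<noteq> \<zero>" "b2 \<otimes> w \<in> E m2" using g(9)[OF f(2)] by blast
    have c: "b1 \<in> carrier R" "b2 \<in> carrier R" "w \<in> carrier R" using Bt[OF b1(2)] Bt[OF b2(1)] f(2) g(1) by blast+
    have "(b1 \<otimes> b2) \<otimes> f = (b2 \<otimes> (b1 \<otimes> \<kappa>)) \<otimes> v \<oplus> b1 \<otimes> (b2 \<otimes> w)" unfolding f using c b1(1) v by algebra
    moreover have "b2 \<otimes> (b1 \<otimes> \<kappa>) \<in> B t (l2 + m1 + l1 + m2)"
      using B_mult[OF t b2(1) b1(4)] by (rule B_mono[OF t, rotated]) simp
    moreover have "b1 \<otimes> (b2 \<otimes> w) \<in> E (l2 + m1 + l1 + m2)"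
      using g(8)[OF b1(2) b2(3)] g(4)[of "l1 + m2" "l2 + m1 + l1 + m2"] by auto
    ultimately have "(b1 \<otimes> b2) \<otimes> f \<in> E2 (l2 + m1 + l1 + m2)" using E2I by simp
    moreover have "b1 \<otimes> b2 \<noteq> \<zero>" using c b1(3) b2(2) by (simp add: integral_iff)
    ultimately show "\<exists>l. \<exists>b\<in>B t l. b \<noteq> \<zero> \<and> (\<exists>m. b \<otimes> f \<in> E2 m)" using B_mult[OF t b1(2) b2(1)] by blast
  qed
  \<comment> \<open>On the new line only the single product of \<open>f\<close> and \<open>v\<close>
    has to be controlled, since coefficients from \<open>B t\<close> pass through \<open>E'\<close>.
    A common denominator is the product of the one for this element and the one from the induction
    hypothesis.\<close>
  moreover have "\<exists>l. \<exists>b\<in>B t l. b \<noteq> \<zero> \<and> (\<exists>\<delta>. \<forall>m. \<forall>e\<in>E2 m. b \<otimes> (f \<otimes> e) \<in> E' (m + \<delta>))"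
    if G: "good t E' n' (carrier R)" and f: "f \<in> carrier R" for E' n' f
  proof -
    note h = goodD[OF G]
    obtain l2 b2 \<delta>2 where b2: "b2 \<in> B t l2" "b2 \<noteq> \<zero>" "\<And>m e. e \<in> E m \<Longrightarrow> b2 \<otimes> (f \<otimes> e) \<in> E' (m + \<delta>2)"
      using E'[OF G f] by blast
    have "f \<otimes> v \<in> carrier R" using f v by simp
    from h(9)[OF this] obtain l1 b1 \<delta>1 where b1: "b1 \<in> B t l1" "b1 \<noteq> \<zero>" "b1 \<otimes> (f \<otimes> v) \<in> E' \<delta>1" by blast
    have c: "b1 \<in> carrier R" "b2 \<in> carrier R" using Bt[OF b1(1)] Bt[OF b2(1)] by blast+
    have "(b1 \<otimes> b2) \<otimes> (f \<otimes> y) \<in> E' (m + (l1 + l2 + \<delta>1 + \<delta>2))" if y: "y \<in> E2 m" for y m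
    proof -
      obtain b e where 1: "b \<in> B t m" "e \<in> E m" "y = b \<otimes> v \<oplus> e" using E2E y by metis
      have "(b1 \<otimes> b2) \<otimes> (f \<otimes> y) = (b2 \<otimes> b) \<otimes> (b1 \<otimes> (f \<otimes> v)) \<oplus> b1 \<otimes> (b2 \<otimes> (f \<otimes> e))"
        unfolding 1 using c Bt[OF 1(1)] ec[OF 1(2)] v f by algebra
      moreover have "(b2 \<otimes> b) \<otimes> (b1 \<otimes> (f \<otimes> v)) \<in> E' (m + (l1 + l2 + \<delta>1 + \<delta>2))"
        using h(8)[OF B_mult[OF t b2(1) 1(1)] b1(3)] h(4)[of "l2 + m + \<delta>1" "m + (l1 + l2 + \<delta>1 + \<delta>2)"] by auto
      moreover have "b1 \<otimes> (b2 \<otimes> (f \<otimes> e)) \<in> E' (m + (l1 + l2 + \<delta>1 + \<delta>2))"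
        using h(8)[OF b1(1) b2(3)[OF 1(2)]] h(4)[of "l1 + (m + \<delta>2)" "m + (l1 + l2 + \<delta>1 + \<delta>2)"] by auto
      ultimately show ?thesis using h(7) by simp
    qed
    moreover have "b1 \<otimes> b2 \<noteq> \<zero>" using c b1(2) b2(2) by (simp add: integral_iff)
    ultimately show ?thesis using B_mult[OF t b1(1) b2(1)] by blast
  qed
  ultimately show ?case by blast
qed

text \<open>Pigeonhole: the \<open>k\<close>-combinations of \<open>g\<^sup>j u\<^sub>i\<close> (\<open>i < M\<close>, \<open>j < J\<close>) lie in a space whose dimension
  grows in \<open>J\<close> with a slope independent of \<open>M\<close>.\<close>

lemma pv_relation_ex:
  assumes t: "t \<in> carrier R" and fin: "finite_dimension (generate_field R (insert t k)) (carrier R)"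
    and g: "g \<in> carrier R"
  shows "\<exists>M::nat. \<forall>u. (\<forall>i<M. u i \<in> carrier R) \<longrightarrow> (\<exists>J \<beta>. (\<forall>i j. \<beta> i j \<in> k) \<and>
     (\<exists>i<M. \<exists>j<J. \<beta> i j \<noteq> \<zero>) \<and> (\<Oplus>i\<in>{..<M}. pv g J (\<beta> i) \<otimes> u i) = \<zero>)"
proof -
  obtain N where N: "dimension N (generate_field R (insert t k)) (carrier R)" using fin finite_dimensionE' by blast
  obtain E where E: "good t E N (carrier R)" and
    E': "\<forall>E' n'. good t E' n' (carrier R) \<longrightarrow> (\<forall>f\<in>carrier R. \<exists>l. \<exists>b\<in>B t l. b \<noteq> \<zero> \<and>
      (\<exists>\<delta>. \<forall>m. \<forall>e\<in>E m. b \<otimes> (f \<otimes> e) \<in> E' (m + \<delta>)))"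
    using good_ex[OF t N generate_field_fractions[OF t]] by (elim exE conjE)
  note h = goodD[OF E] and Bt = B_closed[OF t]
  have ec: "e \<in> carrier R" if "e \<in> E m" for e m using h(10)[OF that] .
  \<comment> \<open>\<open>b\<close> is a denominator for multiplication by \<open>g\<close>, which
    then raises the filtration index by at most \<open>\<delta>\<close>; multiplication by
    \<open>b\<close> itself raises it by at most \<open>l\<close>.\<close>
  obtain l b \<delta> where b: "b \<in> B t l" "b \<noteq> \<zero>" "\<And>m e. e \<in> E m \<Longrightarrow> b \<otimes> (g \<otimes> e) \<in> E (m + \<delta>)"
    using E' E g by meson
  have bc: "b \<in> carrier R" using Bt[OF b(1)] .
  have bpow: "b [^] J \<in> B t (J * l)" for J :: nat
  proof (induction J)
    case (Suc J) then show ?case using B_mult[OF t Suc b(1)] by (simp add: add.commute)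
  qed (simp add: k_ring)
  \<comment> \<open>Every Horner step costs one factor \<open>b\<close> and raises the index by at
    most \<open>l + \<delta>\<close>. This is the slope that does not depend on the number of
    elements \<open>u i\<close>.\<close>
  have pvE: "b [^] J \<otimes> (pv g J \<alpha> \<otimes> e) \<in> E (m + J * (l + \<delta>))" if "e \<in> E m" "\<And>j. \<alpha> j \<in> k" for J \<alpha> e m
    using that
  proof (induction J arbitrary: \<alpha>)
    case 0
    then show ?case using h(3) ec[OF 0(1)] by simp
  next
    case (Suc J)
    let ?p = "pv g J (\<lambda>j. \<alpha> (Suc j))"
    have IH: "b [^] J \<otimes> (?p \<otimes> e) \<in> E (m + J * (l + \<delta>))"
      by (rule Suc.IH[OF Suc.prems(1)]) (rule Suc.prems(2))
    have c: "\<alpha> 0 \<in> carrier R" "?p \<in> carrier R" "e \<in> carrier R" "b [^] J \<in> carrier R"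
      using Suc(2,3) ec g bc by auto
    have alg: "(z \<otimes> b) \<otimes> ((a \<oplus> g \<otimes> w) \<otimes> e) = (z \<otimes> b) \<otimes> (a \<otimes> e) \<oplus> b \<otimes> (g \<otimes> (z \<otimes> (w \<otimes> e)))"
      if "z \<in> carrier R" "a \<in> carrier R" "w \<in> carrier R" for z a w
      using that c(3) g bc by algebra
    have "b [^] Suc J \<otimes> (pv g (Suc J) \<alpha> \<otimes> e) = b [^] Suc J \<otimes> (\<alpha> 0 \<otimes> e) \<oplus> b \<otimes> (g \<otimes> (b [^] J \<otimes> (?p \<otimes> e)))"
      using alg[OF c(4,1,2)] by simp
    moreover have "b [^] Suc J \<otimes> (\<alpha> 0 \<otimes> e) \<in> E (m + Suc J * (l + \<delta>))"
    proof -
      have "\<alpha> 0 \<otimes> e \<in> E m" using h(8)[of "\<alpha> 0" 0 e m] Suc by simp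
      then have "b [^] Suc J \<otimes> (\<alpha> 0 \<otimes> e) \<in> E (Suc J * l + m)" using h(8)[OF bpow] by blast
      then show ?thesis using h(4)[of "Suc J * l + m" "m + Suc J * (l + \<delta>)"] by (auto simp: algebra_simps)
    qed
    moreover have "b \<otimes> (g \<otimes> (b [^] J \<otimes> (?p \<otimes> e))) \<in> E (m + Suc J * (l + \<delta>))"
      using b(3)[OF IH] h(4)[of "m + J * (l + \<delta>) + \<delta>" "m + Suc J * (l + \<delta>)"] by auto
    ultimately show ?case using h(7) by simp
  qed
  \<comment> \<open>One more than the slope. There are \<open>J * M\<close> free coefficients, while
    the values lie in a set of size at most \<open>card k\<close> to the power
    \<open>N * (m0 + 1) + J * (M - 1)\<close>. So any \<open>J\<close> larger than
    \<open>N * (m0 + 1)\<close> forces a coincidence.\<close>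
  define M where "M = N * (l + \<delta>) + 1"
  show ?thesis
  proof (rule exI[of _ M], intro allI impI)
    fix u assume u: "\<forall>i<M. u i \<in> carrier R"
    \<comment> \<open>A common denominator for the elements \<open>u i\<close>, and one index that
      contains all of them.\<close>
    have "\<exists>l. \<exists>c\<in>B t l. c \<noteq> \<zero> \<and> (\<exists>m. \<forall>i<M'. c \<otimes> u i \<in> E m)" if "M' \<le> M" for M'
      using that
    proof (induction M')
      case 0
      then show ?case using k_ring(3) by (intro exI[of _ 0] bexI[of _ \<one>]) auto
    next
      case (Suc M')
      then obtain l1 c1 m1 where c1: "c1 \<in> B t l1" "c1 \<noteq> \<zero>" "\<And>i. i < M' \<Longrightarrow> c1 \<otimes> u i \<in> E m1" by (meson Suc_leD)
      have uM: "u M' \<in> carrier R" using u Suc by simp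
      obtain l2 c2 m2 where c2: "c2 \<in> B t l2" "c2 \<noteq> \<zero>" "c2 \<otimes> u M' \<in> E m2" using h(9)[OF uM] by blast
      have c: "c1 \<in> carrier R" "c2 \<in> carrier R" using Bt[OF c1(1)] Bt[OF c2(1)] .
      have "(c1 \<otimes> c2) \<otimes> u i \<in> E (l1 + l2 + m1 + m2)" if i: "i < Suc M'" for i
      proof (cases "i = M'")
        case True
        have "(c1 \<otimes> c2) \<otimes> u i \<in> E (l1 + m2)" unfolding True using h(8)[OF c1(1) c2(3)] c uM by (simp add: m_assoc)
        then show ?thesis using h(4)[of "l1 + m2" "l1 + l2 + m1 + m2"] by auto
      next
        case False
        then have iM: "i < M'" using i by simp
        have ui: "u i \<in> carrier R" using u Suc iM by simp
        have "(c1 \<otimes> c2) \<otimes> u i = c2 \<otimes> (c1 \<otimes> u i)" using c ui by algebra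
        then have "(c1 \<otimes> c2) \<otimes> u i \<in> E (l2 + m1)" using h(8)[OF c2(1) c1(3)[OF iM]] by simp
        then show ?thesis using h(4)[of "l2 + m1" "l1 + l2 + m1 + m2"] by auto
      qed
      moreover have "c1 \<otimes> c2 \<noteq> \<zero>" using c c1(2) c2(2) by (simp add: integral_iff)
      ultimately show ?case using B_mult[OF t c1(1) c2(1)] by blast
    qed
    then obtain l0 c m0 where c: "c \<in> B t l0" "c \<noteq> \<zero>" "\<And>i. i < M \<Longrightarrow> c \<otimes> u i \<in> E m0" by blast
    have cc: "c \<in> carrier R" using Bt[OF c(1)] .
    define J where "J = N * (m0 + 1) + 1"
    define D where "D = m0 + J * (l + \<delta>)"
    let ?A = "{..<M} \<rightarrow>\<^sub>E ({..<J} \<rightarrow>\<^sub>E k)"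
    \<comment> \<open>\<open>pv\<close> takes coefficient functions defined on all indices, so the
      tuples are continued by zero to stay inside \<open>k\<close>.\<close>
    define e where "e \<alpha> i j = (if i < M \<and> j < J then \<alpha> i j else \<zero>)" for \<alpha> :: "nat \<Rightarrow> nat \<Rightarrow> 'a" and i j
    have ek: "e \<alpha> i j \<in> k" if "\<alpha> \<in> ?A" for \<alpha> i j
      using that k_ring(2) unfolding e_def by (auto simp: PiE_iff)
    define \<Phi> where "\<Phi> \<alpha> = (\<Oplus>i\<in>{..<M}. pv g J (e \<alpha> i) \<otimes> u i)" for \<alpha>
    have term_c: "pv g J (e \<alpha> i) \<otimes> u i \<in> carrier R" if "\<alpha> \<in> ?A" "i < M" for \<alpha> i
      using pv_closed[OF g, of "e \<alpha> i"] ek[OF that(1)] u that(2) by simp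
    have bJ: "c \<otimes> b [^] J \<in> carrier R" using cc bc by simp
    have sum_E: "(\<Oplus>i\<in>I. f i) \<in> E D" if "finite I" "\<And>i. i \<in> I \<Longrightarrow> f i \<in> E D" for I :: "nat set" and f
      using that
    proof (induction I rule: finite_induct)
      case empty then show ?case using h(3) by simp
    next
      case (insert i I)
      have "f \<in> I \<rightarrow> carrier R" "f i \<in> carrier R" using insert(4) ec[of _ D] by blast+
      then show ?case using insert h(7)[of "f i" D] by (simp add: finsum_insert)
    qed
    have mem: "(c \<otimes> b [^] J) \<otimes> \<Phi> \<alpha> \<in> E D" if a: "\<alpha> \<in> ?A" for \<alpha>
    proof -
      have "(c \<otimes> b [^] J) \<otimes> \<Phi> \<alpha> = (\<Oplus>i\<in>{..<M}. (c \<otimes> b [^] J) \<otimes> (pv g J (e \<alpha> i) \<otimes> u i))"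
        unfolding \<Phi>_def using term_c[OF a] bJ by (intro finsum_rdistr) auto
      also have "\<dots> \<in> E D"
      proof (rule sum_E)
        fix i assume i: "i \<in> {..<M}"
        have pc: "pv g J (e \<alpha> i) \<in> carrier R" using pv_closed[OF g] ek[OF a] by blast
        have "(c \<otimes> b [^] J) \<otimes> (pv g J (e \<alpha> i) \<otimes> u i) = b [^] J \<otimes> (pv g J (e \<alpha> i) \<otimes> (c \<otimes> u i))"
          using cc bc pc u i by (simp add: m_ac)
        then show "(c \<otimes> b [^] J) \<otimes> (pv g J (e \<alpha> i) \<otimes> u i) \<in> E D"
          unfolding D_def using pvE[OF c(3), of i "e \<alpha> i" J] ek[OF a] i by simp
      qed simp
      finally show ?thesis .
    qed
    have \<Phi>c: "\<Phi> \<alpha> \<in> carrier R" if "\<alpha> \<in> ?A" for \<alpha>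
      unfolding \<Phi>_def using term_c[OF that] by (intro finsum_closed) auto
    have finA: "finite ?A" using k_finite by (intro finite_PiE) auto
    have "\<not> inj_on (\<lambda>\<alpha>. (c \<otimes> b [^] J) \<otimes> \<Phi> \<alpha>) ?A"
    proof
      assume inj: "inj_on (\<lambda>\<alpha>. (c \<otimes> b [^] J) \<otimes> \<Phi> \<alpha>) ?A"
      have "card ?A \<le> card (E D)" by (rule card_inj_on_le[OF inj _ h(5)]) (use mem in blast)
      also have "\<dots> \<le> card k ^ (N * (D + 1))" by (rule h(6))
      finally have "card k ^ (J * M) \<le> card k ^ (N * (D + 1))" by (simp add: card_PiE power_mult[symmetric])
      then have "J * M \<le> N * (D + 1)" using k_card by (simp add: power_increasing_iff)
      then show False by (simp add: D_def J_def M_def algebra_simps)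
    qed
    then obtain \<alpha> \<alpha>' where a: "\<alpha> \<in> ?A" "\<alpha>' \<in> ?A" "\<alpha> \<noteq> \<alpha>'" "(c \<otimes> b [^] J) \<otimes> \<Phi> \<alpha> = (c \<otimes> b [^] J) \<otimes> \<Phi> \<alpha>'"
      unfolding inj_on_def by blast
    have "c \<otimes> b [^] J \<noteq> \<zero>"
    proof -
      have "b [^] J \<noteq> \<zero>" using b(2) bc by (induction J) (simp_all add: integral_iff)
      then show ?thesis using c(2) cc bc by (simp add: integral_iff)
    qed
    then have eq: "\<Phi> \<alpha> = \<Phi> \<alpha>'" using a(4) m_lcancel[OF _ bJ \<Phi>c[OF a(1)] \<Phi>c[OF a(2)]] by blast
    \<comment> \<open>The difference of two distinct coefficient tuples with the same value gives a
      nontrivial relation.\<close>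
    define \<beta> where "\<beta> i j = e \<alpha> i j \<ominus> e \<alpha>' i j" for i j
    have "\<beta> i j \<in> k" for i j
      unfolding \<beta>_def minus_eq by (intro k_ring(7) k_ring(5) ek a(1,2))
    moreover have "\<exists>i<M. \<exists>j<J. \<beta> i j \<noteq> \<zero>"
    proof (rule ccontr)
      assume no: "\<not> ?thesis"
      have "\<alpha> i j = \<alpha>' i j" if ij: "i < M" "j < J" for i j
      proof -
        have "\<alpha> i j \<in> k" "\<alpha>' i j \<in> k" using ek[OF a(1), of i j] ek[OF a(2), of i j] ij by (auto simp: e_def)
        moreover have "\<alpha> i j \<ominus> \<alpha>' i j = \<zero>" using no ij unfolding \<beta>_def e_def by auto
        ultimately show ?thesis by simp
      qed
      moreover have "\<alpha> i \<in> {..<J} \<rightarrow>\<^sub>E k" "\<alpha>' i \<in> {..<J} \<rightarrow>\<^sub>E k" if "i < M" for i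
        using a(1,2) that by auto
      ultimately have "\<alpha> i = \<alpha>' i" if "i < M" for i
        using that by (intro vec_eqI[of _ J k]) auto
      then have "\<alpha> = \<alpha>'" by (intro vec_eqI[OF a(1,2)])
      then show False using a(3) by blast
    qed
    moreover have "(\<Oplus>i\<in>{..<M}. pv g J (\<beta> i) \<otimes> u i) = \<zero>"
    proof -
      have pc: "pv g J (e \<alpha> i) \<in> carrier R" if "\<alpha> \<in> ?A" for \<alpha> i using pv_closed[OF g] ek[OF that] by blast
      have "pv g J (\<beta> i) = pv g J (e \<alpha> i) \<ominus> pv g J (e \<alpha>' i)" for i
        unfolding \<beta>_def using ek a(1,2) by (intro pv_diff[OF g]) blast+
      then have t1: "pv g J (e \<alpha> i) \<otimes> u i = pv g J (\<beta> i) \<otimes> u i \<oplus> pv g J (e \<alpha>' i) \<otimes> u i"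
        and t2: "pv g J (\<beta> i) \<otimes> u i \<in> carrier R" if "i < M" for i
        using pc[OF a(1), of i] pc[OF a(2), of i] u that
        by (simp_all add: l_distr[symmetric] minus_eq a_assoc l_neg)
      have "\<Phi> \<alpha> = (\<Oplus>i\<in>{..<M}. pv g J (\<beta> i) \<otimes> u i \<oplus> pv g J (e \<alpha>' i) \<otimes> u i)"
        unfolding \<Phi>_def using t1 t2 term_c[OF a(2)] by (intro finsum_cong') auto
      also have "\<dots> = (\<Oplus>i\<in>{..<M}. pv g J (\<beta> i) \<otimes> u i) \<oplus> \<Phi> \<alpha>'"
        unfolding \<Phi>_def using t2 term_c[OF a(2)] by (intro finsum_addf) auto
      finally have "\<zero> \<oplus> \<Phi> \<alpha>' = (\<Oplus>i\<in>{..<M}. pv g J (\<beta> i) \<otimes> u i) \<oplus> \<Phi> \<alpha>'" using eq \<Phi>c[OF a(2)] by simp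
      moreover have "(\<Oplus>i\<in>{..<M}. pv g J (\<beta> i) \<otimes> u i) \<in> carrier R" using t2 by (intro finsum_closed) auto
      ultimately show ?thesis using \<Phi>c[OF a(2)] by (metis a_comm add.r_cancel zero_closed)
    qed
    ultimately show "\<exists>J \<beta>. (\<forall>i j. \<beta> i j \<in> k) \<and> (\<exists>i<M. \<exists>j<J. \<beta> i j \<noteq> \<zero>) \<and>
       (\<Oplus>i\<in>{..<M}. pv g J (\<beta> i) \<otimes> u i) = \<zero>" by blast
  qed
qed

text \<open>If all constant terms vanish, a factor \<open>g\<close> can be cancelled from the
  relation and the coefficients shift down; so a relation with a nonzero constant term exists. At a
  zero of \<open>g\<close> it becomes a nontrivial linear relation over \<open>k\<close>.\<close>

lemma relation_ex:
  assumes t: "t \<in> carrier R" and fin: "finite_dimension (generate_field R (insert t k)) (carrier R)"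
    and g: "g \<in> carrier R" "g \<noteq> \<zero>"
  shows "\<exists>M::nat. \<forall>u. (\<forall>i<M. u i \<in> carrier R) \<longrightarrow> (\<exists>\<alpha> w. (\<forall>i. \<alpha> i \<in> k \<and> (\<exists>m. w i \<in> B g m)) \<and>
     (\<exists>i<M. \<alpha> i \<noteq> \<zero>) \<and> (\<Oplus>i\<in>{..<M}. (\<alpha> i \<oplus> g \<otimes> w i) \<otimes> u i) = \<zero>)"
proof -
  obtain M :: nat where M: "\<forall>u. (\<forall>i<M. u i \<in> carrier R) \<longrightarrow> (\<exists>J \<beta>. (\<forall>i j. \<beta> i j \<in> k) \<and>
     (\<exists>i<M. \<exists>j<J. \<beta> i j \<noteq> \<zero>) \<and> (\<Oplus>i\<in>{..<M}. pv g J (\<beta> i) \<otimes> u i) = \<zero>)"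
    using pv_relation_ex[OF t fin g(1)] by (elim exE)
  show ?thesis
  proof (intro exI[of _ M] allI impI)
    fix u assume u: "\<forall>i<M. u i \<in> carrier R"
    obtain J \<beta> where "\<forall>i j. \<beta> i j \<in> k" "\<exists>i<M. \<exists>j<J. \<beta> i j \<noteq> \<zero>" "(\<Oplus>i\<in>{..<M}. pv g J (\<beta> i) \<otimes> u i) = \<zero>"
      using M[rule_format, of u] u by blast
    then show "\<exists>\<alpha> w. (\<forall>i. \<alpha> i \<in> k \<and> (\<exists>m. w i \<in> B g m)) \<and>
     (\<exists>i<M. \<alpha> i \<noteq> \<zero>) \<and> (\<Oplus>i\<in>{..<M}. (\<alpha> i \<oplus> g \<otimes> w i) \<otimes> u i) = \<zero>"
    proof (induction J arbitrary: \<beta>)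
      case 0 then show ?case by blast
    next
      case (Suc J)
      let ?w = "\<lambda>i. pv g J (\<lambda>j. \<beta> i (Suc j))"
      have w: "?w i \<in> B g J" for i using Suc(2) by (intro pv_in_B[OF g(1)]) blast
      have wc: "?w i \<in> carrier R" for i using B_closed[OF g(1) w] .
      show ?case
      proof (cases "\<exists>i<M. \<beta> i 0 \<noteq> \<zero>")
        case True
        then show ?thesis using Suc(2,4) w by (intro exI[of _ "\<lambda>i. \<beta> i 0"] exI[of _ ?w]) auto
      next
        case False
        have "(\<Oplus>i\<in>{..<M}. pv g (Suc J) (\<beta> i) \<otimes> u i) = (\<Oplus>i\<in>{..<M}. g \<otimes> (?w i \<otimes> u i))"
          using False u wc g by (intro finsum_cong') (simp_all add: m_assoc Pi_def)
        also have "\<dots> = g \<otimes> (\<Oplus>i\<in>{..<M}. ?w i \<otimes> u i)"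
          using u wc g by (intro finsum_rdistr[symmetric]) auto
        finally have "g \<otimes> (\<Oplus>i\<in>{..<M}. ?w i \<otimes> u i) = \<zero>" using Suc(4) by simp
        moreover have "(\<Oplus>i\<in>{..<M}. ?w i \<otimes> u i) \<in> carrier R" using u wc by (intro finsum_closed) auto
        ultimately have z: "(\<Oplus>i\<in>{..<M}. ?w i \<otimes> u i) = \<zero>" using g integral_iff by blast
        have "\<exists>i<M. \<exists>j<J. \<beta> i (Suc j) \<noteq> \<zero>" using Suc(3) False by (metis Suc_less_eq not0_implies_Suc)
        then show ?thesis using Suc(1)[of "\<lambda>i j. \<beta> i (Suc j)"] Suc(2) z by blast
      qed
    qed
  qed
qed

end

text \<open>An irreducible divisor of a nonunit generates a maximal ideal, hence the only one. An
  element not of the form unit times a power of \<open>p\<close> would be divisible by all powers of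
  \<open>p\<close>, and the cofactors would generate a strictly increasing chain of ideals.\<close>

lemma (in principal_domain) unif_ring_of_unique_maximal:
  assumes nf: "\<not> field R" and ex1: "\<exists>!J. maximalideal J R"
  shows "\<exists>p. unif_ring R p \<and> (\<forall>a\<in>carrier R. a \<noteq> \<zero> \<longrightarrow> (\<exists>u\<in>Units R. \<exists>i::nat. a = u \<otimes> p [^] i))"
proof -
  obtain J where J: "maximalideal J R" and uniq: "\<And>J'. maximalideal J' R \<Longrightarrow> J' = J" using ex1 by blast
  interpret J: maximalideal J R by (rule J)
  obtain p where p: "p \<in> carrier R" "J = PIdl p" using exists_gen[OF J.is_ideal] by blast
  have p0: "p \<noteq> \<zero>"
  proof
    assume "p = \<zero>"
    then have "J = {\<zero>}" unfolding p(2) cgenideal_def by (auto intro!: exI[of _ \<zero>])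
    then have "maximalideal {\<zero>} R" using J by simp
    then show False using nf zeromaximalideal_fieldI by blast
  qed
  have pu: "p \<notin> Units R"
    using ideal_unit_imp_carrier[OF J.is_ideal, of p] cgenideal_self[OF p(1)] p(2) J.I_notcarr by blast
  have gen: "\<exists>b\<in>carrier R. a = b \<otimes> p" if a: "a \<in> carrier R" "a \<notin> Units R" for a
  proof (cases "a = \<zero>")
    case True then show ?thesis using p(1) by (intro bexI[of _ \<zero>]) simp_all
  next
    case False
    then obtain b where b: "b \<in> carrier R" "ring_irreducible b" "b divides a"
      using exists_irreducible_divisor[of a] a by blast
    have "PIdl b = J" using uniq irreducible_imp_maximalideal[OF b(1,2)] by blast
    moreover have "a \<in> PIdl b" using b(1,3) unfolding cgenideal_def factor_def by (auto simp: m_comm)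
    ultimately show ?thesis using p(2) unfolding cgenideal_def by blast
  qed
  interpret unif_ring R p
    by (intro unif_ring.intro unif_ring_axioms.intro domain_axioms p(1) p0 pu gen)
  have "\<exists>u\<in>Units R. \<exists>i::nat. a = u \<otimes> p [^] i" if a: "a \<in> carrier R" "a \<noteq> \<zero>" for a
  proof (rule ccontr)
    assume no: "\<not> ?thesis"
    have "\<exists>b\<in>carrier R. a = b \<otimes> p [^] i" for i :: nat
    proof (induction i)
      case 0 then show ?case using a(1) by simp
    next
      case (Suc i)
      then obtain b where b: "b \<in> carrier R" "a = b \<otimes> p [^] i" by blast
      then have "b \<notin> Units R" using no by blast
      then obtain c where "c \<in> carrier R" "b = c \<otimes> p" using gen b(1) by blast
      then show ?case using b p(1) by (intro bexI[of _ c]) (simp_all add: m_assoc m_comm)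
    qed
    then obtain b where b: "\<And>i::nat. b i \<in> carrier R" "\<And>i. a = b i \<otimes> p [^] i" by metis
    have step: "b i = b (Suc i) \<otimes> p" for i
    proof (rule pow_cancel)
      show "b i \<otimes> p [^] i = b (Suc i) \<otimes> p \<otimes> p [^] i"
        using b(2)[of i] b(2)[of "Suc i"] b(1)[of "Suc i"] by (simp add: m_assoc m_comm[of p])
    qed (use b(1) in auto)
    have mono: "PIdl (b i) \<subseteq> PIdl (b j)" if "i \<le> j" for i j
    proof (rule lift_Suc_mono_le[OF _ that])
      fix i
      have "b i \<in> PIdl (b (Suc i))" unfolding cgenideal_def using step[of i] b(1) by (auto simp: m_comm)
      then show "PIdl (b i) \<subseteq> PIdl (b (Suc i))" using cgenideal_minimal[OF cgenideal_ideal] b(1) by blast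
    qed
    have "subset.chain {I. ideal I R} (range (\<lambda>i. PIdl (b i)))"
      unfolding pred_on.chain_def
    proof (intro conjI ballI)
      show "range (\<lambda>i. PIdl (b i)) \<subseteq> {I. ideal I R}" using b(1) cgenideal_ideal by blast
      fix A A' assume "A \<in> range (\<lambda>i. PIdl (b i))" "A' \<in> range (\<lambda>i. PIdl (b i))"
      then obtain i j where "A = PIdl (b i)" "A' = PIdl (b j)" by blast
      then show "(\<subset>)\<^sup>=\<^sup>= A A' \<or> (\<subset>)\<^sup>=\<^sup>= A' A"
        using mono[of i j] mono[of j i] nat_le_linear[of i j] by auto
    qed
    then have "\<Union>(range (\<lambda>i. PIdl (b i))) \<in> range (\<lambda>i. PIdl (b i))"
      by (intro ideal_chain_is_trivial) auto
    then obtain m where m: "(\<Union>i. PIdl (b i)) = PIdl (b m)" by auto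
    have "b (Suc m) \<in> PIdl (b m)" using cgenideal_self[OF b(1)[of "Suc m"]] m by blast
    then obtain c where c: "c \<in> carrier R" "b (Suc m) = c \<otimes> b m" unfolding cgenideal_def by blast
    have bn0: "b (Suc m) \<noteq> \<zero>" using b(2)[of "Suc m"] a(2) p(1) by auto
    \<comment> \<open>Stationarity makes \<open>b (Suc m)\<close> a multiple of \<open>b m\<close>,
      which is itself \<open>p\<close> times \<open>b (Suc m)\<close>; so \<open>p\<close> would be
      a unit.\<close>
    have "b (Suc m) \<otimes> (p \<otimes> c) = b (Suc m) \<otimes> \<one>"
      using c step[of m] b(1)[of "Suc m"] p(1) by (metis m_assoc m_comm m_closed r_one)
    then have "p \<otimes> c = \<one>" using m_lcancel[OF bn0 b(1)] c(1) p(1) by simp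
    then show False using pu p(1) c(1) unfolding Units_def by (auto simp: m_comm)
  qed
  then show ?thesis using unif_ring_axioms by blast
qed

section \<open>Closed points as valuation rings\<close>

locale curve =
  fixes k :: "'a set" and F :: "'a ring" (structure)
  assumes curve: "curve_over_finite_field k F"
begin

sublocale finite_constants F k
  using curve unfolding curve_over_finite_field_def
  by (intro finite_constants.intro finite_constants_axioms.intro) auto

lemma finite_transcendental:
  obtains t where "t \<in> carrier F" "finite_dimension (generate_field F (insert t k)) (carrier F)"
  using curve unfolding curve_over_finite_field_def by blast

abbreviation "pts \<equiv> closed_points k F"
abbreviation "\<R> y \<equiv> local_ring F y"

lemma local_simps [simp]:
  "carrier (\<R> y) = y" "monoid.mult (\<R> y) = monoid.mult F" "one (\<R> y) = \<one>" "ring.zero (\<R> y) = \<zero>" "ring.add (\<R> y) = ring.add F"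
  by (simp_all add: local_ring_def)

lemma local_pow [simp]: "a [^]\<^bsub>\<R> y\<^esub> (i::nat) = a [^] i"
  by (simp add: nat_pow_def)

lemma ptsD:
  assumes "y \<in> pts"
  shows "subring y F" "k \<subseteq> y" "\<And>a. a \<in> y \<Longrightarrow> a \<in> carrier F" "principal_domain (\<R> y)" "\<not> field (\<R> y)"
    "\<exists>!J. maximalideal J (\<R> y)" "\<And>a. a \<in> carrier F \<Longrightarrow> \<exists>b\<in>y. \<exists>c\<in>y - {\<zero>}. a \<otimes> c = b"
  using assms subringE(1)[of y F] unfolding closed_points_def dvr_def local_ring_def by auto

lemmas pts_ring = subringE[OF ptsD(1)]

lemma pts_pow: "y \<in> pts \<Longrightarrow> a \<in> y \<Longrightarrow> a [^] (i::nat) \<in> y"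
  by (induction i) (auto intro: pts_ring)

lemma inv_closed' [simp]: "a \<in> carrier F \<Longrightarrow> a \<noteq> \<zero> \<Longrightarrow> inv a \<in> carrier F"
  using field_Units Units_inv_closed by auto

lemma inv_r [simp]: "a \<in> carrier F \<Longrightarrow> a \<noteq> \<zero> \<Longrightarrow> a \<otimes> inv a = \<one>"
  using field_Units Units_r_inv by auto

lemma inv_l [simp]: "a \<in> carrier F \<Longrightarrow> a \<noteq> \<zero> \<Longrightarrow> inv a \<otimes> a = \<one>"
  using field_Units Units_l_inv by auto

lemma inv_nonzero [simp]: "a \<in> carrier F \<Longrightarrow> a \<noteq> \<zero> \<Longrightarrow> inv a \<noteq> \<zero>"
  using inv_r[of a] by force

lemma inv_eqI: "a \<in> carrier F \<Longrightarrow> b \<in> carrier F \<Longrightarrow> a \<otimes> b = \<one> \<Longrightarrow> inv a = b"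
  using comm_inv_char by blast

lemma inv_inv' [simp]: "a \<in> carrier F \<Longrightarrow> a \<noteq> \<zero> \<Longrightarrow> inv (inv a) = a"
  by (rule inv_eqI) auto

lemma inv_mult':
  assumes "a \<in> carrier F" "a \<noteq> \<zero>" "b \<in> carrier F" "b \<noteq> \<zero>"
  shows "inv (a \<otimes> b) = inv a \<otimes> inv b"
proof (rule inv_eqI)
  have c: "inv a \<in> carrier F" "inv b \<in> carrier F" using assms by simp_all
  have "a \<otimes> b \<otimes> (inv a \<otimes> inv b) = (a \<otimes> inv a) \<otimes> (b \<otimes> inv b)"
    using assms c by (simp del: inv_r inv_l add: m_ac)
  then show "a \<otimes> b \<otimes> (inv a \<otimes> inv b) = \<one>" using assms by simp
qed (use assms in auto)

lemma local_Units: "y \<in> pts \<Longrightarrow> a \<in> Units (\<R> y) \<longleftrightarrow> a \<in> y \<and> a \<noteq> \<zero> \<and> inv a \<in> y"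
proof
  assume y: "y \<in> pts" and a: "a \<in> Units (\<R> y)"
  then obtain b where b: "a \<in> y" "b \<in> y" "a \<otimes> b = \<one>" unfolding Units_def by auto
  have c: "a \<in> carrier F" "b \<in> carrier F" using b ptsD(3)[OF y] by auto
  then have "a \<noteq> \<zero>" using b(3) by auto
  moreover have "inv a = b" using c b(3) by (rule inv_eqI)
  ultimately show "a \<in> y \<and> a \<noteq> \<zero> \<and> inv a \<in> y" using b by simp
next
  assume y: "y \<in> pts" and a: "a \<in> y \<and> a \<noteq> \<zero> \<and> inv a \<in> y"
  then have "a \<in> carrier F" using ptsD(3) by blast
  then show "a \<in> Units (\<R> y)" unfolding Units_def using a by (auto intro!: bexI[of _ "inv a"])
qed

lemma pts_unif:
  assumes y: "y \<in> pts"
  obtains p where "unif_ring (\<R> y) p"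
    "\<And>a. a \<in> y \<Longrightarrow> a \<noteq> \<zero> \<Longrightarrow> \<exists>u\<in>Units (\<R> y). \<exists>i::nat. a = u \<otimes> p [^] i"
proof -
  obtain p where "unif_ring (\<R> y) p \<and> (\<forall>a\<in>y. a \<noteq> \<zero> \<longrightarrow> (\<exists>u\<in>Units (\<R> y). \<exists>i::nat. a = u \<otimes> p [^] i))"
    using principal_domain.unif_ring_of_unique_maximal[OF ptsD(4-6)[OF y]] unfolding local_simps local_pow by (elim exE)
  then show ?thesis by (intro that[of p]) blast+
qed

text \<open>The maximal ideal at \<open>y\<close> as the set of nonunits, which avoids the
  description in \<open>max_ideal\<close>. For a rational function, membership means a zero at
  \<open>y\<close>, and membership of its inverse a pole.\<close>

definition mm :: "'a set \<Rightarrow> 'a set" where "mm y = {a \<in> y. a \<notin> Units (\<R> y)}"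

lemma mm_eq:
  assumes y: "y \<in> pts" and p: "unif_ring (\<R> y) p"
  shows "mm y = {b \<otimes> p |b. b \<in> y}"
proof -
  interpret u: unif_ring "\<R> y" p by (rule p)
  have "mm y = u.I 1" using u.mem_I_1 unfolding mm_def using ideal.Icarr[OF u.I_ideal] by auto
  then show ?thesis using u.p_closed ptsD(3)[OF y] unfolding set_eq_iff u.mem_I by auto
qed

lemma mm_sub: "a \<in> mm y \<Longrightarrow> a \<in> y" by (simp add: mm_def)

lemma mm_mult:
  assumes y: "y \<in> pts" and a: "a \<in> y" "b \<in> mm y"
  shows "a \<otimes> b \<in> mm y" "b \<otimes> a \<in> mm y"
proof -
  obtain p where p: "unif_ring (\<R> y) p" using pts_unif[OF y] .
  interpret u: unif_ring "\<R> y" p by (rule p)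
  obtain c where c: "c \<in> y" "b = c \<otimes> p" using a(2) mm_eq[OF y p] by auto
  have "a \<otimes> b = (a \<otimes> c) \<otimes> p" using c a u.p_closed ptsD(3)[OF y] by (simp add: m_assoc)
  then show "a \<otimes> b \<in> mm y" unfolding mm_eq[OF y p] using pts_ring(6)[OF y a(1) c(1)] by blast
  then show "b \<otimes> a \<in> mm y" using a ptsD(3)[OF y] mm_sub by (simp add: m_comm)
qed

lemma mm_add:
  assumes y: "y \<in> pts" and a: "a \<in> mm y" "b \<in> mm y"
  shows "a \<oplus> b \<in> mm y"
proof -
  obtain p where p: "unif_ring (\<R> y) p" using pts_unif[OF y] .
  interpret u: unif_ring "\<R> y" p by (rule p)
  obtain c where c: "c \<in> y" "a = c \<otimes> p" using a mm_eq[OF y p] by auto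
  obtain d where d: "d \<in> y" "b = d \<otimes> p" using a mm_eq[OF y p] by auto
  have "a \<oplus> b = (c \<oplus> d) \<otimes> p" using c d a u.p_closed ptsD(3)[OF y] by (simp add: l_distr)
  then show "a \<oplus> b \<in> mm y" unfolding mm_eq[OF y p] using pts_ring(7)[OF y c(1) d(1)] by blast
qed

lemma mm_neg:
  assumes y: "y \<in> pts" and a: "a \<in> mm y"
  shows "\<ominus> a \<in> mm y"
proof -
  have "\<ominus> a = (\<ominus> \<one>) \<otimes> a" using a mm_sub ptsD(3)[OF y] by (simp add: l_minus)
  then show ?thesis using mm_mult(1)[OF y _ a] pts_ring(3,5)[OF y] by simp
qed

lemma zero_mm: "y \<in> pts \<Longrightarrow> \<zero> \<in> mm y"
  using local_Units pts_ring(2) unfolding mm_def by blast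

lemma one_not_mm: "y \<in> pts \<Longrightarrow> \<one> \<notin> mm y"
  using local_Units[of y \<one>] pts_ring(3)[of y] unfolding mm_def by simp

lemma unitD: "y \<in> pts \<Longrightarrow> a \<in> y \<Longrightarrow> a \<notin> mm y \<Longrightarrow> a \<noteq> \<zero> \<and> inv a \<in> y"
  using local_Units unfolding mm_def by blast

lemma not_mm_mult:
  assumes y: "y \<in> pts" and a: "a \<in> y" "a \<notin> mm y" "b \<in> y" "b \<notin> mm y"
  shows "a \<otimes> b \<notin> mm y"
proof
  assume "a \<otimes> b \<in> mm y"
  then have "inv a \<otimes> (a \<otimes> b) \<in> mm y" using mm_mult(1)[OF y] unitD[OF y a(1,2)] by blast
  then have "b \<in> mm y" using unitD[OF y a(1,2)] a ptsD(3)[OF y] by (simp add: m_assoc[symmetric])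
  then show False using a by blast
qed

lemma unit_add_mm:
  assumes y: "y \<in> pts" and a: "a \<in> y" "a \<notin> mm y" "b \<in> mm y"
  shows "a \<oplus> b \<in> y" "a \<oplus> b \<notin> mm y"
proof -
  show "a \<oplus> b \<in> y" using pts_ring(7)[OF y a(1) mm_sub[OF a(3)]] .
  show "a \<oplus> b \<notin> mm y"
  proof
    assume "a \<oplus> b \<in> mm y"
    then have "(a \<oplus> b) \<oplus> \<ominus> b \<in> mm y" using mm_add[OF y] mm_neg[OF y a(3)] by blast
    moreover have "(a \<oplus> b) \<oplus> \<ominus> b = a"
      using ptsD(3)[OF y a(1)] ptsD(3)[OF y mm_sub[OF a(3)]] by (simp add: a_assoc r_neg)
    ultimately show False using a(2) by simp
  qed
qed

text \<open>Write \<open>f\<close> as a quotient of \<open>u p [^] i\<close> by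
  \<open>v p [^] j\<close> with units \<open>u\<close> and \<open>v\<close>. If
  \<open>j \<le> i\<close>, then \<open>f\<close> would lie in \<open>y\<close>; otherwise a factor
  \<open>p\<close> is left in the inverse.\<close>

lemma inv_mm:
  assumes y: "y \<in> pts" and f: "f \<in> carrier F" "f \<notin> y"
  shows "f \<noteq> \<zero>" "inv f \<in> mm y"
proof -
  show f0: "f \<noteq> \<zero>" using f pts_ring(2)[OF y] by blast
  obtain p where p: "unif_ring (\<R> y) p"
    "\<And>a. a \<in> y \<Longrightarrow> a \<noteq> \<zero> \<Longrightarrow> \<exists>u\<in>Units (\<R> y). \<exists>i::nat. a = u \<otimes> p [^] i" using pts_unif[OF y] by blast
  interpret u: unif_ring "\<R> y" p by (rule p)
  have pc: "p \<in> carrier F" using u.p_closed ptsD(3)[OF y] by simp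
  have py: "p [^] (i::nat) \<in> y" for i using u.p_closed pts_pow[OF y] by simp
  obtain b c where bc: "b \<in> y" "c \<in> y" "c \<noteq> \<zero>" "f \<otimes> c = b" using ptsD(7)[OF y f(1)] by blast
  have b0: "b \<noteq> \<zero>" using bc f f0 ptsD(3)[OF y] by (auto simp: integral_iff)
  obtain u i where u: "u \<in> Units (\<R> y)" "b = u \<otimes> p [^] (i::nat)" using p(2)[OF bc(1) b0] by blast
  obtain v j where v: "v \<in> Units (\<R> y)" "c = v \<otimes> p [^] (j::nat)" using p(2)[OF bc(2,3)] by blast
  have U: "u \<in> y" "u \<noteq> \<zero>" "inv u \<in> y" "v \<in> y" "v \<noteq> \<zero>" "inv v \<in> y"
    using u(1) v(1) local_Units[OF y] by blast+
  have C: "u \<in> carrier F" "inv u \<in> carrier F" "v \<in> carrier F" "inv v \<in> carrier F"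
    using U ptsD(3)[OF y] by blast+
  have pn0: "p [^] (i::nat) \<noteq> \<zero>" for i using u.pow_nonzero[of i] by simp
  show "inv f \<in> mm y"
  proof (cases "j \<le> i")
    case True
    then obtain m where m: "i = m + j" using le_Suc_ex by (metis add.commute)
    have "(f \<otimes> v) \<otimes> p [^] j = (u \<otimes> p [^] m) \<otimes> p [^] j"
      using bc(4) u(2) v(2) m C pc f(1) by (simp add: m_assoc nat_pow_mult)
    then have "f \<otimes> v = u \<otimes> p [^] m" using m_rcancel[OF pn0[of j]] C pc f(1) by simp
    then have "f = (u \<otimes> p [^] m) \<otimes> inv v" using C U f(1) pc by (metis inv_r m_assoc r_one)
    then show ?thesis using f(2) pts_ring(6)[OF y] U py by metis
  next
    case False
    then obtain m where m: "j = Suc m + i" using less_imp_Suc_add[of i j] by (auto simp: add.commute)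
    have "(f \<otimes> (v \<otimes> p [^] Suc m)) \<otimes> p [^] i = u \<otimes> p [^] i"
    proof -
      have "(f \<otimes> (v \<otimes> p [^] Suc m)) \<otimes> p [^] i = f \<otimes> (v \<otimes> (p [^] Suc m \<otimes> p [^] i))"
        using C pc f(1) by (simp add: m_assoc del: nat_pow_Suc)
      also have "p [^] Suc m \<otimes> p [^] i = p [^] j" unfolding m using pc by (rule nat_pow_mult)
      finally show ?thesis using bc(4) u(2) v(2) by simp
    qed
    then have "f \<otimes> (v \<otimes> p [^] Suc m) = u" using m_rcancel[OF pn0[of i]] C pc f(1) by simp
    then have "f \<otimes> ((v \<otimes> p [^] Suc m) \<otimes> inv u) = \<one>"
      using C U(2) f(1) pc by (simp add: m_assoc[symmetric] del: nat_pow_Suc)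
    then have "inv f = (v \<otimes> p [^] Suc m) \<otimes> inv u" using C pc f(1) by (intro inv_eqI) auto
    also have "\<dots> = ((v \<otimes> inv u) \<otimes> p [^] m) \<otimes> p" using C pc by (simp add: m_ac)
    finally show ?thesis unfolding mm_eq[OF y p(1)] using pts_ring(6)[OF y] U py by blast
  qed
qed

text \<open>The pole of \<open>f\<close> has a finite order \<open>i\<close>, and each factor
  \<open>z\<close> contributes at least one \<open>p\<close>. This Archimedean property stands in
  for numerical valuations in all that follows.\<close>

lemma mm_power_absorb:
  assumes y: "y \<in> pts" and z: "z \<in> mm y" and f: "f \<in> carrier F"
  shows "\<exists>s0. \<forall>s\<ge>s0. f \<otimes> z [^] (s::nat) \<in> mm y"
proof -
  have zy: "z \<in> y" "z \<in> carrier F" using z mm_sub ptsD(3)[OF y] by blast+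
  have zs: "z [^] s \<in> mm y" if s: "s \<ge> 1" for s :: nat
  proof -
    obtain s' where "s = Suc s'" using s by (cases s) auto
    then show ?thesis using mm_mult(1)[OF y pts_pow[OF y zy(1)] z] by simp
  qed
  show ?thesis
  proof (cases "f \<in> y")
    case True
    then have "\<forall>s\<ge>1. f \<otimes> z [^] (s::nat) \<in> mm y" using zs mm_mult(1)[OF y] by blast
    then show ?thesis by blast
  next
    case False
    note f0 = inv_mm[OF y f False]
    obtain p where p: "unif_ring (\<R> y) p"
      "\<And>a. a \<in> y \<Longrightarrow> a \<noteq> \<zero> \<Longrightarrow> \<exists>u\<in>Units (\<R> y). \<exists>i::nat. a = u \<otimes> p [^] i" using pts_unif[OF y] by blast
    interpret u: unif_ring "\<R> y" p by (rule p)
    have pc: "p \<in> carrier F" "p \<in> y" using u.p_closed ptsD(3)[OF y] by simp_all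
    obtain u i where u: "u \<in> Units (\<R> y)" "inv f = u \<otimes> p [^] (i::nat)" using p(2)[OF mm_sub[OF f0(2)]] f f0(1) by auto
    have U: "u \<in> y" "u \<noteq> \<zero>" "inv u \<in> y" using u(1) local_Units[OF y] by blast+
    have C: "u \<in> carrier F" "inv u \<in> carrier F" using U ptsD(3)[OF y] by blast+
    have "f \<otimes> p [^] i = inv u \<otimes> (f \<otimes> (u \<otimes> p [^] i))" using C U f pc by (simp add: m_ac) (simp add: m_assoc[symmetric])
    also have "\<dots> = inv u" unfolding u(2)[symmetric] using f f0(1) C by simp
    finally have fp: "f \<otimes> p [^] i \<in> y" using U by simp
    obtain b where b: "b \<in> y" "z = b \<otimes> p" using z mm_eq[OF y p(1)] by blast
    have bc: "b \<in> carrier F" using b ptsD(3)[OF y] by blast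
    have "f \<otimes> z [^] s \<in> mm y" if s: "s \<ge> Suc i" for s :: nat
    proof -
      obtain m where m: "s = i + Suc m" using s less_imp_Suc_add[of i s] by auto
      have "f \<otimes> z [^] i = (f \<otimes> p [^] i) \<otimes> b [^] i"
        unfolding b(2) using bc pc f by (simp add: nat_pow_distrib m_ac)
      then have 1: "f \<otimes> z [^] i \<in> y" using pts_ring(6)[OF y fp pts_pow[OF y b(1)]] by simp
      have "f \<otimes> z [^] s = (f \<otimes> z [^] i) \<otimes> z [^] Suc m"
        unfolding m using f zy(2) by (simp add: m_assoc nat_pow_mult[symmetric] del: nat_pow_Suc)
      then show ?thesis using mm_mult(1)[OF y 1 zs[of "Suc m"]] by simp
    qed
    then show ?thesis by blast
  qed
qed

text \<open>If \<open>a\<close> lies in \<open>y'\<close> but not in \<open>y\<close>, its inverse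
  vanishes at \<open>y\<close>. High powers of this inverse absorb any pole, so every
  \<open>f\<close> is a product of an element of \<open>y\<close> and a power of \<open>a\<close>
  and lies in \<open>y'\<close>. But \<open>y'\<close> is not the whole field.\<close>

lemma pts_incomparable:
  assumes y: "y \<in> pts" "y' \<in> pts" and sub: "y \<subseteq> y'"
  shows "y = y'"
proof (rule ccontr)
  assume "y \<noteq> y'"
  then obtain a where a: "a \<in> y'" "a \<notin> y" using sub by blast
  have ac: "a \<in> carrier F" using a ptsD(3)[OF y(2)] by blast
  note ia = inv_mm[OF y(1) ac a(2)]
  have "f \<in> y'" if f: "f \<in> carrier F" for f
  proof -
    obtain s where s: "f \<otimes> inv a [^] (s::nat) \<in> mm y" using mm_power_absorb[OF y(1) ia(2) f] by blast
    have "f \<otimes> inv a [^] s \<otimes> a [^] s = f \<otimes> (inv a \<otimes> a) [^] s"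
      using f ac ia(1) by (simp add: m_assoc nat_pow_distrib del: inv_l)
    also have "\<dots> = f" using f ac ia(1) by simp
    finally show ?thesis
      using pts_ring(6)[OF y(2) _ pts_pow[OF y(2) a(1)]] s mm_sub sub by (metis subsetD)
  qed
  then have all: "y' = carrier F" using ptsD(3)[OF y(2)] by blast
  obtain p where p: "unif_ring (\<R> y') p" using pts_unif[OF y(2)] .
  interpret u: unif_ring "\<R> y'" p by (rule p)
  have "p \<in> carrier F" "p \<noteq> \<zero>" "p \<notin> Units (\<R> y')" using u.p_closed u.p_nonzero u.p_nonunit all by simp_all
  then show False using local_Units[OF y(2)] all by simp
qed

text \<open>Induction over the points where a pole is wanted. The element \<open>z\<close> for the
  old points is combined with a \<open>w\<close> that has a zero at \<open>y\<close> and a pole at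
  the new point \<open>y1\<close>; powers of \<open>z\<close> keep the poles at the old points
  whatever \<open>w\<close> does there.\<close>

lemma separating_element:
  assumes y: "y \<in> pts" and Y: "finite Y" "Y \<subseteq> pts" "y \<notin> Y"
  shows "\<exists>z\<in>mm y. z \<noteq> \<zero> \<and> (\<forall>y'\<in>Y. inv z \<in> mm y')"
  using Y
proof (induction Y rule: finite_induct)
  case empty
  obtain p where p: "unif_ring (\<R> y) p" using pts_unif[OF y] .
  interpret u: unif_ring "\<R> y" p by (rule p)
  have "p \<in> mm y" unfolding mm_def using u.p_closed u.p_nonunit by simp
  then show ?case using u.p_nonzero by auto
next
  case (insert y1 Y)
  then obtain z where z: "z \<in> mm y" "z \<noteq> \<zero>" "\<And>y'. y' \<in> Y \<Longrightarrow> inv z \<in> mm y'" by blast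
  have zc1: "z \<in> carrier F" by (rule ptsD(3)[OF y mm_sub[OF z(1)]])
  note zc = zc1 inv_closed'[OF zc1 z(2)]
  have y1: "y1 \<in> pts" "y1 \<noteq> y" and Yp: "\<And>y'. y' \<in> Y \<Longrightarrow> y' \<in> pts" using insert by auto
  obtain a where a: "a \<in> y" "a \<notin> y1" using pts_incomparable[OF y y1(1)] y1(2) by blast
  obtain b where b: "b \<in> y1" "b \<notin> y" using pts_incomparable[OF y1(1) y] y1(2) by blast
  have c: "a \<in> carrier F" "b \<in> carrier F" using a b ptsD(3) y y1 by blast+
  note ia = inv_mm[OF y1(1) c(1) a(2)] and ib = inv_mm[OF y c(2) b(2)]
  have c': "inv a \<in> carrier F" "inv b \<in> carrier F" using c ia ib by simp_all
  \<comment> \<open>Incomparability gives elements regular at exactly one of the two points; this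
    product has a zero at \<open>y\<close> and a pole at \<open>y1\<close>.\<close>
  define w where "w = a \<otimes> inv b"
  have w: "w \<in> mm y" unfolding w_def using mm_mult(1)[OF y a(1) ib(2)] .
  have w0: "w \<noteq> \<zero>" "w \<in> carrier F" unfolding w_def using c c' ia(1) ib(1) by (simp_all add: integral_iff)
  have iw: "inv w = inv a \<otimes> b"
    unfolding w_def using c c' ia(1) ib(1) by (simp add: inv_mult')
  have w1: "inv w \<in> mm y1" unfolding iw using mm_mult(2)[OF y1(1) b(1) ia(2)] .
  have iwc: "inv w \<in> carrier F" using w0 by simp
  have "\<exists>s0. \<forall>s\<ge>s0. inv w \<otimes> inv z [^] (s::nat) \<in> mm y'" if "y' \<in> Y" for y'
    using mm_power_absorb[OF Yp[OF that] z(3)[OF that] iwc] .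
  then obtain S where S: "\<And>y' s. y' \<in> Y \<Longrightarrow> s \<ge> S y' \<Longrightarrow> inv w \<otimes> inv z [^] (s::nat) \<in> mm y'" by metis
  \<comment> \<open>The sum dominates every bound at once, and \<open>Suc\<close> ensures that the
    power of \<open>z\<close> vanishes wherever \<open>z\<close> does.\<close>
  define s where "s = Suc (\<Sum>y'\<in>Y. S y')"
  have Ss: "inv w \<otimes> inv z [^] s \<in> mm y'" if "y' \<in> Y" for y'
    by (rule S[OF that]) (use insert(1) that in \<open>simp add: s_def member_le_sum le_SucI\<close>)
  have zs: "z [^] s \<in> carrier F" "z [^] s \<noteq> \<zero>" "inv z [^] s \<in> carrier F"
  proof -
    show "z [^] s \<noteq> \<zero>" using z(2) zc by (induction s) (simp_all add: integral_iff)
  qed (use zc in auto)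
  have izs: "inv z [^] s \<otimes> z [^] s = \<one>"
    using zc z(2) by (simp add: nat_pow_distrib[symmetric])
  have zsm: "z [^] s \<in> mm y'" if "y' \<in> pts" "z \<in> mm y'" for y'
    using mm_mult(1)[OF that(1) pts_pow[OF that(1) mm_sub[OF that(2)]] that(2)] by (simp add: s_def)
  consider "inv z \<in> mm y1" | "z \<in> mm y1" | "inv z \<notin> mm y1" "z \<notin> mm y1" by blast
  then show ?case
  proof cases
    case 1
    then show ?thesis using z by blast
  next
    case 2
    \<comment> \<open>Here \<open>z\<close> has a zero at \<open>y1\<close>, and a power of it could
      destroy the pole of \<open>w\<close>. The factor \<open>\<one> \<oplus> z [^] s\<close> is a
      unit where \<open>z\<close> vanishes and has the same poles as \<open>z [^] s\<close>.\<close>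
    define v where "v = w \<otimes> (\<one> \<oplus> z [^] s)"
    have u: "\<one> \<oplus> z [^] s \<in> y'" "\<one> \<oplus> z [^] s \<notin> mm y'" if "y' \<in> pts" "z \<in> mm y'" for y'
      using unit_add_mm[OF that(1) pts_ring(3)[OF that(1)] one_not_mm[OF that(1)] zsm[OF that]] .
    have uc: "\<one> \<oplus> z [^] s \<in> carrier F" "\<one> \<oplus> z [^] s \<noteq> \<zero>" using zs unitD[OF y u[OF y z(1)]] by simp_all
    have iv: "inv v = inv w \<otimes> inv (\<one> \<oplus> z [^] s)"
      unfolding v_def by (rule inv_mult'[OF w0(2,1) uc])
    have "v \<in> mm y" unfolding v_def using mm_mult(2)[OF y u(1)[OF y z(1)] w] .
    moreover have "v \<noteq> \<zero>" unfolding v_def using w0 uc by (simp add: integral_iff)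
    moreover have "inv v \<in> mm y1"
      unfolding iv using mm_mult(2)[OF y1(1) _ w1] unitD[OF y1(1) u[OF y1(1) 2]] by blast
    moreover have "inv v \<in> mm y'" if y': "y' \<in> Y" for y'
    proof -
      have "inv z [^] s \<in> mm y'" 
        using mm_mult(1)[OF Yp[OF y'] pts_pow[OF Yp[OF y'] mm_sub[OF z(3)[OF y']]] z(3)[OF y']] by (simp add: s_def)
      note u' = unit_add_mm[OF Yp[OF y'] pts_ring(3)[OF Yp[OF y']] one_not_mm[OF Yp[OF y']] this]
      have u'c: "\<one> \<oplus> inv z [^] s \<in> carrier F" "\<one> \<oplus> inv z [^] s \<noteq> \<zero>" using zs unitD[OF Yp[OF y'] u'] by simp_all
      have "inv (\<one> \<oplus> z [^] s) = inv z [^] s \<otimes> inv (\<one> \<oplus> inv z [^] s)"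
      proof (rule inv_eqI)
        have "(\<one> \<oplus> z [^] s) \<otimes> inv z [^] s = \<one> \<oplus> inv z [^] s"
          using zs izs by (simp add: l_distr m_comm[of "z [^] s"] a_comm)
        then show "(\<one> \<oplus> z [^] s) \<otimes> (inv z [^] s \<otimes> inv (\<one> \<oplus> inv z [^] s)) = \<one>"
          using zs u'c uc by (simp add: m_assoc[symmetric])
      qed (use uc u'c zs in auto)
      then have "inv v = (inv w \<otimes> inv z [^] s) \<otimes> inv (\<one> \<oplus> inv z [^] s)"
        unfolding iv using iwc zs u'c by (simp add: m_assoc)
      then show ?thesis using mm_mult(2)[OF Yp[OF y'] _ Ss[OF y']] unitD[OF Yp[OF y'] u'] by simp
    qed
    ultimately show ?thesis by blast
  next
    case 3
    have zy1: "z \<in> y1" "inv z \<in> y1" using inv_mm(2)[OF y1(1) zc(1)] inv_mm(2)[OF y1(1) zc(2)] 3 z(2) zc by auto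
    \<comment> \<open>Here \<open>z\<close> is a unit at \<open>y1\<close>, so its powers leave the
      pole of \<open>w\<close> there intact.\<close>
    define v where "v = w \<otimes> z [^] s"
    have iv: "inv v = inv w \<otimes> inv z [^] s"
    proof (unfold v_def, rule inv_eqI)
      have "w \<otimes> z [^] s \<otimes> (inv w \<otimes> inv z [^] s) = (w \<otimes> inv w) \<otimes> (inv z [^] s \<otimes> z [^] s)"
        using w0 zs iwc by (simp del: inv_l inv_r add: m_ac)
      then show "w \<otimes> z [^] s \<otimes> (inv w \<otimes> inv z [^] s) = \<one>" using w0 izs by simp
    qed (use w0 zs iwc in auto)
    have "v \<in> mm y" unfolding v_def using mm_mult(1)[OF y _ zsm[OF y z(1)]] w mm_sub by blast
    moreover have "v \<noteq> \<zero>" unfolding v_def using w0 zs by (simp add: integral_iff)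
    moreover have "inv v \<in> mm y1" unfolding iv using mm_mult(2)[OF y1(1) pts_pow[OF y1(1) zy1(2)] w1] .
    moreover have "inv v \<in> mm y'" if y': "y' \<in> Y" for y' unfolding iv by (rule Ss[OF y'])
    ultimately show ?thesis by blast
  qed
qed

text \<open>With a separating element \<open>z\<close>, the inverse of
  \<open>\<one> \<oplus> z\<close> is a unit at \<open>y\<close>, where \<open>z\<close> vanishes,
  and has zeros at the poles of \<open>z\<close>.\<close>

lemma weak_approximation:
  assumes y: "y \<in> pts" and Y: "finite Y" "Y \<subseteq> pts" "y \<notin> Y"
  shows "\<exists>u\<in>y. u \<notin> mm y \<and> (\<forall>y'\<in>Y. u \<in> mm y')"
proof -
  obtain z where z: "z \<in> mm y" "z \<noteq> \<zero>" "\<And>y'. y' \<in> Y \<Longrightarrow> inv z \<in> mm y'" using separating_element[OF assms] by blast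
  have zc1: "z \<in> carrier F" by (rule ptsD(3)[OF y mm_sub[OF z(1)]])
  note zc = zc1 inv_closed'[OF zc1 z(2)]
  note u = unit_add_mm[OF y pts_ring(3)[OF y] one_not_mm[OF y] z(1)]
  have uc: "\<one> \<oplus> z \<in> carrier F" "\<one> \<oplus> z \<noteq> \<zero>" using zc unitD[OF y u] by simp_all
  have iu: "inv (\<one> \<oplus> z) \<in> y" "inv (\<one> \<oplus> z) \<notin> mm y"
  proof -
    show 1: "inv (\<one> \<oplus> z) \<in> y" using unitD[OF y u] by blast
    then have "inv (\<one> \<oplus> z) \<in> Units (\<R> y)" using local_Units[OF y] uc u(1) by simp
    then show "inv (\<one> \<oplus> z) \<notin> mm y" by (simp add: mm_def)
  qed
  have "inv (\<one> \<oplus> z) \<in> mm y'" if y': "y' \<in> Y" for y'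
  proof -
    have yp: "y' \<in> pts" using y' Y by blast
    note u' = unit_add_mm[OF yp pts_ring(3)[OF yp] one_not_mm[OF yp] z(3)[OF y']]
    have u'c: "\<one> \<oplus> inv z \<in> carrier F" "\<one> \<oplus> inv z \<noteq> \<zero>" using zc unitD[OF yp u'] by simp_all
    have "inv (\<one> \<oplus> z) = inv z \<otimes> inv (\<one> \<oplus> inv z)"
    proof (rule inv_eqI)
      have "(\<one> \<oplus> z) \<otimes> inv z = \<one> \<oplus> inv z" using zc z(2) by (simp add: l_distr a_comm)
      then show "(\<one> \<oplus> z) \<otimes> (inv z \<otimes> inv (\<one> \<oplus> inv z)) = \<one>" using zc u'c uc by (simp add: m_assoc[symmetric])
    qed (use uc u'c zc in auto)
    then show ?thesis using mm_mult(2)[OF yp _ z(3)[OF y']] unitD[OF yp u'] by simp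
  qed
  then show ?thesis using iu by blast
qed

lemma B_in_subring:
  assumes "y \<in> pts" "g \<in> y" "b \<in> B g m"
  shows "b \<in> y"
  using assms(3)
proof (induction m arbitrary: b)
  case 0 then show ?case using ptsD(2)[OF assms(1)] by auto
next
  case (Suc m)
  then show ?case using ptsD(2)[OF assms(1)] pts_ring(6,7)[OF assms(1)] assms(2) by auto
qed

lemma k_unit:
  assumes y: "y \<in> pts" and c: "c \<in> k" "c \<noteq> \<zero>"
  shows "c \<notin> mm y"
proof -
  have "inv c \<in> k" using subfield_m_inv(1)[OF k_subfield] c by blast
  then show ?thesis using local_Units[OF y] c ptsD(2)[OF y] unfolding mm_def by blast
qed

text \<open>By the relation of bounded length, elements that are units at one zero of \<open>g\<close> and vanish at the
  others bound the number of zeros of \<open>g\<close>.\<close>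

lemma finite_zeros:
  assumes g: "g \<in> carrier F" "g \<noteq> \<zero>"
  shows "finite {y \<in> pts. g \<in> mm y}"
proof (rule ccontr)
  let ?Z = "{y \<in> pts. g \<in> mm y}"
  assume inf: "infinite ?Z"
  obtain t where t: "t \<in> carrier F" "finite_dimension (generate_field F (insert t k)) (carrier F)"
    by (rule finite_transcendental)
  obtain M :: nat where M: "\<forall>u. (\<forall>i<M. u i \<in> carrier F) \<longrightarrow> (\<exists>\<alpha> w. (\<forall>i. \<alpha> i \<in> k \<and> (\<exists>m. w i \<in> B g m)) \<and>
     (\<exists>i<M. \<alpha> i \<noteq> \<zero>) \<and> (\<Oplus>i\<in>{..<M}. (\<alpha> i \<oplus> g \<otimes> w i) \<otimes> u i) = \<zero>)"
    using relation_ex[OF t g] by (elim exE)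
  obtain Y where Y: "Y \<subseteq> ?Z" "finite Y" "card Y = M" using infinite_arbitrarily_large[OF inf] by metis
  obtain y where y: "bij_betw y {..<M} Y" using ex_bij_betw_nat_finite[OF Y(2)] Y(3) by (auto simp: atLeast0LessThan)
  have yp: "y i \<in> pts" "g \<in> mm (y i)" if "i < M" for i using bij_betwE[OF y] Y(1) that by auto
  have yinj: "y i \<noteq> y j" if "i < M" "j < M" "i \<noteq> j" for i j
    using bij_betw_imp_inj_on[OF y] that by (auto dest: inj_onD)
  have "\<exists>u. i < M \<longrightarrow> u \<in> y i \<and> u \<notin> mm (y i) \<and> (\<forall>y'\<in>y ` ({..<M} - {i}). u \<in> mm y')" for i
  proof (cases "i < M")
    case True
    have "y i \<notin> y ` ({..<M} - {i})" using yinj True by auto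
    then show ?thesis using weak_approximation[of "y i" "y ` ({..<M} - {i})"] yp True by auto
  qed simp
  then obtain u where u: "\<And>i. i < M \<Longrightarrow> u i \<in> y i \<and> u i \<notin> mm (y i) \<and> (\<forall>y'\<in>y ` ({..<M} - {i}). u i \<in> mm y')"
    by metis
  have uc: "u i \<in> carrier F" if "i < M" for i using u[OF that] ptsD(3)[OF yp(1)[OF that]] by blast
  then obtain \<alpha> w where r: "\<And>i. \<alpha> i \<in> k" "\<And>i. \<exists>m. w i \<in> B g m" "\<exists>i<M. \<alpha> i \<noteq> \<zero>"
    "(\<Oplus>i\<in>{..<M}. (\<alpha> i \<oplus> g \<otimes> w i) \<otimes> u i) = \<zero>" using M[rule_format, of u] by blast
  \<comment> \<open>At the zero \<open>y j\<close> of \<open>g\<close> all summands other than the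
    \<open>j\<close>-th vanish together with their \<open>u i\<close>. The \<open>j\<close>-th is a
    product of two units, because \<open>\<alpha> j\<close> is a nonzero constant. So the sum is a
    unit at \<open>y j\<close>, not zero.\<close>
  obtain j where j: "j < M" "\<alpha> j \<noteq> \<zero>" using r(3) by blast
  note yj = yp[OF j(1)]
  let ?f = "\<lambda>i. (\<alpha> i \<oplus> g \<otimes> w i) \<otimes> u i"
  have wy: "w i \<in> y j" for i using r(2)[of i] B_in_subring[OF yj(1) mm_sub[OF yj(2)]] by blast
  have gw: "g \<otimes> w i \<in> mm (y j)" for i using mm_mult(2)[OF yj(1) wy yj(2)] .
  have cf: "\<alpha> i \<oplus> g \<otimes> w i \<in> y j" for i
    using pts_ring(7)[OF yj(1)] r(1)[of i] ptsD(2)[OF yj(1)] mm_sub[OF gw] by blast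
  have fm: "?f i \<in> mm (y j)" if "i \<in> {..<M} - {j}" for i
    using mm_mult(1)[OF yj(1) cf] u[of i] that j(1) by auto
  have fc: "?f i \<in> carrier F" if "i \<in> {..<M}" for i
    using cf ptsD(3)[OF yj(1)] uc that by auto
  have sum_mm: "(\<Oplus>i\<in>I. ?f i) \<in> mm (y j)" if "finite I" "I \<subseteq> {..<M} - {j}" for I
    using that
  proof (induction I rule: finite_induct)
    case empty then show ?case using zero_mm[OF yj(1)] by simp
  next
    case (insert i I)
    have "?f \<in> I \<rightarrow> carrier F" "?f i \<in> carrier F" using insert fc by auto
    then show ?case using insert mm_add[OF yj(1) fm] by (simp add: finsum_insert)
  qed
  have "(\<Oplus>i\<in>insert j ({..<M} - {j}). ?f i) = ?f j \<oplus> (\<Oplus>i\<in>{..<M} - {j}. ?f i)"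
    using fc j(1) by (intro finsum_insert) auto
  moreover have "insert j ({..<M} - {j}) = {..<M}" using j(1) by blast
  ultimately have z: "?f j \<oplus> (\<Oplus>i\<in>{..<M} - {j}. ?f i) = \<zero>" using r(4) by simp
  have s: "(\<Oplus>i\<in>{..<M} - {j}. ?f i) \<in> mm (y j)" by (rule sum_mm) auto
  have "?f j \<notin> mm (y j)"
  proof (rule not_mm_mult[OF yj(1) cf])
    show "\<alpha> j \<oplus> g \<otimes> w j \<notin> mm (y j)"
      using unit_add_mm(2)[OF yj(1) _ k_unit[OF yj(1) r(1) j(2)] gw] ptsD(2)[OF yj(1)] r(1) by blast
  qed (use u[OF j(1)] in auto)
  then have "?f j \<oplus> (\<Oplus>i\<in>{..<M} - {j}. ?f i) \<notin> mm (y j)"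
    using unit_add_mm(2)[OF yj(1) _ _ s] pts_ring(6)[OF yj(1) cf] u[OF j(1)] by blast
  then show False using z zero_mm[OF yj(1)] by simp
qed

text \<open>Poles of \<open>f\<close> are zeros of its inverse. This is the tool that lets finitely
  many rational functions be regular on a neighbourhood of a point.\<close>

lemma finite_poles:
  assumes f: "f \<in> carrier F"
  shows "finite {y \<in> pts. f \<notin> y}"
proof (cases "f = \<zero>")
  case True
  then have "{y \<in> pts. f \<notin> y} = {}" using pts_ring(2) by blast
  then show ?thesis by (simp only: finite.emptyI)
next
  case False
  have "{y \<in> pts. f \<notin> y} \<subseteq> {y \<in> pts. inv f \<in> mm y}" using inv_mm(2) f by blast
  then show ?thesis using finite_zeros[of "inv f"] f False finite_subset by auto
qed

end

section \<open>Finiteness of residue fields\<close>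

lemma (in ring) combine_map:
  assumes "\<And>i. i < n \<Longrightarrow> a i \<in> carrier R" "\<And>i. i < n \<Longrightarrow> b i \<in> carrier R"
  shows "combine (map a [0..<n]) (map b [0..<n]) = (\<Oplus>i\<in>{..<n}. a i \<otimes> b i)"
  using assms
proof (induction n)
  case (Suc n)
  have "combine (map a [0..<Suc n]) (map b [0..<Suc n]) = combine (map a [0..<n]) (map b [0..<n]) \<oplus> combine [a n] [b n]"
    using Suc(2,3) by (subst combine_append) auto
  also have "\<dots> = (\<Oplus>i\<in>{..<n}. a i \<otimes> b i) \<oplus> a n \<otimes> b n" using Suc by simp
  also have "\<dots> = (\<Oplus>i\<in>insert n {..<n}. a i \<otimes> b i)"
    using Suc(2,3) by (subst finsum_insert) (auto simp: a_comm)
  finally show ?case by (simp add: lessThan_Suc)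
qed simp

lemma (in ring) finsum_subring:
  assumes "subring y R" "finite A" "f \<in> A \<rightarrow> y"
  shows "finsum (R\<lparr>carrier := y\<rparr>) f A = finsum R f A"
proof -
  interpret S: ring "R\<lparr>carrier := y\<rparr>" using assms(1) by (rule subring_is_ring)
  show ?thesis
    using assms(2,3)
  proof (induction A rule: finite_induct)
    case empty
    then show ?case using S.finsum_empty by simp
  next
    case (insert a A)
    have "f a \<in> carrier R" "f \<in> A \<rightarrow> carrier R" using insert subringE(1)[OF assms(1)] by auto
    moreover have "f a \<in> y" "f \<in> A \<rightarrow> y" using insert by auto
    ultimately show ?case using insert S.finsum_insert[of A a f] by simp
  qed
qed

text \<open>Coordinates with respect to a basis are unique. For infinite \<open>K\<close> the
  equation still holds by the convention that infinite sets have cardinality zero; a space of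
  dimension zero is treated apart.\<close>

lemma (in ring) dimension_card:
  assumes K: "subfield K R" and d: "dimension n K E"
  shows "card E = card K ^ n" and "finite K \<Longrightarrow> finite E"
proof -
  obtain Us where Us: "set Us \<subseteq> carrier R" "independent K Us" "length Us = n" "Span K Us = E"
    using exists_base[OF K d] by blast
  have Kc: "K \<subseteq> carrier R" using subfieldE(3)[OF K] .
  let ?L = "{Ks. set Ks \<subseteq> K \<and> length Ks = n}"
  have "bij_betw (\<lambda>Ks. combine Ks Us) ?L E"
  proof (rule bij_betw_imageI)
    have mem: "combine Ks Us \<in> E" if "Ks \<in> ?L" for Ks
      using that Us(3) unfolding Us(4)[symmetric] Span_eq_combine_set_length_version[OF K Us(1)] by auto
    show "inj_on (\<lambda>Ks. combine Ks Us) ?L"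
    proof (rule inj_onI)
      fix Ks Ks' assume k: "Ks \<in> ?L" "Ks' \<in> ?L" "combine Ks Us = combine Ks' Us"
      have "combine Ks Us \<in> Span K Us" using mem[OF k(1)] Us(4) by simp
      from unique_decomposition[OF K Us(2) this] show "Ks = Ks'" using k Us(3) by auto
    qed
    show "(\<lambda>Ks. combine Ks Us) ` ?L = E"
      using Us(3) unfolding Us(4)[symmetric] Span_eq_combine_set_length_version[OF K Us(1)] by auto
  qed
  then have b: "bij_betw (\<lambda>Ks. combine Ks Us) {Ks. set Ks \<subseteq> K \<and> length Ks = n} E" .
  show "finite E" if "finite K"
    using bij_betw_finite[OF b] finite_lists_length_eq[OF that, of n] by simp
  show "card E = card K ^ n"
  proof (cases "finite K")
    case True then show ?thesis using bij_betw_same_card[OF b] card_lists_length_eq[OF True, of n] by simp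
  next
    case False
    show ?thesis
    proof (cases n)
      case 0
      then have "{Ks. set Ks \<subseteq> K \<and> length Ks = n} = {[]}" by auto
      then show ?thesis using bij_betw_same_card[OF b] 0 by simp
    next
      case (Suc m)
      have "infinite {Ks. set Ks \<subseteq> K \<and> length Ks = n}"
      proof
        assume fin: "finite {Ks. set Ks \<subseteq> K \<and> length Ks = n}"
        have "(\<lambda>c. replicate n c) ` K \<subseteq> {Ks. set Ks \<subseteq> K \<and> length Ks = n}" by auto
        then have "finite ((\<lambda>c. replicate n c) ` K)" using fin by (rule finite_subset)
        moreover have "inj_on (\<lambda>c. replicate n c) K" using Suc by (auto intro!: inj_onI)
        ultimately show False using False by (auto dest: finite_imageD)
      qed
      then have "infinite E" using bij_betw_finite[OF b] by simp
      then show ?thesis using False Suc by simp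
    qed
  qed
qed

context curve
begin

text \<open>Lifts of residues independent over \<open>k\<close> are subject to a relation of bounded
  length as in \<open>relation_ex\<close> for \<open>p\<close>. Reduction modulo \<open>p\<close>
  leaves only its constants, hence a nontrivial dependence. So the dimension is finite, and
  \<open>degree_at\<close> is a genuine dimension.\<close>

lemma finite_dimension_residue:
  assumes y: "y \<in> pts"
  shows "finite (carrier (residue_field (\<R> y)))"
    and "card (carrier (residue_field (\<R> y))) = card k ^ degree_at k F y"
proof -
  obtain p where p: "unif_ring (\<R> y) p" using pts_unif[OF y] .
  interpret u: unif_ring "\<R> y" p by (rule p)
  let ?\<kappa> = "residue_field (\<R> y)"
  define h where "h a = u.I 1 +>\<^bsub>\<R> y\<^esub> a" for a
  have \<kappa>: "?\<kappa> = u.T 1" by (rule u.residue_field_eq)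
  interpret h: ring_hom_cring "\<R> y" ?\<kappa> h unfolding \<kappa> h_def by (rule u.T_hom)
  have kF: "field ((\<R> y)\<lparr>carrier := k\<rparr>)"
    using subfield_iff(2)[OF k_subfield] by (simp add: local_ring_def)
  have ksub: "subfield k (\<R> y)" by (rule u.subfield_iff(1)[OF kF]) (use ptsD(2)[OF y] in simp)
  have nz: "\<one>\<^bsub>?\<kappa>\<^esub> \<noteq> \<zero>\<^bsub>?\<kappa>\<^esub>"
    using u.F.coset_zero_iff[of \<one> 1] u.mem_I_1[of \<one>] u.Units_one_closed unfolding \<kappa> by (simp add: u.T_ops pts_ring(3)[OF y])
  note im = ring_hom_ring.img_is_subfield[OF h.ring_hom_ring' ksub nz]
  have surj: "\<exists>a\<in>y. h a = c" if "c \<in> carrier ?\<kappa>" for c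
  proof -
    have "c \<in> a_rcosets\<^bsub>\<R> y\<^esub> u.I 1" using that unfolding \<kappa> u.T_carrier .
    then obtain a where "a \<in> carrier (\<R> y)" "c = h a" unfolding h_def by (rule u.F.cosetE)
    then show ?thesis by auto
  qed
  have hp: "h p = \<zero>\<^bsub>?\<kappa>\<^esub>"
    using u.F.coset_zero_iff[of p 1] u.mem_I[of p 1] pts_ring(3)[OF y] u.p_closed ptsD(3)[OF y]
    unfolding \<kappa> h_def by (auto simp: u.T_ops intro!: bexI[of _ \<one>])
  have py: "p \<in> y" "p \<in> carrier F" "p \<noteq> \<zero>" using u.p_closed u.p_nonzero ptsD(3)[OF y] by auto
  have fin: "h.S.finite_dimension (h ` k) (carrier ?\<kappa>)"
  proof (rule ccontr)
    assume inf: "\<not> ?thesis"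
    \<comment> \<open>In infinite dimension no finite list spans everything, so independent lists of
      every length exist.\<close>
    have "\<exists>Us. h.S.independent (h ` k) Us \<and> length Us = n" for n
    proof (induction n)
      case 0 then show ?case by auto
    next
      case (Suc n)
      then obtain Us where Us: "h.S.independent (h ` k) Us" "length Us = n" by blast
      have c: "set Us \<subseteq> carrier ?\<kappa>" using h.S.independent_in_carrier[OF Us(1)] .
      have "h.S.Span (h ` k) Us \<noteq> carrier ?\<kappa>"
        using inf h.S.Span_finite_dimension[OF im(2) c] by auto
      moreover have "h.S.Span (h ` k) Us \<subseteq> carrier ?\<kappa>"
        using h.S.Span_in_carrier[OF subfieldE(3)[OF im(2)] c] .
      ultimately obtain c where "c \<in> carrier ?\<kappa>" "c \<notin> h.S.Span (h ` k) Us" by blast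
      then show ?case using h.S.independent.li_Cons[OF _ _ Us(1)] Us(2) by (metis length_Cons)
    qed
    note ind = this
    obtain t where t: "t \<in> carrier F" "finite_dimension (generate_field F (insert t k)) (carrier F)"
      by (rule finite_transcendental)
    obtain M :: nat where M: "\<forall>u. (\<forall>i<M. u i \<in> carrier F) \<longrightarrow> (\<exists>\<alpha> w. (\<forall>i. \<alpha> i \<in> k \<and> (\<exists>m. w i \<in> B p m)) \<and>
       (\<exists>i<M. \<alpha> i \<noteq> \<zero>) \<and> (\<Oplus>i\<in>{..<M}. (\<alpha> i \<oplus> p \<otimes> w i) \<otimes> u i) = \<zero>)"
      using relation_ex[OF t py(2,3)] by (elim exE)
    obtain Us where Us: "h.S.independent (h ` k) Us" "length Us = M" using ind by blast
    have Uc: "Us ! i \<in> carrier ?\<kappa>" if "i < M" for i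
      using h.S.independent_in_carrier[OF Us(1)] Us(2) that nth_mem by blast
    have "\<exists>a. i < M \<longrightarrow> a \<in> y \<and> h a = Us ! i" for i using surj[OF Uc] by blast
    then obtain v where v: "\<And>i. i < M \<Longrightarrow> v i \<in> y \<and> h (v i) = Us ! i" by metis
    have "\<forall>i<M. v i \<in> carrier F" using v ptsD(3)[OF y] by blast
    then obtain \<alpha> w where r: "\<And>i. \<alpha> i \<in> k" "\<And>i. \<exists>m. w i \<in> B p m" "\<exists>i<M. \<alpha> i \<noteq> \<zero>"
      "(\<Oplus>i\<in>{..<M}. (\<alpha> i \<oplus> p \<otimes> w i) \<otimes> v i) = \<zero>" using M[rule_format, of v] by blast
    have \<alpha>y: "\<alpha> i \<in> y" for i using r(1) ptsD(2)[OF y] by blast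
    have wy: "w i \<in> y" for i using r(2)[of i] B_in_subring[OF y py(1)] by blast
    have cy: "(\<alpha> i \<oplus> p \<otimes> w i) \<otimes> v i \<in> y" if "i < M" for i
      using v[OF that] \<alpha>y wy py(1) by (auto intro!: pts_ring(6,7)[OF y])
    have hterm: "h ((\<alpha> i \<oplus> p \<otimes> w i) \<otimes> v i) = h (\<alpha> i) \<otimes>\<^bsub>?\<kappa>\<^esub> Us ! i" if "i < M" for i
    proof -
      have c: "p \<in> y" "w i \<in> y" "\<alpha> i \<in> y" "v i \<in> y" "p \<otimes> w i \<in> y" "\<alpha> i \<oplus> p \<otimes> w i \<in> y"
        using v[OF that] \<alpha>y wy py(1) by (auto intro!: pts_ring(6,7)[OF y])
      have "h ((\<alpha> i \<oplus> p \<otimes> w i) \<otimes> v i) = (h (\<alpha> i) \<oplus>\<^bsub>?\<kappa>\<^esub> h p \<otimes>\<^bsub>?\<kappa>\<^esub> h (w i)) \<otimes>\<^bsub>?\<kappa>\<^esub> h (v i)"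
        using h.hom_mult[of "\<alpha> i \<oplus> p \<otimes> w i" "v i"] h.hom_add[of "\<alpha> i" "p \<otimes> w i"] h.hom_mult[of p "w i"] c by simp
      then show ?thesis using v[OF that] h.hom_closed[of "w i"] h.hom_closed[of "\<alpha> i"] c unfolding hp by simp
    qed
    have "h (\<Oplus>\<^bsub>\<R> y\<^esub>i\<in>{..<M}. (\<alpha> i \<oplus> p \<otimes> w i) \<otimes> v i) = (\<Oplus>\<^bsub>?\<kappa>\<^esub>i\<in>{..<M}. h ((\<alpha> i \<oplus> p \<otimes> w i) \<otimes> v i))"
      using cy by (intro ring_hom_ring.hom_finsum'[OF h.ring_hom_ring']) auto
    also have "\<dots> = (\<Oplus>\<^bsub>?\<kappa>\<^esub>i\<in>{..<M}. h (\<alpha> i) \<otimes>\<^bsub>?\<kappa>\<^esub> Us ! i)"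
      using hterm Uc h.hom_closed \<alpha>y by (intro h.S.finsum_cong') auto
    also have "\<dots> = h.S.combine (map (\<lambda>i. h (\<alpha> i)) [0..<M]) (map (\<lambda>i. Us ! i) [0..<M])"
      using Uc h.hom_closed \<alpha>y by (intro h.S.combine_map[symmetric]) auto
    also have "map (\<lambda>i. Us ! i) [0..<M] = Us" using Us(2) map_nth by blast
    also have "(\<Oplus>\<^bsub>\<R> y\<^esub>i\<in>{..<M}. (\<alpha> i \<oplus> p \<otimes> w i) \<otimes> v i) = \<zero>"
      unfolding local_ring_def using r(4) cy by (subst finsum_subring[OF ptsD(1)[OF y]]) auto
    finally have "h.S.combine (map (\<lambda>i. h (\<alpha> i)) [0..<M]) Us = \<zero>\<^bsub>?\<kappa>\<^esub>" using h.hom_zero by simp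
    then have "set (take (length Us) (map (\<lambda>i. h (\<alpha> i)) [0..<M])) \<subseteq> {\<zero>\<^bsub>?\<kappa>\<^esub>}"
      using r(1) by (intro h.S.independent_imp_trivial_combine[OF im(2) Us(1)]) auto
    then have "h (\<alpha> i) = \<zero>\<^bsub>?\<kappa>\<^esub>" if "i < M" for i using that Us(2) by (simp add: image_subset_iff)
    then have "h (\<alpha> i) = h \<zero>" if "i < M" for i using that h.hom_zero by simp
    then have "\<alpha> i = \<zero>" if "i < M" for i
      using im(1) r(1) k_ring(2) that by (meson inj_onD)
    then show False using r(3) by blast
  qed
  have deg: "degree_at k F y = h.S.dim (h ` k) (carrier ?\<kappa>)"
    unfolding degree_at_def Let_def h_def u.max_ideal_eq ..
  have dim: "h.S.dimension (degree_at k F y) (h ` k) (carrier ?\<kappa>)"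
    using h.S.finite_dimensionE[OF im(2) fin] unfolding deg over_def .
  show "finite (carrier ?\<kappa>)" using h.S.dimension_card(2)[OF im(2) dim] k_finite by blast
  show "card (carrier ?\<kappa>) = card k ^ degree_at k F y"
    using h.S.dimension_card(1)[OF im(2) dim] card_image[OF im(1)] by simp
qed

end

section \<open>Modifications of vector bundles\<close>

lemma (in module) finsum_smult_rdistr:
  "\<lbrakk>finite A; f \<in> A \<rightarrow> carrier R; v \<in> carrier M\<rbrakk> \<Longrightarrow> (\<Oplus>i\<in>A. f i) \<odot>\<^bsub>M\<^esub> v = (\<Oplus>\<^bsub>M\<^esub>i\<in>A. f i \<odot>\<^bsub>M\<^esub> v)"
  by (induction A rule: finite_induct) (auto simp: smult_l_distr Pi_def)

lemma (in abelian_group) finsum_in_subgroup: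
  assumes "subgroup N (add_monoid G)" "finite A" "f \<in> A \<rightarrow> N"
  shows "(\<Oplus>i\<in>A. f i) \<in> N"
  using assms(2,3)
proof (induction A rule: finite_induct)
  case empty
  then show ?case using subgroup.one_closed[OF assms(1)] by simp
next
  case (insert a A)
  have N: "N \<subseteq> carrier G" using subgroup.subset[OF assms(1)] by simp
  have "f a \<in> carrier G" "f \<in> A \<rightarrow> carrier G" using insert N by auto
  then show ?case using insert subgroup.m_closed[OF assms(1), of "f a"] by (simp add: finsum_insert Pi_def)
qed

context curve
begin

abbreviation "opens \<equiv> nonempty_opens k F"

lemma open_Int: "U \<in> opens \<Longrightarrow> W \<in> opens \<Longrightarrow> y \<in> U \<Longrightarrow> y \<in> W \<Longrightarrow> U \<inter> W \<in> opens"
  unfolding nonempty_opens_def by (auto simp: Diff_Int)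

lemma open_pts: "U \<in> opens \<Longrightarrow> y \<in> U \<Longrightarrow> y \<in> pts"
  unfolding nonempty_opens_def by blast

lemma open_remove:
  assumes U: "U \<in> opens" and y: "y \<in> U" and fin: "finite {y' \<in> pts. \<not> P y'}" and P: "P y"
  shows "{y' \<in> U. P y'} \<in> opens"
proof -
  have "pts - {y' \<in> U. P y'} \<subseteq> (pts - U) \<union> {y' \<in> pts. \<not> P y'}" by blast
  moreover have "finite ((pts - U) \<union> {y' \<in> pts. \<not> P y'})" using U fin unfolding nonempty_opens_def by blast
  ultimately have "finite (pts - {y' \<in> U. P y'})" by (rule finite_subset)
  then show ?thesis using U y P unfolding nonempty_opens_def by blast
qed

lemma open_remove_point:
  assumes "U \<in> opens" "y \<in> U" "y \<noteq> x"
  shows "U - {x} \<in> opens"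
proof -
  have "finite {y' \<in> pts. \<not> y' \<noteq> x}" by (rule finite_subset[of _ "{x}"]) auto
  then have "{y' \<in> U. y' \<noteq> x} \<in> opens" using assms by (intro open_remove) auto
  moreover have "{y' \<in> U. y' \<noteq> x} = U - {x}" by blast
  ultimately show ?thesis by simp
qed

lemma regular_carrier: "carrier (regular_functions F U) = \<Inter>U"
  by (simp add: regular_functions_def)

end

section \<open>Sections and stalks\<close>

locale vector_space_curve = curve k F + V: module F V
  for k and F :: "'a ring" (structure) and V :: "('a, 'v) module"
begin

lemma module_local:
  assumes "y \<in> pts" shows "module (\<R> y) V"
proof (rule moduleI)
  show "cring (\<R> y)" using principal_domain.axioms(1)[OF ptsD(4)[OF assms]] domain.axioms(1) by blast
qed (use ptsD(3)[OF assms] V.M.abelian_group_axioms in \<open>auto simp: V.smult_l_distr V.smult_r_distr V.smult_assoc1\<close>)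

lemma lin_comb_unit:
  assumes "e \<in> {..<n} \<rightarrow> carrier V" "i < n"
  shows "lin_comb n V e (mat_unit_vec n F i) = e i"
proof -
  have "(\<Oplus>\<^bsub>V\<^esub>j\<in>{..<n}. mat_unit_vec n F i j \<odot>\<^bsub>V\<^esub> e j) = mat_unit_vec n F i i \<odot>\<^bsub>V\<^esub> e i"
    using assms funcset_mem[OF assms(1)] by (intro V.M.finsum_single) (auto simp: mat_unit_vec_def)
  then show ?thesis using assms(2) funcset_mem[OF assms(1)] by (simp add: lin_comb_def mat_unit_vec_def)
qed

lemma lin_comb_smult:
  assumes "e \<in> {..<n} \<rightarrow> carrier V" "c \<in> {..<n} \<rightarrow> carrier F" "a \<in> carrier F"
  shows "a \<odot>\<^bsub>V\<^esub> lin_comb n V e c = lin_comb n V e (\<lambda>i\<in>{..<n}. a \<otimes> c i)"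
proof -
  have "a \<odot>\<^bsub>V\<^esub> lin_comb n V e c = (\<Oplus>\<^bsub>V\<^esub>i\<in>{..<n}. a \<odot>\<^bsub>V\<^esub> (c i \<odot>\<^bsub>V\<^esub> e i))"
    unfolding lin_comb_def using assms by (intro V.finsum_smult_ldistr) auto
  also have "\<dots> = lin_comb n V e (\<lambda>i\<in>{..<n}. a \<otimes> c i)"
    unfolding lin_comb_def using assms by (intro V.M.finsum_cong') (auto simp: V.smult_assoc1 Pi_def)
  finally show ?thesis .
qed

abbreviation "bundle n E \<equiv> vector_bundle k F V n E"
abbreviation "st E y \<equiv> carrier (stalk k F V E y)"

lemma st_eq: "st E y = \<Union>{E U |U. U \<in> opens \<and> y \<in> U}"
  by (simp add: stalk_def)

lemma stI: "U \<in> opens \<Longrightarrow> y \<in> U \<Longrightarrow> v \<in> E U \<Longrightarrow> v \<in> st E y"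
  unfolding st_eq by blast

lemma stE:
  assumes "v \<in> st E y" obtains U where "U \<in> opens" "y \<in> U" "v \<in> E U"
  using assms unfolding st_eq by blast

lemma stalk_record: "stalk k F V E y = V\<lparr>carrier := st E y\<rparr>"
  by (simp add: stalk_def)

lemma bundleD:
  assumes "bundle n E"
  shows "E \<in> extensional opens"
    "\<And>U. U \<in> opens \<Longrightarrow> submodule (E U) (regular_functions F U) V"
    "\<And>U W. U \<in> opens \<Longrightarrow> W \<in> opens \<Longrightarrow> W \<subseteq> U \<Longrightarrow> E U \<subseteq> E W"
    "\<And>\<U>. \<U> \<subseteq> opens \<Longrightarrow> \<U> \<noteq> {} \<Longrightarrow> (\<Inter>W\<in>\<U>. E W) \<subseteq> E (\<Union>\<U>)"
    "\<And>y. y \<in> pts \<Longrightarrow> \<exists>U\<in>opens. y \<in> U \<and> (\<exists>e\<in>{..<n} \<rightarrow> carrier V.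
          bij_betw (lin_comb n V e) ({..<n} \<rightarrow>\<^sub>E carrier F) (carrier V) \<and>
          (\<forall>W\<in>opens. W \<subseteq> U \<longrightarrow> E W = lin_comb n V e ` ({..<n} \<rightarrow>\<^sub>E carrier (regular_functions F W))))"
proof -
  note * = assms[unfolded vector_bundle_def]
  show "E \<in> extensional opens" using * by (elim conjE)
  show "\<And>U. U \<in> opens \<Longrightarrow> submodule (E U) (regular_functions F U) V"
    using conjunct1[OF conjunct2[OF conjunct2[OF *]]] by blast
  show "\<And>U W. U \<in> opens \<Longrightarrow> W \<in> opens \<Longrightarrow> W \<subseteq> U \<Longrightarrow> E U \<subseteq> E W"
    using conjunct1[OF conjunct2[OF conjunct2[OF conjunct2[OF *]]]] by blast
  show "\<And>\<U>. \<U> \<subseteq> opens \<Longrightarrow> \<U> \<noteq> {} \<Longrightarrow> (\<Inter>W\<in>\<U>. E W) \<subseteq> E (\<Union>\<U>)"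
    using conjunct1[OF conjunct2[OF conjunct2[OF conjunct2[OF conjunct2[OF *]]]]] by blast
  show "\<And>y. y \<in> pts \<Longrightarrow> \<exists>U\<in>opens. y \<in> U \<and> (\<exists>e\<in>{..<n} \<rightarrow> carrier V.
          bij_betw (lin_comb n V e) ({..<n} \<rightarrow>\<^sub>E carrier F) (carrier V) \<and>
          (\<forall>W\<in>opens. W \<subseteq> U \<longrightarrow> E W = lin_comb n V e ` ({..<n} \<rightarrow>\<^sub>E carrier (regular_functions F W))))"
    using conjunct2[OF conjunct2[OF conjunct2[OF conjunct2[OF conjunct2[OF *]]]]] by (rule bspec)
qed

lemma local_basisE:
  assumes "bundle n E" "y \<in> pts"
  obtains U e where "U \<in> opens" "y \<in> U" "e \<in> {..<n} \<rightarrow> carrier V"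
    "bij_betw (lin_comb n V e) ({..<n} \<rightarrow>\<^sub>E carrier F) (carrier V)"
    "\<And>W. W \<in> opens \<Longrightarrow> W \<subseteq> U \<Longrightarrow> E W = lin_comb n V e ` ({..<n} \<rightarrow>\<^sub>E carrier (regular_functions F W))"
proof -
  from bundleD(5)[OF assms] show ?thesis
  proof (elim bexE conjE)
    fix U e assume "U \<in> opens" "y \<in> U" "e \<in> {..<n} \<rightarrow> carrier V"
      "bij_betw (lin_comb n V e) ({..<n} \<rightarrow>\<^sub>E carrier F) (carrier V)"
      "\<forall>W\<in>opens. W \<subseteq> U \<longrightarrow> E W = lin_comb n V e ` ({..<n} \<rightarrow>\<^sub>E carrier (regular_functions F W))"
    then show thesis by (intro that[of U e]) blast+
  qed
qed

lemma bundle_sections: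
  assumes "bundle n E" "U \<in> opens"
  shows "E U \<subseteq> carrier V" "\<zero>\<^bsub>V\<^esub> \<in> E U" "\<And>v. v \<in> E U \<Longrightarrow> \<ominus>\<^bsub>V\<^esub> v \<in> E U"
    "\<And>v w. v \<in> E U \<Longrightarrow> w \<in> E U \<Longrightarrow> v \<oplus>\<^bsub>V\<^esub> w \<in> E U"
    "\<And>c v. c \<in> \<Inter>U \<Longrightarrow> v \<in> E U \<Longrightarrow> c \<odot>\<^bsub>V\<^esub> v \<in> E U"
proof -
  note s = bundleD(2)[OF assms]
  note g = submodule.axioms(1)[OF s]
  show "E U \<subseteq> carrier V" "\<zero>\<^bsub>V\<^esub> \<in> E U" "\<And>v w. v \<in> E U \<Longrightarrow> w \<in> E U \<Longrightarrow> v \<oplus>\<^bsub>V\<^esub> w \<in> E U"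
    using subgroup.subset[OF g] subgroup.one_closed[OF g] subgroup.m_closed[OF g] by auto
  show "\<And>v. v \<in> E U \<Longrightarrow> \<ominus>\<^bsub>V\<^esub> v \<in> E U"
    using subgroup.m_inv_closed[OF g] by (simp add: a_inv_def)
  show "\<And>c v. c \<in> \<Inter>U \<Longrightarrow> v \<in> E U \<Longrightarrow> c \<odot>\<^bsub>V\<^esub> v \<in> E U"
    using submodule.smult_closed[OF s] by (simp add: regular_carrier)
qed

text \<open>A scalar from the local ring need not be regular on the open set of a given section; its
  finitely many poles are removed first.\<close>

lemma stalk_submodule:
  assumes E: "bundle n E" and y: "y \<in> pts"
  shows "submodule (st E y) (\<R> y) V"
proof -
  interpret L: module "\<R> y" V by (rule module_local[OF y])
  show ?thesis
  proof (rule L.submoduleI)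
    show "st E y \<subseteq> carrier V" using bundle_sections(1)[OF E] unfolding st_eq by blast
    obtain U where U: "U \<in> opens" "y \<in> U" using bundleD(5)[OF E y] by blast
    show "\<zero>\<^bsub>V\<^esub> \<in> st E y" using stI[OF U] bundle_sections(2)[OF E U(1)] by blast
    show "\<ominus>\<^bsub>V\<^esub> v \<in> st E y" if "v \<in> st E y" for v
      using that bundle_sections(3)[OF E] stI by (elim stE) blast
    show "v \<oplus>\<^bsub>V\<^esub> w \<in> st E y" if v: "v \<in> st E y" and w: "w \<in> st E y" for v w
    proof -
      obtain U where U: "U \<in> opens" "y \<in> U" "v \<in> E U" using v by (rule stE)
      obtain U' where U': "U' \<in> opens" "y \<in> U'" "w \<in> E U'" using w by (rule stE)
      have I: "U \<inter> U' \<in> opens" using open_Int U U' by blast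
      have "v \<in> E (U \<inter> U')" "w \<in> E (U \<inter> U')" using bundleD(3)[OF E] U U' I by blast+
      then have "v \<oplus>\<^bsub>V\<^esub> w \<in> E (U \<inter> U')" by (rule bundle_sections(4)[OF E I])
      then show ?thesis using stI[OF I] U U' by blast
    qed
    show "c \<odot>\<^bsub>V\<^esub> v \<in> st E y" if c: "c \<in> carrier (\<R> y)" and v: "v \<in> st E y" for c v
    proof -
      obtain U where U: "U \<in> opens" "y \<in> U" "v \<in> E U" using v by (rule stE)
      let ?W = "{y' \<in> U. c \<in> y'}"
      have W: "?W \<in> opens" using open_remove[OF U(1,2) finite_poles] c ptsD(3)[OF y] by simp
      have "v \<in> E ?W" using bundleD(3)[OF E U(1) W] U(3) by blast
      then have "c \<odot>\<^bsub>V\<^esub> v \<in> E ?W" by (rule bundle_sections(5)[OF E W, rotated]) blast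
      then show ?thesis by (rule stI[OF W, rotated]) (use U c in simp)
    qed
  qed
qed

lemma stalk_local_basis:
  assumes E: "bundle n E" and U: "U \<in> opens" "y \<in> U"
    and loc: "\<And>W. W \<in> opens \<Longrightarrow> W \<subseteq> U \<Longrightarrow> E W = lin_comb n V e ` ({..<n} \<rightarrow>\<^sub>E carrier (regular_functions F W))"
    and v: "v \<in> st E y"
  shows "\<exists>c\<in>{..<n} \<rightarrow>\<^sub>E y. v = lin_comb n V e c"
proof -
  obtain U' where U': "U' \<in> opens" "y \<in> U'" "v \<in> E U'" using v by (rule stE)
  have I: "U \<inter> U' \<in> opens" using open_Int U U' by blast
  have "v \<in> E (U \<inter> U')" using bundleD(3)[OF E U'(1) I] U' by blast
  then obtain c where c: "c \<in> {..<n} \<rightarrow>\<^sub>E \<Inter>(U \<inter> U')" "v = lin_comb n V e c"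
    using loc[OF I] unfolding regular_carrier by blast
  have "c \<in> {..<n} \<rightarrow>\<^sub>E y" using c(1) U U' by (auto simp: PiE_iff)
  then show ?thesis using c(2) by blast
qed

lemma basis_in_stalk:
  assumes E: "bundle n E" and U: "U \<in> opens" "y \<in> U"
    and e: "e \<in> {..<n} \<rightarrow> carrier V"
    and loc: "\<And>W. W \<in> opens \<Longrightarrow> W \<subseteq> U \<Longrightarrow> E W = lin_comb n V e ` ({..<n} \<rightarrow>\<^sub>E carrier (regular_functions F W))"
    and i: "i < n"
  shows "e i \<in> st E y"
proof -
  have "mat_unit_vec n F i \<in> {..<n} \<rightarrow>\<^sub>E carrier (regular_functions F U)"
    using pts_ring(2,3)[OF open_pts[OF U(1)]] by (auto simp: mat_unit_vec_def regular_carrier)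
  then have "e i \<in> E U" unfolding loc[OF U(1) order_refl] using lin_comb_unit[OF e i] by (metis image_eqI)
  then show ?thesis using stI[OF U] by blast
qed

text \<open>Both bundles live in the same \<open>V\<close>, so a local basis of \<open>E\<close> has
  coordinates in \<open>F\<close> with respect to a local basis of \<open>E'\<close>. Their poles at
  \<open>y\<close> have bounded order, and one power of \<open>p\<close> clears them all.\<close>

lemma stalks_commensurable:
  assumes E: "bundle n E" "bundle n E'" and y: "y \<in> pts" and p: "unif_ring (\<R> y) p"
  shows "\<exists>D::nat. \<forall>v\<in>st E y. p [^] D \<odot>\<^bsub>V\<^esub> v \<in> st E' y"
proof -
  interpret u: unif_ring "\<R> y" p by (rule p)
  interpret L: module "\<R> y" V by (rule module_local[OF y])
  have pc: "p \<in> y" "p \<in> carrier F" "p \<noteq> \<zero>" using u.p_closed u.p_nonzero ptsD(3)[OF y] by auto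
  have pm: "p \<in> mm y" unfolding mm_def using u.p_nonunit pc by simp
  note S = stalk_submodule[OF E(1) y] and S' = stalk_submodule[OF E(2) y]
  have S'sm: "c \<odot>\<^bsub>V\<^esub> v \<in> st E' y" if "c \<in> y" "v \<in> st E' y" for c v
    using submodule.smult_closed[OF S'] that by simp
  obtain U e where U: "U \<in> opens" "y \<in> U" "e \<in> {..<n} \<rightarrow> carrier V"
    "bij_betw (lin_comb n V e) ({..<n} \<rightarrow>\<^sub>E carrier F) (carrier V)"
    "\<And>W. W \<in> opens \<Longrightarrow> W \<subseteq> U \<Longrightarrow> E W = lin_comb n V e ` ({..<n} \<rightarrow>\<^sub>E carrier (regular_functions F W))"
    using local_basisE[OF E(1) y] by metis
  obtain U' e' where U': "U' \<in> opens" "y \<in> U'" "e' \<in> {..<n} \<rightarrow> carrier V"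
    "bij_betw (lin_comb n V e') ({..<n} \<rightarrow>\<^sub>E carrier F) (carrier V)"
    "\<And>W. W \<in> opens \<Longrightarrow> W \<subseteq> U' \<Longrightarrow> E' W = lin_comb n V e' ` ({..<n} \<rightarrow>\<^sub>E carrier (regular_functions F W))"
    using local_basisE[OF E(2) y] by metis
  have e'st: "e' i \<in> st E' y" if "i < n" for i using basis_in_stalk[OF E(2) U'(1-3,5) that] .
  have comb: "lin_comb n V e' c \<in> st E' y" if "c \<in> {..<n} \<rightarrow> y" for c
    unfolding lin_comb_def
    by (rule V.M.finsum_in_subgroup[OF submodule.axioms(1)[OF S']]) (use that S'sm e'st in auto)
  \<comment> \<open>The property is kept for all large exponents, not for one, so that the bounds
    for different basis vectors can be combined by adding them.\<close>
  have big: "\<exists>D0. \<forall>D\<ge>D0. p [^] (D::nat) \<odot>\<^bsub>V\<^esub> v \<in> st E' y" if v: "v \<in> carrier V" for v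
  proof -
    obtain c where c: "c \<in> {..<n} \<rightarrow>\<^sub>E carrier F" "v = lin_comb n V e' c"
      using v bij_betw_imp_surj_on[OF U'(4)] by blast
    have "\<exists>D0. \<forall>D\<ge>D0. c i \<otimes> p [^] (D::nat) \<in> mm y" if "i < n" for i
      using mm_power_absorb[OF y pm, of "c i"] c(1) that by (auto simp: PiE_iff)
    then obtain D0 where D0: "\<And>i D. i < n \<Longrightarrow> D \<ge> D0 i \<Longrightarrow> c i \<otimes> p [^] (D::nat) \<in> mm y" by metis
    have "p [^] D \<odot>\<^bsub>V\<^esub> v \<in> st E' y" if D: "D \<ge> (\<Sum>i<n. D0 i)" for D
    proof -
      have "p [^] D \<otimes> c i \<in> y" if "i < n" for i
      proof -
        have "D0 i \<le> (\<Sum>i<n. D0 i)" using that by (intro member_le_sum) auto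
        then have "c i \<otimes> p [^] D \<in> y" using D0[OF that, of D] D mm_sub by simp
        moreover have "c i \<in> carrier F" using c(1) that by auto
        ultimately show ?thesis using pc by (simp add: m_comm)
      qed
      then have "lin_comb n V e' (\<lambda>i\<in>{..<n}. p [^] D \<otimes> c i) \<in> st E' y" by (intro comb) auto
      then show ?thesis using lin_comb_smult[OF U'(3), of c "p [^] D"] c pc by (auto simp: PiE_iff)
    qed
    then show ?thesis by blast
  qed
  have "\<exists>D0. \<forall>D\<ge>D0. p [^] (D::nat) \<odot>\<^bsub>V\<^esub> e i \<in> st E' y" if "i < n" for i
    using big[of "e i"] U(3) that by auto
  then obtain D0 where D0: "\<And>i D. i < n \<Longrightarrow> D \<ge> D0 i \<Longrightarrow> p [^] (D::nat) \<odot>\<^bsub>V\<^esub> e i \<in> st E' y" by metis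
  define D where "D = (\<Sum>i<n. D0 i)"
  have De: "p [^] D \<odot>\<^bsub>V\<^esub> e i \<in> st E' y" if "i < n" for i
    using D0[OF that, of D] that unfolding D_def by (simp add: member_le_sum)
  have "p [^] D \<odot>\<^bsub>V\<^esub> v \<in> st E' y" if v: "v \<in> st E y" for v
  proof -
    obtain c where c: "c \<in> {..<n} \<rightarrow>\<^sub>E y" "v = lin_comb n V e c"
      using stalk_local_basis[OF E(1) U(1,2,5) v] by blast
    have cc: "c i \<in> y" "c i \<in> carrier F" if "i < n" for i using c(1) that ptsD(3)[OF y] by auto
    have "p [^] D \<odot>\<^bsub>V\<^esub> v = (\<Oplus>\<^bsub>V\<^esub>i\<in>{..<n}. p [^] D \<odot>\<^bsub>V\<^esub> (c i \<odot>\<^bsub>V\<^esub> e i))"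
      unfolding c(2) lin_comb_def using cc U(3) pc by (intro V.finsum_smult_ldistr) auto
    also have "\<dots> \<in> st E' y"
    proof (rule V.M.finsum_in_subgroup[OF submodule.axioms(1)[OF S']])
      show "(\<lambda>i. p [^] D \<odot>\<^bsub>V\<^esub> (c i \<odot>\<^bsub>V\<^esub> e i)) \<in> {..<n} \<rightarrow> st E' y"
      proof
        fix i assume i: "i \<in> {..<n}"
        then have ei: "e i \<in> carrier V" using U(3) by auto
        have "p [^] D \<odot>\<^bsub>V\<^esub> (c i \<odot>\<^bsub>V\<^esub> e i) = c i \<odot>\<^bsub>V\<^esub> (p [^] D \<odot>\<^bsub>V\<^esub> e i)"
          using i cc ei pc by (simp add: V.smult_assoc1[symmetric] m_comm)
        then show "p [^] D \<odot>\<^bsub>V\<^esub> (c i \<odot>\<^bsub>V\<^esub> e i) \<in> st E' y" using S'sm De cc i by simp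
      qed
    qed simp
    finally show ?thesis .
  qed
  then show ?thesis by blast
qed

text \<open>A section of \<open>E\<close> over \<open>U\<close> with germ in the stalk of
  \<open>E'\<close> at \<open>x\<close> belongs to \<open>E'\<close> near \<open>x\<close> and, by
  equality off \<open>x\<close>, on \<open>U - {x}\<close>. The sheaf axiom glues the two.\<close>

lemma sections_from_stalk:
  assumes E: "bundle n E" "bundle n E'" and le: "\<And>U. U \<in> opens \<Longrightarrow> E' U \<subseteq> E U"
    and eq: "\<And>U. U \<in> opens \<Longrightarrow> x \<notin> U \<Longrightarrow> E' U = E U" and U: "U \<in> opens" "x \<in> U"
  shows "E' U = {v \<in> E U. v \<in> st E' x}"
proof
  show "E' U \<subseteq> {v \<in> E U. v \<in> st E' x}" using le[OF U(1)] stI[OF U] by blast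
  show "{v \<in> E U. v \<in> st E' x} \<subseteq> E' U"
  proof
    fix v assume v: "v \<in> {v \<in> E U. v \<in> st E' x}"
    then obtain W where W: "W \<in> opens" "x \<in> W" "v \<in> E' W" by (auto elim: stE)
    show "v \<in> E' U"
    proof (cases "U = {x}")
      \<comment> \<open>Treated apart because \<open>U - {x}\<close> would be empty, and bundles are
        recorded on nonempty open sets only.\<close>
      case True then show ?thesis using bundleD(3)[OF E(2) W(1) U(1)] W by blast
    next
      case False
      then obtain y where "y \<in> U" "y \<noteq> x" using U by blast
      then have U0: "U - {x} \<in> opens" using open_remove_point U by blast
      have "v \<in> E' (U - {x})" using eq[OF U0] bundleD(3)[OF E(1) U(1) U0] v by blast
      moreover have "(\<Inter>W\<in>{W, U - {x}}. E' W) \<subseteq> E' (\<Union>{W, U - {x}})"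
        by (rule bundleD(4)[OF E(2)]) (use W U0 in auto)
      ultimately have *: "v \<in> E' (W \<union> (U - {x}))" using W by auto
      have "W \<union> (U - {x}) \<in> opens" 
      proof -
        have "finite (pts - (W \<union> (U - {x})))"
          by (rule finite_subset[of _ "pts - W"]) (use W(1) in \<open>auto simp: nonempty_opens_def\<close>)
        then show ?thesis using W U0 unfolding nonempty_opens_def by blast
      qed
      then show ?thesis using bundleD(3)[OF E(2) _ U(1), of "W \<union> (U - {x})"] * W(2) by blast
    qed
  qed
qed

section \<open>Changing a bundle at one point\<close>

definition modify :: "'a set \<Rightarrow> ('a set set \<Rightarrow> 'v set) \<Rightarrow> 'v set \<Rightarrow> 'a set set \<Rightarrow> 'v set" where
  "modify x E N = (\<lambda>U\<in>opens. if x \<in> U then E U \<inter> N else E U)"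

lemma modify_sections:
  "U \<in> opens \<Longrightarrow> x \<in> U \<Longrightarrow> modify x E N U = E U \<inter> N"
  "U \<in> opens \<Longrightarrow> x \<notin> U \<Longrightarrow> modify x E N U = E U"
  by (simp_all add: modify_def)

lemma modify_stalk: "st (modify x E N) x = st E x \<inter> N"
proof -
  have "{modify x E N U |U. U \<in> opens \<and> x \<in> U} = {E U \<inter> N |U. U \<in> opens \<and> x \<in> U}"
    using modify_sections(1) by (intro Collect_cong) metis
  then show ?thesis unfolding st_eq by auto
qed

lemma same_stalk:
  assumes E: "bundle n E" "bundle n E'" and eq: "\<And>U. U \<in> opens \<Longrightarrow> x \<notin> U \<Longrightarrow> E' U = E U" and "y \<noteq> x"
  shows "st E' y = st E y"
proof -
  have "st E1 y \<subseteq> st E2 y" if b: "bundle n E1" "bundle n E2" "\<And>U. U \<in> opens \<Longrightarrow> x \<notin> U \<Longrightarrow> E1 U = E2 U" for E1 E2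
  proof
    fix v assume "v \<in> st E1 y"
    then obtain U where U: "U \<in> opens" "y \<in> U" "v \<in> E1 U" by (rule stE)
    have U0: "U - {x} \<in> opens" using open_remove_point U \<open>y \<noteq> x\<close> by blast
    have "v \<in> E2 (U - {x})" using bundleD(3)[OF b(1) U(1) U0] b(3)[OF U0] U(3) by blast
    then show "v \<in> st E2 y" using stI[OF U0] U \<open>y \<noteq> x\<close> by blast
  qed
  from this[OF E(2,1)] this[OF E(1,2)] show ?thesis using eq by auto
qed

text \<open>The sheaf conditions pass to the intersection with \<open>N\<close>, and at points other
  than \<open>x\<close> a basis of \<open>E\<close> works after \<open>x\<close> is removed from the
  neighbourhood. Only local freeness at \<open>x\<close> has to be supplied.\<close>

lemma modify_bundle:
  assumes E: "bundle n E" and x: "x \<in> pts" and N: "submodule N (\<R> x) V"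
    and loc: "\<exists>U\<in>opens. x \<in> U \<and> (\<exists>e\<in>{..<n} \<rightarrow> carrier V.
          bij_betw (lin_comb n V e) ({..<n} \<rightarrow>\<^sub>E carrier F) (carrier V) \<and>
          (\<forall>W\<in>opens. W \<subseteq> U \<longrightarrow> modify x E N W = lin_comb n V e ` ({..<n} \<rightarrow>\<^sub>E carrier (regular_functions F W))))"
  shows "bundle n (modify x E N)"
  unfolding vector_bundle_def
proof (intro conjI ballI allI impI)
  interpret L: module "\<R> x" V by (rule module_local[OF x])
  note Ns = L.submoduleE[OF N]
  show "module F V" by (rule V.module_axioms)
  show "modify x E N \<in> extensional opens" by (simp add: modify_def)
  fix U assume U: "U \<in> opens"
  note s = bundle_sections[OF E U]
  show "submodule (modify x E N U) (regular_functions F U) V"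
  proof (cases "x \<in> U")
    case False then show ?thesis using bundleD(2)[OF E U] U by (simp add: modify_sections)
  next
    case True
    have "subgroup (E U \<inter> N) (add_monoid V)"
      by (rule V.M.add.subgroups_Inter_pair[OF submodule.axioms(1)[OF bundleD(2)[OF E U]] submodule.axioms(1)[OF N]])
    then show ?thesis unfolding modify_sections(1)[OF U True]
      by (intro submodule.intro submodule_axioms.intro) (use s(5) Ns(4) True in \<open>auto simp: regular_carrier\<close>)
  qed
next
  fix U W assume "U \<in> opens" "W \<in> opens" "W \<subseteq> U"
  then show "modify x E N U \<subseteq> modify x E N W"
    using bundleD(3)[OF E] by (auto simp: modify_def)
next
  fix \<U> assume \<U>: "\<U> \<subseteq> opens" "\<U> \<noteq> {}"
  have un: "\<Union>\<U> \<in> opens"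
  proof -
    obtain W where W: "W \<in> \<U>" using \<U> by blast
    have "finite (pts - W)" "W \<noteq> {}" using W \<U>(1) unfolding nonempty_opens_def by blast+
    moreover have "pts - \<Union>\<U> \<subseteq> pts - W" using W by blast
    ultimately have "finite (pts - \<Union>\<U>)" "\<Union>\<U> \<noteq> {}" using W by (auto intro: finite_subset)
    moreover have "\<Union>\<U> \<subseteq> pts" using \<U>(1) unfolding nonempty_opens_def by blast
    ultimately show ?thesis unfolding nonempty_opens_def by blast
  qed
  show "(\<Inter>W\<in>\<U>. modify x E N W) \<subseteq> modify x E N (\<Union>\<U>)"
  proof
    fix v assume v: "v \<in> (\<Inter>W\<in>\<U>. modify x E N W)"
    have "v \<in> E W" if W: "W \<in> \<U>" for W
    proof -
      have "v \<in> modify x E N W" "W \<in> opens" using v W \<U>(1) by blast+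
      then show ?thesis by (cases "x \<in> W") (simp_all add: modify_sections)
    qed
    then have vE: "v \<in> E (\<Union>\<U>)" using bundleD(4)[OF E \<U>] by blast
    show "v \<in> modify x E N (\<Union>\<U>)"
    proof (cases "x \<in> \<Union>\<U>")
      case True
      then obtain W where "W \<in> \<U>" "x \<in> W" by blast
      then have "v \<in> N" using v \<U>(1) modify_sections(1)[of W x E N] by blast
      then show ?thesis using vE un True by (simp add: modify_sections(1))
    next
      case False then show ?thesis using vE un by (simp add: modify_sections(2))
    qed
  qed
next
  fix y assume y: "y \<in> pts"
  show "\<exists>U\<in>opens. y \<in> U \<and> (\<exists>e\<in>{..<n} \<rightarrow> carrier V.
          bij_betw (lin_comb n V e) ({..<n} \<rightarrow>\<^sub>E carrier F) (carrier V) \<and>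
          (\<forall>W\<in>opens. W \<subseteq> U \<longrightarrow> modify x E N W = lin_comb n V e ` ({..<n} \<rightarrow>\<^sub>E carrier (regular_functions F W))))"
  proof (cases "y = x")
    case True then show ?thesis using loc by simp
  next
    case False
    obtain U e where U: "U \<in> opens" "y \<in> U" "e \<in> {..<n} \<rightarrow> carrier V"
      "bij_betw (lin_comb n V e) ({..<n} \<rightarrow>\<^sub>E carrier F) (carrier V)"
      "\<And>W. W \<in> opens \<Longrightarrow> W \<subseteq> U \<Longrightarrow> E W = lin_comb n V e ` ({..<n} \<rightarrow>\<^sub>E carrier (regular_functions F W))"
      using local_basisE[OF E y] by metis
    have U0: "U - {x} \<in> opens" using open_remove_point[OF U(1,2) False] .
    have "modify x E N W = lin_comb n V e ` ({..<n} \<rightarrow>\<^sub>E carrier (regular_functions F W))"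
      if W: "W \<in> opens" "W \<subseteq> U - {x}" for W
    proof -
      have "x \<notin> W" "W \<subseteq> U" using W(2) by blast+
      then show ?thesis using modify_sections(2)[OF W(1)] U(5)[OF W(1)] by simp
    qed
    then show ?thesis using U(2-4) False by (intro bexI[OF _ U0] conjI bexI[of _ e]) auto
  qed
qed

lemma lin_comb_split:
  assumes "e \<in> {..<n} \<rightarrow> carrier V" "c \<in> {..<n} \<rightarrow> carrier F" "i < n"
  shows "lin_comb n V e c = c i \<odot>\<^bsub>V\<^esub> e i \<oplus>\<^bsub>V\<^esub> (\<Oplus>\<^bsub>V\<^esub>j\<in>{..<n} - {i}. c j \<odot>\<^bsub>V\<^esub> e j)"
proof -
  have "insert i ({..<n} - {i}) = {..<n}" using assms(3) by blast
  moreover have "(\<Oplus>\<^bsub>V\<^esub>j\<in>insert i ({..<n} - {i}). c j \<odot>\<^bsub>V\<^esub> e j) =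
      c i \<odot>\<^bsub>V\<^esub> e i \<oplus>\<^bsub>V\<^esub> (\<Oplus>\<^bsub>V\<^esub>j\<in>{..<n} - {i}. c j \<odot>\<^bsub>V\<^esub> e j)"
    using assms by (intro V.M.finsum_insert) (auto simp: Pi_def)
  ultimately show ?thesis by (simp add: lin_comb_def)
qed

text \<open>The kernel of a nonzero functional to the residue field has an explicit basis: one basis
  vector \<open>e i0\<close> with nonzero value is multiplied by \<open>p\<close>, and each of the
  others is corrected by a multiple of \<open>e i0\<close> so as to lie in the kernel. On a small
  neighbourhood of \<open>x\<close> the same vectors generate the modified sheaf.\<close>

lemma modify_bundle_step:
  assumes E: "bundle n E" and x: "x \<in> pts" and p: "unif_ring (\<R> x) p"
    and lam_closed: "\<And>v. v \<in> st E x \<Longrightarrow> lam v \<in> carrier (trunc_ring (\<R> x) 1)"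
    and lam_add: "\<And>v w. v \<in> st E x \<Longrightarrow> w \<in> st E x \<Longrightarrow> lam (v \<oplus>\<^bsub>V\<^esub> w) = lam v \<oplus>\<^bsub>trunc_ring (\<R> x) 1\<^esub> lam w"
    and lam_smult: "\<And>c v. c \<in> x \<Longrightarrow> v \<in> st E x \<Longrightarrow>
      lam (c \<odot>\<^bsub>V\<^esub> v) = (unif_ring.I (\<R> x) p 1 +>\<^bsub>\<R> x\<^esub> c) \<otimes>\<^bsub>trunc_ring (\<R> x) 1\<^esub> lam v"
    and lam_nz: "\<exists>v\<in>st E x. lam v \<noteq> \<zero>\<^bsub>trunc_ring (\<R> x) 1\<^esub>"
  shows "bundle n (modify x E {v \<in> st E x. lam v = \<zero>\<^bsub>trunc_ring (\<R> x) 1\<^esub>})"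
proof -
  interpret u: unif_ring "\<R> x" p by (rule p)
  interpret L: module "\<R> x" V by (rule module_local[OF x])
  note One_nat_def [simp del]
  let ?\<kappa> = "trunc_ring (\<R> x) 1"
  define h where "h a = u.I 1 +>\<^bsub>\<R> x\<^esub> a" for a
  interpret \<kappa>: field ?\<kappa>
    unfolding u.trunc_ring_eq by (rule maximalideal.quotient_is_field[OF u.I_1_maximal u.is_cring])
  interpret h: ring_hom_cring "\<R> x" ?\<kappa> h unfolding h_def by (rule u.T_hom)
  define N where "N = {v \<in> st E x. lam v = \<zero>\<^bsub>?\<kappa>\<^esub>}"
  note S = stalk_submodule[OF E x]
  note Sm = L.submoduleE[OF S]
  have stc: "v \<in> carrier V" if "v \<in> st E x" for v using Sm(1) that by blast
  have sm: "c \<odot>\<^bsub>V\<^esub> v \<in> st E x" if "c \<in> x" "v \<in> st E x" for c v using Sm(4) that by simp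
  have ls: "lam (c \<odot>\<^bsub>V\<^esub> v) = h c \<otimes>\<^bsub>?\<kappa>\<^esub> lam v" if "c \<in> x" "v \<in> st E x" for c v
    using lam_smult[OF that] by (simp add: h_def)
  have hz: "h c = \<zero>\<^bsub>?\<kappa>\<^esub> \<longleftrightarrow> c \<in> mm x" if "c \<in> x" for c
    using u.F.coset_zero_iff[of c 1] u.mem_I_1[of c] that by (simp add: h_def u.T_ops mm_def)
  have xc: "c \<in> carrier F" if "c \<in> x" for c using ptsD(3)[OF x that] .
  have pc: "p \<in> x" "p \<in> carrier F" "p \<noteq> \<zero>" using u.p_closed u.p_nonzero xc by auto
  have z0: "\<zero>\<^bsub>V\<^esub> \<in> st E x" using subgroup.one_closed[OF submodule.axioms(1)[OF S]] by simp
  have Nsub: "submodule N (\<R> x) V"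
  proof (rule L.submoduleI)
    show "N \<subseteq> carrier V" using stc by (auto simp: N_def)
    show smN: "c \<odot>\<^bsub>V\<^esub> v \<in> N" if "c \<in> carrier (\<R> x)" "v \<in> N" for c v
      using that sm ls h.hom_closed[of c] \<kappa>.r_null by (simp add: N_def del: One_nat_def)
    have "lam \<zero>\<^bsub>V\<^esub> = lam (\<zero> \<odot>\<^bsub>V\<^esub> \<zero>\<^bsub>V\<^esub>)" by simp
    also have "\<dots> = \<zero>\<^bsub>?\<kappa>\<^esub>" using ls[OF _ z0, of \<zero>] pts_ring(2)[OF x] lam_closed[OF z0] hz[of \<zero>] zero_mm[OF x] by simp
    finally show "\<zero>\<^bsub>V\<^esub> \<in> N" using z0 by (simp add: N_def)
    show "v \<oplus>\<^bsub>V\<^esub> w \<in> N" if "v \<in> N" "w \<in> N" for v w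
      using that Sm(5) lam_add by (simp add: N_def)
    show "\<ominus>\<^bsub>V\<^esub> v \<in> N" if v: "v \<in> N" for v
    proof -
      have "v \<in> carrier V" using v stc by (simp add: N_def)
      then have "\<ominus>\<^bsub>V\<^esub> v = (\<ominus> \<one>) \<odot>\<^bsub>V\<^esub> v" by (simp add: V.smult_l_minus)
      then show ?thesis using smN[OF _ v, of "\<ominus> \<one>"] pts_ring(3,5)[OF x] by simp
    qed
  qed
  note Nm = L.submoduleE[OF Nsub]
  obtain U e where U: "U \<in> opens" "x \<in> U" "e \<in> {..<n} \<rightarrow> carrier V"
    "bij_betw (lin_comb n V e) ({..<n} \<rightarrow>\<^sub>E carrier F) (carrier V)"
    "\<And>W. W \<in> opens \<Longrightarrow> W \<subseteq> U \<Longrightarrow> E W = lin_comb n V e ` ({..<n} \<rightarrow>\<^sub>E carrier (regular_functions F W))"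
    using local_basisE[OF E x] by metis
  have ec: "e i \<in> carrier V" if "i < n" for i using U(3) that by auto
  have est: "e i \<in> st E x" if "i < n" for i using basis_in_stalk[OF E U(1-3,5) that] .
  have "\<exists>i<n. lam (e i) \<noteq> \<zero>\<^bsub>?\<kappa>\<^esub>"
  proof (rule ccontr)
    assume "\<not> ?thesis"
    then have eN: "e i \<in> N" if "i < n" for i using est that by (auto simp: N_def)
    have "v \<in> N" if v: "v \<in> st E x" for v
    proof -
      obtain c where c: "c \<in> {..<n} \<rightarrow>\<^sub>E x" "v = lin_comb n V e c"
        using stalk_local_basis[OF E U(1,2,5) v] by blast
      have "c i \<odot>\<^bsub>V\<^esub> e i \<in> N" if "i < n" for i using Nm(4)[of "c i" "e i"] c(1) eN[OF that] that by auto
      then show ?thesis unfolding c(2) lin_comb_def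
        by (intro V.M.finsum_in_subgroup[OF submodule.axioms(1)[OF Nsub]]) auto
    qed
    then show False using lam_nz by (auto simp: N_def)
  qed
  then obtain i0 where i0: "i0 < n" "lam (e i0) \<noteq> \<zero>\<^bsub>?\<kappa>\<^esub>" by blast
  let ?l0 = "lam (e i0)"
  have l0: "?l0 \<in> carrier ?\<kappa>" "?l0 \<in> Units ?\<kappa>" using lam_closed[OF est[OF i0(1)]] i0(2) \<kappa>.field_Units by auto
  \<comment> \<open>\<open>d\<close> lifts the residue class \<open>- lam (e i) / lam (e i0)\<close>
    to the local ring.\<close>
  have "\<exists>d. i < n \<longrightarrow> d \<in> x \<and> e i \<oplus>\<^bsub>V\<^esub> d \<odot>\<^bsub>V\<^esub> e i0 \<in> N" for i
  proof (cases "i < n")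
    case True
    have li: "lam (e i) \<in> carrier ?\<kappa>" using lam_closed[OF est[OF True]] .
    let ?c = "\<ominus>\<^bsub>?\<kappa>\<^esub> (lam (e i) \<otimes>\<^bsub>?\<kappa>\<^esub> inv\<^bsub>?\<kappa>\<^esub> ?l0)"
    have inv: "inv\<^bsub>?\<kappa>\<^esub> ?l0 \<in> carrier ?\<kappa>" using l0 by (intro \<kappa>.Units_inv_closed)
    then have cc: "?c \<in> carrier ?\<kappa>" using li by simp
    then have "?c \<in> a_rcosets\<^bsub>\<R> x\<^esub> u.I 1" unfolding u.T_carrier .
    then obtain d where d: "d \<in> carrier (\<R> x)" "?c = h d" unfolding h_def by (rule u.F.cosetE)
    have dx: "d \<in> x" using d by simp
    have "lam (e i \<oplus>\<^bsub>V\<^esub> d \<odot>\<^bsub>V\<^esub> e i0) = lam (e i) \<oplus>\<^bsub>?\<kappa>\<^esub> ?c \<otimes>\<^bsub>?\<kappa>\<^esub> ?l0"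
      unfolding d(2) using lam_add[OF est[OF True] sm[OF dx est[OF i0(1)]]] ls[OF dx est[OF i0(1)]] by simp
    also have "?c \<otimes>\<^bsub>?\<kappa>\<^esub> ?l0 = \<ominus>\<^bsub>?\<kappa>\<^esub> lam (e i)"
      using li inv l0 \<kappa>.Units_l_inv[OF l0(2)] by (simp add: \<kappa>.l_minus \<kappa>.m_assoc)
    also have "lam (e i) \<oplus>\<^bsub>?\<kappa>\<^esub> \<dots> = \<zero>\<^bsub>?\<kappa>\<^esub>" using li by (rule \<kappa>.r_neg)
    finally have "e i \<oplus>\<^bsub>V\<^esub> d \<odot>\<^bsub>V\<^esub> e i0 \<in> N"
      using Sm(5)[OF est[OF True] sm[OF dx est[OF i0(1)]]] by (simp add: N_def)
    then show ?thesis using dx by blast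
  qed simp
  then obtain d where d: "\<And>i. i < n \<Longrightarrow> d i \<in> x \<and> e i \<oplus>\<^bsub>V\<^esub> d i \<odot>\<^bsub>V\<^esub> e i0 \<in> N" by metis
  have dc: "d i \<in> carrier F" if "i < n" for i using d[OF that] xc by blast
  define f where "f i = (if i = i0 then p \<odot>\<^bsub>V\<^esub> e i0 else e i \<oplus>\<^bsub>V\<^esub> d i \<odot>\<^bsub>V\<^esub> e i0)" for i
  have fc: "f i \<in> carrier V" if "i < n" for i unfolding f_def using ec[OF that] ec[OF i0(1)] dc[OF that] pc by simp
  \<comment> \<open>The total multiple of \<open>e i0\<close> brought in by the corrections. It does
    not involve the coordinate \<open>i0\<close>, so changing that coordinate leaves it as it
    is.\<close>
  define Q where "Q a = (\<Oplus>j\<in>{..<n} - {i0}. d j \<otimes> a j)" for a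
  define rest where "rest a = (\<Oplus>\<^bsub>V\<^esub>j\<in>{..<n} - {i0}. a j \<odot>\<^bsub>V\<^esub> f j)" for a
  have Qc: "Q a \<in> carrier F" if "a \<in> {..<n} \<rightarrow> carrier F" for a
    unfolding Q_def using that dc by (intro finsum_closed) (auto simp: Pi_def)
  have Qy: "Q a \<in> y" if "y \<in> pts" "a \<in> {..<n} \<rightarrow> y" "\<And>j. j < n \<Longrightarrow> d j \<in> y" for y a
    unfolding Q_def
    by (rule finsum_in_subgroup) (use that pts_ring(6)[OF that(1)] subring.axioms(1)[OF ptsD(1)[OF that(1)]] in auto)
  have Qupd: "Q (a(i0 := t)) = Q a" if "a \<in> {..<n} \<rightarrow> carrier F" for a t
    unfolding Q_def by (intro finsum_cong') (use that dc in auto)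
  have restupd: "rest (a(i0 := t)) = rest a" if "a \<in> {..<n} \<rightarrow> carrier F" for a t
    unfolding rest_def by (intro V.M.finsum_cong') (use that fc in auto)
  have restc: "rest a \<in> carrier V" if "a \<in> {..<n} \<rightarrow> carrier F" for a
    unfolding rest_def using that fc by (intro V.M.finsum_closed) (auto simp: Pi_def)
  have lin_f: "lin_comb n V f b = (p \<otimes> b i0) \<odot>\<^bsub>V\<^esub> e i0 \<oplus>\<^bsub>V\<^esub> rest b" if b: "b \<in> {..<n} \<rightarrow> carrier F" for b
  proof -
    have "b i0 \<in> carrier F" using b i0 by auto
    then have "b i0 \<odot>\<^bsub>V\<^esub> f i0 = (p \<otimes> b i0) \<odot>\<^bsub>V\<^esub> e i0"
      using ec[OF i0(1)] pc by (simp add: f_def V.smult_assoc1[symmetric] m_comm)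
    then show ?thesis using lin_comb_split[of f n b i0] fc b i0 by (simp add: rest_def Pi_def)
  qed
  have rest_eq: "rest a = (\<Oplus>\<^bsub>V\<^esub>j\<in>{..<n} - {i0}. a j \<odot>\<^bsub>V\<^esub> e j) \<oplus>\<^bsub>V\<^esub> Q a \<odot>\<^bsub>V\<^esub> e i0"
    if a: "a \<in> {..<n} \<rightarrow> carrier F" for a
  proof -
    have ac: "a j \<in> carrier F" if "j < n" for j using a that by auto
    have "rest a = (\<Oplus>\<^bsub>V\<^esub>j\<in>{..<n} - {i0}. a j \<odot>\<^bsub>V\<^esub> e j \<oplus>\<^bsub>V\<^esub> (d j \<otimes> a j) \<odot>\<^bsub>V\<^esub> e i0)"
      unfolding rest_def using ac ec dc i0(1)
      by (intro V.M.finsum_cong') (auto simp: f_def V.smult_r_distr V.smult_assoc1[symmetric] m_comm)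
    also have "\<dots> = (\<Oplus>\<^bsub>V\<^esub>j\<in>{..<n} - {i0}. a j \<odot>\<^bsub>V\<^esub> e j) \<oplus>\<^bsub>V\<^esub> (\<Oplus>\<^bsub>V\<^esub>j\<in>{..<n} - {i0}. (d j \<otimes> a j) \<odot>\<^bsub>V\<^esub> e i0)"
      using ac ec dc i0(1) by (intro V.M.finsum_addf) auto
    also have "(\<Oplus>\<^bsub>V\<^esub>j\<in>{..<n} - {i0}. (d j \<otimes> a j) \<odot>\<^bsub>V\<^esub> e i0) = Q a \<odot>\<^bsub>V\<^esub> e i0"
      unfolding Q_def using ac dc ec[OF i0(1)] by (intro V.finsum_smult_rdistr[symmetric]) auto
    finally show ?thesis .
  qed
  have lin_e: "lin_comb n V e a = (a i0 \<ominus> Q a) \<odot>\<^bsub>V\<^esub> e i0 \<oplus>\<^bsub>V\<^esub> rest a" if a: "a \<in> {..<n} \<rightarrow> carrier F" for a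
  proof -
    have ai: "a i0 \<in> carrier F" using a i0 by auto
    let ?s = "\<Oplus>\<^bsub>V\<^esub>j\<in>{..<n} - {i0}. a j \<odot>\<^bsub>V\<^esub> e j"
    have sc: "?s \<in> carrier V" using a ec by (intro V.M.finsum_closed) (auto simp: Pi_def)
    have "a i0 \<odot>\<^bsub>V\<^esub> e i0 = (a i0 \<ominus> Q a) \<odot>\<^bsub>V\<^esub> e i0 \<oplus>\<^bsub>V\<^esub> Q a \<odot>\<^bsub>V\<^esub> e i0"
      using ai Qc[OF a] ec[OF i0(1)] by (simp add: V.smult_l_distr[symmetric] minus_eq a_assoc l_neg)
    then show ?thesis
      unfolding rest_eq[OF a] lin_comb_split[OF U(3) a i0(1)]
      using ai Qc[OF a] ec[OF i0(1)] sc by (simp add: V.M.a_ac)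
  qed
  \<comment> \<open>Translates coordinates with respect to \<open>f\<close> into coordinates with
    respect to \<open>e\<close>; \<open>T'\<close> is its inverse over \<open>F\<close>, and only
    \<open>T'\<close> divides by \<open>p\<close>.\<close>
  define T where "T b = b(i0 := p \<otimes> b i0 \<oplus> Q b)" for b
  define T' where "T' a = a(i0 := inv p \<otimes> (a i0 \<ominus> Q a))" for a
  have ip: "inv p \<in> carrier F" using pc by simp
  have PF: "b \<in> {..<n} \<rightarrow> carrier F" if "b \<in> {..<n} \<rightarrow>\<^sub>E carrier F" for b using that by auto
  have upd: "b(i0 := t) \<in> {..<n} \<rightarrow>\<^sub>E carrier F" if "b \<in> {..<n} \<rightarrow>\<^sub>E carrier F" "t \<in> carrier F" for b t
    using that i0(1) by (auto simp: PiE_iff extensional_def)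
  have bic: "b i0 \<in> carrier F" if "b \<in> {..<n} \<rightarrow>\<^sub>E carrier F" for b using that i0(1) by auto
  have Tc: "T b \<in> {..<n} \<rightarrow>\<^sub>E carrier F" if b: "b \<in> {..<n} \<rightarrow>\<^sub>E carrier F" for b
    unfolding T_def using Qc[OF PF[OF b]] pc bic[OF b] by (intro upd b) simp
  have T'c: "T' a \<in> {..<n} \<rightarrow>\<^sub>E carrier F" if a: "a \<in> {..<n} \<rightarrow>\<^sub>E carrier F" for a
    unfolding T'_def using Qc[OF PF[OF a]] ip bic[OF a] by (intro upd a) simp
  have TT': "T (T' a) = a" if a: "a \<in> {..<n} \<rightarrow>\<^sub>E carrier F" for a
  proof -
    have ai: "a i0 \<in> carrier F" "Q a \<in> carrier F" using a i0 Qc[OF PF[OF a]] by auto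
    have "p \<otimes> (inv p \<otimes> (a i0 \<ominus> Q a)) \<oplus> Q a = a i0"
      using ai pc ip by (simp add: m_assoc[symmetric]) (simp add: minus_eq a_assoc l_neg)
    then show ?thesis by (simp add: T_def T'_def Qupd[OF PF[OF a]])
  qed
  have T'T: "T' (T b) = b" if b: "b \<in> {..<n} \<rightarrow>\<^sub>E carrier F" for b
  proof -
    have bi: "b i0 \<in> carrier F" "Q b \<in> carrier F" using b i0 Qc[OF PF[OF b]] by auto
    have "p \<otimes> b i0 \<oplus> Q b \<ominus> Q b = p \<otimes> b i0" using bi pc by (simp add: minus_eq a_assoc r_neg)
    then have "inv p \<otimes> (p \<otimes> b i0 \<oplus> Q b \<ominus> Q b) = b i0" using bi pc ip by (simp add: m_assoc[symmetric])
    then show ?thesis by (simp add: T_def T'_def Qupd[OF PF[OF b]])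
  qed
  have lin_T: "lin_comb n V f b = lin_comb n V e (T b)" if b: "b \<in> {..<n} \<rightarrow>\<^sub>E carrier F" for b
  proof -
    have bi: "b i0 \<in> carrier F" "Q b \<in> carrier F" using b i0 Qc[OF PF[OF b]] by auto
    have "p \<otimes> b i0 \<oplus> Q b \<ominus> Q b = p \<otimes> b i0" using bi pc by (simp add: minus_eq a_assoc r_neg)
    then show ?thesis
      unfolding lin_f[OF PF[OF b]] lin_e[OF PF[OF Tc[OF b]]] by (simp add: T_def Qupd[OF PF[OF b]] restupd[OF PF[OF b]])
  qed
  have bijT: "bij_betw T ({..<n} \<rightarrow>\<^sub>E carrier F) ({..<n} \<rightarrow>\<^sub>E carrier F)"
    by (rule bij_betwI[where g = T']) (use Tc T'c TT' T'T in auto)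
  have bijf: "bij_betw (lin_comb n V f) ({..<n} \<rightarrow>\<^sub>E carrier F) (carrier V)"
    using bij_betw_trans[OF bijT U(4)] by (subst bij_betw_cong[of _ _ "lin_comb n V e \<circ> T"]) (auto simp: lin_T)
  have fN: "f i \<in> N" if "i < n" "i \<noteq> i0" for i using d[OF that(1)] that(2) by (simp add: f_def)
  have restN: "rest a \<in> N" if a: "a \<in> {..<n} \<rightarrow> x" for a
    unfolding rest_def
  proof (rule V.M.finsum_in_subgroup[OF submodule.axioms(1)[OF Nsub]])
    show "(\<lambda>j. a j \<odot>\<^bsub>V\<^esub> f j) \<in> {..<n} - {i0} \<rightarrow> N"
    proof
      fix j assume j: "j \<in> {..<n} - {i0}"
      have "a j \<in> x" using a j by auto
      then show "a j \<odot>\<^bsub>V\<^esub> f j \<in> N" using Nm(4)[of "a j" "f j"] fN[of j] j by simp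
    qed
  qed simp
  \<comment> \<open>In terms of \<open>e i0\<close> and the corrected vectors, the functional sees
    only the coefficient of \<open>e i0\<close>, which is \<open>a i0 \<ominus> Q a\<close>.\<close>
  have crit: "lin_comb n V e a \<in> N \<longleftrightarrow> a i0 \<ominus> Q a \<in> mm x" if a: "a \<in> {..<n} \<rightarrow> x" for a
  proof -
    have aF: "a \<in> {..<n} \<rightarrow> carrier F" using a xc by auto
    have tx: "a i0 \<ominus> Q a \<in> x"
    proof -
      have "a i0 \<in> x" "Q a \<in> x" using a i0(1) Qy[OF x a] d by auto
      then show ?thesis using pts_ring(5,7)[OF x] by (simp add: minus_eq)
    qed
    have tst: "(a i0 \<ominus> Q a) \<odot>\<^bsub>V\<^esub> e i0 \<in> st E x" using sm[OF tx est[OF i0(1)]] .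
    have rst: "rest a \<in> st E x" "lam (rest a) = \<zero>\<^bsub>?\<kappa>\<^esub>" using restN[OF a] by (auto simp: N_def)
    have vst: "lin_comb n V e a \<in> st E x" unfolding lin_e[OF aF] using Sm(5)[OF tst rst(1)] .
    have "lam (lin_comb n V e a) = h (a i0 \<ominus> Q a) \<otimes>\<^bsub>?\<kappa>\<^esub> ?l0"
      unfolding lin_e[OF aF] lam_add[OF tst rst(1)] rst(2) ls[OF tx est[OF i0(1)]]
      using h.hom_closed[of "a i0 \<ominus> Q a"] tx l0(1) by simp
    then have "lin_comb n V e a \<in> N \<longleftrightarrow> h (a i0 \<ominus> Q a) = \<zero>\<^bsub>?\<kappa>\<^esub>"
      using vst h.hom_closed[of "a i0 \<ominus> Q a"] tx l0(1) i0(2) \<kappa>.integral_iff by (simp add: N_def)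
    then show ?thesis using hz[OF tx] by simp
  qed
  \<comment> \<open>The coefficients of \<open>T\<close> have to be regular, and \<open>p\<close>
    has to be invertible away from \<open>x\<close>. At \<open>x\<close> itself \<open>p\<close>
    vanishes, and the condition on sections supplies the divisibility instead.\<close>
  let ?P = "\<lambda>y. (\<forall>j<n. d j \<in> y) \<and> p \<in> y \<and> (y = x \<or> inv p \<in> y)"
  define U1 where "U1 = {y \<in> U. ?P y}"
  have U1: "U1 \<in> opens"
    unfolding U1_def
  proof (rule open_remove[OF U(1,2)])
    have "{y \<in> pts. \<not> ?P y} \<subseteq> (\<Union>j<n. {y \<in> pts. d j \<notin> y}) \<union> {y \<in> pts. p \<notin> y} \<union> {y \<in> pts. inv p \<notin> y}" by auto
    moreover have "finite ((\<Union>j<n. {y \<in> pts. d j \<notin> y}) \<union> {y \<in> pts. p \<notin> y} \<union> {y \<in> pts. inv p \<notin> y})"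
      using finite_poles dc pc ip by auto
    ultimately show "finite {y \<in> pts. \<not> ?P y}" by (rule finite_subset)
  qed (use d pc in auto)
  have xU1: "x \<in> U1" unfolding U1_def using U(2) d pc by auto
  have sec: "modify x E N W = lin_comb n V f ` ({..<n} \<rightarrow>\<^sub>E carrier (regular_functions F W))"
    if W: "W \<in> opens" "W \<subseteq> U1" for W
  proof -
    have WU: "W \<subseteq> U" using W(2) by (auto simp: U1_def)
    have EW: "E W = lin_comb n V e ` ({..<n} \<rightarrow>\<^sub>E \<Inter>W)" using U(5)[OF W(1) WU] by (simp add: regular_carrier)
    have Wp: "y \<in> pts" "\<And>j. j < n \<Longrightarrow> d j \<in> y" "p \<in> y" "y \<noteq> x \<Longrightarrow> inv p \<in> y" if "y \<in> W" for y
      using open_pts[OF W(1) that] W(2) that by (auto simp: U1_def)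
    obtain y0 where y0: "y0 \<in> W" using W(1) unfolding nonempty_opens_def by blast
    have F: "a \<in> {..<n} \<rightarrow>\<^sub>E carrier F" if "a \<in> {..<n} \<rightarrow>\<^sub>E \<Inter>W" for a
      using that ptsD(3)[OF Wp(1)[OF y0]] y0 by (auto simp: PiE_iff)
    have Ty: "T b \<in> {..<n} \<rightarrow>\<^sub>E \<Inter>W" if b: "b \<in> {..<n} \<rightarrow>\<^sub>E \<Inter>W" for b
    proof (rule PiE_I)
      fix j assume j: "j \<in> {..<n}"
      show "T b j \<in> \<Inter>W"
      proof
        fix y assume y: "y \<in> W"
        have bY: "b \<in> {..<n} \<rightarrow> y" using b y by auto
        have "Q b \<in> y" using Qy[OF Wp(1)[OF y] bY] Wp(2)[OF y] by blast
        then have "p \<otimes> b i0 \<oplus> Q b \<in> y"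
          using pts_ring(6,7)[OF Wp(1)[OF y]] Wp(3)[OF y] funcset_mem[OF bY, of i0] i0(1) by simp
        then show "T b j \<in> y" using bY j by (auto simp: T_def)
      qed
    next
      fix j assume "j \<notin> {..<n}" then show "T b j = undefined" using b i0(1) by (auto simp: T_def PiE_def extensional_def)
    qed
    show ?thesis
      unfolding regular_carrier
    proof
      show "lin_comb n V f ` ({..<n} \<rightarrow>\<^sub>E \<Inter>W) \<subseteq> modify x E N W"
      proof
        fix v assume "v \<in> lin_comb n V f ` ({..<n} \<rightarrow>\<^sub>E \<Inter>W)"
        then obtain b where b: "b \<in> {..<n} \<rightarrow>\<^sub>E \<Inter>W" "v = lin_comb n V f b" by blast
        have vT: "v = lin_comb n V e (T b)" using b lin_T[OF F[OF b(1)]] by simp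
        then have vE: "v \<in> E W" unfolding EW using Ty[OF b(1)] by blast
        have "v \<in> N" if xW: "x \<in> W"
        proof -
          have Tx: "T b \<in> {..<n} \<rightarrow> x" using Ty[OF b(1)] xW by auto
          have bx: "b i0 \<in> x" "b i0 \<in> carrier F" "Q b \<in> carrier F"
            using b(1) xW i0(1) xc Qc[OF PF[OF F[OF b(1)]]] by auto
          have "T b i0 \<ominus> Q (T b) = p \<otimes> b i0"
            using bx pc by (simp add: T_def Qupd[OF PF[OF F[OF b(1)]]] minus_eq a_assoc r_neg)
          also have "\<dots> \<in> mm x"
            by (rule mm_mult(2)[OF x bx(1)]) (use u.p_nonunit pc in \<open>simp add: mm_def\<close>)
          finally show ?thesis unfolding vT using crit[OF Tx] by blast
        qed
        then show "v \<in> modify x E N W" using vE W(1) by (simp add: modify_def)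
      qed
      show "modify x E N W \<subseteq> lin_comb n V f ` ({..<n} \<rightarrow>\<^sub>E \<Inter>W)"
      proof
        fix v assume v: "v \<in> modify x E N W"
        then have vE: "v \<in> E W" and vN: "x \<in> W \<Longrightarrow> v \<in> N" using W(1) by (auto simp: modify_def split: if_splits)
        obtain a where a: "a \<in> {..<n} \<rightarrow>\<^sub>E \<Inter>W" "v = lin_comb n V e a" using vE unfolding EW by blast
        have aF: "a i0 \<in> carrier F" "Q a \<in> carrier F" using F[OF a(1)] i0(1) Qc[OF PF[OF F[OF a(1)]]] by auto
        have "T' a \<in> {..<n} \<rightarrow>\<^sub>E \<Inter>W"
        proof (rule PiE_I)
          fix j assume j: "j \<in> {..<n}"
          show "T' a j \<in> \<Inter>W"
          proof
            fix y assume y: "y \<in> W"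
            have ay: "a \<in> {..<n} \<rightarrow> y" using a y by auto
            have "Q a \<in> y" using Qy[OF Wp(1)[OF y] ay] Wp(2)[OF y] by blast
            then have t: "a i0 \<ominus> Q a \<in> y"
              using pts_ring(5,7)[OF Wp(1)[OF y]] funcset_mem[OF ay, of i0] i0(1) by (simp add: minus_eq)
            \<comment> \<open>Where \<open>p\<close> is invertible this is clear; at
              \<open>x\<close> membership of the section in \<open>N\<close> makes
              \<open>a i0 \<ominus> Q a\<close> a multiple of \<open>p\<close>, by
              \<open>crit\<close>.\<close>
            have "inv p \<otimes> (a i0 \<ominus> Q a) \<in> y"
            proof (cases "y = x")
              case False then show ?thesis using pts_ring(6)[OF Wp(1)[OF y] Wp(4)[OF y] t] by simp
            next
              case True
              then have "lin_comb n V e a \<in> N" "a \<in> {..<n} \<rightarrow> x" using vN y a(2) ay by auto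
              then have "a i0 \<ominus> Q a \<in> mm x" using crit by blast
              then obtain c where c: "c \<in> x" "a i0 \<ominus> Q a = c \<otimes> p" using mm_eq[OF x p] by blast
              then have "inv p \<otimes> (a i0 \<ominus> Q a) = c"
                using xc[OF c(1)] pc ip m_comm[of c p] by (simp add: m_assoc[symmetric])
              then show ?thesis using c(1) True by simp
            qed
            then show "T' a j \<in> y" using ay j by (auto simp: T'_def)
          qed
        next
          fix j assume "j \<notin> {..<n}" then show "T' a j = undefined" using a(1) i0(1) by (auto simp: T'_def PiE_def extensional_def)
        qed
        moreover have "v = lin_comb n V f (T' a)"
          using lin_T[OF T'c[OF F[OF a(1)]]] TT'[OF F[OF a(1)]] a(2) by simp
        ultimately show "v \<in> lin_comb n V f ` ({..<n} \<rightarrow>\<^sub>E \<Inter>W)" by blast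
      qed
    qed
  qed
  have "bundle n (modify x E N)"
  proof (rule modify_bundle[OF E x Nsub])
    show "\<exists>U\<in>opens. x \<in> U \<and> (\<exists>e\<in>{..<n} \<rightarrow> carrier V.
          bij_betw (lin_comb n V e) ({..<n} \<rightarrow>\<^sub>E carrier F) (carrier V) \<and>
          (\<forall>W\<in>opens. W \<subseteq> U \<longrightarrow> modify x E N W = lin_comb n V e ` ({..<n} \<rightarrow>\<^sub>E carrier (regular_functions F W))))"
      by (intro bexI[OF _ U1] conjI bexI[of _ f] ballI impI) (use xU1 bijf sec fc in auto)
  qed
  then show ?thesis unfolding N_def .
qed

lemma stalk_torsion_free:
  assumes E: "bundle n E" and x: "x \<in> pts" and p: "unif_ring (\<R> x) p"
  shows "torsion_free_module (\<R> x) p (stalk k F V E x)"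
proof -
  interpret u: unif_ring "\<R> x" p by (rule p)
  interpret L: module "\<R> x" V by (rule module_local[OF x])
  note S = stalk_submodule[OF E x]
  have pc: "p \<in> carrier F" "p \<noteq> \<zero>" using u.p_closed u.p_nonzero ptsD(3)[OF x] by auto
  have m: "module (\<R> x) (stalk k F V E x)"
    by (subst stalk_record) (rule submodule.submodule_is_module[OF S L.module_axioms])
  show ?thesis
  proof (rule torsion_free_module.intro[OF p m], rule torsion_free_module_axioms.intro)
    fix v assume v: "v \<in> st E x" "p \<odot>\<^bsub>stalk k F V E x\<^esub> v = \<zero>\<^bsub>stalk k F V E x\<^esub>"
    then have vV: "v \<in> carrier V" "p \<odot>\<^bsub>V\<^esub> v = \<zero>\<^bsub>V\<^esub>" using L.submoduleE(1)[OF S] by (auto simp: stalk_def)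
    have "v = (inv p \<otimes> p) \<odot>\<^bsub>V\<^esub> v" using vV pc by simp
    also have "\<dots> = \<zero>\<^bsub>V\<^esub>" using vV pc V.smult_assoc1[of "inv p" p v] by simp
    finally show "v = \<zero>\<^bsub>stalk k F V E x\<^esub>" by (simp add: stalk_def)
  qed
qed

lemma modify_full:
  assumes E: "bundle n E" and N: "\<And>v. v \<in> st E x \<Longrightarrow> v \<in> N"
  shows "modify x E N = E"
proof
  fix U
  show "modify x E N U = E U"
  proof (cases "U \<in> opens")
    case True then show ?thesis using N stI[OF True] by (auto simp: modify_def)
  next
    case False then show ?thesis using bundleD(1)[OF E] by (simp add: modify_def extensional_def)
  qed
qed

lemma modify_modify: "N' \<subseteq> N \<Longrightarrow> modify x (modify x E N) N' = modify x E N'"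
  by (auto simp: modify_def fun_eq_iff)

text \<open>Imposes the vanishing of the first \<open>s\<close> coordinates one after another. The
  functionals all come from the trivialization of the original stalk, while the stalk shrinks at
  every step.\<close>

lemma modify_coord_bundle:
  assumes E: "bundle n E" and x: "x \<in> pts" and p: "unif_ring (\<R> x) p"
    and b: "b \<in> module_isos (completion (\<R> x)) (module_completion (\<R> x) (stalk k F V E x))
              (free_module m (completion (\<R> x)))"
  shows "s \<le> m \<Longrightarrow> bundle n (modify x E {v \<in> st E x. \<forall>i<s.
      torsion_free_module.coord (\<R> x) p (stalk k F V E x) b i v = \<zero>\<^bsub>trunc_ring (\<R> x) 1\<^esub>})"
proof -
  let ?W = "stalk k F V E x"
  note One_nat_def [simp del]
  interpret W: torsion_free_module "\<R> x" p ?W by (rule stalk_torsion_free[OF E x p])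
  define N where "N s = {v \<in> st E x. \<forall>i<s. W.coord b i v = \<zero>\<^bsub>W.T 1\<^esub>}" for s
  have "bundle n (modify x E (N s))" if "s \<le> m" for s
    using that
  proof (induction s)
    case 0
    have "modify x E (N 0) = E" by (rule modify_full[OF E]) (simp add: N_def)
    then show ?case using E by simp
  next
    case (Suc s)
    then have IH: "bundle n (modify x E (N s))" and sm: "s < m" by auto
    have st: "st (modify x E (N s)) x = N s" unfolding modify_stalk by (auto simp: N_def)
    have NW: "v \<in> carrier ?W" if "v \<in> N s" for v using that by (simp add: N_def)
    have ops: "v \<oplus>\<^bsub>?W\<^esub> w = v \<oplus>\<^bsub>V\<^esub> w" "c \<odot>\<^bsub>?W\<^esub> v = c \<odot>\<^bsub>V\<^esub> v" for v w c by (simp_all add: stalk_def)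
    \<comment> \<open>Independence of the coordinates: some vector has the value
      \<open>\<one>\<close> at coordinate \<open>s\<close> and zero at all others, hence survives
      the previous conditions.\<close>
    have nz: "\<exists>v\<in>N s. W.coord b s v \<noteq> \<zero>\<^bsub>W.T 1\<^esub>"
    proof -
      have T1: "(if i = s then \<one>\<^bsub>W.T 1\<^esub> else \<zero>\<^bsub>W.T 1\<^esub>) \<in> carrier (W.T 1)" for i
        using cring.axioms(1)[OF W.T_cring] by (auto simp: ring.ring_simprules)
      have "\<one>\<^bsub>W.T 1\<^esub> \<noteq> \<zero>\<^bsub>W.T 1\<^esub>"
        using W.F.coset_zero_iff[of "\<one>" 1] W.mem_I_1[of "\<one>"] W.Units_one_closed W.one_closed
        by (simp add: W.T_ops del: One_nat_def)
      moreover obtain v where "v \<in> carrier ?W" "\<forall>i<m. W.coord b i v = (if i = s then \<one>\<^bsub>W.T 1\<^esub> else \<zero>\<^bsub>W.T 1\<^esub>)"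
        using W.coord_surj[OF b, of "\<lambda>i. if i = s then \<one>\<^bsub>W.T 1\<^esub> else \<zero>\<^bsub>W.T 1\<^esub>"] T1 by auto
      ultimately show ?thesis using sm by (intro bexI[of _ v]) (auto simp: N_def)
    qed
    have "bundle n (modify x (modify x E (N s)) {v \<in> st (modify x E (N s)) x. W.coord b s v = \<zero>\<^bsub>W.T 1\<^esub>})"
    proof (rule modify_bundle_step[OF IH x p])
      show "W.coord b s v \<in> carrier (W.T 1)" if "v \<in> st (modify x E (N s)) x" for v
        using W.coord_closed[OF b NW sm] that unfolding st by blast
      show "W.coord b s (v \<oplus>\<^bsub>V\<^esub> w) = W.coord b s v \<oplus>\<^bsub>W.T 1\<^esub> W.coord b s w"
        if "v \<in> st (modify x E (N s)) x" "w \<in> st (modify x E (N s)) x" for v w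
        using W.coord_add[OF b NW NW sm] that unfolding st ops by blast
      show "W.coord b s (c \<odot>\<^bsub>V\<^esub> v) = (W.I 1 +>\<^bsub>\<R> x\<^esub> c) \<otimes>\<^bsub>W.T 1\<^esub> W.coord b s v"
        if "c \<in> x" "v \<in> st (modify x E (N s)) x" for c v
        using W.coord_smult[OF b _ NW sm] that unfolding st ops by simp
      show "\<exists>v\<in>st (modify x E (N s)) x. W.coord b s v \<noteq> \<zero>\<^bsub>W.T 1\<^esub>" unfolding st by (rule nz)
    qed
    moreover have "{v \<in> st (modify x E (N s)) x. W.coord b s v = \<zero>\<^bsub>W.T 1\<^esub>} = N (Suc s)"
      unfolding st by (auto simp: N_def less_Suc_eq)
    moreover have "N (Suc s) \<subseteq> N s" by (auto simp: N_def)
    ultimately show ?case by (simp add: modify_modify)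
  qed
  then show "s \<le> m \<Longrightarrow> bundle n (modify x E {v \<in> st E x. \<forall>i<s. W.coord b i v = \<zero>\<^bsub>W.T 1\<^esub>})"
    unfolding N_def .
qed

end

section \<open>Level groups of parabolic, opposite parabolic and Levi type\<close>

context cring
begin

lemma mat_transpose_closed:
  "A \<in> carrier (mat_monoid n R) \<Longrightarrow> mat_transpose n A \<in> carrier (mat_monoid n R)"
  unfolding mat_transpose_def by (intro mat_carrierI) (rule mat_entry)

lemma mat_transpose_mult:
  assumes A: "A \<in> carrier (mat_monoid n R)" "B \<in> carrier (mat_monoid n R)"
  shows "mat_transpose n (A \<otimes>\<^bsub>mat_monoid n R\<^esub> B) = mat_transpose n B \<otimes>\<^bsub>mat_monoid n R\<^esub> mat_transpose n A"
proof (rule mat_eqI[where R = R])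
  fix i j assume ij: "i < n" "j < n"
  have "(\<Oplus>l\<in>{..<n}. A (j, l) \<otimes> B (l, i)) = (\<Oplus>l\<in>{..<n}. B (l, i) \<otimes> A (j, l))"
    using mat_entry[OF A(1) ij(2)] mat_entry[OF A(2) _ ij(1)] by (intro finsum_cong') (auto simp: m_comm)
  also have "\<dots> = (\<Oplus>l\<in>{..<n}. mat_transpose n B (i, l) \<otimes> mat_transpose n A (l, j))"
    using mat_entry[OF A(1) ij(2)] mat_entry[OF A(2) _ ij(1)] ij
    by (intro finsum_cong') (auto simp: mat_transpose_def)
  finally show "mat_transpose n (A \<otimes>\<^bsub>mat_monoid n R\<^esub> B) (i, j) =
      (mat_transpose n B \<otimes>\<^bsub>mat_monoid n R\<^esub> mat_transpose n A) (i, j)"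
    using ij by (simp add: mat_transpose_def mat_mult_eq)
qed (intro mat_transpose_closed mat_mult_closed A)+

lemma mat_transpose_transpose:
  "A \<in> carrier (mat_monoid n R) \<Longrightarrow> mat_transpose n (mat_transpose n A) = A"
  by (rule mat_eqI[where R = R]) (auto intro!: mat_transpose_closed, simp add: mat_transpose_def)

lemma mat_transpose_one: "mat_transpose n \<one>\<^bsub>mat_monoid n R\<^esub> = \<one>\<^bsub>mat_monoid n R\<^esub>"
  by (rule mat_eqI[where R = R])
    (auto intro!: mat_transpose_closed monoid.one_closed mat_monoid_monoid, simp add: mat_transpose_def mat_one_eq)

lemma mat_transpose_GL:
  assumes "A \<in> carrier (GL n R)" shows "mat_transpose n A \<in> carrier (GL n R)"
proof -
  interpret G: group "GL n R" by (rule GL_group)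
  have A: "A \<in> carrier (mat_monoid n R)" "inv\<^bsub>GL n R\<^esub> A \<in> carrier (mat_monoid n R)"
    using assms GL_in_mat G.inv_closed by blast+
  note t = mat_transpose_closed[OF A(1)] mat_transpose_closed[OF A(2)]
  show ?thesis
  proof (rule GL_I[OF t])
    show "mat_transpose n A \<otimes>\<^bsub>mat_monoid n R\<^esub> mat_transpose n (inv\<^bsub>GL n R\<^esub> A) = \<one>\<^bsub>mat_monoid n R\<^esub>"
      unfolding mat_transpose_mult[OF A(2,1), symmetric] using G.l_inv[OF assms] by (simp add: mat_transpose_one)
    show "mat_transpose n (inv\<^bsub>GL n R\<^esub> A) \<otimes>\<^bsub>mat_monoid n R\<^esub> mat_transpose n A = \<one>\<^bsub>mat_monoid n R\<^esub>"
      unfolding mat_transpose_mult[OF A, symmetric] using G.r_inv[OF assms] by (simp add: mat_transpose_one)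
  qed
qed

lemma opp_parabolicD:
  assumes "g \<in> opp_parabolic n r R"
  shows "g \<in> carrier (GL n R)" "i < r \<Longrightarrow> r \<le> j \<Longrightarrow> j < n \<Longrightarrow> r \<le> n \<Longrightarrow> g (i, j) = \<zero>"
  using assms mat_transpose_GL unfolding opp_parabolic_def parabolic_def by (auto simp: mat_transpose_def)

lemma unip_radicalI:
  assumes g: "g \<in> carrier (GL n R)" and r: "r \<le> n"
    and e: "\<And>i j. i < n \<Longrightarrow> j < n \<Longrightarrow> r \<le> i \<or> j < r \<Longrightarrow> g (i, j) = (if i = j then \<one> else \<zero>)"
  shows "g \<in> unip_radical n r R"
  unfolding unip_radical_def parabolic_def mem_Collect_eq
proof (intro conjI allI impI g)
  show "g (i, j) = \<zero>" if "r \<le> i \<and> i < n \<and> j < r" for i j using e[of i j] that r by simp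
  show "g (i, j) = (if i = j then \<one> else \<zero>)" if "i < n" "j < n" "(i < r) = (j < r)" for i j
    by (rule e[OF that(1,2)]) (use that(3) in linarith)
qed

lemma opp_unip_radicalI:
  assumes g: "g \<in> carrier (GL n R)" and r: "r \<le> n"
    and e: "\<And>i j. i < n \<Longrightarrow> j < n \<Longrightarrow> i < r \<or> r \<le> j \<Longrightarrow> g (i, j) = (if i = j then \<one> else \<zero>)"
  shows "g \<in> opp_unip_radical n r R"
proof -
  have "mat_transpose n g \<in> unip_radical n r R"
    by (rule unip_radicalI[OF mat_transpose_GL[OF g] r]) (use e in \<open>auto simp: mat_transpose_def\<close>)
  then show ?thesis
    using mat_transpose_transpose[OF GL_in_mat[OF g]] unfolding opp_unip_radical_def by (metis image_eqI)
qed

text \<open>Two block triangular matrices with equal diagonal blocks differ by a unipotent one. The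
  index set \<open>S\<close> stands for \<open>{..<r}\<close> or \<open>{r..}\<close>, which covers
  both directions of triangularity. In the relevant entries \<open>B\<close> may be replaced by
  \<open>A\<close>, since the terms where they differ carry a zero factor.\<close>

lemma inv_mult_same_diagonal_blocks:
  assumes A: "A \<in> carrier (GL n R)" and B: "B \<in> carrier (GL n R)"
    and z: "\<And>i j. i < n \<Longrightarrow> j < n \<Longrightarrow> i \<notin> S \<Longrightarrow> j \<in> S \<Longrightarrow>
      A (i, j) = \<zero> \<and> B (i, j) = \<zero> \<and> (inv\<^bsub>GL n R\<^esub> A) (i, j) = \<zero>"
    and eq: "\<And>i j. i < n \<Longrightarrow> j < n \<Longrightarrow> (i \<in> S \<longleftrightarrow> j \<in> S) \<Longrightarrow> A (i, j) = B (i, j)"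
    and ij: "i < n" "j < n" "i \<notin> S \<or> j \<in> S"
  shows "(inv\<^bsub>GL n R\<^esub> A \<otimes>\<^bsub>mat_monoid n R\<^esub> B) (i, j) = (if i = j then \<one> else \<zero>)"
proof -
  interpret G: group "GL n R" by (rule GL_group)
  let ?C = "inv\<^bsub>GL n R\<^esub> A"
  have M: "A \<in> carrier (mat_monoid n R)" "B \<in> carrier (mat_monoid n R)" "?C \<in> carrier (mat_monoid n R)"
    using A B GL_in_mat G.inv_closed by blast+
  have "?C (i, l) \<otimes> B (l, j) = ?C (i, l) \<otimes> A (l, j)" if l: "l < n" for l
  proof (cases "i \<notin> S \<and> l \<in> S")
    case True
    then show ?thesis using z[OF ij(1) l] mat_entry[OF M(1) l ij(2)] mat_entry[OF M(2) l ij(2)] by simp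
  next
    case False
    show ?thesis
    proof (cases "l \<in> S \<longleftrightarrow> j \<in> S")
      case True then show ?thesis using eq[OF l ij(2)] by simp
    next
      case f: False
      then have "l \<notin> S" "j \<in> S" using False ij(3) by auto
      then show ?thesis using z[OF l ij(2)] by simp
    qed
  qed
  then have "(\<Oplus>l\<in>{..<n}. ?C (i, l) \<otimes> B (l, j)) = (\<Oplus>l\<in>{..<n}. ?C (i, l) \<otimes> A (l, j))"
    using mat_entry[OF M(1) _ ij(2)] mat_entry[OF M(3) ij(1)] by (intro finsum_cong') auto
  then have "(?C \<otimes>\<^bsub>mat_monoid n R\<^esub> B) (i, j) = (?C \<otimes>\<^bsub>mat_monoid n R\<^esub> A) (i, j)"
    using ij by (simp add: mat_mult_eq)
  also have "\<dots> = (if i = j then \<one> else \<zero>)" using G.l_inv[OF A] ij by (simp add: mat_one_eq)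
  finally show ?thesis .
qed

end

text \<open>Separates the matrix argument from group schemes: \<open>P\<close> stands for the points
  of the level group over the truncated ring, and \<open>level\<close> is its preimage.\<close>

locale congruence_level = unif_ring R p for R :: "('a, 'm) ring_scheme" (structure) and p +
  fixes n r d :: nat and \<pi> and P :: "(nat \<times> nat \<Rightarrow> 'a set) set"
  assumes unif: "is_uniformizer \<pi>" and r_le_n: "r \<le> n" and d_pos: "1 \<le> d"
    and P_subgroup: "subgroup P (GL n (T d))"
begin

definition level :: "(nat \<times> nat \<Rightarrow> nat \<Rightarrow> 'a set) set" where
  "level = {g \<in> carrier (GL n \<O>). mat_map n (\<lambda>f. f d) g \<in> P}"

sublocale ev: ring_hom_cring \<O> "T d" "\<lambda>f. f d" by (rule ev_hom)
sublocale ev1: ring_hom_cring \<O> "T 1" "\<lambda>f. f 1" by (rule ev_hom)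
sublocale sc: scaling \<O> n r \<pi> by (rule scaling_O[OF unif r_le_n])

lemma level_subgroup: "subgroup level (GL n \<O>)"
proof (rule sc.G.subgroupI)
  show "level \<subseteq> carrier (GL n \<O>)" by (auto simp: level_def)
  have "\<one>\<^bsub>GL n \<O>\<^esub> \<in> level"
    using subgroup.one_closed[OF P_subgroup] sc.G.one_closed by (simp add: level_def ev.mat_map_one)
  then show "level \<noteq> {}" by blast
  show "inv\<^bsub>GL n \<O>\<^esub> k \<in> level" if "k \<in> level" for k
    using that subgroup.m_inv_closed[OF P_subgroup] by (simp add: level_def ev.mat_map_inv)
  show "k \<otimes>\<^bsub>GL n \<O>\<^esub> k' \<in> level" if "k \<in> level" "k' \<in> level" for k k'
  proof -
    have "k \<otimes>\<^bsub>GL n \<O>\<^esub> k' \<in> carrier (GL n \<O>)" using that by (intro sc.G.m_closed) (simp_all add: level_def)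
    then show ?thesis
      using that subgroup.m_closed[OF P_subgroup, of "mat_map n (\<lambda>f. f d) k" "mat_map n (\<lambda>f. f d) k'"] sc.G_M
      by (simp add: level_def ev.mat_map_mult)
  qed
qed

lemma red_entry: "i < n \<Longrightarrow> j < n \<Longrightarrow> mat_map n (\<lambda>f. f d) g (i, j) = g (i, j) d"
  by (simp add: mat_map_def)

lemma eval_zero_lower:
  assumes f: "f \<in> carrier \<O>" "f d = \<zero>\<^bsub>T d\<^esub>"
  shows "f 1 = \<zero>\<^bsub>T 1\<^esub>"
proof -
  obtain c where c: "c \<in> carrier \<O>" "f = \<pi> [^]\<^bsub>\<O>\<^esub> d \<otimes>\<^bsub>\<O>\<^esub> c" using unif_dvd_iff[OF unif f(1)] f(2) by blast
  obtain e where e: "d = Suc e" using d_pos by (cases d) auto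
  have "f = \<pi> [^]\<^bsub>\<O>\<^esub> (1::nat) \<otimes>\<^bsub>\<O>\<^esub> (\<pi> [^]\<^bsub>\<O>\<^esub> e \<otimes>\<^bsub>\<O>\<^esub> c)"
    unfolding c(2) e using c(1) by (simp add: O.m_ac)
  moreover have "\<pi> [^]\<^bsub>\<O>\<^esub> e \<otimes>\<^bsub>\<O>\<^esub> c \<in> carrier \<O>" using c(1) by simp
  ultimately show ?thesis using unif_dvd_iff[OF unif f(1), of 1] by blast
qed

text \<open>Passing from \<open>k\<close> to its conjugate keeps the diagonal blocks and multiplies
  the lower left block by \<open>\<pi>\<close>. The upper right block is the one about which the
  conditions on the level group must decide.\<close>

lemma conj_entries:
  assumes k: "k \<in> carrier (GL n \<O>)" and Z: "Z \<in> carrier (GL n \<O>)"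
    and eq: "k \<otimes>\<^bsub>mat_monoid n \<O>\<^esub> sc.\<Delta> = sc.\<Delta> \<otimes>\<^bsub>mat_monoid n \<O>\<^esub> Z" and ij: "i < n" "j < n"
  shows "(i < r \<longleftrightarrow> j < r) \<Longrightarrow> Z (i, j) = k (i, j)" "r \<le> i \<Longrightarrow> j < r \<Longrightarrow> Z (i, j) = k (i, j) \<otimes>\<^bsub>\<O>\<^esub> \<pi>"
proof -
  have M: "k \<in> carrier (mat_monoid n \<O>)" "Z \<in> carrier (mat_monoid n \<O>)" using k Z sc.G_M by auto
  note c = mat_entry[OF M(1) ij] mat_entry[OF M(2) ij]
  have e: "k (i, j) \<otimes>\<^bsub>\<O>\<^esub> sc.q j = sc.q i \<otimes>\<^bsub>\<O>\<^esub> Z (i, j)"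
    using sc.mult_Delta[OF M(1) ij] sc.Delta_mult[OF M(2) ij] eq by simp
  show "Z (i, j) = k (i, j)" if "i < r \<longleftrightarrow> j < r"
  proof -
    have "sc.q j = sc.q i" using that by (simp add: sc.q_def)
    then have "sc.q i \<otimes>\<^bsub>\<O>\<^esub> Z (i, j) = sc.q i \<otimes>\<^bsub>\<O>\<^esub> k (i, j)" using e c by (simp add: O.m_comm)
    then show ?thesis using sc.q_cancel c by blast
  qed
  show "Z (i, j) = k (i, j) \<otimes>\<^bsub>\<O>\<^esub> \<pi>" if "r \<le> i" "j < r"
    using e that c by (simp add: sc.q_def)
qed

lemma level_by_quotient:
  assumes k: "k \<in> level" and Z: "Z \<in> carrier (GL n \<O>)"
    and q: "inv\<^bsub>GL n (T d)\<^esub> mat_map n (\<lambda>f. f d) k \<otimes>\<^bsub>mat_monoid n (T d)\<^esub> mat_map n (\<lambda>f. f d) Z \<in> P"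
  shows "Z \<in> level"
proof -
  interpret GT: group "GL n (T d)" by (rule ev.S.GL_group)
  let ?A = "mat_map n (\<lambda>f. f d) k" and ?B = "mat_map n (\<lambda>f. f d) Z"
  have A: "?A \<in> P" "?A \<in> carrier (GL n (T d))" using k ev.mat_map_GL by (auto simp: level_def)
  have B: "?B \<in> carrier (GL n (T d))" using Z by (rule ev.mat_map_GL)
  have "?B = ?A \<otimes>\<^bsub>GL n (T d)\<^esub> (inv\<^bsub>GL n (T d)\<^esub> ?A \<otimes>\<^bsub>GL n (T d)\<^esub> ?B)"
    using A B by (simp only: GT.m_assoc[symmetric] GT.inv_closed GT.r_inv GT.l_one)
  also have "\<dots> \<in> P" using subgroup.m_closed[OF P_subgroup A(1)] q by simp
  finally show ?thesis using Z by (simp add: level_def)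
qed

text \<open>Here \<open>s = 0\<close>. The lower left blocks vanish modulo the power
  \<open>d\<close> of the maximal ideal, hence also in the residue field, and remain zero under
  conjugation. What conjugation does to the upper right block is an element of \<open>U\<close>,
  which lies in \<open>P\<close>.\<close>

lemma hecke_matrices_parabolic:
  assumes U: "unip_radical n r (T d) \<subseteq> P" and sub: "P \<subseteq> parabolic n r (T d)"
  shows "hecke_matrices \<O> n r \<pi> (T 1) (\<lambda>f. f 1) 0 level"
proof (intro hecke_matrices.intro hecke_matrices_axioms.intro sc.scaling_axioms ev1.ring_hom_cring_axioms level_subgroup)
  have ll: "k (i, j) d = \<zero>\<^bsub>T d\<^esub>" if "k \<in> level" "r \<le> i" "i < n" "j < r" for k i j
  proof -
    have "mat_map n (\<lambda>f. f d) k (i, j) = \<zero>\<^bsub>T d\<^esub>"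
      using that sub by (auto simp: level_def parabolic_def)
    then show ?thesis using that r_le_n by (simp add: red_entry)
  qed
  show "f 1 = \<zero>\<^bsub>T 1\<^esub> \<longleftrightarrow> (\<exists>c\<in>carrier \<O>. f = \<pi> \<otimes>\<^bsub>\<O>\<^esub> c)" if "f \<in> carrier \<O>" for f
    using unif_dvd_iff[OF unif that, of 1] by simp
  show "(\<lambda>f. f 1) ` carrier \<O> = carrier (T 1)" by (rule ev_surj)
  show "sc.dvd_ur 0 k" if "k \<in> level" for k
  proof -
    have "k \<in> carrier (mat_monoid n \<O>)" using that sc.G_M by (auto simp: level_def)
    then have "k (i, j) \<in> carrier \<O>" if "upper_right n r i j" for i j
      using that mat_entry by (fastforce simp: upper_right_def)
    then show ?thesis by (auto simp: sc.dvd_ur_def)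
  qed
  show "upper_block n r \<O> (\<lambda>ij. \<pi> [^]\<^bsub>\<O>\<^esub> (0::nat) \<otimes>\<^bsub>\<O>\<^esub> B ij) \<in> level" if B: "B \<in> {..<r} \<times> {..<n - r} \<rightarrow> carrier \<O>" for B
  proof -
    have B': "(\<lambda>ij. \<pi> [^]\<^bsub>\<O>\<^esub> (0::nat) \<otimes>\<^bsub>\<O>\<^esub> B ij) \<in> {..<r} \<times> {..<n - r} \<rightarrow> carrier \<O>" using B by (auto simp: Pi_def)
    let ?u = "upper_block n r \<O> (\<lambda>ij. \<pi> [^]\<^bsub>\<O>\<^esub> (0::nat) \<otimes>\<^bsub>\<O>\<^esub> B ij)"
    have uG: "?u \<in> carrier (GL n \<O>)" by (rule sc.upper_block_inv(1)[OF B'])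
    have "mat_map n (\<lambda>f. f d) ?u \<in> unip_radical n r (T d)"
      using ev.mat_map_GL[OF uG] r_le_n by (auto simp: unip_radical_def parabolic_def red_entry upper_block_def O_ops)
    then show ?thesis using uG U by (auto simp: level_def)
  qed
  show "Z \<in> level" if k: "k \<in> level" and Z: "Z \<in> carrier (GL n \<O>)"
    and eq: "k \<otimes>\<^bsub>mat_monoid n \<O>\<^esub> sc.\<Delta> = sc.\<Delta> \<otimes>\<^bsub>mat_monoid n \<O>\<^esub> Z" for k Z
  proof (rule level_by_quotient[OF k Z])
    let ?A = "mat_map n (\<lambda>f. f d) k" and ?B = "mat_map n (\<lambda>f. f d) Z"
    interpret GT: group "GL n (T d)" by (rule ev.S.GL_group)
    have kG: "k \<in> carrier (GL n \<O>)" using k by (simp add: level_def)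
    note e = conj_entries[OF kG Z eq]
    have A: "?A \<in> carrier (GL n (T d))" "?B \<in> carrier (GL n (T d))" using ev.mat_map_GL kG Z by auto
    have iA: "inv\<^bsub>GL n (T d)\<^esub> ?A \<in> parabolic n r (T d)"
      using subgroup.m_inv_closed[OF P_subgroup] k sub by (auto simp: level_def)
    have z: "?A (i, j) = \<zero>\<^bsub>T d\<^esub> \<and> ?B (i, j) = \<zero>\<^bsub>T d\<^esub> \<and> (inv\<^bsub>GL n (T d)\<^esub> ?A) (i, j) = \<zero>\<^bsub>T d\<^esub>"
      if "i < n" "j < n" "i \<notin> {..<r}" "j \<in> {..<r}" for i j
      using that iA ll[OF k] e(2)[of i j] by (auto simp: red_entry parabolic_def O_ops O_eval ev.S.l_null[OF O_eval])
    have b: "?A (i, j) = ?B (i, j)" if "i < n" "j < n" "i \<in> {..<r} \<longleftrightarrow> j \<in> {..<r}" for i j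
      using that e(1)[of i j] by (simp add: red_entry)
    have "inv\<^bsub>GL n (T d)\<^esub> ?A \<otimes>\<^bsub>GL n (T d)\<^esub> ?B \<in> carrier (GL n (T d))" using A by (intro GT.m_closed GT.inv_closed)
    then have "inv\<^bsub>GL n (T d)\<^esub> ?A \<otimes>\<^bsub>mat_monoid n (T d)\<^esub> ?B \<in> unip_radical n r (T d)"
      unfolding GL_mult
    proof (rule ev.S.unip_radicalI[OF _ r_le_n])
      fix i j assume ij: "i < n" "j < n" "r \<le> i \<or> j < r"
      show "(inv\<^bsub>GL n (T d)\<^esub> ?A \<otimes>\<^bsub>mat_monoid n (T d)\<^esub> ?B) (i, j) = (if i = j then \<one>\<^bsub>T d\<^esub> else \<zero>\<^bsub>T d\<^esub>)"
      proof (rule ev.S.inv_mult_same_diagonal_blocks[where S = "{..<r}", OF A])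
        show "?A (i, j) = \<zero>\<^bsub>T d\<^esub> \<and> ?B (i, j) = \<zero>\<^bsub>T d\<^esub> \<and> (inv\<^bsub>GL n (T d)\<^esub> ?A) (i, j) = \<zero>\<^bsub>T d\<^esub>"
          if "i < n" "j < n" "i \<notin> {..<r}" "j \<in> {..<r}" for i j using that by (rule z)
        show "?A (i, j) = ?B (i, j)" if "i < n" "j < n" "i \<in> {..<r} \<longleftrightarrow> j \<in> {..<r}" for i j using that by (rule b)
        show "i < n" "j < n" by (rule ij)+
        show "i \<notin> {..<r} \<or> j \<in> {..<r}" using ij(3) by (simp add: not_less)
      qed
    qed
    then show "inv\<^bsub>GL n (T d)\<^esub> ?A \<otimes>\<^bsub>mat_monoid n (T d)\<^esub> ?B \<in> P" using U by blast
  qed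
  show "1 \<le> (0::nat) \<or> (\<forall>k\<in>level. \<forall>i j. r \<le> i \<and> i < n \<and> j < r \<longrightarrow> k (i, j) 1 = \<zero>\<^bsub>T 1\<^esub>)"
  proof (intro disjI2 ballI allI impI)
    fix k i j assume k: "k \<in> level" and ij: "r \<le> i \<and> i < n \<and> j < r"
    have "k (i, j) \<in> carrier \<O>" using mat_entry[OF sc.G_M, of k n i j] k ij r_le_n by (simp add: level_def)
    then show "k (i, j) 1 = \<zero>\<^bsub>T 1\<^esub>" using eval_zero_lower[of "k (i, j)"] ll[OF k, of i j] ij by blast
  qed
qed

text \<open>Here \<open>s = d\<close>, and the matrices \<open>u (\<pi> [^] d \<otimes> B)\<close>
  reduce to the identity. The premise \<open>conj\<close> collects what is known of the reduction of
  a conjugate: equal diagonal blocks, zero upper right block, and a lower left block that is a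
  multiple of the old one.\<close>

lemma hecke_matrices_deep:
  assumes ur: "\<And>g i j. g \<in> P \<Longrightarrow> i < r \<Longrightarrow> r \<le> j \<Longrightarrow> j < n \<Longrightarrow> g (i, j) = \<zero>\<^bsub>T d\<^esub>"
    and conj: "\<And>A B. A \<in> P \<Longrightarrow> B \<in> carrier (GL n (T d)) \<Longrightarrow>
      (\<And>i j. i < n \<Longrightarrow> j < n \<Longrightarrow> (i < r \<longleftrightarrow> j < r) \<Longrightarrow> A (i, j) = B (i, j)) \<Longrightarrow>
      (\<And>i j. i < n \<Longrightarrow> j < n \<Longrightarrow> i < r \<Longrightarrow> r \<le> j \<Longrightarrow> B (i, j) = \<zero>\<^bsub>T d\<^esub>) \<Longrightarrow>
      (\<And>i j. i < n \<Longrightarrow> j < n \<Longrightarrow> r \<le> i \<Longrightarrow> j < r \<Longrightarrow> \<exists>c\<in>carrier (T d). B (i, j) = A (i, j) \<otimes>\<^bsub>T d\<^esub> c) \<Longrightarrow> B \<in> P"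
  shows "hecke_matrices \<O> n r \<pi> (T 1) (\<lambda>f. f 1) d level"
proof (intro hecke_matrices.intro hecke_matrices_axioms.intro sc.scaling_axioms ev1.ring_hom_cring_axioms level_subgroup)
  show "f 1 = \<zero>\<^bsub>T 1\<^esub> \<longleftrightarrow> (\<exists>c\<in>carrier \<O>. f = \<pi> \<otimes>\<^bsub>\<O>\<^esub> c)" if "f \<in> carrier \<O>" for f
    using unif_dvd_iff[OF unif that, of 1] by simp
  show "(\<lambda>f. f 1) ` carrier \<O> = carrier (T 1)" by (rule ev_surj)
  show "sc.dvd_ur d k" if k: "k \<in> level" for k
    unfolding sc.dvd_ur_def
  proof (intro allI impI)
    fix i j assume ij: "upper_right n r i j"
    then have ij': "i < n" "j < n" "i < r" "r \<le> j" using r_le_n by (auto simp: upper_right_def)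
    have "mat_map n (\<lambda>f. f d) k (i, j) = \<zero>\<^bsub>T d\<^esub>" using ur ij' k by (auto simp: level_def)
    moreover have "k (i, j) \<in> carrier \<O>" 
      using mat_entry[OF sc.G_M ij'(1,2)] k by (simp add: level_def)
    ultimately show "\<exists>c\<in>carrier \<O>. k (i, j) = \<pi> [^]\<^bsub>\<O>\<^esub> d \<otimes>\<^bsub>\<O>\<^esub> c"
      using unif_dvd_iff[OF unif, of "k (i, j)" d] ij' by (simp add: red_entry)
  qed
  show "upper_block n r \<O> (\<lambda>ij. \<pi> [^]\<^bsub>\<O>\<^esub> d \<otimes>\<^bsub>\<O>\<^esub> B ij) \<in> level" if B: "B \<in> {..<r} \<times> {..<n - r} \<rightarrow> carrier \<O>" for B
  proof -
    have B': "(\<lambda>ij. \<pi> [^]\<^bsub>\<O>\<^esub> d \<otimes>\<^bsub>\<O>\<^esub> B ij) \<in> {..<r} \<times> {..<n - r} \<rightarrow> carrier \<O>" using B by (auto simp: Pi_def)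
    let ?u = "upper_block n r \<O> (\<lambda>ij. \<pi> [^]\<^bsub>\<O>\<^esub> d \<otimes>\<^bsub>\<O>\<^esub> B ij)"
    have uG: "?u \<in> carrier (GL n \<O>)" by (rule sc.upper_block_inv(1)[OF B'])
    have z: "(\<pi> [^]\<^bsub>\<O>\<^esub> d \<otimes>\<^bsub>\<O>\<^esub> B (i, j)) d = \<zero>\<^bsub>T d\<^esub>" if "i < r" "j < n - r" for i j
    proof -
      have Bc: "B (i, j) \<in> carrier \<O>" using B that by auto
      then have "\<pi> [^]\<^bsub>\<O>\<^esub> d \<otimes>\<^bsub>\<O>\<^esub> B (i, j) \<in> carrier \<O>" by simp
      from unif_dvd_iff[OF unif this, of d] Bc show ?thesis by blast
    qed
    have "mat_map n (\<lambda>f. f d) ?u = \<one>\<^bsub>GL n (T d)\<^esub>"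
      unfolding GL_one
    proof (rule mat_eqI[OF ev.mat_map_closed[OF sc.G_M[OF uG]] monoid.one_closed[OF ev.S.mat_monoid_monoid]])
      fix i j assume "i < n" "j < n"
      then show "mat_map n (\<lambda>f. f d) ?u (i, j) = \<one>\<^bsub>mat_monoid n (T d)\<^esub> (i, j)"
        using z[of i "j - r"] by (auto simp: red_entry upper_block_def mat_one_eq O_ops(3,4))
    qed
    then show ?thesis using uG subgroup.one_closed[OF P_subgroup] by (simp add: level_def del: GL_one)
  qed
  show "Z \<in> level" if k: "k \<in> level" and Z: "Z \<in> carrier (GL n \<O>)"
    and eq: "k \<otimes>\<^bsub>mat_monoid n \<O>\<^esub> sc.\<Delta> = sc.\<Delta> \<otimes>\<^bsub>mat_monoid n \<O>\<^esub> Z" and dv: "sc.dvd_ur d Z" for k Z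
  proof -
    let ?A = "mat_map n (\<lambda>f. f d) k" and ?B = "mat_map n (\<lambda>f. f d) Z"
    have kG: "k \<in> carrier (GL n \<O>)" using k by (simp add: level_def)
    note e = conj_entries[OF kG Z eq]
    have "?B \<in> P"
    proof (rule conj[of ?A])
      show "?A \<in> P" using k by (simp add: level_def)
      show "?B \<in> carrier (GL n (T d))" by (rule ev.mat_map_GL[OF Z])
      show "?A (i, j) = ?B (i, j)" if "i < n" "j < n" "i < r \<longleftrightarrow> j < r" for i j
        using that e(1)[of i j] by (simp add: red_entry)
      show "?B (i, j) = \<zero>\<^bsub>T d\<^esub>" if "i < n" "j < n" "i < r" "r \<le> j" for i j
      proof -
        have "\<exists>c\<in>carrier \<O>. Z (i, j) = \<pi> [^]\<^bsub>\<O>\<^esub> d \<otimes>\<^bsub>\<O>\<^esub> c" using dv that by (auto simp: sc.dvd_ur_def upper_right_def)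
        then show ?thesis
          using unif_dvd_iff[OF unif mat_entry[OF sc.G_M[OF Z] that(1,2)], of d] that by (simp add: red_entry)
      qed
      show "\<exists>c\<in>carrier (T d). ?B (i, j) = ?A (i, j) \<otimes>\<^bsub>T d\<^esub> c" if "i < n" "j < n" "r \<le> i" "j < r" for i j
        using that e(2)[of i j] O_eval[OF unif_closed[OF unif], of d] by (auto simp: red_entry O_ops)
    qed
    then show ?thesis using Z by (simp add: level_def)
  qed
  show "1 \<le> d \<or> (\<forall>k\<in>level. \<forall>i j. r \<le> i \<and> i < n \<and> j < r \<longrightarrow> k (i, j) 1 = \<zero>\<^bsub>T 1\<^esub>)" using d_pos by blast
qed

text \<open>The change in the lower left block is absorbed by the opposite unipotent
  radical.\<close>

lemma hecke_matrices_opp_parabolic: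
  assumes U: "opp_unip_radical n r (T d) \<subseteq> P" and sub: "P \<subseteq> opp_parabolic n r (T d)"
  shows "hecke_matrices \<O> n r \<pi> (T 1) (\<lambda>f. f 1) d level"
proof (rule hecke_matrices_deep)
  show ur: "g (i, j) = \<zero>\<^bsub>T d\<^esub>" if "g \<in> P" "i < r" "r \<le> j" "j < n" for g i j
    using ev.S.opp_parabolicD(2)[of g n r i j] that sub r_le_n by blast
  fix A B assume A: "A \<in> P" and B: "B \<in> carrier (GL n (T d))"
    and d: "\<And>i j. i < n \<Longrightarrow> j < n \<Longrightarrow> (i < r \<longleftrightarrow> j < r) \<Longrightarrow> A (i, j) = B (i, j)"
    and z: "\<And>i j. i < n \<Longrightarrow> j < n \<Longrightarrow> i < r \<Longrightarrow> r \<le> j \<Longrightarrow> B (i, j) = \<zero>\<^bsub>T d\<^esub>"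
  interpret GT: group "GL n (T d)" by (rule ev.S.GL_group)
  have AG: "A \<in> carrier (GL n (T d))" using subgroup.subset[OF P_subgroup] A by blast
  have iA: "inv\<^bsub>GL n (T d)\<^esub> A \<in> P" by (rule subgroup.m_inv_closed[OF P_subgroup A])
  let ?C = "inv\<^bsub>GL n (T d)\<^esub> A \<otimes>\<^bsub>GL n (T d)\<^esub> B"
  have CG: "?C \<in> carrier (GL n (T d))" using AG B by (intro GT.m_closed GT.inv_closed)
  have "?C \<in> opp_unip_radical n r (T d)"
  proof (rule ev.S.opp_unip_radicalI[OF CG r_le_n])
    fix i j assume ij: "i < n" "j < n" "i < r \<or> r \<le> j"
    show "?C (i, j) = (if i = j then \<one>\<^bsub>T d\<^esub> else \<zero>\<^bsub>T d\<^esub>)"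
      unfolding GL_mult
      by (rule ev.S.inv_mult_same_diagonal_blocks[OF AG B, where S = "{r..}"])
        (use ur[OF A] ur[OF iA] z d ij in auto)
  qed
  then have "A \<otimes>\<^bsub>GL n (T d)\<^esub> ?C \<in> P" using subgroup.m_closed[OF P_subgroup A] U by blast
  moreover have "A \<otimes>\<^bsub>GL n (T d)\<^esub> ?C = B"
    using AG B by (simp only: GT.m_assoc[symmetric] GT.inv_closed GT.r_inv GT.l_one)
  ultimately show "B \<in> P" by simp
qed

text \<open>The lower left block of the reduction is zero, and so is any multiple of it: conjugation
  leaves the reduction unchanged.\<close>

lemma hecke_matrices_levi:
  assumes sub: "P \<subseteq> levi n r (T d)"
  shows "hecke_matrices \<O> n r \<pi> (T 1) (\<lambda>f. f 1) d level"
proof (rule hecke_matrices_deep)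
  show "g (i, j) = \<zero>\<^bsub>T d\<^esub>" if "g \<in> P" "i < r" "r \<le> j" "j < n" for g i j
    using that sub r_le_n by (force simp: levi_def)
  fix A B assume A: "A \<in> P" and B: "B \<in> carrier (GL n (T d))"
    and d: "\<And>i j. i < n \<Longrightarrow> j < n \<Longrightarrow> (i < r \<longleftrightarrow> j < r) \<Longrightarrow> A (i, j) = B (i, j)"
    and z: "\<And>i j. i < n \<Longrightarrow> j < n \<Longrightarrow> i < r \<Longrightarrow> r \<le> j \<Longrightarrow> B (i, j) = \<zero>\<^bsub>T d\<^esub>"
    and l: "\<And>i j. i < n \<Longrightarrow> j < n \<Longrightarrow> r \<le> i \<Longrightarrow> j < r \<Longrightarrow> \<exists>c\<in>carrier (T d). B (i, j) = A (i, j) \<otimes>\<^bsub>T d\<^esub> c"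
  have AL: "A \<in> carrier (GL n (T d))" "\<And>i j. i < n \<Longrightarrow> j < n \<Longrightarrow> (i < r) \<noteq> (j < r) \<Longrightarrow> A (i, j) = \<zero>\<^bsub>T d\<^esub>"
    using A sub by (auto simp: levi_def)
  have "B = A"
  proof (rule mat_eqI[OF ev.S.GL_in_mat[OF B] ev.S.GL_in_mat[OF AL(1)]])
    fix i j assume ij: "i < n" "j < n"
    consider "i < r \<longleftrightarrow> j < r" | "i < r" "r \<le> j" | "r \<le> i" "j < r" by linarith
    then show "B (i, j) = A (i, j)"
    proof cases
      case 1 then show ?thesis using d[OF ij] by simp
    next
      case 2 then show ?thesis using z[OF ij] AL(2)[OF ij] by simp
    next
      case 3 then show ?thesis using l[OF ij] AL(2)[OF ij] by auto
    qed
  qed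
  then show "B \<in> P" using A by simp
qed

end

section \<open>Hecke edges\<close>

context curve
begin

text \<open>Provides the test algebra at which the hypotheses on group schemes and subfunctors are
  evaluated; its elements are cosets, as the type of test algebras demands.\<close>

lemma k_algebra_trunc:
  assumes x: "x \<in> pts" and p: "unif_ring (\<R> x) p"
  shows "k_algebra k F (trunc_ring (\<R> x) d) (\<lambda>a. max_ideal_pow (\<R> x) d +>\<^bsub>\<R> x\<^esub> a)"
proof -
  interpret u: unif_ring "\<R> x" p by (rule p)
  interpret h: ring_hom_cring "\<R> x" "u.T d" "\<lambda>a. u.I d +>\<^bsub>\<R> x\<^esub> a" by (rule u.T_hom)
  have kx: "a \<in> x" if "a \<in> k" for a using ptsD(2)[OF x] that by blast
  have "(\<lambda>a. u.I d +>\<^bsub>\<R> x\<^esub> a) \<in> ring_hom (F\<lparr>carrier := k\<rparr>) (u.T d)"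
    using h.hom_closed h.hom_mult h.hom_add h.hom_one kx
    by (intro ring_hom_memI) simp_all
  then show ?thesis by (simp add: k_algebra_def u.max_ideal_pow_eq u.T_cring)
qed

lemma local_points_subgroup:
  assumes x: "x \<in> pts" and p: "unif_ring (\<R> x) p" and S: "algebraic_subgroup n k F S"
  shows "subgroup (local_points n F S x d) (GL n (trunc_ring (\<R> x) d))"
  using S k_algebra_trunc[OF x p] unfolding algebraic_subgroup_def local_points_def Let_def by blast

lemma local_points_le:
  assumes x: "x \<in> pts" and p: "unif_ring (\<R> x) p"
  shows "subfunctor k F (GL_points n F S) (\<lambda>A _. Q A) \<Longrightarrow> local_points n F S x d \<subseteq> Q (trunc_ring (\<R> x) d)"
    and "subfunctor k F (\<lambda>A _. Q A) (GL_points n F S) \<Longrightarrow> Q (trunc_ring (\<R> x) d) \<subseteq> local_points n F S x d"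
  using k_algebra_trunc[OF x p] unfolding subfunctor_def local_points_def Let_def by blast+

lemma residue_matrices_card:
  assumes "x \<in> pts"
  shows "card (residue_matrices F x r s) = card k ^ (r * s * degree_at k F x)"
  using finite_dimension_residue[OF assms]
  by (simp add: residue_matrices_def card_PiE power_mult[symmetric] mult.commute mult.left_commute)

end

lemma (in vector_space_curve) stalk_ops [simp]:
  "v \<oplus>\<^bsub>stalk k F V E y\<^esub> w = v \<oplus>\<^bsub>V\<^esub> w" "c \<odot>\<^bsub>stalk k F V E y\<^esub> v = c \<odot>\<^bsub>V\<^esub> v" "\<zero>\<^bsub>stalk k F V E y\<^esub> = \<zero>\<^bsub>V\<^esub>"
  by (simp_all add: stalk_def)

text \<open>Two uniformizers are at work: \<open>\<pi>\<close> belongs to the completed ring and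
  enters \<open>\<Delta>\<close>, whereas \<open>p\<close> belongs to the local ring and acts on
  \<open>V\<close>. The first is given with the problem, the second is auxiliary.\<close>

locale bundle_with_level = vector_space_curve k F V
  for k and F :: "'a ring" (structure) and V :: "('a, 'v) module" +
  fixes n r :: nat and x :: "'a set" and D :: "'a set \<Rightarrow> nat"
    and H :: "'a set \<Rightarrow> ((nat \<times> nat) multiset \<Rightarrow> 'a) set"
    and E :: "'a set set \<Rightarrow> 'v set"
    and \<phi> :: "'a set \<Rightarrow> ('v set \<Rightarrow> nat \<Rightarrow> 'a set) set"
    and a :: "(nat \<Rightarrow> 'v set) \<Rightarrow> nat \<Rightarrow> nat \<Rightarrow> 'a set"
    and \<pi> :: "nat \<Rightarrow> 'a set" and p :: 'a
  assumes x: "x \<in> pts" and p: "unif_ring (\<R> x) p" and r_n: "r \<le> n"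
    and Dx: "1 \<le> D x" and Hx: "algebraic_subgroup n k F (H x)"
    and E: "bundle n E" and \<phi>: "\<phi> \<in> level_structures k F V n D H E"
    and a: "a \<in> trivializations k F V n E x"
    and \<pi>: "uniformizer F x \<pi>"
begin

abbreviation "P \<equiv> local_points n F (H x) x (D x)"

sublocale W: torsion_free_module "\<R> x" p "stalk k F V E x" by (rule stalk_torsion_free[OF E x p])

lemma unif: "W.is_uniformizer \<pi>"
  using \<pi> by (simp add: W.is_uniformizer_def uniformizer_def compl_ring_def)

lemma trivializations_eq:
  "trivializations k F V n E' x = module_isos W.\<O> (module_completion (\<R> x) (stalk k F V E' x)) (free_module n W.\<O>)"
  by (simp add: trivializations_def Let_def)

lemma a_triv: "a \<in> W.triv n" using a by (simp add: trivializations_eq)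

sublocale C: congruence_level "\<R> x" p n r "D x" \<pi> P
  by (intro congruence_level.intro congruence_level_axioms.intro p unif r_n Dx local_points_subgroup[OF x p Hx])

lemma level_subgroup_eq: "level_subgroup n F (H x) (D x) x = C.level"
  by (simp add: level_subgroup_def C.level_def compl_ring_def mat_map_def)

definition sub_stalk :: "(nat \<times> nat \<Rightarrow> nat \<Rightarrow> 'a set) \<Rightarrow> 'v set" where
  "sub_stalk g = {v \<in> st E x. a (W.hat v) \<in> lattice n W.\<O> g}"

definition sub_bundle :: "(nat \<times> nat \<Rightarrow> nat \<Rightarrow> 'a set) \<Rightarrow> 'a set set \<Rightarrow> 'v set" where
  "sub_bundle g = modify x E (sub_stalk g)"

lemma modification: "g \<in> C.sc.scaled \<Longrightarrow> modification (\<R> x) p (stalk k F V E x) n r \<pi> a g"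
  by (intro modification.intro modification_axioms.intro W.torsion_free_module_axioms unif r_n a_triv)

lemma sub_stalk_N: "g \<in> C.sc.scaled \<Longrightarrow> modification.N (\<R> x) p (stalk k F V E x) n a g = sub_stalk g"
  by (simp add: modification.N_def[OF modification] sub_stalk_def)

text \<open>Changing \<open>a\<close> by the inverse of the left factor of \<open>g\<close> turns
  the lattice condition into the vanishing of the first \<open>r\<close> coordinates, the form
  needed both for local freeness and for the quotient.\<close>

lemma sub_stalk_coord:
  assumes g: "g \<in> C.sc.scaled"
  shows "\<exists>b\<in>W.triv n. sub_stalk g = {v \<in> st E x. \<forall>i<r. W.coord b i v = \<zero>\<^bsub>W.T 1\<^esub>}"
proof -
  obtain A B where AB: "A \<in> carrier (GL n W.\<O>)" "B \<in> carrier (GL n W.\<O>)"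
    "g = A \<otimes>\<^bsub>mat_monoid n W.\<O>\<^esub> Delta n r W.\<O> \<pi> \<otimes>\<^bsub>mat_monoid n W.\<O>\<^esub> B"
    using g by (rule C.sc.scaledE)
  have iA: "inv\<^bsub>GL n W.\<O>\<^esub> A \<in> carrier (GL n W.\<O>)" using AB(1) by (rule C.sc.G.inv_closed)
  let ?b = "\<lambda>s\<in>carrier W.\<W>. mat_vec n W.\<O> (inv\<^bsub>GL n W.\<O>\<^esub> A) (a s)"
  have "?b \<in> W.triv n" by (rule W.triv_comp[OF a_triv iA])
  moreover have "a (W.hat v) \<in> lattice n W.\<O> g \<longleftrightarrow> (\<forall>i<r. W.coord ?b i v = \<zero>\<^bsub>W.T 1\<^esub>)" if "v \<in> st E x" for v
    unfolding AB(3) W.scaled_lattice_iff[OF unif r_n AB(1,2) W.triv_closed[OF a_triv W.hat_closed[OF that]]]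
    using W.hat_closed[OF that] by (simp add: W.coord_def)
  ultimately show ?thesis unfolding sub_stalk_def by (intro bexI[of _ ?b]) auto
qed

lemma sub_bundle_stalk: "st (sub_bundle g) x = sub_stalk g"
  unfolding sub_bundle_def modify_stalk by (auto simp: sub_stalk_def)

lemma sub_bundle_stalk_eq: "stalk k F V (sub_bundle g) x = stalk k F V E x\<lparr>carrier := sub_stalk g\<rparr>"
  using sub_bundle_stalk[of g] by (simp add: stalk_def)

lemma sub_bundle_bundle:
  assumes "g \<in> C.sc.scaled" shows "bundle n (sub_bundle g)"
proof -
  obtain b where b: "b \<in> W.triv n" "sub_stalk g = {v \<in> st E x. \<forall>i<r. W.coord b i v = \<zero>\<^bsub>W.T 1\<^esub>}"
    using sub_stalk_coord[OF assms] by blast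
  show ?thesis unfolding sub_bundle_def b(2) by (rule modify_coord_bundle[OF E x p b(1) r_n])
qed

lemma sub_bundle_le: "U \<in> opens \<Longrightarrow> sub_bundle g U \<subseteq> E U"
  "U \<in> opens \<Longrightarrow> x \<notin> U \<Longrightarrow> sub_bundle g U = E U"
  by (auto simp: sub_bundle_def modify_def)

text \<open>The edge relation fixes \<open>E'\<close> off \<open>x\<close> and its completed stalk
  at \<open>x\<close>. By commensurability, membership in the stalk can be tested in the completion;
  the sections then follow from the stalk by gluing.\<close>

lemma sub_bundle_unique:
  assumes E': "bundle n E'" and le: "\<And>U. U \<in> opens \<Longrightarrow> E' U \<subseteq> E U"
    and off: "\<And>U. U \<in> opens \<Longrightarrow> x \<notin> U \<Longrightarrow> E' U = E U"
    and im: "completion_incl (\<R> x) (stalk k F V E x) ` carrier (module_completion (\<R> x) (stalk k F V E' x)) =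
      {s \<in> carrier W.\<W>. a s \<in> lattice n W.\<O> g}"
  shows "E' = sub_bundle g"
proof -
  interpret L: module "\<R> x" V by (rule module_local[OF x])
  have stle: "st E' x \<subseteq> st E x" using le stI by (blast elim: stE)
  note S = L.submoduleE[OF stalk_submodule[OF E' x]]
  have neg: "\<ominus>\<^bsub>stalk k F V E x\<^esub> v = \<ominus>\<^bsub>V\<^esub> v" if "v \<in> st E x" for v
  proof -
    have "v \<in> carrier V" "\<ominus>\<^bsub>V\<^esub> v \<in> st E x" using L.submoduleE(1,3)[OF stalk_submodule[OF E x]] that by auto
    then show ?thesis using W.W.M.minus_equality[of "\<ominus>\<^bsub>V\<^esub> v" v] that by (simp add: V.M.l_neg)
  qed
  have "submodule (st E' x) (\<R> x) (stalk k F V E x)"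
  proof (rule W.W.submoduleI)
    show "\<zero>\<^bsub>stalk k F V E x\<^esub> \<in> st E' x"
      using subgroup.one_closed[OF submodule.axioms(1)[OF stalk_submodule[OF E' x]]] by simp
  qed (use stle S neg in auto)
  then interpret SP: submodule_pair "\<R> x" p "stalk k F V E x" "st E' x"
    by (intro submodule_pair.intro submodule_pair_axioms.intro W.torsion_free_module_axioms)
  have W': "stalk k F V E x\<lparr>carrier := st E' x\<rparr> = stalk k F V E' x" by (simp add: stalk_def)
  have im': "SP.incl ` carrier SP.S.\<W> = {s \<in> carrier W.\<W>. a s \<in> lattice n W.\<O> g}"
    unfolding W' by (rule im)
  obtain d where d: "\<And>v. v \<in> st E x \<Longrightarrow> p [^] (d::nat) \<odot>\<^bsub>V\<^esub> v \<in> st E' x"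
    using stalks_commensurable[OF E E' x p] by blast
  have "v \<in> st E' x \<longleftrightarrow> v \<in> sub_stalk g" for v
  proof
    assume v: "v \<in> st E' x"
    then have "SP.incl (SP.S.hat v) \<in> SP.incl ` carrier SP.S.\<W>" using SP.S.hat_closed by simp
    then show "v \<in> sub_stalk g" unfolding im' SP.incl_hat[OF v] using stle v by (auto simp: sub_stalk_def)
  next
    assume v: "v \<in> sub_stalk g"
    then have "v \<in> st E x" "W.hat v \<in> SP.incl ` carrier SP.S.\<W>"
      unfolding im' using W.hat_closed by (auto simp: sub_stalk_def)
    then show "v \<in> st E' x" using SP.incl_hat_conv[of d v] d by simp
  qed
  then have st: "st E' x = sub_stalk g" by blast
  show ?thesis
  proof
    fix U
    show "E' U = sub_bundle g U"
    proof (cases "U \<in> opens")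
      case False
      then show ?thesis using bundleD(1)[OF E'] by (simp add: sub_bundle_def modify_def extensional_def)
    next
      case U: True
      show ?thesis
        using sections_from_stalk[OF E E' le off U] off[OF U] U st
        by (cases "x \<in> U") (auto simp: sub_bundle_def modify_def)
    qed
  qed
qed

text \<open>The first \<open>r\<close> coordinates in the residue field map the stalk of
  \<open>E\<close> onto the free module of rank \<open>r\<close>, with the stalk of the subbundle as
  kernel. Most of the proof transports this map to cosets.\<close>

lemma sub_bundle_quotient:
  assumes g: "g \<in> C.sc.scaled"
  shows "quotient_iso_residue_power k F V r x E (sub_bundle g)"
proof -
  interpret m: modification "\<R> x" p "stalk k F V E x" n r \<pi> a g by (rule modification[OF g])
  let ?N = "sub_stalk g" and ?W = "stalk k F V E x"
  obtain b where b: "b \<in> W.triv n" "?N = {v \<in> st E x. \<forall>i<r. W.coord b i v = \<zero>\<^bsub>W.T 1\<^esub>}"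
    using sub_stalk_coord[OF g] by blast
  have N: "submodule ?N (\<R> x) ?W" using m.N_submodule sub_stalk_N[OF g] by simp
  interpret N: abelian_subgroup ?N ?W
    by (rule abelian_subgroupI3[OF _ W.W.M.abelian_group_axioms])
      (rule additive_subgroup.intro[OF submodule.axioms(1)[OF N]])
  have stl: "stalk k F V (sub_bundle g) y = stalk k F V E y" if "y \<in> pts" "y \<noteq> x" for y
  proof -
    have "st (sub_bundle g) y = st E y"
      using same_stalk[OF E sub_bundle_bundle[OF g] _ that(2)] sub_bundle_le(2) by blast
    then show ?thesis by (simp add: stalk_def)
  qed
  have mmN: "c \<odot>\<^bsub>V\<^esub> s \<in> ?N" if c: "c \<in> max_ideal (\<R> x)" and s: "s \<in> st E x" for c s
  proof -
    obtain e where e: "e \<in> x" "c = e \<otimes> p" using c W.mem_I[of c 1] ptsD(3)[OF x] W.p_closed by (auto simp: W.max_ideal_eq)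
    have "c \<odot>\<^bsub>V\<^esub> s = e \<odot>\<^bsub>?W\<^esub> (p \<odot>\<^bsub>?W\<^esub> s)"
      using W.W.smult_assoc1[of e p s] W.p_closed e s by simp
    also have "\<dots> \<in> ?N" using m.N_smult[OF _ m.pW, of e s] e s by (simp add: sub_stalk_N[OF g])
    finally show ?thesis .
  qed
  let ?f = "\<lambda>v. \<lambda>i\<in>{..<r}. W.coord b i v"
  have ir: "i < n" if "i < r" for i using that r_n by simp
  have fc: "?f v \<in> {..<r} \<rightarrow>\<^sub>E carrier (W.T 1)" if "v \<in> st E x" for v
    unfolding restrict_PiE_iff by (intro ballI W.coord_closed[OF b(1) that ir]) (simp only: lessThan_iff)
  have eq: "?f v = ?f w" if v: "v \<in> st E x" "w \<in> st E x" "v \<in> ?N +>\<^bsub>?W\<^esub> w" for v w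
  proof -
    obtain u where u: "u \<in> ?N" "v = u \<oplus>\<^bsub>?W\<^esub> w" using v(3) by (auto simp: a_r_coset_def')
    have "W.coord b i v = W.coord b i w" if "i < r" for i
    proof -
      have ui: "u \<in> st E x" "W.coord b i u = \<zero>\<^bsub>W.T 1\<^esub>" using u(1) that unfolding b(2) by blast+
      show ?thesis
        unfolding u(2) W.coord_add[OF b(1) ui(1) v(2) ir[OF that]] ui(2)
        by (rule C.ev1.S.l_zero[OF W.coord_closed[OF b(1) v(2) ir[OF that]]])
    qed
    then show ?thesis by (intro restrict_ext) simp
  qed
  have conv: "v \<in> ?N +>\<^bsub>?W\<^esub> w" if v: "v \<in> st E x" "w \<in> st E x" "?f v = ?f w" for v w
  proof -
    have d: "v \<ominus>\<^bsub>?W\<^esub> w \<in> st E x" using v W.W.M.minus_closed by blast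
    have vd: "v = (v \<ominus>\<^bsub>?W\<^esub> w) \<oplus>\<^bsub>?W\<^esub> w"
      using v by (simp only: W.W.M.minus_eq W.W.M.a_assoc W.W.M.l_neg W.W.M.r_zero W.W.M.a_inv_closed)
    have "W.coord b i (v \<ominus>\<^bsub>?W\<^esub> w) = \<zero>\<^bsub>W.T 1\<^esub>" if i: "i < r" for i
    proof -
      have "W.coord b i v = W.coord b i (v \<ominus>\<^bsub>?W\<^esub> w) \<oplus>\<^bsub>W.T 1\<^esub> W.coord b i w"
        unfolding W.coord_add[OF b(1) d v(2) ir[OF i], symmetric] vd[symmetric] ..
      moreover have "W.coord b i v = W.coord b i w" using fun_cong[OF v(3), of i] i by (simp only: restrict_apply' lessThan_iff)
      ultimately show ?thesis
        using C.ev1.S.add.r_cancel_one'[OF W.coord_closed[OF b(1) v(2) ir[OF i]] W.coord_closed[OF b(1) d ir[OF i]]]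
        by argo
    qed
    then have "v \<ominus>\<^bsub>?W\<^esub> w \<in> ?N" unfolding b(2) using d by blast
    then show ?thesis using vd by (auto simp: a_r_coset_def')
  qed
  \<comment> \<open>The value at a coset is taken at a chosen representative; \<open>eq\<close>
    makes the choice irrelevant, and \<open>conv\<close> gives injectivity.\<close>
  define f where "f S = ?f (SOME v. v \<in> st E x \<and> S = ?N +>\<^bsub>?W\<^esub> v)" for S
  have f: "f (?N +>\<^bsub>?W\<^esub> v) = ?f v" if v: "v \<in> st E x" for v
  proof -
    let ?w = "SOME w. w \<in> st E x \<and> ?N +>\<^bsub>?W\<^esub> v = ?N +>\<^bsub>?W\<^esub> w"
    have w: "?w \<in> st E x \<and> ?N +>\<^bsub>?W\<^esub> v = ?N +>\<^bsub>?W\<^esub> ?w" by (rule someI[of _ v]) (use v in simp)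
    then have "v \<in> ?N +>\<^bsub>?W\<^esub> ?w" using N.a_rcos_self[OF v] by simp
    then show ?thesis unfolding f_def using eq[OF v conjunct1[OF w]] by simp
  qed
  have Q: "carrier (quot_module ?W ?N) = a_rcosets\<^bsub>?W\<^esub> ?N" by (simp add: quot_module_def)
  have QE: "\<exists>v\<in>st E x. S = ?N +>\<^bsub>?W\<^esub> v" if "S \<in> carrier (quot_module ?W ?N)" for S
    using that unfolding Q by (auto simp: A_RCOSETS_def')
  let ?F = "restrict f (carrier (quot_module ?W ?N))"
  have QI: "?N +>\<^bsub>?W\<^esub> v \<in> carrier (quot_module ?W ?N)" if "v \<in> st E x" for v
    using that unfolding Q by (auto simp: A_RCOSETS_def')
  have "?F \<in> module_isos (residue_field (\<R> x)) (quot_module ?W ?N) (free_module r (residue_field (\<R> x)))"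
    unfolding W.residue_field_eq
  proof (rule module_isosI)
    show "bij_betw ?F (carrier (quot_module ?W ?N)) (carrier (free_module r (W.T 1)))"
      unfolding bij_betw_restrict_eq free_module_simps
    proof (rule bij_betw_imageI)
      show "inj_on f (carrier (quot_module ?W ?N))"
      proof (rule inj_onI)
        fix S S' assume S: "S \<in> carrier (quot_module ?W ?N)" "S' \<in> carrier (quot_module ?W ?N)" "f S = f S'"
        obtain v w where vw: "v \<in> st E x" "S = ?N +>\<^bsub>?W\<^esub> v" "w \<in> st E x" "S' = ?N +>\<^bsub>?W\<^esub> w"
          using QE[OF S(1)] QE[OF S(2)] by blast
        then have "v \<in> ?N +>\<^bsub>?W\<^esub> w" using conv S(3) f by simp
        then show "S = S'" unfolding vw(2,4) by (rule N.a_repr_independence'[OF _ vw(3), symmetric])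
      qed
      show "f ` carrier (quot_module ?W ?N) = {..<r} \<rightarrow>\<^sub>E carrier (W.T 1)"
      proof
        show "f ` carrier (quot_module ?W ?N) \<subseteq> {..<r} \<rightarrow>\<^sub>E carrier (W.T 1)"
          using QE f fc by (metis image_subsetI)
        show "{..<r} \<rightarrow>\<^sub>E carrier (W.T 1) \<subseteq> f ` carrier (quot_module ?W ?N)"
        proof
          fix t assume t: "t \<in> {..<r} \<rightarrow>\<^sub>E carrier (W.T 1)"
          have tc: "(if i < r then t i else \<zero>\<^bsub>W.T 1\<^esub>) \<in> carrier (W.T 1)" if "i < n" for i
            using PiE_mem[OF t, of i] C.ev1.S.zero_closed by (cases "i < r") (simp_all only: lessThan_iff if_True if_False)
          obtain v where v: "v \<in> st E x" "\<forall>i<n. W.coord b i v = (if i < r then t i else \<zero>\<^bsub>W.T 1\<^esub>)"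
          proof -
            have "\<exists>v\<in>st E x. \<forall>i<n. W.coord b i v = (if i < r then t i else \<zero>\<^bsub>W.T 1\<^esub>)"
              by (rule W.coord_surj[OF b(1) tc])
            then show thesis by (elim bexE) (rule that)
          qed
          have "?f v = t" using v(2) t r_n by (intro PiE_ext[OF fc[OF v(1)] t]) simp
          then show "t \<in> f ` carrier (quot_module ?W ?N)" using f[OF v(1)] QI[OF v(1)] by (metis image_eqI)
        qed
      qed
    qed
    show "?F (S \<oplus>\<^bsub>quot_module ?W ?N\<^esub> S') = ?F S \<oplus>\<^bsub>free_module r (W.T 1)\<^esub> ?F S'"
      if S: "S \<in> carrier (quot_module ?W ?N)" "S' \<in> carrier (quot_module ?W ?N)" for S S'
    proof -
      obtain v w where vw: "v \<in> st E x" "S = ?N +>\<^bsub>?W\<^esub> v" "w \<in> st E x" "S' = ?N +>\<^bsub>?W\<^esub> w"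
        using QE[OF S(1)] QE[OF S(2)] by blast
      have s: "v \<oplus>\<^bsub>?W\<^esub> w \<in> st E x" using vw W.W.M.a_closed by blast
      have "S \<oplus>\<^bsub>quot_module ?W ?N\<^esub> S' = ?N +>\<^bsub>?W\<^esub> (v \<oplus>\<^bsub>?W\<^esub> w)"
        unfolding vw(2,4) using N.a_rcos_sum[OF vw(1,3)] by (simp add: quot_module_def)
      moreover have "?f (v \<oplus>\<^bsub>?W\<^esub> w) = (\<lambda>i\<in>{..<r}. ?f v i \<oplus>\<^bsub>W.T 1\<^esub> ?f w i)"
        by (intro restrict_ext) (simp only: W.coord_add[OF b(1) vw(1,3) ir] lessThan_iff restrict_apply' simp_thms)
      ultimately show ?thesis
        using S by (simp only: free_module_simps restrict_apply' f[OF s] f[OF vw(1)] f[OF vw(3)] QI[OF s] vw(2,4))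
    qed
    show "?F (c \<odot>\<^bsub>quot_module ?W ?N\<^esub> S) = c \<odot>\<^bsub>free_module r (W.T 1)\<^esub> ?F S"
      if c: "c \<in> carrier (W.T 1)" and S: "S \<in> carrier (quot_module ?W ?N)" for c S
    proof -
      obtain v where v: "v \<in> st E x" "S = ?N +>\<^bsub>?W\<^esub> v" using QE[OF S] by blast
      obtain e where e: "e \<in> x" "c = W.I 1 +>\<^bsub>\<R> x\<^esub> e" using c unfolding W.T_carrier by (auto elim: W.F.cosetE)
      have ev: "e \<odot>\<^bsub>?W\<^esub> v \<in> st E x" using e v W.W.smult_closed[of e v] by simp
      \<comment> \<open>Scalars and elements of the quotient are both cosets, and the product is a
        union over representatives. All of them have the same coordinates, hence the same
        coset.\<close>
      have coset: "?N +>\<^bsub>?W\<^esub> (e' \<odot>\<^bsub>?W\<^esub> v') = ?N +>\<^bsub>?W\<^esub> (e \<odot>\<^bsub>?W\<^esub> v)" if "e' \<in> c" "v' \<in> S" for e' v'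
      proof -
        have e': "e' \<in> x" using W.F.coset_carrier[of e e' 1] e that by simp
        have v': "v' \<in> st E x" using N.a_elemrcos_carrier[OF v(1)] that v(2) by simp
        have ev': "e' \<odot>\<^bsub>?W\<^esub> v' \<in> st E x" using e' v' W.W.smult_closed[of e' v'] by simp
        have ce: "W.I 1 +>\<^bsub>\<R> x\<^esub> e' = W.I 1 +>\<^bsub>\<R> x\<^esub> e"
          using W.F.mem_coset_iff[of e e' 1] W.F.coset_eq_iff[of e' e 1] e e' that by simp
        have fvv: "?f v' = ?f v" using eq[OF v' v(1)] that v(2) by simp
        have vv: "W.coord b i v' = W.coord b i v" if "i < r" for i using fun_cong[OF fvv, of i] that by (simp only: restrict_apply' lessThan_iff)
        have ex: "e \<in> carrier (\<R> x)" "e' \<in> carrier (\<R> x)" using e e' by simp_all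
        have "?f (e' \<odot>\<^bsub>?W\<^esub> v') = ?f (e \<odot>\<^bsub>?W\<^esub> v)"
        proof (rule restrict_ext)
          fix i assume "i \<in> {..<r}"
          then have i: "i < r" by simp
          show "W.coord b i (e' \<odot>\<^bsub>?W\<^esub> v') = W.coord b i (e \<odot>\<^bsub>?W\<^esub> v)"
            unfolding W.coord_smult[OF b(1) ex(2) v' ir[OF i]] W.coord_smult[OF b(1) ex(1) v(1) ir[OF i]] ce vv[OF i] ..
        qed
        then have "e' \<odot>\<^bsub>?W\<^esub> v' \<in> ?N +>\<^bsub>?W\<^esub> (e \<odot>\<^bsub>?W\<^esub> v)" by (rule conv[OF ev' ev])
        then show ?thesis by (rule N.a_repr_independence'[OF _ ev, symmetric])
      qed
      have "e \<in> c" "v \<in> S" using W.F.coset_self[of e 1] e N.a_rcos_self[OF v(1)] v(2) by auto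
      then have "c \<odot>\<^bsub>quot_module ?W ?N\<^esub> S = ?N +>\<^bsub>?W\<^esub> (e \<odot>\<^bsub>?W\<^esub> v)"
      proof -
        have "(\<Union>e'\<in>c. \<Union>v'\<in>S. ?N +>\<^bsub>?W\<^esub> (e' \<odot>\<^bsub>?W\<^esub> v')) = (\<Union>e'\<in>c. \<Union>v'\<in>S. ?N +>\<^bsub>?W\<^esub> (e \<odot>\<^bsub>?W\<^esub> v))"
          by (intro SUP_cong refl) (rule coset)
        also have "\<dots> = ?N +>\<^bsub>?W\<^esub> (e \<odot>\<^bsub>?W\<^esub> v)" using \<open>e \<in> c\<close> \<open>v \<in> S\<close> by blast
        finally show ?thesis by (simp only: quot_module_def module.simps)
      qed
      moreover have "?f (e \<odot>\<^bsub>?W\<^esub> v) = (\<lambda>i\<in>{..<r}. c \<otimes>\<^bsub>W.T 1\<^esub> ?f v i)"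
      proof (rule restrict_ext)
        fix i assume i: "i \<in> {..<r}"
        have "e \<in> carrier (\<R> x)" using e by simp
        then show "W.coord b i (e \<odot>\<^bsub>?W\<^esub> v) = c \<otimes>\<^bsub>W.T 1\<^esub> ?f v i"
          using i W.coord_smult[OF b(1) _ v(1) ir, of e i] e(2) by (simp only: lessThan_iff restrict_apply')
      qed
      ultimately show ?thesis
        using S by (simp only: free_module_simps restrict_apply' f[OF ev] f[OF v(1)] QI[OF ev] v(2))
    qed
  qed simp
  then show ?thesis
    unfolding quotient_iso_residue_power_def Let_def sub_bundle_stalk
    using stl mmN by blast
qed

lemma local_structures_stalk_cong:
  assumes "stalk k F V E1 y = stalk k F V E2 y"
  shows "local_level_structures k F V n S d E1 y = local_level_structures k F V n S d E2 y"
  using assms unfolding local_level_structures_def level_class_def Let_def by simp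

lemma sub_bundle_stalk_off:
  assumes "g \<in> C.sc.scaled" "y \<noteq> x"
  shows "stalk k F V (sub_bundle g) y = stalk k F V E y"
proof -
  have "st (sub_bundle g) y = st E y"
    using same_stalk[OF E sub_bundle_bundle[OF assms(1)] _ assms(2)] sub_bundle_le(2) by blast
  then show ?thesis by (simp add: stalk_def)
qed

lemma reduce_in_level_structures:
  assumes E': "bundle n E'" and a': "a' \<in> trivializations k F V n E' x"
  shows "level_class k F V n (H x) (D x) E' x (reduce_trivialization k F V n E' x (D x) a')
    \<in> local_level_structures k F V n (H x) (D x) E' x"
proof -
  interpret S: torsion_free_module "\<R> x" p "stalk k F V E' x" by (rule stalk_torsion_free[OF E' x p])
  have a'': "a' \<in> S.triv n" using a' by (simp add: trivializations_eq)
  have "reduce_trivialization k F V n E' x (D x) a' = S.red n a' (D x)"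
    unfolding reduce_trivialization_def Let_def S.red_def[OF a''] ..
  then show ?thesis
    using S.red_iso[OF a'', of "D x"] unfolding local_level_structures_def Let_def by simp
qed

text \<open>The level structure at \<open>x\<close> comes from the trivialization of
  \<open>new_triv_ex\<close>. At other points the stalks are equal, so that the old structure can be
  taken over literally.\<close>

lemma edge_exists:
  assumes g: "g \<in> C.sc.scaled" and c: "g \<in> c"
  shows "\<exists>\<phi>'. hecke_edge k F V n D H x E \<phi> a c (sub_bundle g) \<phi>'"
proof -
  interpret m: modification "\<R> x" p "stalk k F V E x" n r \<pi> a g by (rule modification[OF g])
  note N = sub_stalk_N[OF g]
  note S = sub_bundle_stalk_eq[of g]
  obtain a' where a': "a' \<in> m.S.triv n" "\<And>s. s \<in> carrier m.S.\<W> \<Longrightarrow> mat_vec n W.\<O> g (a' s) = a (m.incl s)"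
    using m.new_triv_ex by blast
  have a't: "a' \<in> trivializations k F V n (sub_bundle g) x"
    using a'(1) unfolding trivializations_eq S N .
  let ?l = "level_class k F V n (H x) (D x) (sub_bundle g) x (reduce_trivialization k F V n (sub_bundle g) x (D x) a')"
  let ?\<phi>' = "\<lambda>y\<in>supp k F D. if y = x then ?l else \<phi> y"
  have xs: "x \<in> supp k F D" using x Dx by (simp add: supp_def)
  have "?\<phi>' \<in> level_structures k F V n D H (sub_bundle g)"
    unfolding level_structures_def restrict_PiE_iff
  proof
    fix y assume y: "y \<in> supp k F D"
    show "(if y = x then ?l else \<phi> y) \<in> local_level_structures k F V n (H y) (D y) (sub_bundle g) y"
    proof (cases "y = x")
      case True
      then show ?thesis using reduce_in_level_structures[OF sub_bundle_bundle[OF g] a't] by simp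
    next
      case False
      have "\<phi> y \<in> local_level_structures k F V n (H y) (D y) E y"
        using \<phi> y unfolding level_structures_def by (rule PiE_mem)
      then show ?thesis using False local_structures_stalk_cong[OF sub_bundle_stalk_off[OF g False]] by simp
    qed
  qed
  moreover have "completion_incl (\<R> x) (stalk k F V E x) ` carrier (module_completion (\<R> x) (stalk k F V (sub_bundle g) x)) =
      {s \<in> carrier W.\<W>. a s \<in> mat_vec n W.\<O> g ` carrier (free_module n W.\<O>)}"
    using m.image_lattice unfolding S N lattice_def free_module_simps .
  moreover have "\<forall>s\<in>carrier (module_completion (\<R> x) (stalk k F V (sub_bundle g) x)).
      mat_vec n W.\<O> g (a' s) = a (completion_incl (\<R> x) (stalk k F V E x) s)"
    using a'(2) unfolding S N by blast
  moreover have "?\<phi>' x = ?l" "\<forall>y\<in>supp k F D - {x}. ?\<phi>' y = \<phi> y" using xs by auto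
  ultimately have "hecke_edge k F V n D H x E \<phi> a c (sub_bundle g) ?\<phi>'"
    unfolding hecke_edge_def Let_def
    by (intro conjI ballI impI sub_bundle_bundle[OF g] sub_bundle_le bexI[OF _ c] bexI[OF _ a't]) (assumption | blast)+
  then show ?thesis by blast
qed

lemma edge_target:
  assumes "hecke_edge k F V n D H x E \<phi> a c E' \<phi>'"
  obtains g a' where "g \<in> c" "E' = sub_bundle g" "bundle n E'" "a' \<in> trivializations k F V n E' x"
    "\<And>s. s \<in> carrier (module_completion (\<R> x) (stalk k F V E' x)) \<Longrightarrow>
      mat_vec n W.\<O> g (a' s) = a (completion_incl (\<R> x) (stalk k F V E x) s)"
    "\<phi>' x = level_class k F V n (H x) (D x) E' x (reduce_trivialization k F V n E' x (D x) a')"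
proof -
  note e = assms[unfolded hecke_edge_def Let_def]
  have E': "bundle n E'" using e by (elim conjE)
  have le: "\<And>U. U \<in> opens \<Longrightarrow> E' U \<subseteq> E U" "\<And>U. U \<in> opens \<Longrightarrow> x \<notin> U \<Longrightarrow> E' U = E U"
    using e by (elim conjE; blast)+
  from e show thesis
  proof (elim conjE bexE)
    fix g a' assume g: "g \<in> c"
      and im: "completion_incl (\<R> x) (stalk k F V E x) ` carrier (module_completion (\<R> x) (stalk k F V E' x)) =
        {s \<in> carrier W.\<W>. a s \<in> mat_vec n W.\<O> g ` carrier (free_module n W.\<O>)}"
      and a': "a' \<in> trivializations k F V n E' x"
        "\<forall>s\<in>carrier (module_completion (\<R> x) (stalk k F V E' x)).
          mat_vec n W.\<O> g (a' s) = a (completion_incl (\<R> x) (stalk k F V E x) s)"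
        "\<phi>' x = level_class k F V n (H x) (D x) E' x (reduce_trivialization k F V n E' x (D x) a')"
    have "E' = sub_bundle g"
      using im unfolding free_module_simps lattice_def[symmetric] by (intro sub_bundle_unique[OF E' le])
    then show thesis using that[OF g _ E' a'(1) _ a'(3)] a'(2) by blast
  qed
qed

lemma sub_bundle_cong: "lattice n W.\<O> g = lattice n W.\<O> g' \<Longrightarrow> sub_bundle g = sub_bundle g'"
  by (simp add: sub_bundle_def sub_stalk_def)

text \<open>The lattice is recovered from the stalk of the subbundle: it is the image under
  \<open>a\<close> of the completed elements whose first truncation comes from that stalk.\<close>

lemma sub_bundle_lattice:
  assumes g: "g \<in> C.sc.scaled" "g' \<in> C.sc.scaled" and eq: "sub_bundle g = sub_bundle g'"
  shows "lattice n W.\<O> g = lattice n W.\<O> g'"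
proof -
  have l: "lattice n W.\<O> g = a ` {s \<in> carrier W.\<W>. \<exists>v\<in>st (sub_bundle g) x. s 1 = W.hat v 1}"
    if g: "g \<in> C.sc.scaled" for g
  proof -
    interpret m: modification "\<R> x" p "stalk k F V E x" n r \<pi> a g by (rule modification[OF g])
    have "{s \<in> carrier W.\<W>. \<exists>v\<in>st (sub_bundle g) x. s 1 = W.hat v 1} = {s \<in> carrier W.\<W>. a s \<in> lattice n W.\<O> g}"
    proof -
      have "m.incl ` carrier m.S.\<W> = {s \<in> carrier W.\<W>. \<exists>v\<in>m.N. s 1 = W.hat v 1}"
        by (rule m.incl_image) (rule m.pW)
      then show ?thesis unfolding m.image_lattice unfolding sub_bundle_stalk sub_stalk_N[OF g] by (rule sym)
    qed
    also have "a ` \<dots> = lattice n W.\<O> g"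
    proof
      show "lattice n W.\<O> g \<subseteq> a ` {s \<in> carrier W.\<W>. a s \<in> lattice n W.\<O> g}"
      proof
        fix v assume v: "v \<in> lattice n W.\<O> g"
        have "v \<in> {..<n} \<rightarrow>\<^sub>E carrier W.\<O>" by (rule W.O.lattice_closed[OF C.sc.scaled_in_M[OF g] v])
        then obtain s where "s \<in> carrier W.\<W>" "a s = v" using W.triv_surj[OF a_triv] by blast
        then show "v \<in> a ` {s \<in> carrier W.\<W>. a s \<in> lattice n W.\<O> g}" using v by blast
      qed
    qed blast
    finally show ?thesis by (rule sym)
  qed
  show ?thesis unfolding l[OF g(1)] l[OF g(2)] eq ..
qed

text \<open>Injectivity of \<open>g\<close> turns the equation into \<open>a' = c a''\<close>.
  Reductions then differ by an element of the group \<open>P\<close>, whose left translates make up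
  the class.\<close>

lemma level_class_unique:
  assumes E': "bundle n E'"
    and a': "a' \<in> trivializations k F V n E' x" "a'' \<in> trivializations k F V n E' x"
    and g: "g \<in> C.sc.scaled" and c: "c \<in> C.level"
    and eq: "\<And>s. s \<in> carrier (module_completion (\<R> x) (stalk k F V E' x)) \<Longrightarrow>
      mat_vec n W.\<O> g (a' s) = mat_vec n W.\<O> (g \<otimes>\<^bsub>mat_monoid n W.\<O>\<^esub> c) (a'' s)"
  shows "level_class k F V n (H x) (D x) E' x (reduce_trivialization k F V n E' x (D x) a') =
    level_class k F V n (H x) (D x) E' x (reduce_trivialization k F V n E' x (D x) a'')"
proof -
  interpret S: torsion_free_module "\<R> x" p "stalk k F V E' x" by (rule stalk_torsion_free[OF E' x p])
  have t: "a' \<in> S.triv n" "a'' \<in> S.triv n" using a' by (simp_all add: trivializations_eq)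
  have r: "reduce_trivialization k F V n E' x (D x) a' = S.red n a' (D x)"
    "reduce_trivialization k F V n E' x (D x) a'' = S.red n a'' (D x)"
    unfolding reduce_trivialization_def Let_def S.red_def[OF t(1)] S.red_def[OF t(2)] by (rule refl)+
  have cG: "c \<in> carrier (GL n W.\<O>)" and cP: "mat_map n (\<lambda>f. f (D x)) c \<in> P" using c by (auto simp: C.level_def)
  note cM = C.sc.G_M[OF cG] and gM = C.sc.scaled_in_M[OF g]
  have ac: "a' s = mat_vec n W.\<O> c (a'' s)" if s: "s \<in> carrier S.\<W>" for s
  proof -
    note v = S.triv_closed[OF t(1) s] S.triv_closed[OF t(2) s]
    have "mat_vec n W.\<O> g (a' s) = mat_vec n W.\<O> g (mat_vec n W.\<O> c (a'' s))"
      unfolding eq[OF s] by (rule W.O.mat_vec_mult[OF gM cM v(2)])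
    then show ?thesis by (rule inj_onD[OF C.sc.scaled_vec_inj[OF g] _ v(1) W.O.mat_vec_closed[OF cM v(2)]])
  qed
  let ?T = "W.T (D x)" and ?c = "mat_map n (\<lambda>f. f (D x)) c" and ?Tr = "carrier (S.TW (D x))"
  interpret GT: group "GL n ?T" by (rule C.ev.S.GL_group)
  have rd: "S.red n a' (D x) t' = mat_vec n ?T ?c (S.red n a'' (D x) t')" if "t' \<in> ?Tr" for t'
    by (rule S.red_mat_vec[OF t(2,1) cM ac that])
  note PG = subgroup.subset[OF C.P_subgroup]
  have f: "(\<lambda>s\<in>?Tr. mat_vec n ?T h (S.red n a' (D x) s)) = (\<lambda>s\<in>?Tr. mat_vec n ?T (h \<otimes>\<^bsub>mat_monoid n ?T\<^esub> ?c) (S.red n a'' (D x) s))"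
    if h: "h \<in> P" for h
  proof (rule restrict_ext)
    fix s assume s: "s \<in> ?Tr"
    have M: "h \<in> carrier (mat_monoid n ?T)" "?c \<in> carrier (mat_monoid n ?T)"
      using h cP PG C.ev.S.GL_in_mat by blast+
    show "mat_vec n ?T h (S.red n a' (D x) s) = mat_vec n ?T (h \<otimes>\<^bsub>mat_monoid n ?T\<^esub> ?c) (S.red n a'' (D x) s)"
      unfolding rd[OF s] C.ev.S.mat_vec_mult[OF M S.red_closed[OF t(2) s]] ..
  qed
  \<comment> \<open>Right translation by an element of the subgroup permutes it, so the sets of left
    translates of the two reductions coincide.\<close>
  have Pc: "(\<lambda>h. h \<otimes>\<^bsub>mat_monoid n ?T\<^esub> ?c) ` P = P"
  proof
    show "(\<lambda>h. h \<otimes>\<^bsub>mat_monoid n ?T\<^esub> ?c) ` P \<subseteq> P"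
      using subgroup.m_closed[OF C.P_subgroup _ cP] by auto
    show "P \<subseteq> (\<lambda>h. h \<otimes>\<^bsub>mat_monoid n ?T\<^esub> ?c) ` P"
    proof
      fix h assume h: "h \<in> P"
      have i: "inv\<^bsub>GL n ?T\<^esub> ?c \<in> P" by (rule subgroup.m_inv_closed[OF C.P_subgroup cP])
      have "h \<in> carrier (GL n ?T)" "?c \<in> carrier (GL n ?T)" using h cP PG by auto
      then have "h = h \<otimes>\<^bsub>GL n ?T\<^esub> inv\<^bsub>GL n ?T\<^esub> ?c \<otimes>\<^bsub>GL n ?T\<^esub> ?c"
        by (simp only: GT.m_assoc GT.inv_closed GT.l_inv GT.r_one)
      moreover have "h \<otimes>\<^bsub>GL n ?T\<^esub> inv\<^bsub>GL n ?T\<^esub> ?c \<in> P" by (rule subgroup.m_closed[OF C.P_subgroup h i])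
      ultimately show "h \<in> (\<lambda>h. h \<otimes>\<^bsub>mat_monoid n ?T\<^esub> ?c) ` P" unfolding GL_mult by (rule image_eqI)
    qed
  qed
  have "(\<lambda>h. \<lambda>s\<in>?Tr. mat_vec n ?T h (S.red n a' (D x) s)) ` P =
      (\<lambda>h. \<lambda>s\<in>?Tr. mat_vec n ?T h (S.red n a'' (D x) s)) ` (\<lambda>h. h \<otimes>\<^bsub>mat_monoid n ?T\<^esub> ?c) ` P"
    unfolding image_image by (rule image_cong[OF refl f])
  then show ?thesis unfolding level_class_def Let_def r Pc .
qed

end

section \<open>Targets and edges in the two cases\<close>

locale hecke_case = bundle_with_level +
  fixes s :: nat
  assumes hm: "hecke_matrices (completion (\<R> x)) n r \<pi> (trunc_ring (\<R> x) 1) (\<lambda>f. f 1) s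
    (congruence_level.level (\<R> x) n (D x) (local_points n F (H x) x (D x)))"
begin

sublocale hm: hecke_matrices W.\<O> n r \<pi> "W.T 1" "\<lambda>f. f 1" s C.level by (rule hm)

abbreviation "targets \<equiv> hecke_targets k F V n r D H x \<pi> E \<phi> a"

lemma edge_cosets_eq: "edge_cosets n r F (H x) (D x) x \<pi> = (\<lambda>g. g <#\<^bsub>mat_monoid n W.\<O>\<^esub> C.level) ` hm.double_coset"
  unfolding edge_cosets_def Let_def level_subgroup_eq hm.double_coset_def by (simp add: compl_ring_def)

text \<open>The edge relation allows any representative of the coset, not only the one from which
  the coset was formed.\<close>

lemma edge_coset_mem:
  assumes "c \<in> edge_cosets n r F (H x) (D x) x \<pi>" "g \<in> c"
  shows "g \<in> hm.double_coset"
proof -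
  obtain g0 where g0: "g0 \<in> hm.double_coset" "c = g0 <#\<^bsub>mat_monoid n W.\<O>\<^esub> C.level"
    using assms(1) unfolding edge_cosets_eq by blast
  obtain c' where "c' \<in> C.level" "g = g0 \<otimes>\<^bsub>mat_monoid n W.\<O>\<^esub> c'"
    using assms(2) unfolding g0(2) l_coset_def by blast
  then show ?thesis using hm.double_coset_mult[OF g0(1)] by simp
qed

lemma target_bundles: "fst ` targets = sub_bundle ` hm.double_coset"
proof
  show "fst ` targets \<subseteq> sub_bundle ` hm.double_coset"
  proof
    fix E' assume "E' \<in> fst ` targets"
    then obtain \<phi>' c where c: "c \<in> edge_cosets n r F (H x) (D x) x \<pi>" "hecke_edge k F V n D H x E \<phi> a c E' \<phi>'"
      unfolding hecke_targets_def by auto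
    obtain g where "g \<in> c" "E' = sub_bundle g" using c(2) by (rule edge_target)
    then show "E' \<in> sub_bundle ` hm.double_coset" using edge_coset_mem[OF c(1)] by blast
  qed
  show "sub_bundle ` hm.double_coset \<subseteq> fst ` targets"
  proof
    fix E' assume "E' \<in> sub_bundle ` hm.double_coset"
    then obtain g where g: "g \<in> hm.double_coset" "E' = sub_bundle g" by blast
    note gs = hm.double_coset_scaled[OF g(1)]
    let ?c = "g <#\<^bsub>mat_monoid n W.\<O>\<^esub> C.level"
    obtain \<phi>' where e: "hecke_edge k F V n D H x E \<phi> a ?c (sub_bundle g) \<phi>'"
      using edge_exists[OF gs hm.coset_mem[OF C.sc.scaled_in_M[OF gs]]] by blast
    have "?c \<in> edge_cosets n r F (H x) (D x) x \<pi>" unfolding edge_cosets_eq using g(1) by (rule imageI)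
    then have "(sub_bundle g, \<phi>') \<in> targets" unfolding hecke_targets_def using e by blast
    then show "E' \<in> fst ` targets" unfolding g(2) by (rule rev_image_eqI) simp
  qed
qed

lemma residue_matrices_eq: "residue_matrices F x r (n - r) = {..<r} \<times> {..<n - r} \<rightarrow>\<^sub>E carrier (W.T 1)"
  by (simp only: residue_matrices_def W.residue_field_eq)

text \<open>Equal underlying bundles have equal lattices, and for \<open>s = 0\<close> equal
  lattices mean equal cosets; then the two trivializations differ by an element of the level
  group.\<close>

lemma level_structure_unique:
  assumes s: "s = 0" and t: "(E', \<phi>') \<in> targets" "(E', \<phi>'') \<in> targets"
  shows "\<phi>' x = \<phi>'' x"
proof -
  obtain c where c: "c \<in> edge_cosets n r F (H x) (D x) x \<pi>" "hecke_edge k F V n D H x E \<phi> a c E' \<phi>'"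
    using t(1) unfolding hecke_targets_def by blast
  obtain c' where c': "c' \<in> edge_cosets n r F (H x) (D x) x \<pi>" "hecke_edge k F V n D H x E \<phi> a c' E' \<phi>''"
    using t(2) unfolding hecke_targets_def by blast
  obtain g a1 where g: "g \<in> c" "E' = sub_bundle g" "bundle n E'" "a1 \<in> trivializations k F V n E' x"
    "\<And>s. s \<in> carrier (module_completion (\<R> x) (stalk k F V E' x)) \<Longrightarrow>
      mat_vec n W.\<O> g (a1 s) = a (completion_incl (\<R> x) (stalk k F V E x) s)"
    "\<phi>' x = level_class k F V n (H x) (D x) E' x (reduce_trivialization k F V n E' x (D x) a1)"
    using c(2) by (rule edge_target) blast
  obtain g' a2 where g': "g' \<in> c'" "E' = sub_bundle g'" "bundle n E'" "a2 \<in> trivializations k F V n E' x"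
    "\<And>s. s \<in> carrier (module_completion (\<R> x) (stalk k F V E' x)) \<Longrightarrow>
      mat_vec n W.\<O> g' (a2 s) = a (completion_incl (\<R> x) (stalk k F V E x) s)"
    "\<phi>'' x = level_class k F V n (H x) (D x) E' x (reduce_trivialization k F V n E' x (D x) a2)"
    using c'(2) by (rule edge_target) blast
  note d = edge_coset_mem[OF c(1) g(1)] edge_coset_mem[OF c'(1) g'(1)]
  note sc = hm.double_coset_scaled[OF d(1)] hm.double_coset_scaled[OF d(2)]
  have "lattice n W.\<O> g = lattice n W.\<O> g'" using g(2) g'(2) by (intro sub_bundle_lattice[OF sc]) simp
  then obtain l where l: "l \<in> C.level" "g' = g \<otimes>\<^bsub>mat_monoid n W.\<O>\<^esub> l"
    using hm.double_coset_lattice_eq[OF s d] by blast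
  show ?thesis
    unfolding g(6) g'(6)
    by (rule level_class_unique[OF g(3,4) g'(4) sc(1) l(1)]) (simp only: g(5) g'(5)[unfolded l(2)])
qed

lemma parabolic_case:
  assumes s: "s = 0"
  shows "card (fst ` targets) = card k ^ (r * (n - r) * degree_at k F x)"
    and "E' \<in> fst ` targets \<Longrightarrow> quotient_iso_residue_power k F V r x E E'"
    and "E' \<in> fst ` targets \<Longrightarrow> \<exists>!\<psi>. \<exists>\<phi>'. (E', \<phi>') \<in> targets \<and> \<psi> = \<phi>' x"
proof -
  \<comment> \<open>The counting statement refers to no lifts, so arbitrary ones are fixed. In
    \<open>deep_case\<close> they are prescribed by \<open>l\<close> instead.\<close>
  define L where "L C = (SOME L. hm.is_lift C L)" for C
  have L: "hm.is_lift C (L C)" if "C \<in> residue_matrices F x r (n - r)" for C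
    unfolding L_def by (rule someI_ex[OF hm.lift_ex[OF that[unfolded residue_matrices_eq]]])
  have "bij_betw (\<lambda>C. sub_bundle (hm.edge_mat (L C))) (residue_matrices F x r (n - r)) (fst ` targets)"
    unfolding target_bundles
  proof (rule bij_betw_imageI)
    show "inj_on (\<lambda>C. sub_bundle (hm.edge_mat (L C))) (residue_matrices F x r (n - r))"
    proof (rule inj_onI)
      fix C C' assume C: "C \<in> residue_matrices F x r (n - r)" "C' \<in> residue_matrices F x r (n - r)"
        "sub_bundle (hm.edge_mat (L C)) = sub_bundle (hm.edge_mat (L C'))"
      note sc = hm.double_coset_scaled[OF hm.edge_mat_double_coset[OF L[OF C(1)]]]
        hm.double_coset_scaled[OF hm.edge_mat_double_coset[OF L[OF C(2)]]]
      have l: "lattice n W.\<O> (hm.edge_mat (L C)) = lattice n W.\<O> (hm.edge_mat (L C'))"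
        by (rule sub_bundle_lattice[OF sc C(3)])
      show "C = C'"
        using C(1,2) unfolding residue_matrices_eq
      proof (rule PiE_ext)
        fix ij assume "ij \<in> {..<r} \<times> {..<n - r}"
        then show "C ij = C' ij"
          using hm.edge_mat_lattice_inj[OF s L[OF C(1)] L[OF C(2)] l] by (cases ij) (simp only: mem_Sigma_iff lessThan_iff)
      qed
    qed
    show "(\<lambda>C. sub_bundle (hm.edge_mat (L C))) ` residue_matrices F x r (n - r) = sub_bundle ` hm.double_coset"
    proof
      show "(\<lambda>C. sub_bundle (hm.edge_mat (L C))) ` residue_matrices F x r (n - r) \<subseteq> sub_bundle ` hm.double_coset"
        using hm.edge_mat_double_coset[OF L] by blast
      show "sub_bundle ` hm.double_coset \<subseteq> (\<lambda>C. sub_bundle (hm.edge_mat (L C))) ` residue_matrices F x r (n - r)"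
      proof
        fix E' assume "E' \<in> sub_bundle ` hm.double_coset"
        then obtain g where g: "g \<in> hm.double_coset" "E' = sub_bundle g" by blast
        obtain C where C: "C \<in> residue_matrices F x r (n - r)"
          "\<And>L. hm.is_lift C L \<Longrightarrow> \<exists>l\<in>C.level. g = hm.edge_mat L \<otimes>\<^bsub>mat_monoid n W.\<O>\<^esub> l"
          using hm.double_coset_normal_form[OF g(1)] unfolding residue_matrices_eq by blast
        obtain l where l: "l \<in> C.level" "g = hm.edge_mat (L C) \<otimes>\<^bsub>mat_monoid n W.\<O>\<^esub> l" using C(2)[OF L[OF C(1)]] by blast
        have "hm.edge_mat (L C) \<in> carrier (mat_monoid n W.\<O>)"
          by (rule C.sc.scaled_in_M[OF hm.double_coset_scaled[OF hm.edge_mat_double_coset[OF L[OF C(1)]]]])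
        then have "lattice n W.\<O> g = lattice n W.\<O> (hm.edge_mat (L C))"
          unfolding l(2) by (rule C.sc.lattice_mult_GL[OF _ hm.K_G[OF l(1)]])
        then have "E' = sub_bundle (hm.edge_mat (L C))" unfolding g(2) by (rule sub_bundle_cong)
        then show "E' \<in> (\<lambda>C. sub_bundle (hm.edge_mat (L C))) ` residue_matrices F x r (n - r)"
          using C(1) by (rule image_eqI)
      qed
    qed
  qed
  from bij_betw_same_card[OF this] residue_matrices_card[OF x]
  show "card (fst ` targets) = card k ^ (r * (n - r) * degree_at k F x)" by simp
  show "quotient_iso_residue_power k F V r x E E'" if t: "E' \<in> fst ` targets"
  proof -
    obtain g where "g \<in> hm.double_coset" "E' = sub_bundle g" using t unfolding target_bundles by blast
    then show ?thesis using sub_bundle_quotient[OF hm.double_coset_scaled] by blast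
  qed
  show "\<exists>!\<psi>. \<exists>\<phi>'. (E', \<phi>') \<in> targets \<and> \<psi> = \<phi>' x" if t0: "E' \<in> fst ` targets"
  proof -
    obtain \<phi>' where t: "(E', \<phi>') \<in> targets" using t0 by force
    show ?thesis
    proof (rule ex1I[of _ "\<phi>' x"])
      show "\<exists>\<phi>''. (E', \<phi>'') \<in> targets \<and> \<phi>' x = \<phi>'' x" using t by blast
      show "\<psi> = \<phi>' x" if "\<exists>\<phi>''. (E', \<phi>'') \<in> targets \<and> \<psi> = \<phi>'' x" for \<psi>
        using that level_structure_unique[OF s _ t] by blast
    qed
  qed
qed

text \<open>\<open>s \<ge> 1\<close> makes the lattice constant on the double coset, hence a single
  subbundle, while the cosets themselves are still separated by the upper right blocks modulo
  \<open>\<pi> [^] (s + 1)\<close>.\<close>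

lemma deep_case:
  assumes s: "s = D x"
  shows "\<exists>!E'. E' \<in> fst ` targets"
    and "residue_lift F x l \<Longrightarrow> bij_betw
      (\<lambda>C. (upper_block n r W.\<O> (\<lambda>ij. (\<pi> [^]\<^bsub>W.\<O>\<^esub> D x) \<otimes>\<^bsub>W.\<O>\<^esub> l (C ij))
         \<otimes>\<^bsub>mat_monoid n W.\<O>\<^esub> Delta n r W.\<O> \<pi>) <#\<^bsub>mat_monoid n W.\<O>\<^esub> C.level)
      (residue_matrices F x r (n - r)) (edge_cosets n r F (H x) (D x) x \<pi>)"
proof -
  have s1: "1 \<le> s" using Dx s by simp
  have "hm.double_coset \<noteq> {}" using hm.double_cosetI[OF hm.K_one hm.K_one] by blast
  moreover have "sub_bundle g = sub_bundle (Delta n r W.\<O> \<pi>)" if "g \<in> hm.double_coset" for g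
    by (rule sub_bundle_cong[OF hm.double_coset_lattice_const[OF s1 that]])
  ultimately have "fst ` targets = {sub_bundle (Delta n r W.\<O> \<pi>)}" unfolding target_bundles by auto
  then show "\<exists>!E'. E' \<in> fst ` targets" by simp
  show "bij_betw
      (\<lambda>C. (upper_block n r W.\<O> (\<lambda>ij. (\<pi> [^]\<^bsub>W.\<O>\<^esub> D x) \<otimes>\<^bsub>W.\<O>\<^esub> l (C ij))
         \<otimes>\<^bsub>mat_monoid n W.\<O>\<^esub> Delta n r W.\<O> \<pi>) <#\<^bsub>mat_monoid n W.\<O>\<^esub> C.level)
      (residue_matrices F x r (n - r)) (edge_cosets n r F (H x) (D x) x \<pi>)" if l: "residue_lift F x l"
  proof -
    have lift: "hm.is_lift C (\<lambda>ij. l (C ij))" if C: "C \<in> residue_matrices F x r (n - r)" for C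
      unfolding hm.is_lift_def
    proof
      fix ij assume "ij \<in> {..<r} \<times> {..<n - r}"
      then have "C ij \<in> carrier (residue_field (\<R> x))" using C unfolding residue_matrices_def by (rule PiE_mem[rotated])
      then show "l (C ij) \<in> carrier W.\<O> \<and> l (C ij) 1 = C ij"
        using l unfolding residue_lift_def compl_ring_def by blast
    qed
    have "bij_betw (\<lambda>C. hm.edge_mat (\<lambda>ij. l (C ij)) <#\<^bsub>mat_monoid n W.\<O>\<^esub> C.level)
      ({..<r} \<times> {..<n - r} \<rightarrow>\<^sub>E carrier (W.T 1)) ((\<lambda>g. g <#\<^bsub>mat_monoid n W.\<O>\<^esub> C.level) ` hm.double_coset)"
      by (rule hm.edge_cosets_bij) (rule lift, simp only: residue_matrices_eq)
    then show ?thesis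
      unfolding edge_cosets_eq residue_matrices_eq hm.edge_mat_def unfolding s .
  qed
qed

end

theorem theorem1p4:
  fixes k :: "'a set" and F :: "'a ring" and V :: "('a, 'v) module"
    and n r :: nat and x :: "'a set" and D :: "'a set \<Rightarrow> nat"
    and H :: "'a set \<Rightarrow> ((nat \<times> nat) multiset \<Rightarrow> 'a) set"
    and E :: "'a set set \<Rightarrow> 'v set"
    and \<phi> :: "'a set \<Rightarrow> ('v set \<Rightarrow> nat \<Rightarrow> 'a set) set"
    and a :: "(nat \<Rightarrow> 'v set) \<Rightarrow> nat \<Rightarrow> nat \<Rightarrow> 'a set"
    and \<pi> :: "nat \<Rightarrow> 'a set"
  assumes "curve_over_finite_field k F"
    and "1 \<le> r" and "r \<le> n - 1"
    and "x \<in> closed_points k F"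
    and "effective_divisor k F D" and "1 \<le> D x"
    and "\<forall>y\<in>supp k F D. algebraic_subgroup n k F (H y)"
    and "vector_bundle k F V n E"
    and "\<phi> \<in> level_structures k F V n D H E"
    and "compatible_trivialization k F V n D x E \<phi> a"
    and "uniformizer F x \<pi>"
  defines "targets \<equiv> hecke_targets k F V n r D H x \<pi> E \<phi> a"
    and "N \<equiv> card k ^ (r * (n - r) * degree_at k F x)"
    and "Hx \<equiv> GL_points n F (H x)"
    and "R \<equiv> compl_ring F x"
    and "K \<equiv> level_subgroup n F (H x) (D x) x"
  shows
    "(subfunctor k F (\<lambda>A _. unip_radical n r A) Hx \<and> subfunctor k F Hx (\<lambda>A _. parabolic n r A)
      \<longrightarrow> card (fst ` targets) = N \<and>
          (\<forall>E'\<in>fst ` targets.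
             quotient_iso_residue_power k F V r x E E' \<and>
             (\<exists>!\<psi>. \<exists>\<phi>'. (E', \<phi>') \<in> targets \<and> \<psi> = \<phi>' x)))
     \<and>
     ((subfunctor k F (\<lambda>A _. opp_unip_radical n r A) Hx \<and>
       subfunctor k F Hx (\<lambda>A _. opp_parabolic n r A)) \<or>
      subfunctor k F Hx (\<lambda>A _. levi n r A)
      \<longrightarrow> (\<exists>!E'. E' \<in> fst ` targets) \<and>
          card (residue_matrices F x r (n - r)) = N \<and>
          (\<forall>l. residue_lift F x l \<longrightarrow>
             bij_betw
               (\<lambda>C. (upper_block n r R
                       (\<lambda>ij. (\<pi> [^]\<^bsub>R\<^esub> D x) \<otimes>\<^bsub>R\<^esub> l (C ij))
                     \<otimes>\<^bsub>mat_monoid n R\<^esub> Delta n r R \<pi>) <#\<^bsub>mat_monoid n R\<^esub> K)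
               (residue_matrices F x r (n - r))
               (edge_cosets n r F (H x) (D x) x \<pi>)))"
proof -
  interpret curve k F by (rule curve.intro) fact
  \<comment> \<open>An auxiliary choice: the constructions in \<open>V\<close> depend on it, the
    conclusion does not mention it.\<close>
  obtain p where p: "unif_ring (\<R> x) p" using pts_unif[OF \<open>x \<in> closed_points k F\<close>] by blast
  have mod: "module F V" using \<open>vector_bundle k F V n E\<close> unfolding vector_bundle_def by (elim conjE)
  interpret vector_space_curve k F V by (intro vector_space_curve.intro curve_axioms mod)
  have xs: "x \<in> supp k F D" using assms(4,6) by (simp add: supp_def)
  interpret B: bundle_with_level k F V n r x D H E \<phi> a \<pi> p
  proof (intro bundle_with_level.intro bundle_with_level_axioms.intro vector_space_curve_axioms p)
    show "r \<le> n" using assms(3) by simp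
    show "algebraic_subgroup n k F (H x)" using assms(7) xs by blast
    show "a \<in> trivializations k F V n E x" using assms(10) by (simp add: compatible_trivialization_def)
  qed (fact assms)+
  have case_I: "hecke_case k F V n r x D H E \<phi> a \<pi> p s"
    if "hecke_matrices B.W.\<O> n r \<pi> (B.W.T 1) (\<lambda>f. f 1) s B.C.level" for s
    by (intro hecke_case.intro hecke_case_axioms.intro B.bundle_with_level_axioms that)
  have R: "R = B.W.\<O>" and K: "K = B.C.level"
    unfolding R_def K_def compl_ring_def B.level_subgroup_eq by (rule refl)+
  show ?thesis
  proof (intro conjI impI)
    assume "subfunctor k F (\<lambda>A _. unip_radical n r A) Hx \<and> subfunctor k F Hx (\<lambda>A _. parabolic n r A)"
    then have "hecke_matrices B.W.\<O> n r \<pi> (B.W.T 1) (\<lambda>f. f 1) 0 B.C.level"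
      unfolding Hx_def
      by (intro B.C.hecke_matrices_parabolic local_points_le[OF assms(4) p]) auto
    then interpret I: hecke_case k F V n r x D H E \<phi> a \<pi> p 0 by (rule case_I)
    note c = I.parabolic_case[OF refl, folded targets_def]
    show "card (fst ` targets) = N" unfolding N_def by (rule c(1))
    show "\<forall>E'\<in>fst ` targets. quotient_iso_residue_power k F V r x E E' \<and>
        (\<exists>!\<psi>. \<exists>\<phi>'. (E', \<phi>') \<in> targets \<and> \<psi> = \<phi>' x)"
      by (intro ballI conjI c(2,3))
  next
    assume "(subfunctor k F (\<lambda>A _. opp_unip_radical n r A) Hx \<and>
       subfunctor k F Hx (\<lambda>A _. opp_parabolic n r A)) \<or> subfunctor k F Hx (\<lambda>A _. levi n r A)"
    then have "hecke_matrices B.W.\<O> n r \<pi> (B.W.T 1) (\<lambda>f. f 1) (D x) B.C.level"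
    proof (elim disjE conjE)
      assume "subfunctor k F (\<lambda>A _. opp_unip_radical n r A) Hx" "subfunctor k F Hx (\<lambda>A _. opp_parabolic n r A)"
      then show ?thesis unfolding Hx_def
        by (intro B.C.hecke_matrices_opp_parabolic local_points_le[OF assms(4) p])
    next
      assume "subfunctor k F Hx (\<lambda>A _. levi n r A)"
      then show ?thesis unfolding Hx_def
        by (intro B.C.hecke_matrices_levi local_points_le[OF assms(4) p])
    qed
    then interpret I: hecke_case k F V n r x D H E \<phi> a \<pi> p "D x" by (rule case_I)
    note c = I.deep_case[OF refl, folded targets_def]
    show "\<exists>!E'. E' \<in> fst ` targets" by (rule c(1))
    show "card (residue_matrices F x r (n - r)) = N" unfolding N_def by (rule residue_matrices_card[OF assms(4)])
    show "\<forall>l. residue_lift F x l \<longrightarrow>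
             bij_betw
               (\<lambda>C. (upper_block n r R
                       (\<lambda>ij. (\<pi> [^]\<^bsub>R\<^esub> D x) \<otimes>\<^bsub>R\<^esub> l (C ij))
                     \<otimes>\<^bsub>mat_monoid n R\<^esub> Delta n r R \<pi>) <#\<^bsub>mat_monoid n R\<^esub> K)
               (residue_matrices F x r (n - r))
               (edge_cosets n r F (H x) (D x) x \<pi>)"
      unfolding R K by (intro allI impI) (rule c(2))
  qed
qed

end
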